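(* Let $K$ be a field of characteristic zero, let $\mathbb G=\operatorname{Spec}\mathcal A^*$ be an infinitesimal formal group, and write $L:=T_e\mathbb G$. Then: (1) The natural morphism $U(L)\to A$ is an isomorphism of bialgebras. (2) The morphism $U(L)_n/U(L)_{n-1}\to A_n/A_{n-1}$ is an isomorphism (for every $n$). (3) $L$ is the module of primitive elements of $U(L)$, and $U(L)_n/U(L)_{n-1}=S^nL$ (for every $n$).
   Context: All functors are covariant functors on the category of commutative $K$-algebras, $\mathcal K(S)=S$. For a $K$-vector space $M$, $\mathcal M(S)=M\otimes_KS$ and $\mathcal M^*(S)=\operatorname{Hom}_K(M,S)$; such $\mathcal M^*$ are called module schemes, and $M\mapsto\mathcal M^*$ is an anti-equivalence (with $(\mathcal M^* )^*=\mathcal M$) from vector spaces to module schemes. A commutative bialgebra scheme $\mathcal A^*$ is the dual of a cocommutative $K$-bialgebra $A$; $(\operatorname{Spec}\mathcal A^* )(S)=\operatorname{Hom}_{\mathcal K\text{-alg}}(\mathcal A^*,\mathcal S)$, with $\mathcal S(S')=S\otimes_KS'$, is then a functor of monoids with unit the counit $e:\mathcal A^*\to\mathcal K$ (evaluation at $1\in A$). Let $\mathcal I^*=\operatorname{Ker}e$. $\mathcal I^{*n}$ is the module scheme closure in $\mathcal A^*$ (smallest module subscheme containing it) of the image of the multiplication $\mathcal I^*\otimes\overset{n}{\cdots}\otimes\mathcal I^*\to\mathcal A^*$. $\mathbb G=\operatorname{Spec}\mathcal A^*$ is an infinitesimal formal monoid if $\mathcal A^*=\varprojlim_i\mathcal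 A^*/\mathcal I^{*i}$, and an infinitesimal formal group if moreover it is a functor of groups. $T_e\mathbb G:=\operatorname{Der}_{\mathcal K}(\mathcal A^*,\mathcal K)=\operatorname{Hom}_{\mathcal K}(\mathcal I^*/\mathcal I^{*2},\mathcal K)$ (derivations at $e$), which is identified with the Lie algebra of primitive elements of $A$, those $a$ with $c(a)=a\otimes1+1\otimes a$, $c$ being the comultiplication of $A$. $U(L)$ is the universal enveloping algebra of $L$ with its standard bialgebra structure, and $U(L)\to A$ is the algebra morphism extending the inclusion $L\hookrightarrow A$. $U(L)_n$ is the image in $U(L)$ of $\bigoplus_{i\le n}T^iL$ ($T^iL$ the $i$-th tensor power), and $A_n\subseteq A$ is the vector space with $\mathcal A_n=(\mathcal A^*/\mathcal I^{*n+1})^*$; $U(L)_n$ maps into $A_n$. $S^nL$ is the $n$-th symmetric power, and the equality in (3) is via the natural morphism $S^nL\to U(L)_n/U(L)_{n-1}$. *)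

theory Defs
  imports "HOL-Algebra.Algebraic_Closure_Type" "HOL-Library.Poly_Mapping"
begin

section \<open>Linear algebra over the field \<open>'k\<close>\<close>

text \<open>
  Structures that vary inside a statement (test algebras, tensor products, quotients, enveloping
  algebras) are carrier-based records of HOL-Algebra over the ground field \<^term>\<open>KK\<close>, which is
  the type \<open>'k\<close>. For a mere vector space the fields \<open>mult\<close> and \<open>one\<close> carry no
  information.
\<close>

abbreviation KK :: "'k::field ring" where
  "KK \<equiv> ring_of_type_algebra"

definition linear_map ::
  "('r, 'x) ring_scheme \<Rightarrow> ('r, 'v, 'y) module_scheme \<Rightarrow> ('r, 'w, 'z) module_scheme \<Rightarrow> ('v \<Rightarrow> 'w) \<Rightarrow> bool"
  where
  "linear_map R V W f \<longleftrightarrow> f \<in> carrier V \<rightarrow> carrier W \<and>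
     (\<forall>x\<in>carrier V. \<forall>y\<in>carrier V. f (x \<oplus>\<^bsub>V\<^esub> y) = f x \<oplus>\<^bsub>W\<^esub> f y) \<and>
     (\<forall>c\<in>carrier R. \<forall>x\<in>carrier V. f (c \<odot>\<^bsub>V\<^esub> x) = c \<odot>\<^bsub>W\<^esub> f x)"

definition linear_iso ::
  "('r, 'x) ring_scheme \<Rightarrow> ('r, 'v, 'y) module_scheme \<Rightarrow> ('r, 'w, 'z) module_scheme \<Rightarrow> ('v \<Rightarrow> 'w) \<Rightarrow> bool"
  where
  "linear_iso R V W f \<longleftrightarrow> linear_map R V W f \<and> bij_betw f (carrier V) (carrier W)"

definition lspan :: "('r, 'x) ring_scheme \<Rightarrow> ('r, 'v, 'y) module_scheme \<Rightarrow> 'v set \<Rightarrow> 'v set" where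
  "lspan R M Z = \<Inter>{H. submodule H R M \<and> Z \<subseteq> H}"

text \<open>
  The quotient by a subspace (or by an ideal, when the multiplication is meaningful), extending
  the library's \<^const>\<open>FactRing\<close> by the scalar multiplication.
\<close>

definition quot_module :: "('r, 'v, 'y) module_scheme \<Rightarrow> 'v set \<Rightarrow> ('r, 'v set) module" where
  "quot_module V W =
     ring.extend (V Quot W) (module.fields (\<lambda>c Z. \<Union>x\<in>Z. W +>\<^bsub>V\<^esub> (c \<odot>\<^bsub>V\<^esub> x)))"

text \<open>
  A ring as a module over itself; over the functor variable \<open>S\<close> this is \<open>\<K>(S) = S\<close>.
\<close>

definition self_module :: "('r, 'x) ring_scheme \<Rightarrow> ('r, 'r) module" where
  "self_module S = ring.extend (ring.truncate S) (module.fields (monoid.mult S))"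

subsection \<open>Free vector spaces and monoid algebras\<close>

definition pm_mult :: "('x \<Rightarrow> 'x \<Rightarrow> 'x) \<Rightarrow> ('x \<Rightarrow>\<^sub>0 'k::field) \<Rightarrow> ('x \<Rightarrow>\<^sub>0 'k) \<Rightarrow> ('x \<Rightarrow>\<^sub>0 'k)" where
  "pm_mult m p q = (\<Sum>x\<in>Poly_Mapping.keys p. \<Sum>y\<in>Poly_Mapping.keys q.
     Poly_Mapping.single (m x y) (Poly_Mapping.lookup p x * Poly_Mapping.lookup q y))"

text \<open>
  The vector space with basis \<open>Z\<close>, with the bilinear multiplication that extends the operation
  \<open>m\<close> on basis elements and with the basis element \<open>e\<close> as its unit.
\<close>

definition free_alg :: "'x set \<Rightarrow> ('x \<Rightarrow> 'x \<Rightarrow> 'x) \<Rightarrow> 'x \<Rightarrow> ('k::field, 'x \<Rightarrow>\<^sub>0 'k) module" where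
  "free_alg Z m e =
     \<lparr>carrier = {p. Poly_Mapping.keys p \<subseteq> Z}, monoid.mult = pm_mult m, one = Poly_Mapping.single e 1,
      zero = 0, add = (+), module.smult = (\<lambda>c. Poly_Mapping.map ((*) c))\<rparr>"

text \<open>Linear extension to the free vector space of a map on the basis.\<close>

definition lext :: "('k::field, 'w, 'z) module_scheme \<Rightarrow> ('x \<Rightarrow> 'w) \<Rightarrow> ('x \<Rightarrow>\<^sub>0 'k) \<Rightarrow> 'w" where
  "lext P B p = (\<Oplus>\<^bsub>P\<^esub>x\<in>Poly_Mapping.keys p. Poly_Mapping.lookup p x \<odot>\<^bsub>P\<^esub> B x)"

subsection \<open>Tensor products over \<open>'k\<close>\<close>

text \<open>
  \<open>V \<otimes> W\<close> is the free vector space on \<open>V \<times> W\<close> modulo the bilinearity relations. If \<open>V\<close> and \<open>W\<close>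
  are algebras, the multiplication is that of the tensor product of algebras.
\<close>

definition tens_free ::
  "('k::field, 'v, 'y) module_scheme \<Rightarrow> ('k, 'w, 'z) module_scheme \<Rightarrow> ('k, 'v \<times> 'w \<Rightarrow>\<^sub>0 'k) module" where
  "tens_free V W = free_alg (carrier V \<times> carrier W)
     (\<lambda>x y. (fst x \<otimes>\<^bsub>V\<^esub> fst y, snd x \<otimes>\<^bsub>W\<^esub> snd y)) (\<one>\<^bsub>V\<^esub>, \<one>\<^bsub>W\<^esub>)"

definition bilin_rel ::
  "('k::field, 'v, 'y) module_scheme \<Rightarrow> ('k, 'w, 'z) module_scheme \<Rightarrow> ('v \<times> 'w \<Rightarrow>\<^sub>0 'k) set" where
  "bilin_rel V W = lspan KK (tens_free V W)
    ({Poly_Mapping.single (v \<oplus>\<^bsub>V\<^esub> v', w) 1 - Poly_Mapping.single (v, w) 1 - Poly_Mapping.single (v', w) 1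
        | v v' w. v \<in> carrier V \<and> v' \<in> carrier V \<and> w \<in> carrier W} \<union>
     {Poly_Mapping.single (v, w \<oplus>\<^bsub>W\<^esub> w') 1 - Poly_Mapping.single (v, w) 1 - Poly_Mapping.single (v, w') 1
        | v w w'. v \<in> carrier V \<and> w \<in> carrier W \<and> w' \<in> carrier W} \<union>
     {Poly_Mapping.single (c \<odot>\<^bsub>V\<^esub> v, w) 1 - Poly_Mapping.single (v, w) c
        | c v w. v \<in> carrier V \<and> w \<in> carrier W} \<union>
     {Poly_Mapping.single (v, c \<odot>\<^bsub>W\<^esub> w) 1 - Poly_Mapping.single (v, w) c
        | c v w. v \<in> carrier V \<and> w \<in> carrier W})"

definition tensor ::
  "('k::field, 'v, 'y) module_scheme \<Rightarrow> ('k, 'w, 'z) module_scheme \<Rightarrow> ('k, ('v \<times> 'w \<Rightarrow>\<^sub>0 'k) set) module"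
  where
  "tensor V W = quot_module (tens_free V W) (bilin_rel V W)"

definition pure_tensor ::
  "('k::field, 'v, 'y) module_scheme \<Rightarrow> ('k, 'w, 'z) module_scheme \<Rightarrow> 'v \<Rightarrow> 'w \<Rightarrow> ('v \<times> 'w \<Rightarrow>\<^sub>0 'k) set"
  where
  "pure_tensor V W v w = bilin_rel V W +>\<^bsub>tens_free V W\<^esub> Poly_Mapping.single (v, w) 1"

text \<open>
  The linear map \<open>V \<otimes> W \<rightarrow> P\<close> with \<open>v \<otimes> w \<mapsto> B v w\<close>. For bilinear \<open>B\<close> the linear extension of \<open>B\<close>
  is constant on every coset \<open>Z\<close>, and \<^const>\<open>the_elem\<close> picks its value.
\<close>

definition tlift ::
  "('k::field, 'p, 'z) module_scheme \<Rightarrow> ('v \<Rightarrow> 'w \<Rightarrow> 'p) \<Rightarrow> ('v \<times> 'w \<Rightarrow>\<^sub>0 'k) set \<Rightarrow> 'p" where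
  "tlift P B Z = the_elem (lext P (\<lambda>(v, w). B v w) ` Z)"

definition tensor_map ::
  "('k::field, 'p, 'y) module_scheme \<Rightarrow> ('k, 'q, 'z) module_scheme \<Rightarrow>
   ('v \<Rightarrow> 'p) \<Rightarrow> ('w \<Rightarrow> 'q) \<Rightarrow> ('v \<times> 'w \<Rightarrow>\<^sub>0 'k) set \<Rightarrow> ('p \<times> 'q \<Rightarrow>\<^sub>0 'k) set" where
  "tensor_map P Q f g = tlift (tensor P Q) (\<lambda>v w. pure_tensor P Q (f v) (g w))"

section \<open>Bialgebras\<close>

record (overloaded) ('k, 'v) bialg = "('k, 'v) module" +
  comult :: "'v \<Rightarrow> ('v \<times> 'v \<Rightarrow>\<^sub>0 'k) set"
  counit :: "'v \<Rightarrow> 'k"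

text \<open>The record of a bialgebra whose underlying ring is a type of class \<^class>\<open>ring_1\<close>.\<close>

definition bialg_of_type ::
  "('k \<Rightarrow> 'a \<Rightarrow> 'a) \<Rightarrow> ('a \<Rightarrow> ('a \<times> 'a \<Rightarrow>\<^sub>0 'k) set) \<Rightarrow> ('a \<Rightarrow> 'k) \<Rightarrow> ('k::field, 'a::ring_1) bialg"
  where
  "bialg_of_type scale \<Delta> \<epsilon> =
     \<lparr>carrier = UNIV, monoid.mult = (*), one = 1, zero = 0, add = (+),
      module.smult = scale, comult = \<Delta>, counit = \<epsilon>\<rparr>"

locale bialgebra = module KK A + ring A
  for A :: "('k::field, 'v, 'z) bialg_scheme" (structure) +
  assumes smult_mult_left:
      "\<lbrakk>x \<in> carrier A; y \<in> carrier A\<rbrakk> \<Longrightarrow> (c \<odot> x) \<otimes> y = c \<odot> (x \<otimes> y)"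
    and smult_mult_right:
      "\<lbrakk>x \<in> carrier A; y \<in> carrier A\<rbrakk> \<Longrightarrow> x \<otimes> (c \<odot> y) = c \<odot> (x \<otimes> y)"
    and comult_linear: "linear_map KK A (tensor A A) (comult A)"
    and counit_linear: "linear_map KK A (self_module KK) (counit A)"
    and coassoc:
      "x \<in> carrier A \<Longrightarrow>
        tlift (tensor A (tensor A A))
          (\<lambda>t c. tlift (tensor A (tensor A A))
             (\<lambda>a b. pure_tensor A (tensor A A) a (pure_tensor A A b c)) t)
          (tensor_map (tensor A A) A (comult A) id (comult A x))
        = tensor_map A (tensor A A) id (comult A) (comult A x)"
    and counit_left: "x \<in> carrier A \<Longrightarrow> tlift A (\<lambda>a b. counit A a \<odot> b) (comult A x) = x"
    and counit_right: "x \<in> carrier A \<Longrightarrow> tlift A (\<lambda>a b. counit A b \<odot> a) (comult A x) = x"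
    and comult_mult:
      "\<lbrakk>x \<in> carrier A; y \<in> carrier A\<rbrakk> \<Longrightarrow>
        comult A (x \<otimes> y) = comult A x \<otimes>\<^bsub>tensor A A\<^esub> comult A y"
    and comult_one: "comult A \<one> = \<one>\<^bsub>tensor A A\<^esub>"
    and counit_mult:
      "\<lbrakk>x \<in> carrier A; y \<in> carrier A\<rbrakk> \<Longrightarrow> counit A (x \<otimes> y) = counit A x * counit A y"
    and counit_one: "counit A \<one> = 1"

locale cocommutative_bialgebra = bialgebra +
  assumes cocomm:
    "x \<in> carrier A \<Longrightarrow> tlift (tensor A A) (\<lambda>a b. pure_tensor A A b a) (comult A x) = comult A x"

definition bialgebra_iso ::
  "('k::field, 'v, 'y) bialg_scheme \<Rightarrow> ('k, 'w, 'z) bialg_scheme \<Rightarrow> ('v \<Rightarrow> 'w) \<Rightarrow> bool" where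
  "bialgebra_iso A B h \<longleftrightarrow> linear_iso KK A B h \<and> h \<in> ring_hom A B \<and>
     (\<forall>x\<in>carrier A. comult B (h x) = tensor_map B B h h (comult A x)) \<and>
     (\<forall>x\<in>carrier A. counit B (h x) = counit A x)"

definition primitives :: "('k::field, 'v, 'z) bialg_scheme \<Rightarrow> 'v set" where
  "primitives A = {a \<in> carrier A.
     comult A a = pure_tensor A A a \<one>\<^bsub>A\<^esub> \<oplus>\<^bsub>tensor A A\<^esub> pure_tensor A A \<one>\<^bsub>A\<^esub> a}"

section \<open>Functors on commutative \<open>'k\<close>-algebras\<close>

text \<open>
  The test algebras are the commutative \<open>'k\<close>-algebras whose carrier is a subset of the type \<open>'s\<close>,
  which plays the role of a universe; the theorem is stated for every \<open>'s\<close> into which the type of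
  the bialgebra embeds.
\<close>

definition kalgs :: "('k::field, 's) module set" where
  "kalgs = {S. algebra KK S}"

definition kalg_hom :: "('k::field, 's) module \<Rightarrow> ('k, 's) module \<Rightarrow> ('s \<Rightarrow> 's) set" where
  "kalg_hom S T = {h \<in> ring_hom S T. linear_map KK S T h}"

text \<open>
  A functor of \<open>\<K>\<close>-modules: \<open>fob F S\<close> is an \<open>S\<close>-module and \<open>far F S T h\<close> is the map
  \<open>F(S) \<rightarrow> F(T)\<close> induced by \<open>h : S \<rightarrow> T\<close>. If \<open>F\<close> is a functor of algebras, the record \<open>fob F S\<close>
  holds the multiplication as well.
\<close>

record ('k, 's, 't) modfun =
  fob :: "('k, 's) module \<Rightarrow> ('s, 't) module"
  far :: "('k, 's) module \<Rightarrow> ('k, 's) module \<Rightarrow> ('s \<Rightarrow> 's) \<Rightarrow> 't \<Rightarrow> 't"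

text \<open>The morphisms of functors of \<open>\<K>\<close>-modules.\<close>

definition Hom_fun ::
  "('k::field, 's, 't) modfun \<Rightarrow> ('k, 's, 'u) modfun \<Rightarrow> (('k, 's) module \<Rightarrow> 't \<Rightarrow> 'u) set" where
  "Hom_fun F G = {\<phi>. (\<forall>S\<in>kalgs. linear_map S (fob F S) (fob G S) (\<phi> S)) \<and>
     (\<forall>S\<in>kalgs. \<forall>T\<in>kalgs. \<forall>h\<in>kalg_hom S T. \<forall>x\<in>carrier (fob F S).
        \<phi> T (far F S T h x) = far G S T h (\<phi> S x))}"

text \<open>The functor \<open>\<K>(S) = S\<close>.\<close>

definition K_fun :: "('k::field, 's, 's) modfun" where
  "K_fun = \<lparr>fob = self_module, far = (\<lambda>S T h. h)\<rparr>"

text \<open>The functor \<open>T \<mapsto> S \<otimes> T\<close> of (commutative) \<open>\<K>\<close>-algebras attached to an algebra \<open>S\<close>.\<close>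

definition scalar_fun :: "('k::field, 's) module \<Rightarrow> ('k, 's, ('s \<times> 's \<Rightarrow>\<^sub>0 'k) set) modfun" where
  "scalar_fun S =
     \<lparr>fob = (\<lambda>T. ring.extend (ring.truncate (tensor S T))
        (module.fields (\<lambda>t Z. pure_tensor S T \<one>\<^bsub>S\<^esub> t \<otimes>\<^bsub>tensor S T\<^esub> Z))),
      far = (\<lambda>T T' h. tensor_map S T' id h)\<rparr>"

text \<open>The module scheme \<open>V\<^sup>*(S) = Hom(V, S)\<close>.\<close>

definition dual :: "('k::field, 'v, 'z) module_scheme \<Rightarrow> ('k, 's, 'v \<Rightarrow> 's) modfun" where
  "dual V =
     \<lparr>fob = (\<lambda>S. \<lparr>carrier = {f \<in> extensional (carrier V). linear_map KK V S f},
        monoid.mult = undefined, one = undefined,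
        zero = (\<lambda>x\<in>carrier V. \<zero>\<^bsub>S\<^esub>),
        add = (\<lambda>f g. \<lambda>x\<in>carrier V. f x \<oplus>\<^bsub>S\<^esub> g x),
        module.smult = (\<lambda>s f. \<lambda>x\<in>carrier V. s \<otimes>\<^bsub>S\<^esub> f x)\<rparr>),
      far = (\<lambda>S T h f. \<lambda>x\<in>carrier V. h (f x))\<rparr>"

text \<open>
  \<open>A\<^sup>*\<close> as a functor of algebras, the multiplication being dual to the comultiplication of \<open>A\<close>.
\<close>

definition dual_alg :: "('k::field, 'v, 'z) bialg_scheme \<Rightarrow> ('k, 's, 'v \<Rightarrow> 's) modfun" where
  "dual_alg A =
     \<lparr>fob = (\<lambda>S. (fob (dual A) S)
        \<lparr>monoid.mult := (\<lambda>f g. \<lambda>a\<in>carrier A. tlift S (\<lambda>x y. f x \<otimes>\<^bsub>S\<^esub> g y) (comult A a)),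
         one := (\<lambda>a\<in>carrier A. counit A a \<odot>\<^bsub>S\<^esub> \<one>\<^bsub>S\<^esub>)\<rparr>),
      far = far (dual A)\<rparr>"

subsection \<open>Submodule functors and module scheme closure\<close>

definition submodule_fun ::
  "('k::field, 's, 't) modfun \<Rightarrow> (('k, 's) module \<Rightarrow> 't set) \<Rightarrow> bool" where
  "submodule_fun F N \<longleftrightarrow> (\<forall>S\<in>kalgs. submodule (N S) S (fob F S)) \<and>
     (\<forall>S\<in>kalgs. \<forall>T\<in>kalgs. \<forall>h\<in>kalg_hom S T. far F S T h ` N S \<subseteq> N T)"

definition sub_fun ::
  "('k::field, 's, 't) modfun \<Rightarrow> (('k, 's) module \<Rightarrow> 't set) \<Rightarrow> ('k, 's, 't) modfun" where
  "sub_fun F N = \<lparr>fob = (\<lambda>S. (fob F S)\<lparr>carrier := N S\<rparr>), far = far F\<rparr>"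

definition quot_fun ::
  "('k::field, 's, 't) modfun \<Rightarrow> (('k, 's) module \<Rightarrow> 't set) \<Rightarrow> ('k, 's, 't set) modfun" where
  "quot_fun F N =
     \<lparr>fob = (\<lambda>S. quot_module (fob F S) (N S)),
      far = (\<lambda>S T h Z. \<Union>x\<in>Z. N T +>\<^bsub>fob F T\<^esub> far F S T h x)\<rparr>"

definition module_subscheme ::
  "('k::field, 's, 't) modfun \<Rightarrow> (('k, 's) module \<Rightarrow> 't set) \<Rightarrow> bool" where
  "module_subscheme F N \<longleftrightarrow> submodule_fun F N \<and>
     (\<exists>(M :: ('k, 's) module) \<theta>. module KK M \<and> \<theta> \<in> Hom_fun (dual M) (sub_fun F N) \<and>
        (\<forall>S\<in>kalgs. bij_betw (\<theta> S) (carrier (fob (dual M) S)) (N S)))"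

definition scheme_closure ::
  "('k::field, 's, 't) modfun \<Rightarrow> (('k, 's) module \<Rightarrow> 't set) \<Rightarrow> ('k, 's) module \<Rightarrow> 't set" where
  "scheme_closure F Z S =
     \<Inter>{N S | N. module_subscheme F N \<and> (\<forall>T\<in>kalgs. Z T \<subseteq> N T)}"

section \<open>Infinitesimal formal groups\<close>

text \<open>The kernel \<open>I\<^sup>*\<close> of \<open>e : A\<^sup>* \<rightarrow> \<K>\<close>, the evaluation at \<open>1\<close>.\<close>

definition aug_ideal :: "('k::field, 'v, 'z) bialg_scheme \<Rightarrow> ('k, 's) module \<Rightarrow> ('v \<Rightarrow> 's) set" where
  "aug_ideal A S = {f \<in> carrier (fob (dual A) S). f \<one>\<^bsub>A\<^esub> = \<zero>\<^bsub>S\<^esub>}"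

text \<open>
  At \<open>S\<close> the functor \<open>I\<^sup>* \<otimes> \<dots> \<otimes> I\<^sup>*\<close> is the tensor power of \<open>I\<^sup>*(S)\<close> over \<open>S\<close>, so the image of the
  multiplication is the \<open>S\<close>-linear span of the \<open>n\<close>-fold products.
\<close>

definition aug_mult_image ::
  "('k::field, 'v, 'z) bialg_scheme \<Rightarrow> nat \<Rightarrow> ('k, 's) module \<Rightarrow> ('v \<Rightarrow> 's) set" where
  "aug_mult_image A n S = lspan S (fob (dual A) S)
     {foldr (monoid.mult (fob (dual_alg A) S)) fs \<one>\<^bsub>fob (dual_alg A) S\<^esub>
        | fs. length fs = n \<and> set fs \<subseteq> aug_ideal A S}"

definition aug_power ::
  "('k::field, 'v, 'z) bialg_scheme \<Rightarrow> nat \<Rightarrow> ('k, 's) module \<Rightarrow> ('v \<Rightarrow> 's) set" where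
  "aug_power A n = scheme_closure (dual A) (aug_mult_image A n)"

text \<open>
  \<open>A\<^sup>* = lim A\<^sup>*/I\<^sup>*\<^sup>i\<close> (\<open>i \<ge> 1\<close>): the natural morphism to the inverse limit is bijective on every
  test algebra. The type argument fixes the universe of test algebras.
\<close>

definition infinitesimal_formal_monoid ::
  "'s itself \<Rightarrow> ('k::field, 'v, 'z) bialg_scheme \<Rightarrow> bool" where
  "infinitesimal_formal_monoid _ A \<longleftrightarrow> cocommutative_bialgebra A \<and>
     (\<forall>S :: ('k, 's) module \<in> kalgs.
        bij_betw (\<lambda>f. \<lambda>i\<in>{1..}. aug_power A i S +>\<^bsub>fob (dual A) S\<^esub> f)
          (carrier (fob (dual A) S))
          {Z \<in> \<Pi>\<^sub>E i\<in>{1..}. carrier (fob (quot_fun (dual A) (aug_power A i)) S).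
             \<forall>i\<ge>1. (\<Union>f\<in>Z (Suc i). aug_power A i S +>\<^bsub>fob (dual A) S\<^esub> f) = Z i})"

subsection \<open>The functor of monoids \<open>Spec A\<^sup>*\<close>\<close>

definition spec ::
  "('k::field, 'v, 'z) bialg_scheme \<Rightarrow> ('k, 's) module \<Rightarrow>
   (('k, 's) module \<Rightarrow> ('v \<Rightarrow> 's) \<Rightarrow> ('s \<times> 's \<Rightarrow>\<^sub>0 'k) set) set" where
  "spec A S = {\<phi> \<in> Hom_fun (dual_alg A) (scalar_fun S).
     \<forall>T\<in>kalgs. \<phi> T \<in> ring_hom (fob (dual_alg A) T) (fob (scalar_fun S) T)}"

text \<open>
  \<open>\<chi>\<close> is the product of the points \<open>\<phi>\<close> and \<open>\<psi>\<close>: the composite of the map \<open>A\<^sup>* \<rightarrow> (A \<otimes> A)\<^sup>*\<close> dual to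
  the multiplication of \<open>A\<close> with the morphism \<open>\<theta> : (A \<otimes> A)\<^sup>* \<rightarrow> \<S>\<close> that extends
  \<open>f \<otimes> g \<mapsto> \<phi>(f) \<psi>(g)\<close>.
\<close>

definition spec_prod ::
  "('k::field, 'v, 'z) bialg_scheme \<Rightarrow> ('k, 's) module \<Rightarrow>
   (('k, 's) module \<Rightarrow> ('v \<Rightarrow> 's) \<Rightarrow> ('s \<times> 's \<Rightarrow>\<^sub>0 'k) set) \<Rightarrow>
   (('k, 's) module \<Rightarrow> ('v \<Rightarrow> 's) \<Rightarrow> ('s \<times> 's \<Rightarrow>\<^sub>0 'k) set) \<Rightarrow>
   (('k, 's) module \<Rightarrow> ('v \<Rightarrow> 's) \<Rightarrow> ('s \<times> 's \<Rightarrow>\<^sub>0 'k) set) \<Rightarrow> bool" where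
  "spec_prod A S \<phi> \<psi> \<chi> \<longleftrightarrow> (\<exists>\<theta> \<in> Hom_fun (dual (tensor A A)) (scalar_fun S).
     (\<forall>T\<in>kalgs. \<forall>f\<in>carrier (fob (dual A) T). \<forall>g\<in>carrier (fob (dual A) T).
        \<theta> T (\<lambda>Z\<in>carrier (tensor A A). tlift T (\<lambda>a b. f a \<otimes>\<^bsub>T\<^esub> g b) Z)
          = \<phi> T f \<otimes>\<^bsub>tensor S T\<^esub> \<psi> T g) \<and>
     (\<forall>T\<in>kalgs. \<forall>f\<in>carrier (fob (dual A) T).
        \<chi> T f = \<theta> T (\<lambda>Z\<in>carrier (tensor A A). f (tlift A (monoid.mult A) Z))))"

text \<open>The unit point: \<open>e\<close> followed by the structure morphism \<open>\<K> \<rightarrow> \<S>\<close>.\<close>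

definition spec_one ::
  "('k::field, 'v, 'z) bialg_scheme \<Rightarrow> ('k, 's) module \<Rightarrow>
   ('k, 's) module \<Rightarrow> ('v \<Rightarrow> 's) \<Rightarrow> ('s \<times> 's \<Rightarrow>\<^sub>0 'k) set" where
  "spec_one A S T f = pure_tensor S T \<one>\<^bsub>S\<^esub> (f \<one>\<^bsub>A\<^esub>)"

definition infinitesimal_formal_group ::
  "'s itself \<Rightarrow> ('k::field, 'v, 'z) bialg_scheme \<Rightarrow> bool" where
  "infinitesimal_formal_group U A \<longleftrightarrow> infinitesimal_formal_monoid U A \<and>
     (\<forall>S :: ('k, 's) module \<in> kalgs. \<forall>\<phi>\<in>spec A S. \<exists>\<psi>\<in>spec A S.
        spec_prod A S \<phi> \<psi> (spec_one A S) \<and> spec_prod A S \<psi> \<phi> (spec_one A S))"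

subsection \<open>The tangent space and the filtration of \<open>A\<close>\<close>

text \<open>The derivations at \<open>e\<close>.\<close>

definition Der_e ::
  "('k::field, 'v, 'z) bialg_scheme \<Rightarrow> (('k, 's) module \<Rightarrow> ('v \<Rightarrow> 's) \<Rightarrow> 's) set" where
  "Der_e A = {D \<in> Hom_fun (dual A) K_fun.
     \<forall>S\<in>kalgs. \<forall>f\<in>carrier (fob (dual A) S). \<forall>g\<in>carrier (fob (dual A) S).
       D S (f \<otimes>\<^bsub>fob (dual_alg A) S\<^esub> g) = (D S f \<otimes>\<^bsub>S\<^esub> g \<one>\<^bsub>A\<^esub>) \<oplus>\<^bsub>S\<^esub> (f \<one>\<^bsub>A\<^esub> \<otimes>\<^bsub>S\<^esub> D S g)}"

text \<open>
  As \<open>Hom(A\<^sup>*, \<K>) = A\<close>, every morphism \<open>A\<^sup>* \<rightarrow> \<K>\<close> is the evaluation at an element of \<open>A\<close>. The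
  following two definitions are the subspaces of \<open>A\<close> that correspond to \<open>Der(A\<^sup>*, \<K>)\<close> and to
  \<open>Hom(A\<^sup>*/I\<^sup>*\<^sup>n\<^sup>+\<^sup>1, \<K>)\<close>.
\<close>

definition tangent :: "'s itself \<Rightarrow> ('k::field, 'v, 'z) bialg_scheme \<Rightarrow> 'v set" where
  "tangent _ A = {a \<in> carrier A. (\<lambda>(S :: ('k, 's) module) f. f a) \<in> Der_e A}"

definition dual_filt :: "'s itself \<Rightarrow> ('k::field, 'v, 'z) bialg_scheme \<Rightarrow> nat \<Rightarrow> 'v set" where
  "dual_filt _ A n = {a \<in> carrier A.
     \<exists>\<eta> \<in> Hom_fun (quot_fun (dual A) (aug_power A (n + 1))) K_fun.
       \<forall>S :: ('k, 's) module \<in> kalgs. \<forall>f\<in>carrier (fob (dual A) S).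
         \<eta> S (aug_power A (n + 1) S +>\<^bsub>fob (dual A) S\<^esub> f) = f a}"

record ('k, 'v) lie_alg = "('k, 'v) module" +
  bracket :: "'v \<Rightarrow> 'v \<Rightarrow> 'v"

definition tangent_lie ::
  "'s itself \<Rightarrow> ('k::field, 'v, 'z) bialg_scheme \<Rightarrow> ('k, 'v) lie_alg" where
  "tangent_lie U A =
     \<lparr>carrier = tangent U A, monoid.mult = undefined, one = undefined, zero = \<zero>\<^bsub>A\<^esub>, add = add A,
      module.smult = module.smult A, bracket = (\<lambda>x y. (x \<otimes>\<^bsub>A\<^esub> y) \<ominus>\<^bsub>A\<^esub> (y \<otimes>\<^bsub>A\<^esub> x))\<rparr>"

section \<open>Enveloping algebras and symmetric powers\<close>

text \<open>
  \<open>U(L)\<close> is presented by letters \<open>[x]\<close>, \<open>x \<in> L\<close>: the linearity relations turn the free algebra on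
  the set \<open>L\<close> into the tensor algebra \<open>T(L)\<close>, in which words of length \<open>i\<close> span \<open>T\<^sup>i L\<close>.
\<close>

abbreviation word_alg :: "('k::field, 'v, 'z) lie_alg_scheme \<Rightarrow> ('k, 'v list \<Rightarrow>\<^sub>0 'k) module" where
  "word_alg L \<equiv> free_alg (lists (carrier L)) (@) []"

definition env_ideal :: "('k::field, 'v, 'z) lie_alg_scheme \<Rightarrow> ('v list \<Rightarrow>\<^sub>0 'k) set" where
  "env_ideal L = genideal (word_alg L)
    ({Poly_Mapping.single [x \<oplus>\<^bsub>L\<^esub> y] 1 - Poly_Mapping.single [x] 1 - Poly_Mapping.single [y] 1
        | x y. x \<in> carrier L \<and> y \<in> carrier L} \<union>
     {Poly_Mapping.single [c \<odot>\<^bsub>L\<^esub> x] 1 - Poly_Mapping.single [x] c | c x. x \<in> carrier L} \<union>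
     {Poly_Mapping.single [x, y] 1 - Poly_Mapping.single [y, x] 1
          - Poly_Mapping.single [bracket L x y] 1
        | x y. x \<in> carrier L \<and> y \<in> carrier L})"

definition env_alg ::
  "('k::field, 'v, 'z) lie_alg_scheme \<Rightarrow> ('k, ('v list \<Rightarrow>\<^sub>0 'k) set) module" where
  "env_alg L = quot_module (word_alg L) (env_ideal L)"

definition env_incl :: "('k::field, 'v, 'z) lie_alg_scheme \<Rightarrow> 'v \<Rightarrow> ('v list \<Rightarrow>\<^sub>0 'k) set" where
  "env_incl L x = env_ideal L +>\<^bsub>word_alg L\<^esub> Poly_Mapping.single [x] 1"

text \<open>
  The comultiplication and the counit are the algebra morphisms with \<open>x \<mapsto> x \<otimes> 1 + 1 \<otimes> x\<close> and
  \<open>x \<mapsto> 0\<close> for \<open>x \<in> L\<close>.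
\<close>

definition env ::
  "('k::field, 'v, 'z) lie_alg_scheme \<Rightarrow> ('k, ('v list \<Rightarrow>\<^sub>0 'k) set) bialg" where
  "env L = (let U = env_alg L; UU = tensor U U;
      \<delta> = (\<lambda>x. pure_tensor U U (env_incl L x) \<one>\<^bsub>U\<^esub> \<oplus>\<^bsub>UU\<^esub> pure_tensor U U \<one>\<^bsub>U\<^esub> (env_incl L x))
    in module.extend U (bialg.fields
      (\<lambda>Z. the_elem (lext UU (\<lambda>w. foldr (\<lambda>x t. \<delta> x \<otimes>\<^bsub>UU\<^esub> t) w \<one>\<^bsub>UU\<^esub>) ` Z))
      (\<lambda>Z. the_elem ((\<lambda>p. Poly_Mapping.lookup p []) ` Z))))"

text \<open>\<open>U(L)\<^sub>n\<close>, the classes of combinations of words of length at most \<open>n\<close>.\<close>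

definition env_filt ::
  "('k::field, 'v, 'z) lie_alg_scheme \<Rightarrow> nat \<Rightarrow> ('v list \<Rightarrow>\<^sub>0 'k) set set" where
  "env_filt L n = {env_ideal L +>\<^bsub>word_alg L\<^esub> p | p.
     p \<in> carrier (word_alg L) \<and> (\<forall>w\<in>Poly_Mapping.keys p. length w \<le> n)}"

text \<open>The algebra morphism \<open>U(L) \<rightarrow> A\<close> that extends an inclusion of \<open>L\<close> in \<open>A\<close>.\<close>

definition env_map :: "('k::field, 'v, 'z) module_scheme \<Rightarrow> ('v list \<Rightarrow>\<^sub>0 'k) set \<Rightarrow> 'v" where
  "env_map A Z = the_elem (lext A (\<lambda>w. foldr (monoid.mult A) w \<one>\<^bsub>A\<^esub>) ` Z)"

text \<open>
  \<open>S\<^sup>n L\<close>: words of length \<open>n\<close> modulo multilinearity and exchange of neighbouring letters.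
\<close>

abbreviation word_space ::
  "('k::field, 'v, 'z) lie_alg_scheme \<Rightarrow> nat \<Rightarrow> ('k, 'v list \<Rightarrow>\<^sub>0 'k) module" where
  "word_space L n \<equiv> (word_alg L)\<lparr>carrier :=
     {p. Poly_Mapping.keys p \<subseteq> {w \<in> lists (carrier L). length w = n}}\<rparr>"

definition sym_power ::
  "('k::field, 'v, 'z) lie_alg_scheme \<Rightarrow> nat \<Rightarrow> ('k, ('v list \<Rightarrow>\<^sub>0 'k) set) module" where
  "sym_power L n = quot_module (word_space L n) (lspan KK (word_space L n)
    ({Poly_Mapping.single (u @ [x \<oplus>\<^bsub>L\<^esub> y] @ v) 1 - Poly_Mapping.single (u @ [x] @ v) 1
          - Poly_Mapping.single (u @ [y] @ v) 1
        | u v x y. u \<in> lists (carrier L) \<and> v \<in> lists (carrier L) \<and>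
            x \<in> carrier L \<and> y \<in> carrier L \<and> length u + 1 + length v = n} \<union>
     {Poly_Mapping.single (u @ [c \<odot>\<^bsub>L\<^esub> x] @ v) 1 - Poly_Mapping.single (u @ [x] @ v) c
        | u v c x. u \<in> lists (carrier L) \<and> v \<in> lists (carrier L) \<and>
            x \<in> carrier L \<and> length u + 1 + length v = n} \<union>
     {Poly_Mapping.single (u @ [x, y] @ v) 1 - Poly_Mapping.single (u @ [y, x] @ v) 1
        | u v x y. u \<in> lists (carrier L) \<and> v \<in> lists (carrier L) \<and>
            x \<in> carrier L \<and> y \<in> carrier L \<and> length u + 2 + length v = n}))"

subsection \<open>Associated graded pieces\<close>

text \<open>
  \<open>F\<^sub>n / F\<^sub>n\<^sub>-\<^sub>1\<close> for a filtration \<open>F\<close> of \<open>V\<close> by subspaces, where \<open>F\<^sub>-\<^sub>1 = 0\<close>.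
\<close>

definition prev_filt :: "('r, 'v, 'z) module_scheme \<Rightarrow> (nat \<Rightarrow> 'v set) \<Rightarrow> nat \<Rightarrow> 'v set" where
  "prev_filt V F n = (case n of 0 \<Rightarrow> {\<zero>\<^bsub>V\<^esub>} | Suc m \<Rightarrow> F m)"

definition gr :: "('r, 'v, 'z) module_scheme \<Rightarrow> (nat \<Rightarrow> 'v set) \<Rightarrow> nat \<Rightarrow> ('r, 'v set) module" where
  "gr V F n = quot_module (V\<lparr>carrier := F n\<rparr>) (prev_filt V F n)"

text \<open>The map of graded pieces induced by \<open>h : V \<rightarrow> W\<close>, where \<open>G\<close> is the filtration of \<open>W\<close>.\<close>

definition gr_map ::
  "('r, 'w, 'z) module_scheme \<Rightarrow> (nat \<Rightarrow> 'w set) \<Rightarrow> nat \<Rightarrow> ('v \<Rightarrow> 'w) \<Rightarrow> 'v set \<Rightarrow> 'w set" where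
  "gr_map W G n h Z = (\<Union>x\<in>Z. prev_filt W G n +>\<^bsub>W\<^esub> h x)"

text \<open>The natural morphism \<open>S\<^sup>n L \<rightarrow> U(L)\<^sub>n / U(L)\<^sub>n\<^sub>-\<^sub>1\<close>, \<open>x\<^sub>1 \<cdots> x\<^sub>n \<mapsto> x\<^sub>1 \<cdots> x\<^sub>n\<close>.\<close>

definition sym_to_gr ::
  "('k::field, 'v, 'z) lie_alg_scheme \<Rightarrow> nat \<Rightarrow>
   ('v list \<Rightarrow>\<^sub>0 'k) set \<Rightarrow> ('v list \<Rightarrow>\<^sub>0 'k) set set" where
  "sym_to_gr L n =
     gr_map (env L) (env_filt L) n (\<lambda>p. env_ideal L +>\<^bsub>word_alg L\<^esub> p)"

end

theory Submission
  imports Defs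
begin

text \<open>
  Let \<open>G n \<subseteq> A\<close> be the annihilator of the products of \<open>n\<close> functionals \<open>A \<rightarrow> K\<close> that vanish at \<open>1\<close>. A module
  subscheme of \<open>A\<^sup>*\<close> is the annihilator of a subspace of \<open>A\<close>, so \<open>I\<^sup>*\<^sup>n\<close> is the annihilator of \<open>G n\<close>;
  hence \<open>A\<^sub>n = G (n + 1)\<close>, and completeness of \<open>A\<^sup>*\<close> says that the \<open>G n\<close> exhaust \<open>A\<close>.

  Let \<open>e : A \<rightarrow> L\<close> be a linear projection onto the primitive elements with \<open>e(1) = 0\<close>. By induction and
  cocommutativity, \<open>a \<mapsto> \<Sum> e(a\<^sub>1) a\<^sub>2\<close> acts on \<open>G (n + 1) / G n\<close> as multiplication by \<open>n\<close>. Since its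
  image lies in \<open>L \<cdot> G n\<close>, characteristic zero shows that \<open>G (n + 1)\<close> is spanned by the products of
  at most \<open>n\<close> elements of \<open>L\<close>.

  The map \<open>a \<mapsto> \<Sum> e(a\<^sub>1) \<cdots> e(a\<^sub>n) \<in> S\<^sup>n L\<close> kills \<open>G n\<close> and sends \<open>x\<^sub>1 \<cdots> x\<^sub>n\<close> to \<open>n! x\<^sub>1 \<cdots> x\<^sub>n\<close> for \<open>x\<^sub>i \<in> L\<close>.
  So the surjection \<open>S\<^sup>n L \<rightarrow> U(L)\<^sub>n / U(L)\<^sub>n\<^sub>-\<^sub>1\<close> followed by the map to \<open>G (n + 1) / G n\<close> is injective,
  and both maps are isomorphisms. In particular the Poincare-Birkhoff-Witt theorem for \<open>L\<close> is a
  consequence, not an ingredient.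
\<close>

text \<open>Elements of A \<otimes> A are never expanded. A Sweedler sum is the value at
  \<open>\<Delta> a\<close> of the linear map induced by a bilinear map B, and one vanishing
  principle, \<open>sw_G_zero\<close>, replaces basis computations: if B vanishes on 1 \<otimes> A
  and on A \<otimes> G n, its sum vanishes at every element of G (n + 1). Since the target of B is
  an arbitrary vector space, the principle applies to A, K, \<open>S\<^sup>n L\<close> and every
  test algebra; this is how a filtration defined by K-valued functionals controls products of
  functionals over all test algebras.

  The operator built from e imitates Euler's operator: in a product of n primitive elements it moves
  each factor to the front in turn, up to shorter products. The normalization e(1) = 0 provides the
  vanishing on 1 \<otimes> A.

  The closure in the definition of the ideal powers quantifies over all module subschemes. The
  annihilator of G n contains the n-th power over every test algebra; equality is proved at K, for
  positive exponents. That step needs square-zero extensions, which must fit into the fixed universe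
  of test algebras.\<close>

lemma carrier_KK [simp]: "carrier (KK :: 'k::field ring) = UNIV"
  and add_KK [simp]: "x \<oplus>\<^bsub>KK\<^esub> y = (x + y :: 'k::field)"
  and mult_KK [simp]: "x \<otimes>\<^bsub>KK\<^esub> y = (x * y :: 'k::field)"
  and zero_KK [simp]: "\<zero>\<^bsub>KK\<^esub> = (0 :: 'k::field)"
  and one_KK [simp]: "\<one>\<^bsub>KK\<^esub> = (1 :: 'k::field)"
  by (simp_all add: ring_of_type_algebra_def)

lemma a_inv_KK [simp]: "\<ominus>\<^bsub>KK\<^esub> x = (- x :: 'k::field)"
proof -
  interpret cring "KK :: 'k ring" ..
  show ?thesis
    by (rule minus_equality) auto
qed

lemma (in abelian_group) minus_eq_zero_iff [simp]:
  assumes "x \<in> carrier G" "y \<in> carrier G"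
  shows "x \<ominus> y = \<zero> \<longleftrightarrow> x = y"
  using assms by (metis a_minus_def a_inv_closed minus_equality minus_minus r_neg)

section \<open>Linear maps, submodules and spans\<close>

lemma linear_mapI:
  assumes "\<And>x. x \<in> carrier V \<Longrightarrow> f x \<in> carrier W"
    and "\<And>x y. x \<in> carrier V \<Longrightarrow> y \<in> carrier V \<Longrightarrow> f (x \<oplus>\<^bsub>V\<^esub> y) = f x \<oplus>\<^bsub>W\<^esub> f y"
    and "\<And>c x. c \<in> carrier R \<Longrightarrow> x \<in> carrier V \<Longrightarrow> f (c \<odot>\<^bsub>V\<^esub> x) = c \<odot>\<^bsub>W\<^esub> f x"
  shows "linear_map R V W f"
  using assms unfolding linear_map_def by auto

lemma linear_mapD:
  assumes "linear_map R V W f"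
  shows "x \<in> carrier V \<Longrightarrow> f x \<in> carrier W"
    and "x \<in> carrier V \<Longrightarrow> y \<in> carrier V \<Longrightarrow> f (x \<oplus>\<^bsub>V\<^esub> y) = f x \<oplus>\<^bsub>W\<^esub> f y"
    and "c \<in> carrier R \<Longrightarrow> x \<in> carrier V \<Longrightarrow> f (c \<odot>\<^bsub>V\<^esub> x) = c \<odot>\<^bsub>W\<^esub> f x"
  using assms unfolding linear_map_def by auto

lemma linear_map_comp:
  assumes "linear_map R V W f" "linear_map R W U g"
  shows "linear_map R V U (\<lambda>x. g (f x))"
  using assms unfolding linear_map_def by (auto simp: Pi_iff)

lemma linear_map_cong:
  assumes "\<And>x. x \<in> carrier V \<Longrightarrow> f x = g x" "module R V"
  shows "linear_map R V W f \<longleftrightarrow> linear_map R V W g"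
proof -
  interpret module R V by fact
  show ?thesis unfolding linear_map_def using assms(1) by (auto simp: Pi_iff)
qed

context
  fixes R V W f
  assumes V: "module R V" and W: "module R W" and f: "linear_map R V W f"
begin

interpretation V: module R V by (rule V)
interpretation W: module R W by (rule W)

lemma linear_map_zero: "f \<zero>\<^bsub>V\<^esub> = \<zero>\<^bsub>W\<^esub>"
proof -
  have "f \<zero>\<^bsub>V\<^esub> = f (\<zero>\<^bsub>R\<^esub> \<odot>\<^bsub>V\<^esub> \<zero>\<^bsub>V\<^esub>)" by simp
  also have "\<dots> = \<zero>\<^bsub>R\<^esub> \<odot>\<^bsub>W\<^esub> f \<zero>\<^bsub>V\<^esub>" using linear_mapD[OF f] by blast
  finally show ?thesis using linear_mapD(1)[OF f] by simp
qed

lemma linear_map_a_inv: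
  assumes "x \<in> carrier V" shows "f (\<ominus>\<^bsub>V\<^esub> x) = \<ominus>\<^bsub>W\<^esub> f x"
proof -
  have "f (\<ominus>\<^bsub>V\<^esub> x) \<oplus>\<^bsub>W\<^esub> f x = f (\<ominus>\<^bsub>V\<^esub> x \<oplus>\<^bsub>V\<^esub> x)"
    using assms linear_mapD(2)[OF f] by simp
  then have "f (\<ominus>\<^bsub>V\<^esub> x) \<oplus>\<^bsub>W\<^esub> f x = \<zero>\<^bsub>W\<^esub>"
    using assms by (simp add: V.M.l_neg linear_map_zero)
  then show ?thesis
    using assms linear_mapD(1)[OF f] by (metis W.M.minus_equality V.M.a_inv_closed)
qed

lemma linear_map_minus:
  assumes "x \<in> carrier V" "y \<in> carrier V"
  shows "f (x \<ominus>\<^bsub>V\<^esub> y) = f x \<ominus>\<^bsub>W\<^esub> f y"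
  using assms linear_mapD(2)[OF f] by (simp add: a_minus_def linear_map_a_inv)

lemma linear_map_finsum:
  assumes "finite I" "\<And>i. i \<in> I \<Longrightarrow> g i \<in> carrier V"
  shows "f (\<Oplus>\<^bsub>V\<^esub>i\<in>I. g i) = (\<Oplus>\<^bsub>W\<^esub>i\<in>I. f (g i))"
  using assms
proof (induction I)
  case empty then show ?case by (simp add: linear_map_zero)
next
  case (insert x F)
  then have "g \<in> F \<rightarrow> carrier V" "(\<lambda>i. f (g i)) \<in> F \<rightarrow> carrier W" "g x \<in> carrier V" "f (g x) \<in> carrier W"
    using linear_mapD(1)[OF f] by auto
  with insert show ?case
    using linear_mapD(1,2)[OF f] by simp
qed

lemma linear_map_inj_on:
  assumes "\<And>x. x \<in> carrier V \<Longrightarrow> f x = \<zero>\<^bsub>W\<^esub> \<Longrightarrow> x = \<zero>\<^bsub>V\<^esub>"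
  shows "inj_on f (carrier V)"
proof (rule inj_onI)
  fix x y assume *: "x \<in> carrier V" "y \<in> carrier V" "f x = f y"
  then have "f (x \<ominus>\<^bsub>V\<^esub> y) = \<zero>\<^bsub>W\<^esub>"
    using linear_mapD(1)[OF f] by (simp add: linear_map_minus)
  with assms * show "x = y" using V.M.minus_eq_zero_iff V.M.minus_closed by blast
qed

end

lemma linear_map_inv_into:
  assumes f: "linear_map R V W f" and b: "bij_betw f (carrier V) (carrier W)" and V: "module R V"
  shows "linear_map R W V (inv_into (carrier V) f)"
proof -
  interpret V: module R V by fact
  let ?g = "inv_into (carrier V) f"
  have g: "?g y \<in> carrier V" "f (?g y) = y" if "y \<in> carrier W" for y
    using b that by (auto simp: bij_betw_def inv_into_into f_inv_into_f)
  have gf: "?g (f x) = x" if "x \<in> carrier V" for x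
    using b that by (simp add: bij_betw_def)
  show ?thesis
  proof (rule linear_mapI)
    fix x y assume xy: "x \<in> carrier W" "y \<in> carrier W"
    have "x \<oplus>\<^bsub>W\<^esub> y = f (?g x \<oplus>\<^bsub>V\<^esub> ?g y)" using xy g linear_mapD(2)[OF f] by simp
    then show "?g (x \<oplus>\<^bsub>W\<^esub> y) = ?g x \<oplus>\<^bsub>V\<^esub> ?g y" using gf xy g by simp
  next
    fix c x assume xy: "c \<in> carrier R" "x \<in> carrier W"
    have "c \<odot>\<^bsub>W\<^esub> x = f (c \<odot>\<^bsub>V\<^esub> ?g x)" using xy g linear_mapD(3)[OF f] by simp
    then show "?g (c \<odot>\<^bsub>W\<^esub> x) = c \<odot>\<^bsub>V\<^esub> ?g x" using gf xy g by simp
  qed (use g in auto)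
qed

text \<open>Negatives come for free from the scalar -1.\<close>

lemma (in module) submoduleI':
  assumes "H \<subseteq> carrier M" "\<zero>\<^bsub>M\<^esub> \<in> H"
    and "\<And>a b. a \<in> H \<Longrightarrow> b \<in> H \<Longrightarrow> a \<oplus>\<^bsub>M\<^esub> b \<in> H"
    and "\<And>a x. a \<in> carrier R \<Longrightarrow> x \<in> H \<Longrightarrow> a \<odot>\<^bsub>M\<^esub> x \<in> H"
  shows "submodule H R M"
proof (rule submoduleI)
  fix a assume a: "a \<in> H"
  then have "\<ominus>\<^bsub>M\<^esub> a = (\<ominus> \<one>) \<odot>\<^bsub>M\<^esub> a" using assms(1) by (subst smult_l_minus) auto
  then show "\<ominus>\<^bsub>M\<^esub> a \<in> H" using a assms(4) by simp
qed (use assms in auto)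

lemma (in module) submodule_zero: "submodule H R M \<Longrightarrow> \<zero>\<^bsub>M\<^esub> \<in> H"
  using subgroup.one_closed submodule.axioms(1) by fastforce

lemma (in module) submodule_minus:
  "submodule H R M \<Longrightarrow> a \<in> H \<Longrightarrow> b \<in> H \<Longrightarrow> a \<ominus>\<^bsub>M\<^esub> b \<in> H"
  by (simp add: a_minus_def submoduleE)

lemma (in module) submodule_Inter:
  assumes "\<And>H. H \<in> \<H> \<Longrightarrow> submodule H R M" "\<H> \<noteq> {}"
  shows "submodule (\<Inter>\<H>) R M"
proof (rule submoduleI')
  show "\<Inter>\<H> \<subseteq> carrier M" using assms submoduleE(1) by blast
qed (use assms submodule_zero submoduleE in auto)

lemma (in module) submodule_kernel:
  assumes W: "module R W" and f: "linear_map R M W f"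
  shows "submodule {x \<in> carrier M. f x = \<zero>\<^bsub>W\<^esub>} R M"
proof -
  interpret W: module R W by fact
  show ?thesis
    by (rule submoduleI')
      (use linear_map_zero[OF module_axioms W f] linear_mapD[OF f] in auto)
qed

lemma (in module) lspan_submodule:
  assumes "Z \<subseteq> carrier M" shows "submodule (lspan R M Z) R M"
  unfolding lspan_def
  by (rule submodule_Inter) (use assms carrier_is_submodule in auto)

lemma lspan_superset: "Z \<subseteq> lspan R M Z"
  unfolding lspan_def by blast

lemma lspan_minimal: "submodule H R M \<Longrightarrow> Z \<subseteq> H \<Longrightarrow> lspan R M Z \<subseteq> H"
  unfolding lspan_def by blast

subsection \<open>Quotients\<close>

text \<open>The zero of the quotient is literally the set \<open>W\<close>, not a coset written with
  a representative; vanishing in a quotient is therefore always tested by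
  \<open>coset_eq_H_iff\<close>.\<close>

lemma quot_module_simps:
  "carrier (quot_module V W) = (\<lambda>x. W +>\<^bsub>V\<^esub> x) ` carrier V"
  "add (quot_module V W) = set_add V"
  "\<zero>\<^bsub>quot_module V W\<^esub> = W"
  "module.smult (quot_module V W) = (\<lambda>c Z. \<Union>x\<in>Z. W +>\<^bsub>V\<^esub> (c \<odot>\<^bsub>V\<^esub> x))"
  "monoid.mult (quot_module V W) = rcoset_mult V W"
  "\<one>\<^bsub>quot_module V W\<^esub> = W +>\<^bsub>V\<^esub> \<one>\<^bsub>V\<^esub>"
  by (auto simp: quot_module_def FactRing_def ring.defs module.defs A_RCOSETS_def RCOSETS_def a_r_coset_def)

text \<open>The base ring is kept general because the same facts serve quotients over K (tensor
  products, symmetric powers, U(L), graded pieces) and quotients of \<open>dual A\<close> over a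
  test algebra.\<close>

locale quot_mod = module R M for R (structure) and M (structure) and H +
  assumes H: "submodule H R M"
begin

abbreviation "Q \<equiv> quot_module M H"

lemma H_subset: "H \<subseteq> carrier M" using H submoduleE by blast

lemma additive: "additive_subgroup H M"
  using H by (simp add: additive_subgroup_def submodule_def)

lemma abel: "abelian_subgroup H M"
  by (rule abelian_subgroupI3[OF additive abelian_group_axioms])

interpretation Hs: additive_subgroup H M by (rule additive)
interpretation Ha: abelian_subgroup H M by (rule abel)

lemma coset_eq_iff:
  assumes "x \<in> carrier M" "y \<in> carrier M"
  shows "H +>\<^bsub>M\<^esub> x = H +>\<^bsub>M\<^esub> y \<longleftrightarrow> x \<ominus>\<^bsub>M\<^esub> y \<in> H"
proof
  assume "H +>\<^bsub>M\<^esub> x = H +>\<^bsub>M\<^esub> y"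
  then have "x \<in> H +>\<^bsub>M\<^esub> y" using Ha.a_rcos_self[OF assms(1)] by simp
  then show "x \<ominus>\<^bsub>M\<^esub> y \<in> H"
    unfolding a_minus_def by (rule Ha.a_rcos_module_imp[OF assms(2)])
next
  assume "x \<ominus>\<^bsub>M\<^esub> y \<in> H"
  then have "x \<in> H +>\<^bsub>M\<^esub> y"
    unfolding a_minus_def by (rule Ha.a_rcos_module_rev[OF assms(2,1)])
  then show "H +>\<^bsub>M\<^esub> x = H +>\<^bsub>M\<^esub> y"
    using Ha.a_repr_independence'[OF _ assms(2)] by metis
qed

lemma coset_eq_H_iff:
  assumes "x \<in> carrier M" shows "H +>\<^bsub>M\<^esub> x = H \<longleftrightarrow> x \<in> H"
  using Ha.a_rcos_const Ha.a_rcos_self[OF assms] by auto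

lemma coset_mem_iff:
  assumes "x \<in> carrier M" "y \<in> carrier M"
  shows "y \<in> H +>\<^bsub>M\<^esub> x \<longleftrightarrow> H +>\<^bsub>M\<^esub> y = H +>\<^bsub>M\<^esub> x"
  using Ha.a_repr_independence'[of y x] Ha.a_rcos_self[OF assms(2)] assms by blast

lemma coset_subset: "x \<in> carrier M \<Longrightarrow> H +>\<^bsub>M\<^esub> x \<subseteq> carrier M"
  using Hs.a_subset M.a_r_coset_subset_G by blast

lemma coset_self: "x \<in> carrier M \<Longrightarrow> x \<in> H +>\<^bsub>M\<^esub> x"
  by (rule Ha.a_rcos_self)

lemma coset_add:
  assumes "x \<in> carrier M" "y \<in> carrier M"
  shows "(H +>\<^bsub>M\<^esub> x) \<oplus>\<^bsub>Q\<^esub> (H +>\<^bsub>M\<^esub> y) = H +>\<^bsub>M\<^esub> (x \<oplus>\<^bsub>M\<^esub> y)"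
  using assms by (simp add: quot_module_simps Ha.a_rcos_sum)

text \<open>Scalar multiplication on a quotient, \<open>gr_map\<close> and the functoriality of
  \<open>quot_fun\<close> are all defined as unions over a coset; a map that is constant on cosets
  collapses such a union to one value.\<close>

lemma coset_UN:
  assumes g: "\<And>x y. x \<in> carrier M \<Longrightarrow> y \<in> carrier M \<Longrightarrow> x \<ominus>\<^bsub>M\<^esub> y \<in> H \<Longrightarrow> g x = g y"
    and x: "x \<in> carrier M"
  shows "(\<Union>z\<in>H +>\<^bsub>M\<^esub> x. g z) = g x"
proof -
  have "g z = g x" if "z \<in> H +>\<^bsub>M\<^esub> x" for z
  proof -
    have z: "z \<in> carrier M" using that coset_subset[OF x] by auto
    then have "H +>\<^bsub>M\<^esub> z = H +>\<^bsub>M\<^esub> x" using coset_mem_iff[OF x] that by simp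
    then show ?thesis by (intro g z x) (simp add: coset_eq_iff[OF z x])
  qed
  then have "g ` (H +>\<^bsub>M\<^esub> x) = {g x}" using coset_self[OF x] by blast
  then show ?thesis by simp
qed

lemma coset_the_elem:
  assumes g: "\<And>x y. x \<in> carrier M \<Longrightarrow> y \<in> carrier M \<Longrightarrow> x \<ominus>\<^bsub>M\<^esub> y \<in> H \<Longrightarrow> g x = g y"
    and x: "x \<in> carrier M"
  shows "the_elem (g ` (H +>\<^bsub>M\<^esub> x)) = g x"
proof -
  have "g z = g x" if "z \<in> H +>\<^bsub>M\<^esub> x" for z
  proof -
    have z: "z \<in> carrier M" using that coset_subset[OF x] by auto
    then have "H +>\<^bsub>M\<^esub> z = H +>\<^bsub>M\<^esub> x" using coset_mem_iff[OF x] that by simp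
    then show ?thesis by (intro g z x) (simp add: coset_eq_iff[OF z x])
  qed
  then have "g ` (H +>\<^bsub>M\<^esub> x) = {g x}" using coset_self[OF x] by blast
  then show ?thesis by simp
qed

lemma coset_smult:
  assumes "c \<in> carrier R" "x \<in> carrier M"
  shows "c \<odot>\<^bsub>Q\<^esub> (H +>\<^bsub>M\<^esub> x) = H +>\<^bsub>M\<^esub> (c \<odot>\<^bsub>M\<^esub> x)"
  unfolding quot_module_simps
proof (rule coset_UN)
  fix x y assume *: "x \<in> carrier M" "y \<in> carrier M" "x \<ominus>\<^bsub>M\<^esub> y \<in> H"
  then have "c \<odot>\<^bsub>M\<^esub> (x \<ominus>\<^bsub>M\<^esub> y) \<in> H" using H submoduleE(4) assms by blast
  moreover have "c \<odot>\<^bsub>M\<^esub> (x \<ominus>\<^bsub>M\<^esub> y) = c \<odot>\<^bsub>M\<^esub> x \<ominus>\<^bsub>M\<^esub> c \<odot>\<^bsub>M\<^esub> y"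
    using * assms by (simp add: a_minus_def smult_r_distr smult_r_minus)
  ultimately show "H +>\<^bsub>M\<^esub> c \<odot>\<^bsub>M\<^esub> x = H +>\<^bsub>M\<^esub> c \<odot>\<^bsub>M\<^esub> y"
    using * assms by (subst coset_eq_iff) auto
qed (use assms in auto)

lemma quot_cases:
  assumes "Z \<in> carrier Q" obtains x where "x \<in> carrier M" "Z = H +>\<^bsub>M\<^esub> x"
  using assms by (auto simp: quot_module_simps)

lemma coset_carrier: "x \<in> carrier M \<Longrightarrow> H +>\<^bsub>M\<^esub> x \<in> carrier Q"
  by (auto simp: quot_module_simps)

lemma quot_abelian_group: "abelian_group Q"
proof (rule abelian_groupI)
  fix Z assume "Z \<in> carrier Q"
  then obtain x where "x \<in> carrier M" "Z = H +>\<^bsub>M\<^esub> x" by (rule quot_cases)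
  then show "\<exists>Y\<in>carrier Q. Y \<oplus>\<^bsub>Q\<^esub> Z = \<zero>\<^bsub>Q\<^esub>"
    by (intro bexI[of _ "H +>\<^bsub>M\<^esub> (\<ominus>\<^bsub>M\<^esub> x)"])
      (auto simp: coset_add quot_module_simps(3) coset_eq_H_iff M.l_neg coset_carrier submodule_zero[OF H])
  have "\<zero>\<^bsub>Q\<^esub> = H +>\<^bsub>M\<^esub> \<zero>\<^bsub>M\<^esub>"
    by (simp add: quot_module_simps(3) H_subset M.a_coset_add_zero)
  then show "\<zero>\<^bsub>Q\<^esub> \<oplus>\<^bsub>Q\<^esub> Z = Z"
    using \<open>Z = _\<close> \<open>x \<in> _\<close> by (simp add: coset_add)
next
  show "\<zero>\<^bsub>Q\<^esub> \<in> carrier Q"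
    using coset_carrier[of "\<zero>\<^bsub>M\<^esub>"] by (simp add: quot_module_simps(3) H_subset M.a_coset_add_zero)
qed (auto elim!: quot_cases simp: coset_add coset_carrier M.a_ac)

lemma quot_is_module: "module R Q"
proof (rule moduleI)
  show "cring R" by (rule R.is_cring)
  show "abelian_group Q" by (rule quot_abelian_group)
qed (auto elim!: quot_cases simp: coset_add coset_smult coset_carrier smult_l_distr smult_r_distr smult_assoc1)

lemma coset_linear: "linear_map R M Q (\<lambda>x. H +>\<^bsub>M\<^esub> x)"
  by (rule linear_mapI) (auto simp: coset_add coset_smult coset_carrier)

text \<open>Universal property of the quotient, phrased with \<open>the_elem\<close> because
  \<open>tlift\<close>, \<open>env_map\<close>, \<open>mulL\<close> and the comultiplication of U(L)
  are defined that way.\<close>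

lemma quot_lift:
  assumes W: "module R W" and f: "linear_map R M W f" and k: "\<And>x. x \<in> H \<Longrightarrow> f x = \<zero>\<^bsub>W\<^esub>"
  shows "x \<in> carrier M \<Longrightarrow> the_elem (f ` (H +>\<^bsub>M\<^esub> x)) = f x"
    and "linear_map R Q W (\<lambda>Z. the_elem (f ` Z))"
proof -
  interpret W: module R W by fact
  show *: "the_elem (f ` (H +>\<^bsub>M\<^esub> x)) = f x" if "x \<in> carrier M" for x
  proof (rule coset_the_elem[OF _ that])
    fix x y assume xy: "x \<in> carrier M" "y \<in> carrier M" "x \<ominus>\<^bsub>M\<^esub> y \<in> H"
    then have "f x \<ominus>\<^bsub>W\<^esub> f y = \<zero>\<^bsub>W\<^esub>" using k linear_map_minus[OF module_axioms W f] by metis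
    then show "f x = f y" using xy linear_mapD(1)[OF f] by simp
  qed
  show "linear_map R Q W (\<lambda>Z. the_elem (f ` Z))"
    by (rule linear_mapI)
      (auto elim!: quot_cases simp: coset_add coset_smult * linear_mapD[OF f])
qed

end

subsection \<open>Free vector spaces\<close>

lemma lookup_scale [simp]: "Poly_Mapping.lookup (Poly_Mapping.map ((*) c) p) x = (c::'k::field) * Poly_Mapping.lookup p x"
  by (simp add: Poly_Mapping.map.rep_eq when_def)

lemma scale_single [simp]:
  "Poly_Mapping.map ((*) c) (Poly_Mapping.single x d) = Poly_Mapping.single x ((c::'k::field) * d)"
  by (rule poly_mapping_eqI) (simp add: lookup_single when_def)

lemma scale_zero [simp]: "Poly_Mapping.map ((*) (c::'k::field)) 0 = 0"
  by (rule poly_mapping_eqI) simp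

lemma free_alg_simps [simp]:
  "carrier (free_alg Z m e) = {p. Poly_Mapping.keys p \<subseteq> Z}"
  "p \<oplus>\<^bsub>free_alg Z m e\<^esub> q = p + q"
  "\<zero>\<^bsub>free_alg Z m e\<^esub> = 0"
  "\<one>\<^bsub>free_alg Z m e\<^esub> = Poly_Mapping.single e 1"
  "p \<otimes>\<^bsub>free_alg Z m e\<^esub> q = pm_mult m p q"
  "c \<odot>\<^bsub>free_alg Z m e\<^esub> p = Poly_Mapping.map ((*) c) p"
  by (simp_all add: free_alg_def)

lemma in_keys_scale [simp]:
  "x \<in> Poly_Mapping.keys (Poly_Mapping.map ((*) (c::'k::field)) p) \<longleftrightarrow> c \<noteq> 0 \<and> x \<in> Poly_Mapping.keys p"
  by (simp add: in_keys_iff)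

lemma keys_scale: "Poly_Mapping.keys (Poly_Mapping.map ((*) (c::'k::field)) p) \<subseteq> Poly_Mapping.keys p"
  by (auto simp: in_keys_iff)

lemma free_alg_module: "module KK (free_alg Z m e :: ('k::field, 'x \<Rightarrow>\<^sub>0 'k) module)"
proof (rule moduleI)
  show "abelian_group (free_alg Z m e :: ('k::field, 'x \<Rightarrow>\<^sub>0 'k) module)"
  proof (rule abelian_groupI)
    fix x :: "'x \<Rightarrow>\<^sub>0 'k" assume "x \<in> carrier (free_alg Z m e)"
    then show "\<exists>y\<in>carrier (free_alg Z m e). y \<oplus>\<^bsub>free_alg Z m e\<^esub> x = \<zero>\<^bsub>free_alg Z m e\<^esub>"
      by (intro bexI[of _ "- x"]) (auto simp: in_keys_iff)
  next
    fix x y :: "'x \<Rightarrow>\<^sub>0 'k" assume "x \<in> carrier (free_alg Z m e)" "y \<in> carrier (free_alg Z m e)"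
    then show "x \<oplus>\<^bsub>free_alg Z m e\<^esub> y \<in> carrier (free_alg Z m e)"
      using Poly_Mapping.keys_add[of x y] by auto
  qed (auto simp: ac_simps)
qed (auto intro!: poly_mapping_eqI simp: lookup_add algebra_simps)

lemma free_alg_a_inv [simp]:
  fixes p :: "'x \<Rightarrow>\<^sub>0 'k::field"
  assumes "p \<in> carrier (free_alg Z m e)"
  shows "\<ominus>\<^bsub>free_alg Z m e\<^esub> p = - p"
proof -
  interpret module KK "free_alg Z m e :: ('k::field, 'x \<Rightarrow>\<^sub>0 'k) module" by (rule free_alg_module)
  show ?thesis using assms by (intro M.minus_equality) (auto simp: in_keys_iff)
qed

lemma free_alg_minus [simp]:
  fixes p :: "'x \<Rightarrow>\<^sub>0 'k::field"
  assumes "q \<in> carrier (free_alg Z m e)"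
  shows "p \<ominus>\<^bsub>free_alg Z m e\<^esub> q = p - q"
  using assms by (simp add: a_minus_def del: free_alg_simps(1))

lemma free_induct [consumes 1, case_names zero single]:
  fixes p :: "'x \<Rightarrow>\<^sub>0 'k::field"
  assumes "Poly_Mapping.keys p \<subseteq> Z" "P 0"
    and "\<And>x c q. x \<in> Z \<Longrightarrow> Poly_Mapping.keys q \<subseteq> Z \<Longrightarrow> P q \<Longrightarrow> P (Poly_Mapping.single x c + q)"
  shows "P p"
proof -
  have "finite F \<Longrightarrow> F \<subseteq> Z \<Longrightarrow> \<forall>p. Poly_Mapping.keys p = F \<longrightarrow> P p" for F
  proof (induction F rule: finite_induct)
    case empty then show ?case using assms(2) by auto
  next
    case (insert x F)
    show ?case
    proof (intro allI impI)
      fix p :: "'x \<Rightarrow>\<^sub>0 'k" assume p: "Poly_Mapping.keys p = insert x F"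
      define q where "q = p - Poly_Mapping.single x (Poly_Mapping.lookup p x)"
      have "Poly_Mapping.lookup q y = (if y = x then 0 else Poly_Mapping.lookup p y)" for y
        by (simp add: q_def lookup_minus lookup_single when_def)
      then have "Poly_Mapping.keys q = Poly_Mapping.keys p - {x}"
        by (auto simp: in_keys_iff split: if_splits)
      with p insert(2) have "Poly_Mapping.keys q = F" by simp
      then have "P (Poly_Mapping.single x (Poly_Mapping.lookup p x) + q)"
        using insert by (intro assms(3)) auto
      then show "P p" by (simp add: q_def)
    qed
  qed
  from this[of "Poly_Mapping.keys p"] show ?thesis using assms(1) by simp
qed

context
  fixes P :: "('k::field, 'w, 'z) module_scheme" (structure)
  assumes P: "module KK P"
begin

interpretation P: module KK P by (rule P)

text \<open>Terms outside the support vanish, so p, q and p + q can be summed over one common finite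
  set and additivity becomes a termwise statement.\<close>

lemma lext_superset:
  assumes "finite J" "Poly_Mapping.keys p \<subseteq> J" "\<And>x. x \<in> J \<Longrightarrow> B x \<in> carrier P"
  shows "lext P B p = (\<Oplus>\<^bsub>P\<^esub>x\<in>J. Poly_Mapping.lookup p x \<odot>\<^bsub>P\<^esub> B x)"
proof -
  have "(\<Oplus>\<^bsub>P\<^esub>x\<in>J. Poly_Mapping.lookup p x \<odot>\<^bsub>P\<^esub> B x) =
    (\<Oplus>\<^bsub>P\<^esub>x\<in>Poly_Mapping.keys p. Poly_Mapping.lookup p x \<odot>\<^bsub>P\<^esub> B x)"
    using assms P.smult_l_null
    by (intro P.add.finprod_mono_neutral_cong_left[symmetric]) (auto simp: in_keys_iff Pi_iff)
  then show ?thesis by (simp add: lext_def)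
qed

lemma lext_linear:
  fixes Z :: "'x set"
  assumes "\<And>x. x \<in> Z \<Longrightarrow> B x \<in> carrier P"
  shows "linear_map KK (free_alg Z m e) P (lext P B)"
proof (rule linear_mapI)
  fix p :: "'x \<Rightarrow>\<^sub>0 'k" assume "p \<in> carrier (free_alg Z m e)"
  then show "lext P B p \<in> carrier P"
    using assms unfolding lext_def by (intro P.finsum_closed) auto
next
  fix p q :: "'x \<Rightarrow>\<^sub>0 'k" assume p: "p \<in> carrier (free_alg Z m e)" and q: "q \<in> carrier (free_alg Z m e)"
  let ?J = "Poly_Mapping.keys p \<union> Poly_Mapping.keys q"
  have B: "B x \<in> carrier P" if "x \<in> ?J" for x using that p q assms by auto
  have "lext P B (p + q) = (\<Oplus>\<^bsub>P\<^esub>x\<in>?J. Poly_Mapping.lookup (p + q) x \<odot>\<^bsub>P\<^esub> B x)"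
    using Poly_Mapping.keys_add[of p q] B by (intro lext_superset) auto
  also have "\<dots> = (\<Oplus>\<^bsub>P\<^esub>x\<in>?J. Poly_Mapping.lookup p x \<odot>\<^bsub>P\<^esub> B x \<oplus>\<^bsub>P\<^esub> Poly_Mapping.lookup q x \<odot>\<^bsub>P\<^esub> B x)"
    using B P.smult_l_distr by (intro P.finsum_cong') (auto simp: lookup_add)
  also have "\<dots> = (\<Oplus>\<^bsub>P\<^esub>x\<in>?J. Poly_Mapping.lookup p x \<odot>\<^bsub>P\<^esub> B x) \<oplus>\<^bsub>P\<^esub> (\<Oplus>\<^bsub>P\<^esub>x\<in>?J. Poly_Mapping.lookup q x \<odot>\<^bsub>P\<^esub> B x)"
    using B by (intro P.finsum_addf) auto
  also have "\<dots> = lext P B p \<oplus>\<^bsub>P\<^esub> lext P B q"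
    using B lext_superset[of ?J p B] lext_superset[of ?J q B] by auto
  finally show "lext P B (p \<oplus>\<^bsub>free_alg Z m e\<^esub> q) = lext P B p \<oplus>\<^bsub>P\<^esub> lext P B q" by simp
next
  fix c and p :: "'x \<Rightarrow>\<^sub>0 'k" assume p: "p \<in> carrier (free_alg Z m e)"
  have B: "B x \<in> carrier P" if "x \<in> Poly_Mapping.keys p" for x using that p assms by auto
  have "lext P B (Poly_Mapping.map ((*) c) p) =
      (\<Oplus>\<^bsub>P\<^esub>x\<in>Poly_Mapping.keys p. Poly_Mapping.lookup (Poly_Mapping.map ((*) c) p) x \<odot>\<^bsub>P\<^esub> B x)"
    using keys_scale B by (intro lext_superset) auto
  also have "\<dots> = (\<Oplus>\<^bsub>P\<^esub>x\<in>Poly_Mapping.keys p. c \<odot>\<^bsub>P\<^esub> (Poly_Mapping.lookup p x \<odot>\<^bsub>P\<^esub> B x))"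
    using B P.smult_assoc1 by (intro P.finsum_cong') auto
  also have "\<dots> = c \<odot>\<^bsub>P\<^esub> lext P B p"
    unfolding lext_def using B by (intro P.finsum_smult_ldistr[symmetric]) auto
  finally show "lext P B (c \<odot>\<^bsub>free_alg Z m e\<^esub> p) = c \<odot>\<^bsub>P\<^esub> lext P B p" by simp
qed

lemma lext_single [simp]:
  assumes "B x \<in> carrier P" shows "lext P B (Poly_Mapping.single x c) = c \<odot>\<^bsub>P\<^esub> B x"
proof -
  have "lext P B (Poly_Mapping.single x c) = (\<Oplus>\<^bsub>P\<^esub>y\<in>{x}. Poly_Mapping.lookup (Poly_Mapping.single x c) y \<odot>\<^bsub>P\<^esub> B y)"
    using assms by (intro lext_superset) auto
  also have "\<dots> = c \<odot>\<^bsub>P\<^esub> B x" using assms by simp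
  finally show ?thesis .
qed

lemma lext_cong:
  assumes "\<And>x. x \<in> Poly_Mapping.keys p \<Longrightarrow> B x = B' x" "\<And>x. x \<in> Poly_Mapping.keys p \<Longrightarrow> B' x \<in> carrier P"
  shows "lext P B p = lext P B' p"
  unfolding lext_def using assms by (intro P.finsum_cong') auto

lemma free_linear_eq:
  assumes f: "linear_map KK (free_alg Z m e) P f" and g: "linear_map KK (free_alg Z m e) P g"
    and fg: "\<And>x. x \<in> Z \<Longrightarrow> f (Poly_Mapping.single x 1) = g (Poly_Mapping.single x 1)"
    and p: "p \<in> carrier (free_alg Z m e)"
  shows "f p = g p"
proof -
  have "Poly_Mapping.keys p \<subseteq> Z" using p by simp
  then show ?thesis
  proof (induction rule: free_induct)
    case zero
    then show ?case
      using linear_map_zero[OF free_alg_module P f] linear_map_zero[OF free_alg_module P g] by simp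
  next
    case (single x c q)
    have "h (Poly_Mapping.single x c + q) = c \<odot>\<^bsub>P\<^esub> h (Poly_Mapping.single x 1) \<oplus>\<^bsub>P\<^esub> h q"
      if h: "linear_map KK (free_alg Z m e) P h" for h
      using linear_mapD(2)[OF h, of "Poly_Mapping.single x c" q] single
        linear_mapD(3)[OF h, of c "Poly_Mapping.single x 1"] by simp
    from this[OF f] this[OF g] show ?case using fg single by simp
  qed
qed

end

subsection \<open>Associative algebras\<close>

text \<open>The algebra part of a bialgebra, kept separate since tensor products, word algebras and
  \<open>env_alg\<close> carry a product but no comultiplication field.\<close>

locale assoc_alg = module KK A + ring A for A :: "('k::field, 'v, 'z) module_scheme" (structure) +
  assumes smult_mult_left:
      "\<lbrakk>x \<in> carrier A; y \<in> carrier A\<rbrakk> \<Longrightarrow> (c \<odot> x) \<otimes> y = c \<odot> (x \<otimes> y)"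
    and smult_mult_right:
      "\<lbrakk>x \<in> carrier A; y \<in> carrier A\<rbrakk> \<Longrightarrow> x \<otimes> (c \<odot> y) = c \<odot> (x \<otimes> y)"

lemma pm_mult_add_left: "pm_mult m (p + q) r = pm_mult m p r + pm_mult m q r"
  unfolding pm_mult_def
  by (rule setsum_keys_plus_distrib)
    (simp_all add: Poly_Mapping.single_add distrib_right sum.distrib)

lemma pm_mult_add_right: "pm_mult m r (p + q) = pm_mult m r p + pm_mult m r q"
  unfolding pm_mult_def sum.distrib[symmetric]
  by (rule sum.cong[OF refl], rule setsum_keys_plus_distrib)
    (simp_all add: Poly_Mapping.single_add distrib_left)

lemma pm_mult_single [simp]:
  "pm_mult m (Poly_Mapping.single x c) (Poly_Mapping.single y d) = Poly_Mapping.single (m x y) (c * d)"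
  by (simp add: pm_mult_def)

lemma pm_mult_zero [simp]: "pm_mult m 0 p = 0" "pm_mult m p 0 = 0"
  by (simp_all add: pm_mult_def)

lemma pm_mult_minus_left: "pm_mult m (p - q) r = pm_mult m p r - pm_mult m q r"
  using pm_mult_add_left[of m "p - q" q r] by simp

lemma pm_mult_minus_right: "pm_mult m r (p - q) = pm_mult m r p - pm_mult m r q"
  using pm_mult_add_right[of m r "p - q" q] by simp

lemma pm_mult_closed:
  assumes "Poly_Mapping.keys p \<subseteq> Z" "Poly_Mapping.keys q \<subseteq> Z" "\<And>x y. x \<in> Z \<Longrightarrow> y \<in> Z \<Longrightarrow> m x y \<in> Z"
  shows "Poly_Mapping.keys (pm_mult m p q) \<subseteq> Z"
proof -
  have "Poly_Mapping.keys (\<Sum>x\<in>I. g x) \<subseteq> Z"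
    if "\<And>x. x \<in> I \<Longrightarrow> Poly_Mapping.keys (g x) \<subseteq> Z" for I and g :: "'c \<Rightarrow> 'a \<Rightarrow>\<^sub>0 'b"
    using that
  proof (induction I rule: infinite_finite_induct)
    case (insert x F)
    then show ?case using Poly_Mapping.keys_add[of "g x" "sum g F"] by auto
  qed auto
  note * = this
  show ?thesis unfolding pm_mult_def using assms by (intro *) auto
qed

text \<open>Covers both free constructions at once: \<open>tens_free\<close>, with basis the pairs
  of elements, and \<open>word_alg\<close>, with basis the words under concatenation.\<close>

lemma free_assoc_alg:
  fixes Z :: "'x set" and m :: "'x \<Rightarrow> 'x \<Rightarrow> 'x"
  assumes closed: "\<And>x y. x \<in> Z \<Longrightarrow> y \<in> Z \<Longrightarrow> m x y \<in> Z" and e: "e \<in> Z"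
    and assoc: "\<And>x y z. x \<in> Z \<Longrightarrow> y \<in> Z \<Longrightarrow> z \<in> Z \<Longrightarrow> m (m x y) z = m x (m y z)"
    and unit: "\<And>x. x \<in> Z \<Longrightarrow> m e x = x" "\<And>x. x \<in> Z \<Longrightarrow> m x e = x"
  shows "assoc_alg (free_alg Z m e :: ('k::field, 'x \<Rightarrow>\<^sub>0 'k) module)"
proof -
  let ?F = "free_alg Z m e :: ('k::field, 'x \<Rightarrow>\<^sub>0 'k) module"
  interpret module KK ?F by (rule free_alg_module)
  have map_add: "Poly_Mapping.map ((*) d) (p + q) = Poly_Mapping.map ((*) d) p + Poly_Mapping.map ((*) d) q"
    for d and p q :: "'x \<Rightarrow>\<^sub>0 'k"
    by (rule poly_mapping_eqI) (simp add: lookup_add algebra_simps)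
  have sp: "pm_mult m (Poly_Mapping.single x c) (Poly_Mapping.map ((*) d) q) =
      Poly_Mapping.map ((*) d) (pm_mult m (Poly_Mapping.single x c) q)" for x c d and q :: "'x \<Rightarrow>\<^sub>0 'k"
  proof -
    have "Poly_Mapping.keys q \<subseteq> UNIV" by simp
    then show ?thesis
    proof (induction rule: free_induct)
      case (single y b q)
      then show ?case by (simp add: pm_mult_add_right map_add mult.left_commute)
    qed auto
  qed
  have left: "pm_mult m (Poly_Mapping.map ((*) c) p) q = Poly_Mapping.map ((*) c) (pm_mult m p q)" for c and p q :: "'x \<Rightarrow>\<^sub>0 'k"
  proof -
    have "Poly_Mapping.keys p \<subseteq> UNIV" by simp
    then show ?thesis
    proof (induction rule: free_induct)
      case (single x b p)
      have "pm_mult m (Poly_Mapping.single x (c * b)) q = Poly_Mapping.map ((*) c) (pm_mult m (Poly_Mapping.single x b) q)"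
      proof -
        have "Poly_Mapping.keys q \<subseteq> UNIV" by simp
        then show ?thesis
          by (induction rule: free_induct) (simp_all add: pm_mult_add_right map_add mult.assoc)
      qed
      with single show ?case by (simp add: pm_mult_add_left map_add)
    qed auto
  qed
  have right: "pm_mult m p (Poly_Mapping.map ((*) c) q) = Poly_Mapping.map ((*) c) (pm_mult m p q)" for c and p q :: "'x \<Rightarrow>\<^sub>0 'k"
  proof -
    have "Poly_Mapping.keys p \<subseteq> UNIV" by simp
    then show ?thesis
      by (induction rule: free_induct) (simp_all add: pm_mult_add_left map_add sp)
  qed
  have cl: "Poly_Mapping.keys (pm_mult m p q) \<subseteq> Z"
    if "Poly_Mapping.keys p \<subseteq> Z" "Poly_Mapping.keys q \<subseteq> Z" for p q :: "'x \<Rightarrow>\<^sub>0 'k"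
    using pm_mult_closed that closed by metis
  have ass: "pm_mult m (pm_mult m p q) r = pm_mult m p (pm_mult m q r)"
    if p: "Poly_Mapping.keys p \<subseteq> Z" and q: "Poly_Mapping.keys q \<subseteq> Z" and r: "Poly_Mapping.keys r \<subseteq> Z"
    for p q r :: "'x \<Rightarrow>\<^sub>0 'k"
    using p
  proof (induction rule: free_induct)
    case (single x c p')
    have "pm_mult m (pm_mult m (Poly_Mapping.single x c) q) r = pm_mult m (Poly_Mapping.single x c) (pm_mult m q r)"
      using q
    proof (induction rule: free_induct)
      case (single y d q')
      have "pm_mult m (pm_mult m (Poly_Mapping.single x c) (Poly_Mapping.single y d)) r =
          pm_mult m (Poly_Mapping.single x c) (pm_mult m (Poly_Mapping.single y d) r)"
        using r
        by (induction rule: free_induct)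
          (simp_all add: pm_mult_add_right assoc \<open>x \<in> Z\<close> \<open>y \<in> Z\<close> mult.assoc)
      with single show ?case by (simp add: pm_mult_add_left pm_mult_add_right)
    qed auto
    with single show ?case by (simp add: pm_mult_add_left)
  qed auto
  have one: "pm_mult m (Poly_Mapping.single e 1) p = p" "pm_mult m p (Poly_Mapping.single e 1) = p"
    if p: "Poly_Mapping.keys p \<subseteq> Z" for p :: "'x \<Rightarrow>\<^sub>0 'k"
    using p by (induction rule: free_induct) (simp_all add: pm_mult_add_left pm_mult_add_right unit)
  have "ring ?F"
  proof (rule ringI)
    show "abelian_group ?F" by (rule abelian_group_axioms)
    show "Group.monoid ?F" by (rule monoidI) (use e cl ass one in auto)
  qed (simp_all add: pm_mult_add_left pm_mult_add_right)
  then show ?thesis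
    by (intro assoc_alg.intro assoc_alg_axioms.intro module_axioms) (simp_all add: left right)
qed

context assoc_alg
begin

text \<open>Scalars act through the algebra: c x = (c 1) x.\<close>

lemma ideal_submodule:
  assumes "ideal J A" shows "submodule J KK A"
proof (rule submoduleI')
  interpret J: ideal J A by fact
  show "J \<subseteq> carrier A" by (rule J.a_subset)
  show "\<zero> \<in> J" by simp
  show "a \<oplus> b \<in> J" if "a \<in> J" "b \<in> J" for a b using that by (rule J.a_closed)
  show "c \<odot> x \<in> J" if "x \<in> J" for c x
  proof -
    have x: "x \<in> carrier A" using that J.a_subset by blast
    then have "c \<odot> x = (c \<odot> \<one>) \<otimes> x" by (simp add: smult_mult_left)
    also have "\<dots> \<in> J" using that by (intro J.I_l_closed) auto
    finally show ?thesis .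
  qed
qed

lemma quot_mult:
  assumes "ideal J A" "x \<in> carrier A" "y \<in> carrier A"
  shows "(J +> x) \<otimes>\<^bsub>quot_module A J\<^esub> (J +> y) = J +> (x \<otimes> y)"
  using assms by (simp add: quot_module_simps ideal.rcoset_mult_add)

lemma quot_assoc_alg:
  assumes J: "ideal J A" shows "assoc_alg (quot_module A J)"
proof -
  interpret quot_mod KK A J
    by (intro quot_mod.intro quot_mod_axioms.intro module_axioms ideal_submodule J)
  have "ring Q"
  proof (rule ringI)
    show "abelian_group Q" by (rule quot_abelian_group)
    show "Group.monoid Q"
    proof (rule monoidI)
      show "\<one>\<^bsub>Q\<^esub> \<in> carrier Q" by (simp add: quot_module_simps(6) coset_carrier)
    qed (auto elim!: quot_cases simp: quot_mult[OF J] coset_carrier m_assoc quot_module_simps(6))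
  qed (auto elim!: quot_cases simp: quot_mult[OF J] coset_add coset_carrier l_distr r_distr)
  then show ?thesis
    by (intro assoc_alg.intro assoc_alg_axioms.intro quot_is_module)
      (auto elim!: quot_cases simp: quot_mult[OF J] coset_smult smult_mult_left smult_mult_right)
qed

end

subsection \<open>Tensor products\<close>

definition bilin ::
  "('k::field, 'v, 'y) module_scheme \<Rightarrow> ('k, 'w, 'z) module_scheme \<Rightarrow> ('k, 'p, 'x) module_scheme \<Rightarrow>
   ('v \<Rightarrow> 'w \<Rightarrow> 'p) \<Rightarrow> bool" where
  "bilin V W P B \<longleftrightarrow> (\<forall>v\<in>carrier V. linear_map KK W P (B v)) \<and>
     (\<forall>w\<in>carrier W. linear_map KK V P (\<lambda>v. B v w))"

lemma KK_smult [simp]: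
  assumes "module KK P" "x \<in> carrier P"
  shows "1 \<odot>\<^bsub>P\<^esub> x = x" "0 \<odot>\<^bsub>P\<^esub> x = \<zero>\<^bsub>P\<^esub>"
  using module.smult_one[OF assms] module.smult_l_null[OF assms] by simp_all

lemma bilinI:
  assumes "\<And>v w. v \<in> carrier V \<Longrightarrow> w \<in> carrier W \<Longrightarrow> B v w \<in> carrier P"
    and "\<And>v v' w. v \<in> carrier V \<Longrightarrow> v' \<in> carrier V \<Longrightarrow> w \<in> carrier W \<Longrightarrow> B (v \<oplus>\<^bsub>V\<^esub> v') w = B v w \<oplus>\<^bsub>P\<^esub> B v' w"
    and "\<And>v w w'. v \<in> carrier V \<Longrightarrow> w \<in> carrier W \<Longrightarrow> w' \<in> carrier W \<Longrightarrow> B v (w \<oplus>\<^bsub>W\<^esub> w') = B v w \<oplus>\<^bsub>P\<^esub> B v w'"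
    and "\<And>c v w. v \<in> carrier V \<Longrightarrow> w \<in> carrier W \<Longrightarrow> B (c \<odot>\<^bsub>V\<^esub> v) w = c \<odot>\<^bsub>P\<^esub> B v w"
    and "\<And>c v w. v \<in> carrier V \<Longrightarrow> w \<in> carrier W \<Longrightarrow> B v (c \<odot>\<^bsub>W\<^esub> w) = c \<odot>\<^bsub>P\<^esub> B v w"
  shows "bilin V W P B"
  using assms unfolding bilin_def by (auto intro!: linear_mapI)

lemma bilinD:
  assumes "bilin V W P B"
  shows "v \<in> carrier V \<Longrightarrow> w \<in> carrier W \<Longrightarrow> B v w \<in> carrier P"
    and "v \<in> carrier V \<Longrightarrow> v' \<in> carrier V \<Longrightarrow> w \<in> carrier W \<Longrightarrow> B (v \<oplus>\<^bsub>V\<^esub> v') w = B v w \<oplus>\<^bsub>P\<^esub> B v' w"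
    and "v \<in> carrier V \<Longrightarrow> w \<in> carrier W \<Longrightarrow> w' \<in> carrier W \<Longrightarrow> B v (w \<oplus>\<^bsub>W\<^esub> w') = B v w \<oplus>\<^bsub>P\<^esub> B v w'"
    and "v \<in> carrier V \<Longrightarrow> w \<in> carrier W \<Longrightarrow> B (c \<odot>\<^bsub>V\<^esub> v) w = c \<odot>\<^bsub>P\<^esub> B v w"
    and "v \<in> carrier V \<Longrightarrow> w \<in> carrier W \<Longrightarrow> B v (c \<odot>\<^bsub>W\<^esub> w) = c \<odot>\<^bsub>P\<^esub> B v w"
    and "v \<in> carrier V \<Longrightarrow> linear_map KK W P (B v)"
    and "w \<in> carrier W \<Longrightarrow> linear_map KK V P (\<lambda>v. B v w)"
  using assms unfolding bilin_def linear_map_def by auto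

lemma bilin_comp:
  assumes "bilin V W P B" "linear_map KK V' V f" "linear_map KK W' W g" "linear_map KK P Q h"
  shows "bilin V' W' Q (\<lambda>v w. h (B (f v) (g w)))"
proof (rule bilinI)
qed (use linear_mapD[OF assms(2)] linear_mapD[OF assms(3)] linear_mapD[OF assms(4)] bilinD[OF assms(1)] in \<open>simp_all\<close>)

abbreviation (input) "bilin_gens V W \<equiv>
    ({Poly_Mapping.single (v \<oplus>\<^bsub>V\<^esub> v', w) 1 - Poly_Mapping.single (v, w) 1 - Poly_Mapping.single (v', w) 1
        | v v' w. v \<in> carrier V \<and> v' \<in> carrier V \<and> w \<in> carrier W} \<union>
     {Poly_Mapping.single (v, w \<oplus>\<^bsub>W\<^esub> w') 1 - Poly_Mapping.single (v, w) 1 - Poly_Mapping.single (v, w') 1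
        | v w w'. v \<in> carrier V \<and> w \<in> carrier W \<and> w' \<in> carrier W} \<union>
     {Poly_Mapping.single (c \<odot>\<^bsub>V\<^esub> v, w) 1 - Poly_Mapping.single (v, w) c
        | c v w. v \<in> carrier V \<and> w \<in> carrier W} \<union>
     {Poly_Mapping.single (v, c \<odot>\<^bsub>W\<^esub> w) 1 - Poly_Mapping.single (v, w) c
        | c v w. v \<in> carrier V \<and> w \<in> carrier W}) "

lemma keys_minus_subset:
  "Poly_Mapping.keys p \<subseteq> Z \<Longrightarrow> Poly_Mapping.keys q \<subseteq> Z \<Longrightarrow> Poly_Mapping.keys (p - q :: 'x \<Rightarrow>\<^sub>0 'c::ab_group_add) \<subseteq> Z"
  unfolding subset_iff in_keys_iff lookup_minus by (metis diff_self)

context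
  fixes V :: "('k::field, 'v, 'y) module_scheme" and W :: "('k, 'w, 'z) module_scheme"
  assumes V: "module KK V" and W: "module KK W"
begin

interpretation V: module KK V by (rule V)
interpretation W: module KK W by (rule W)

lemma tens_free_module: "module KK (tens_free V W)"
  unfolding tens_free_def by (rule free_alg_module)

lemma tens_free_carrier: "p \<in> carrier (tens_free V W) \<longleftrightarrow> Poly_Mapping.keys p \<subseteq> carrier V \<times> carrier W"
  by (simp add: tens_free_def)

interpretation F: module KK "tens_free V W" by (rule tens_free_module)

lemma tens_free_single [simp]:
  "v \<in> carrier V \<Longrightarrow> w \<in> carrier W \<Longrightarrow> Poly_Mapping.single (v, w) c \<in> carrier (tens_free V W)"
  by (simp add: tens_free_carrier)

lemma tens_free_minus_closed:
  "p \<in> carrier (tens_free V W) \<Longrightarrow> q \<in> carrier (tens_free V W) \<Longrightarrow> p - q \<in> carrier (tens_free V W)"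
  unfolding tens_free_carrier by (rule keys_minus_subset)

lemma bilin_gens_subset: "bilin_gens V W \<subseteq> carrier (tens_free V W)"
  by (auto intro!: tens_free_minus_closed)

lemma bilin_rel_submodule: "submodule (bilin_rel V W) KK (tens_free V W)"
  unfolding bilin_rel_def using F.lspan_submodule bilin_gens_subset by blast

interpretation T: quot_mod KK "tens_free V W" "bilin_rel V W"
  by (intro quot_mod.intro quot_mod_axioms.intro tens_free_module bilin_rel_submodule)

lemma tensor_module: "module KK (tensor V W)"
  unfolding tensor_def by (rule T.quot_is_module)

interpretation TT: module KK "tensor V W" by (rule tensor_module)

lemma bilin_gens_rel:
  assumes "v \<in> carrier V" "v' \<in> carrier V" "w \<in> carrier W" "w' \<in> carrier W"
  shows "Poly_Mapping.single (v \<oplus>\<^bsub>V\<^esub> v', w) 1 - Poly_Mapping.single (v, w) 1 - Poly_Mapping.single (v', w) 1 \<in> bilin_rel V W"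
    and "Poly_Mapping.single (v, w \<oplus>\<^bsub>W\<^esub> w') 1 - Poly_Mapping.single (v, w) 1 - Poly_Mapping.single (v, w') 1 \<in> bilin_rel V W"
    and "Poly_Mapping.single (c \<odot>\<^bsub>V\<^esub> v, w) 1 - Poly_Mapping.single (v, w) c \<in> bilin_rel V W"
    and "Poly_Mapping.single (v, c \<odot>\<^bsub>W\<^esub> w) 1 - Poly_Mapping.single (v, w) c \<in> bilin_rel V W"
  unfolding bilin_rel_def by (rule lspan_superset[THEN subsetD], use assms in blast)+

lemma tens_free_ops:
  "p \<oplus>\<^bsub>tens_free V W\<^esub> q = p + q" "c \<odot>\<^bsub>tens_free V W\<^esub> p = Poly_Mapping.map ((*) c) p"
  "q \<in> carrier (tens_free V W) \<Longrightarrow> p \<ominus>\<^bsub>tens_free V W\<^esub> q = p - q" "\<zero>\<^bsub>tens_free V W\<^esub> = 0"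
  by (simp_all add: tens_free_def)

lemma bilin_pure_tensor: "bilin V W (tensor V W) (pure_tensor V W)"
proof (rule bilinI)
  fix v w assume "v \<in> carrier V" "w \<in> carrier W"
  then show "pure_tensor V W v w \<in> carrier (tensor V W)"
    by (simp add: pure_tensor_def tensor_def T.coset_carrier)
next
  fix v v' w assume "v \<in> carrier V" "v' \<in> carrier V" "w \<in> carrier W"
  then show "pure_tensor V W (v \<oplus>\<^bsub>V\<^esub> v') w = pure_tensor V W v w \<oplus>\<^bsub>tensor V W\<^esub> pure_tensor V W v' w"
    unfolding pure_tensor_def tensor_def
    using bilin_gens_rel(1)[of v v' w w]
    by (subst T.coset_add) (simp_all add: T.coset_eq_iff tens_free_ops diff_diff_eq tens_free_carrier
        keys_add[THEN subset_trans])
next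
  fix v w w' assume "v \<in> carrier V" "w \<in> carrier W" "w' \<in> carrier W"
  then show "pure_tensor V W v (w \<oplus>\<^bsub>W\<^esub> w') = pure_tensor V W v w \<oplus>\<^bsub>tensor V W\<^esub> pure_tensor V W v w'"
    unfolding pure_tensor_def tensor_def
    using bilin_gens_rel(2)[of v v w w']
    by (subst T.coset_add) (simp_all add: T.coset_eq_iff tens_free_ops diff_diff_eq tens_free_carrier
        keys_add[THEN subset_trans])
next
  fix c v w assume "v \<in> carrier V" "w \<in> carrier W"
  then show "pure_tensor V W (c \<odot>\<^bsub>V\<^esub> v) w = c \<odot>\<^bsub>tensor V W\<^esub> pure_tensor V W v w"
    unfolding pure_tensor_def tensor_def
    using bilin_gens_rel(3)[of v v w w c]
    by (subst T.coset_smult) (simp_all add: T.coset_eq_iff tens_free_ops)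
next
  fix c v w assume "v \<in> carrier V" "w \<in> carrier W"
  then show "pure_tensor V W v (c \<odot>\<^bsub>W\<^esub> w) = c \<odot>\<^bsub>tensor V W\<^esub> pure_tensor V W v w"
    unfolding pure_tensor_def tensor_def
    using bilin_gens_rel(4)[of v v w w c]
    by (subst T.coset_smult) (simp_all add: T.coset_eq_iff tens_free_ops)
qed

lemma tens_free_linear_eq:
  assumes P: "module KK P"
    and f: "linear_map KK (tens_free V W) P f" and g: "linear_map KK (tens_free V W) P g"
    and fg: "\<And>v w. v \<in> carrier V \<Longrightarrow> w \<in> carrier W \<Longrightarrow> f (Poly_Mapping.single (v, w) 1) = g (Poly_Mapping.single (v, w) 1)"
    and p: "p \<in> carrier (tens_free V W)"
  shows "f p = g p"
  by (rule free_linear_eq[OF P f[unfolded tens_free_def] g[unfolded tens_free_def] _ p[unfolded tens_free_def]])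
    (use fg in auto)

lemma lext_tens_free_linear:
  assumes "module KK P" "\<And>v w. v \<in> carrier V \<Longrightarrow> w \<in> carrier W \<Longrightarrow> B v w \<in> carrier P"
  shows "linear_map KK (tens_free V W) P (lext P (\<lambda>(v, w). B v w))"
  unfolding tens_free_def by (rule lext_linear) (use assms in auto)

lemma tensor_cases:
  assumes "t \<in> carrier (tensor V W)"
  obtains p where "Poly_Mapping.keys p \<subseteq> carrier V \<times> carrier W" "t = bilin_rel V W +>\<^bsub>tens_free V W\<^esub> p"
  using assms unfolding tensor_def by (auto elim!: T.quot_cases simp: tens_free_carrier)

lemma tensor_coset_linear: "linear_map KK (tens_free V W) (tensor V W) ((+>\<^bsub>tens_free V W\<^esub>) (bilin_rel V W))"
  unfolding tensor_def by (rule T.coset_linear)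

context
  fixes P :: "('k, 'p, 'x) module_scheme" and B
  assumes P: "module KK P" and B: "bilin V W P B"
begin

interpretation P: module KK P by (rule P)

text \<open>The kernel of the linear extension is a subspace, so only the four kinds of generating
  relations have to be checked, and these are exactly bilinearity of B.\<close>

lemma lext_bilin_rel:
  assumes "p \<in> bilin_rel V W" shows "lext P (\<lambda>(v, w). B v w) p = \<zero>\<^bsub>P\<^esub>"
proof -
  let ?f = "lext P (\<lambda>(v, w). B v w)"
  have f: "linear_map KK (tens_free V W) P ?f"
    by (rule lext_tens_free_linear[OF P]) (rule bilinD[OF B])
  have f1: "?f (Poly_Mapping.single (v, w) c) = c \<odot>\<^bsub>P\<^esub> B v w" if "v \<in> carrier V" "w \<in> carrier W" for v w c
    using that bilinD(1)[OF B] by (subst lext_single[OF P]) auto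
  have fm: "?f (p - q) = ?f p \<ominus>\<^bsub>P\<^esub> ?f q"
    if "Poly_Mapping.keys p \<subseteq> carrier V \<times> carrier W" "Poly_Mapping.keys q \<subseteq> carrier V \<times> carrier W" for p q
    using that linear_map_minus[OF tens_free_module P f, of p q] by (simp add: tens_free_ops tens_free_carrier)
  have z: "(x \<oplus>\<^bsub>P\<^esub> y) \<ominus>\<^bsub>P\<^esub> x \<ominus>\<^bsub>P\<^esub> y = \<zero>\<^bsub>P\<^esub>" if "x \<in> carrier P" "y \<in> carrier P" for x y
  proof -
    have "(x \<oplus>\<^bsub>P\<^esub> y) \<ominus>\<^bsub>P\<^esub> x \<ominus>\<^bsub>P\<^esub> y = (x \<oplus>\<^bsub>P\<^esub> y) \<oplus>\<^bsub>P\<^esub> \<ominus>\<^bsub>P\<^esub> (x \<oplus>\<^bsub>P\<^esub> y)"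
      using that by (simp add: a_minus_def P.M.a_assoc P.M.minus_add)
    then show ?thesis using that by (simp add: P.M.r_neg)
  qed
  have "bilin_rel V W \<subseteq> {p \<in> carrier (tens_free V W). ?f p = \<zero>\<^bsub>P\<^esub>}"
    unfolding bilin_rel_def
  proof (rule lspan_minimal)
    show "submodule {p \<in> carrier (tens_free V W). ?f p = \<zero>\<^bsub>P\<^esub>} KK (tens_free V W)"
      by (rule F.submodule_kernel[OF P f])
    show "bilin_gens V W \<subseteq> {p \<in> carrier (tens_free V W). ?f p = \<zero>\<^bsub>P\<^esub>}"
      using bilinD(1-5)[OF B]
      by (auto simp: fm f1 z keys_minus_subset KK_smult[OF P] intro!: tens_free_minus_closed)
  qed
  with assms show ?thesis by auto
qed

lemma tlift_coset:
  assumes "Poly_Mapping.keys p \<subseteq> carrier V \<times> carrier W"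
  shows "tlift P B (bilin_rel V W +>\<^bsub>tens_free V W\<^esub> p) = lext P (\<lambda>(v, w). B v w) p"
  unfolding tlift_def
  using assms lext_bilin_rel lext_tens_free_linear[OF P, of B] bilinD(1)[OF B]
  by (intro T.quot_lift(1)[OF P]) (auto simp: tens_free_carrier)

lemma tlift_linear: "linear_map KK (tensor V W) P (tlift P B)"
  unfolding tlift_def[abs_def] tensor_def
  using lext_bilin_rel lext_tens_free_linear[OF P, of B] bilinD(1)[OF B]
  by (intro T.quot_lift(2)[OF P]) auto

lemma tlift_pure [simp]:
  assumes "v \<in> carrier V" "w \<in> carrier W"
  shows "tlift P B (pure_tensor V W v w) = B v w"
  using assms bilinD(1)[OF B] unfolding pure_tensor_def
  by (subst tlift_coset) (auto simp: lext_single[OF P] P)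

end

text \<open>Every element of the tensor product has a representative in the free space on pairs, so
  pure tensors span. Nearly every identity on a tensor product below is proved through this
  lemma.\<close>

lemma tensor_linear_eq:
  assumes P: "module KK P"
    and f: "linear_map KK (tensor V W) P f" and g: "linear_map KK (tensor V W) P g"
    and fg: "\<And>v w. v \<in> carrier V \<Longrightarrow> w \<in> carrier W \<Longrightarrow> f (pure_tensor V W v w) = g (pure_tensor V W v w)"
    and t: "t \<in> carrier (tensor V W)"
  shows "f t = g t"
proof -
  obtain p where p: "Poly_Mapping.keys p \<subseteq> carrier V \<times> carrier W" "t = bilin_rel V W +>\<^bsub>tens_free V W\<^esub> p"
    using t by (rule tensor_cases)
  have "(\<lambda>p. f (bilin_rel V W +>\<^bsub>tens_free V W\<^esub> p)) p = (\<lambda>p. g (bilin_rel V W +>\<^bsub>tens_free V W\<^esub> p)) p"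
    by (rule tens_free_linear_eq[OF P linear_map_comp[OF tensor_coset_linear f] linear_map_comp[OF tensor_coset_linear g]])
      (use fg p in \<open>auto simp: pure_tensor_def tens_free_carrier\<close>)
  then show ?thesis using p by simp
qed

end

lemma tlift_comp:
  assumes V: "module KK V" and W: "module KK W" and P: "module KK P" and Q: "module KK Q"
    and B: "bilin V W P B" and h: "linear_map KK P Q h" and t: "t \<in> carrier (tensor V W)"
  shows "h (tlift P B t) = tlift Q (\<lambda>v w. h (B v w)) t"
proof (rule tensor_linear_eq[OF V W Q _ _ _ t])
  have B': "bilin V W Q (\<lambda>v w. h (B v w))"
    using bilinD[OF B] linear_mapD[OF h] by (intro bilinI) simp_all
  show "linear_map KK (tensor V W) Q (\<lambda>t. h (tlift P B t))"
    by (rule linear_map_comp[OF tlift_linear[OF V W P B] h])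
  show "linear_map KK (tensor V W) Q (tlift Q (\<lambda>v w. h (B v w)))"
    by (rule tlift_linear[OF V W Q B'])
  show "h (tlift P B (pure_tensor V W v w)) = tlift Q (\<lambda>v w. h (B v w)) (pure_tensor V W v w)"
    if "v \<in> carrier V" "w \<in> carrier W" for v w
    using that tlift_pure[OF V W P B that] tlift_pure[OF V W Q B' that] by simp
qed

context
  fixes V :: "('k::field, 'v, 'y) module_scheme" and W :: "('k, 'w, 'z) module_scheme"
  assumes V: "assoc_alg V" and W: "assoc_alg W"
begin

interpretation V: assoc_alg V by (rule V)
interpretation W: assoc_alg W by (rule W)

lemma tens_free_assoc_alg: "assoc_alg (tens_free V W)"
  unfolding tens_free_def by (rule free_assoc_alg) (auto simp: V.m_assoc W.m_assoc)

interpretation F: assoc_alg "tens_free V W" by (rule tens_free_assoc_alg)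
interpretation T: quot_mod KK "tens_free V W" "bilin_rel V W"
  by (intro quot_mod.intro quot_mod_axioms.intro bilin_rel_submodule V.module_axioms W.module_axioms F.module_axioms)

lemma tens_free_mult_single:
  "Poly_Mapping.single (v, w) c \<otimes>\<^bsub>tens_free V W\<^esub> Poly_Mapping.single (v', w') d =
   Poly_Mapping.single (v \<otimes>\<^bsub>V\<^esub> v', w \<otimes>\<^bsub>W\<^esub> w') (c * d)"
  by (simp add: tens_free_def)

text \<open>Multiplying a bilinearity relation by a basis pair gives another relation of the same
  kind. By linearity the relations form a two-sided ideal, which is what makes the tensor product of
  algebras an algebra.\<close>

lemma bilin_rel_mult_single:
  assumes p: "p \<in> bilin_rel V W" and vw: "v \<in> carrier V" "w \<in> carrier W"
  shows "Poly_Mapping.single (v, w) 1 \<otimes>\<^bsub>tens_free V W\<^esub> p \<in> bilin_rel V W"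
    and "p \<otimes>\<^bsub>tens_free V W\<^esub> Poly_Mapping.single (v, w) 1 \<in> bilin_rel V W"
proof -
  let ?s = "Poly_Mapping.single (v, w) (1::'k)"
  note mods = V.module_axioms W.module_axioms
  note sub = F.submoduleE[OF bilin_rel_submodule[OF mods]] F.submodule_zero[OF bilin_rel_submodule[OF mods]]
  have mult: "p \<otimes>\<^bsub>tens_free V W\<^esub> q = pm_mult (\<lambda>x y. (fst x \<otimes>\<^bsub>V\<^esub> fst y, snd x \<otimes>\<^bsub>W\<^esub> snd y)) p q" for p q
    by (simp add: tens_free_def)
  have s: "?s \<in> carrier (tens_free V W)" using vw by (simp add: tens_free_carrier[OF mods])
  have sL: "submodule {p \<in> carrier (tens_free V W). ?s \<otimes>\<^bsub>tens_free V W\<^esub> p \<in> bilin_rel V W} KK (tens_free V W)"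
    using s sub(2-) by (intro F.submoduleI') (auto simp: F.r_distr F.smult_mult_right)
  have sR: "submodule {p \<in> carrier (tens_free V W). p \<otimes>\<^bsub>tens_free V W\<^esub> ?s \<in> bilin_rel V W} KK (tens_free V W)"
    using s sub(2-) by (intro F.submoduleI') (auto simp: F.l_distr F.smult_mult_left)
  have L: "bilin_rel V W \<subseteq> {p \<in> carrier (tens_free V W). ?s \<otimes>\<^bsub>tens_free V W\<^esub> p \<in> bilin_rel V W}"
  proof (subst bilin_rel_def, rule lspan_minimal[OF sL], rule subsetI, rule CollectI, rule conjI)
    fix p assume p: "p \<in> bilin_gens V W"
    then show "p \<in> carrier (tens_free V W)" using bilin_gens_subset[OF mods] by blast
    show "?s \<otimes>\<^bsub>tens_free V W\<^esub> p \<in> bilin_rel V W"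
      using p vw bilin_gens_rel[OF mods]
      by (auto simp: mult pm_mult_minus_right V.r_distr W.r_distr V.smult_mult_right W.smult_mult_right)
  qed
  have R: "bilin_rel V W \<subseteq> {p \<in> carrier (tens_free V W). p \<otimes>\<^bsub>tens_free V W\<^esub> ?s \<in> bilin_rel V W}"
  proof (subst bilin_rel_def, rule lspan_minimal[OF sR], rule subsetI, rule CollectI, rule conjI)
    fix p assume p: "p \<in> bilin_gens V W"
    then show "p \<in> carrier (tens_free V W)" using bilin_gens_subset[OF mods] by blast
    show "p \<otimes>\<^bsub>tens_free V W\<^esub> ?s \<in> bilin_rel V W"
      using p vw bilin_gens_rel[OF mods]
      by (auto simp: mult pm_mult_minus_left V.l_distr W.l_distr V.smult_mult_left W.smult_mult_left)
  qed
  show "?s \<otimes>\<^bsub>tens_free V W\<^esub> p \<in> bilin_rel V W" using L p by blast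
  show "p \<otimes>\<^bsub>tens_free V W\<^esub> ?s \<in> bilin_rel V W" using R p by blast
qed

lemma bilin_rel_ideal: "ideal (bilin_rel V W) (tens_free V W)"
proof (rule idealI)
  note mods = V.module_axioms W.module_axioms
  note sub = F.submoduleE[OF bilin_rel_submodule[OF mods]] F.submodule_zero[OF bilin_rel_submodule[OF mods]]
  show "ring (tens_free V W)" by (rule F.ring_axioms)
  show "subgroup (bilin_rel V W) (add_monoid (tens_free V W))"
    using bilin_rel_submodule[OF mods] by (rule submodule.axioms)
  fix a x assume a: "a \<in> bilin_rel V W" and x: "x \<in> carrier (tens_free V W)"
  have "Poly_Mapping.keys x \<subseteq> carrier V \<times> carrier W" using x by (simp add: tens_free_carrier[OF mods])
  then have "x \<otimes>\<^bsub>tens_free V W\<^esub> a \<in> bilin_rel V W \<and> a \<otimes>\<^bsub>tens_free V W\<^esub> x \<in> bilin_rel V W"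
  proof (induction rule: free_induct)
    case zero
    then show ?case using sub by (simp add: tens_free_def)
  next
    case (single y c q)
    obtain v w where y: "y = (v, w)" by (cases y)
    have ac: "a \<in> carrier (tens_free V W)" using a sub(1) by blast
    have yc: "Poly_Mapping.single y (1::'k) \<in> carrier (tens_free V W)" "q \<in> carrier (tens_free V W)"
      "Poly_Mapping.single y c \<in> carrier (tens_free V W)"
      using single by (auto simp: tens_free_carrier[OF mods])
    have c: "Poly_Mapping.single y c = c \<odot>\<^bsub>tens_free V W\<^esub> Poly_Mapping.single y 1"
      by (simp add: tens_free_def)
    have "Poly_Mapping.single y c \<otimes>\<^bsub>tens_free V W\<^esub> a \<in> bilin_rel V W"
      "a \<otimes>\<^bsub>tens_free V W\<^esub> Poly_Mapping.single y c \<in> bilin_rel V W"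
      unfolding c using ac yc a single y
      by (auto simp: F.smult_mult_left F.smult_mult_right intro!: sub(4) bilin_rel_mult_single)
    then show ?case
      using single sub(5) ac yc F.l_distr[of "Poly_Mapping.single y c" q a] F.r_distr[of "Poly_Mapping.single y c" q a]
      by (simp add: tens_free_ops[OF mods])
  qed
  then show "x \<otimes>\<^bsub>tens_free V W\<^esub> a \<in> bilin_rel V W" "a \<otimes>\<^bsub>tens_free V W\<^esub> x \<in> bilin_rel V W" by auto
qed

lemma tensor_assoc_alg: "assoc_alg (tensor V W)"
  unfolding tensor_def by (rule F.quot_assoc_alg[OF bilin_rel_ideal])

lemma pure_tensor_mult:
  assumes "v \<in> carrier V" "v' \<in> carrier V" "w \<in> carrier W" "w' \<in> carrier W"
  shows "pure_tensor V W v w \<otimes>\<^bsub>tensor V W\<^esub> pure_tensor V W v' w' = pure_tensor V W (v \<otimes>\<^bsub>V\<^esub> v') (w \<otimes>\<^bsub>W\<^esub> w')"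
  unfolding tensor_def pure_tensor_def
  using assms by (subst F.quot_mult[OF bilin_rel_ideal])
    (auto simp: tens_free_mult_single tens_free_carrier[OF V.module_axioms W.module_axioms])

lemma tensor_one: "\<one>\<^bsub>tensor V W\<^esub> = pure_tensor V W \<one>\<^bsub>V\<^esub> \<one>\<^bsub>W\<^esub>"
  by (simp add: tensor_def pure_tensor_def quot_module_simps) (simp add: tens_free_def)

end

section \<open>Sweedler calculus in a cocommutative bialgebra\<close>

lemma self_module_simps [simp]:
  "carrier (self_module S) = carrier S" "x \<oplus>\<^bsub>self_module S\<^esub> y = x \<oplus>\<^bsub>S\<^esub> y"
  "\<zero>\<^bsub>self_module S\<^esub> = \<zero>\<^bsub>S\<^esub>" "\<one>\<^bsub>self_module S\<^esub> = \<one>\<^bsub>S\<^esub>" "x \<otimes>\<^bsub>self_module S\<^esub> y = x \<otimes>\<^bsub>S\<^esub> y"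
  "c \<odot>\<^bsub>self_module S\<^esub> x = c \<otimes>\<^bsub>S\<^esub> x"
  by (simp_all add: self_module_def ring.defs module.defs)

lemma self_module_module:
  assumes "cring S" shows "module S (self_module S)"
proof -
  interpret cring S by fact
  show ?thesis
  proof (rule moduleI)
    show "abelian_group (self_module S)"
    proof (rule abelian_groupI)
      fix x assume x: "x \<in> carrier (self_module S)"
      then show "\<exists>y\<in>carrier (self_module S). y \<oplus>\<^bsub>self_module S\<^esub> x = \<zero>\<^bsub>self_module S\<^esub>"
        by (intro bexI[of _ "\<ominus>\<^bsub>S\<^esub> x"]) (auto simp: l_neg)
    qed (auto simp: a_ac)
  qed (auto simp: l_distr r_distr m_assoc is_cring)
qed

abbreviation KM :: "('k::field, 'k) module" where "KM \<equiv> self_module KK"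

lemma KM_module: "module KK (KM :: ('k::field, 'k) module)"
  by (rule self_module_module) (rule cring_from_type_algebra)

text \<open>The carrier of A is a whole type, so its operations are those of a type class and the
  theory of bases for \<open>vector_space\<close> becomes available for A.\<close>

locale cbialg =
  fixes scale :: "'k::field \<Rightarrow> 'a::ring_1 \<Rightarrow> 'a"
    and \<Delta> :: "'a \<Rightarrow> ('a \<times> 'a \<Rightarrow>\<^sub>0 'k) set"
    and \<epsilon> :: "'a \<Rightarrow> 'k"
    and A :: "('k, 'a) bialg"
  assumes A_eq: "A = bialg_of_type scale \<Delta> \<epsilon>"
    and cocommutative: "cocommutative_bialgebra A"
begin

lemma A_simps [simp]:
  "carrier A = UNIV" "x \<oplus>\<^bsub>A\<^esub> y = x + y" "x \<otimes>\<^bsub>A\<^esub> y = x * y" "\<zero>\<^bsub>A\<^esub> = 0" "\<one>\<^bsub>A\<^esub> = 1"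
  "c \<odot>\<^bsub>A\<^esub> x = scale c x" "comult A = \<Delta>" "counit A = \<epsilon>"
  by (simp_all add: A_eq bialg_of_type_def)

lemma A_add [simp]: "add A = (+)" and A_mult [simp]: "monoid.mult A = (*)" and A_smult [simp]: "module.smult A = scale"
  by (simp_all add: A_eq bialg_of_type_def)

sublocale B: cocommutative_bialgebra A by (rule cocommutative)

sublocale A: assoc_alg A
  by unfold_locales (use B.smult_mult_left B.smult_mult_right in auto)

lemma A_a_inv [simp]: "\<ominus>\<^bsub>A\<^esub> x = - x"
  by (rule B.minus_equality) auto

lemma A_minus [simp]: "x \<ominus>\<^bsub>A\<^esub> y = x - y"
  by (simp add: a_minus_def)

sublocale vs: vector_space scale
  using B.smult_r_distr B.smult_l_distr B.smult_assoc1 B.smult_one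
  by unfold_locales auto

lemmas A_module = B.module_axioms

lemma scale_mult: "scale c x * y = scale c (x * y)" "x * scale c y = scale c (x * y)"
  using A.smult_mult_left[of x y c] A.smult_mult_right[of x y c] by auto

text \<open>In Sweedler notation, \<open>sw P B a\<close> is \<Sum> B(a1, a2) with values in P.
  Nested occurrences stand for iterated comultiplications.\<close>

definition sw :: "('k, 'p, 'z) module_scheme \<Rightarrow> ('a \<Rightarrow> 'a \<Rightarrow> 'p) \<Rightarrow> 'a \<Rightarrow> 'p" where
  "sw P B a = tlift P B (\<Delta> a)"

abbreviation "lin \<equiv> linear_map KK A"
abbreviation "bil \<equiv> bilin A A"

lemma linI:
  assumes "\<And>x. f x \<in> carrier P" "\<And>x y. f (x + y) = f x \<oplus>\<^bsub>P\<^esub> f y" "\<And>c x. f (scale c x) = c \<odot>\<^bsub>P\<^esub> f x"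
  shows "lin P f"
  using assms by (intro linear_mapI) auto

lemma linD:
  assumes "lin P f"
  shows "f x \<in> carrier P" "f (x + y) = f x \<oplus>\<^bsub>P\<^esub> f y" "f (scale c x) = c \<odot>\<^bsub>P\<^esub> f x"
  using linear_mapD[OF assms] by auto

lemma lin_zero: "module KK P \<Longrightarrow> lin P f \<Longrightarrow> f 0 = \<zero>\<^bsub>P\<^esub>"
  using linear_map_zero[OF A_module, of P f] by simp

lemma lin_minus: "module KK P \<Longrightarrow> lin P f \<Longrightarrow> f (x - y) = f x \<ominus>\<^bsub>P\<^esub> f y"
  using linear_map_minus[OF A_module, of P f x y] by simp

lemma bilI:
  assumes "\<And>x. lin P (B x)" "\<And>y. lin P (\<lambda>x. B x y)" shows "bil P B"
  using assms by (simp add: bilin_def)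

lemma bilD:
  assumes "bil P B" shows "lin P (B x)" "lin P (\<lambda>x. B x y)" "B x y \<in> carrier P"
  using assms linear_mapD(1)[of KK A P "B x" y] by (auto simp: bilin_def)

lemma \<Delta>_closed [simp]: "\<Delta> a \<in> carrier (tensor A A)"
  using linear_mapD(1)[OF B.comult_linear, of a] by simp

lemma \<Delta>_lin: "lin (tensor A A) \<Delta>"
  using B.comult_linear by simp

lemma \<epsilon>_lin: "lin KM \<epsilon>"
  using B.counit_linear by simp

lemma \<epsilon>_simps [simp]: "\<epsilon> (x + y) = \<epsilon> x + \<epsilon> y" "\<epsilon> (scale c x) = c * \<epsilon> x" "\<epsilon> 1 = 1" "\<epsilon> (x * y) = \<epsilon> x * \<epsilon> y"
  "\<epsilon> 0 = 0" "\<epsilon> (x - y) = \<epsilon> x - \<epsilon> y"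
proof -
  show add: "\<epsilon> (x + y) = \<epsilon> x + \<epsilon> y" for x y using linD(2)[OF \<epsilon>_lin] by simp
  show "\<epsilon> (scale c x) = c * \<epsilon> x" using linD(3)[OF \<epsilon>_lin] by simp
  show "\<epsilon> 1 = 1" "\<epsilon> (x * y) = \<epsilon> x * \<epsilon> y" using B.counit_one B.counit_mult by auto
  show "\<epsilon> 0 = 0" using lin_zero[OF KM_module \<epsilon>_lin] by simp
  show "\<epsilon> (x - y) = \<epsilon> x - \<epsilon> y" using add[of "x - y" y] by simp
qed

definition tril :: "('k, 'p, 'z) module_scheme \<Rightarrow> ('a \<Rightarrow> 'a \<Rightarrow> 'a \<Rightarrow> 'p) \<Rightarrow> bool" where
  "tril P t \<longleftrightarrow> (\<forall>x y. lin P (t x y)) \<and> (\<forall>x z. lin P (\<lambda>y. t x y z)) \<and> (\<forall>y z. lin P (\<lambda>x. t x y z))"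

context
  fixes P :: "('k, 'p, 'z) module_scheme"
  assumes P: "module KK P"
begin

interpretation P: module KK P by (rule P)

lemma sw_lin: "bil P B \<Longrightarrow> lin P (sw P B)"
  unfolding sw_def[abs_def]
  by (rule linear_map_comp[OF \<Delta>_lin tlift_linear[OF A_module A_module P]])

lemma sw_closed: "bil P B \<Longrightarrow> sw P B a \<in> carrier P"
  by (rule linD[OF sw_lin])

lemma sw_comp:
  assumes "module KK Q" "bil P B" "linear_map KK P Q h"
  shows "h (sw P B a) = sw Q (\<lambda>x y. h (B x y)) a"
  unfolding sw_def using assms by (intro tlift_comp[OF A_module A_module P]) auto

lemma bil_add: "bil P B \<Longrightarrow> bil P C \<Longrightarrow> bil P (\<lambda>x y. B x y \<oplus>\<^bsub>P\<^esub> C x y)"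
  by (intro bilI linI) (auto simp: bilD linD[OF bilD(1)] linD[OF bilD(2)] P.M.a_ac P.smult_r_distr)

lemma bil_smult: "bil P B \<Longrightarrow> bil P (\<lambda>x y. c \<odot>\<^bsub>P\<^esub> B x y)"
  by (intro bilI linI) (auto simp: bilD linD[OF bilD(1)] linD[OF bilD(2)] P.smult_r_distr mult.commute
      P.smult_assoc1[symmetric, simplified])

lemma sw_eqI:
  assumes f: "linear_map KK (tensor A A) P f" and B: "bil P B"
    and eq: "\<And>x y. f (pure_tensor A A x y) = B x y"
  shows "f (\<Delta> a) = sw P B a"
  unfolding sw_def
  by (rule tensor_linear_eq[OF A_module A_module P f tlift_linear[OF A_module A_module P B]])
    (simp_all add: eq tlift_pure[OF A_module A_module P B])

lemma sw_add:
  assumes B: "bil P B" and C: "bil P C"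
  shows "sw P (\<lambda>x y. B x y \<oplus>\<^bsub>P\<^esub> C x y) a = sw P B a \<oplus>\<^bsub>P\<^esub> sw P C a"
  unfolding sw_def[of P B] sw_def[of P C]
  using linear_mapD[OF tlift_linear[OF A_module A_module P B]] linear_mapD[OF tlift_linear[OF A_module A_module P C]]
  by (intro sw_eqI[symmetric] bil_add B C linear_mapI)
    (auto simp: P.M.a_ac P.smult_r_distr tlift_pure[OF A_module A_module P B] tlift_pure[OF A_module A_module P C])

lemma sw_smult:
  assumes B: "bil P B"
  shows "sw P (\<lambda>x y. c \<odot>\<^bsub>P\<^esub> B x y) a = c \<odot>\<^bsub>P\<^esub> sw P B a"
  unfolding sw_def[of P B]
  using linear_mapD[OF tlift_linear[OF A_module A_module P B]]
  by (intro sw_eqI[symmetric] bil_smult B linear_mapI)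
    (auto simp: P.smult_r_distr tlift_pure[OF A_module A_module P B] mult.commute
      P.smult_assoc1[symmetric, simplified])

lemma sw_zero: "sw P (\<lambda>x y. \<zero>\<^bsub>P\<^esub>) a = \<zero>\<^bsub>P\<^esub>"
proof -
  have b: "bil P (\<lambda>x y. \<zero>\<^bsub>P\<^esub>)" by (intro bilI linI) auto
  show ?thesis using sw_smult[OF b, of 0 a] sw_closed[OF b] P by simp
qed

lemma sw_finsum:
  assumes "finite I" "\<And>i. i \<in> I \<Longrightarrow> bil P (B i)"
  shows "bil P (\<lambda>x y. \<Oplus>\<^bsub>P\<^esub>i\<in>I. B i x y) \<and> sw P (\<lambda>x y. \<Oplus>\<^bsub>P\<^esub>i\<in>I. B i x y) a = (\<Oplus>\<^bsub>P\<^esub>i\<in>I. sw P (B i) a)"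
  using assms
proof (induction I)
  case empty
  then show ?case by (auto intro!: bilI linI simp: sw_zero)
next
  case (insert j I)
  have b: "B i x y \<in> carrier P" if "i \<in> insert j I" for i x y
    by (rule bilD(3)[OF insert.prems[OF that]])
  have s: "sw P (B i) a \<in> carrier P" if "i \<in> insert j I" for i
    by (rule sw_closed[OF insert.prems[OF that]])
  have 1: "(\<Oplus>\<^bsub>P\<^esub>i\<in>insert j I. B i x y) = B j x y \<oplus>\<^bsub>P\<^esub> (\<Oplus>\<^bsub>P\<^esub>i\<in>I. B i x y)" for x y
    using insert b by (intro P.finsum_insert) auto
  have 2: "(\<Oplus>\<^bsub>P\<^esub>i\<in>insert j I. sw P (B i) a) = sw P (B j) a \<oplus>\<^bsub>P\<^esub> (\<Oplus>\<^bsub>P\<^esub>i\<in>I. sw P (B i) a)"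
    using insert s by (intro P.finsum_insert) auto
  show ?case unfolding 1 2 using insert bil_add[of "B j"] sw_add[of "B j"] by simp
qed

text \<open>The flip of A \<otimes> A fixes \<open>\<Delta> a\<close>, and composing it with the map
  induced by B exchanges the arguments of B.\<close>

lemma sw_cocomm:
  assumes B: "bil P B" shows "sw P B a = sw P (\<lambda>x y. B y x) a"
proof -
  have pt: "bil (tensor A A) (\<lambda>x y. pure_tensor A A y x)"
    using bilin_pure_tensor[OF A_module A_module] by (auto simp: bilin_def)
  have "sw P B a = tlift P B (tlift (tensor A A) (\<lambda>x y. pure_tensor A A y x) (\<Delta> a))"
    using B.cocomm[of a] by (simp add: sw_def)
  also have "\<dots> = tlift P B (sw (tensor A A) (\<lambda>x y. pure_tensor A A y x) a)" by (simp add: sw_def)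
  also have "\<dots> = sw P (\<lambda>x y. tlift P B (pure_tensor A A y x)) a"
    unfolding sw_def
    by (rule tlift_comp[OF A_module A_module tensor_module[OF A_module A_module] P pt
          tlift_linear[OF A_module A_module P B]]) simp
  finally show ?thesis by (simp add: tlift_pure[OF A_module A_module P B])
qed

lemma sw_counit:
  assumes f: "lin P f"
  shows "sw P (\<lambda>x y. \<epsilon> x \<odot>\<^bsub>P\<^esub> f y) a = f a" "sw P (\<lambda>x y. \<epsilon> y \<odot>\<^bsub>P\<^esub> f x) a = f a"
proof -
  have b: "bil A (\<lambda>x y. scale (\<epsilon> x) y)"
    by (intro bilI linI) (auto simp: vs.scale_right_distrib vs.scale_left_distrib mult.commute)
  have b': "bil A (\<lambda>x y. scale (\<epsilon> y) x)"
    by (intro bilI linI) (auto simp: vs.scale_right_distrib vs.scale_left_distrib mult.commute)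
  have "sw A (\<lambda>x y. scale (\<epsilon> x) y) a = a" "sw A (\<lambda>x y. scale (\<epsilon> y) x) a = a"
    using B.counit_left[of a] B.counit_right[of a] by (simp_all add: sw_def)
  then have "f a = sw P (\<lambda>x y. f (scale (\<epsilon> x) y)) a" "f a = sw P (\<lambda>x y. f (scale (\<epsilon> y) x)) a"
    using tlift_comp[OF A_module A_module A_module P b f, of "\<Delta> a"]
      tlift_comp[OF A_module A_module A_module P b' f, of "\<Delta> a"] by (simp_all add: sw_def)
  then show "sw P (\<lambda>x y. \<epsilon> x \<odot>\<^bsub>P\<^esub> f y) a = f a" "sw P (\<lambda>x y. \<epsilon> y \<odot>\<^bsub>P\<^esub> f x) a = f a"
    using linD(3)[OF f] by simp_all
qed

text \<open>Splitting one argument of a trilinear map leaves a bilinear map; without this neither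
  side of coassociativity would be a legitimate Sweedler sum.\<close>

lemma tril_sw:
  assumes t: "tril P t"
  shows "bil P (\<lambda>x z. sw P (\<lambda>u v. t x u v) z)" "bil P (\<lambda>z c. sw P (\<lambda>u v. t u v c) z)"
proof -
  have b: "bil P (t x)" "bil P (\<lambda>u v. t u v c)" "bil P (\<lambda>x z. t x y z)" for x c y
    using t by (auto simp: tril_def intro!: bilI)
  have l: "t (x + x') y z = t x y z \<oplus>\<^bsub>P\<^esub> t x' y z" "t x y (z + z') = t x y z \<oplus>\<^bsub>P\<^esub> t x y z'"
    "t (scale c x) y z = c \<odot>\<^bsub>P\<^esub> t x y z" "t x y (scale c z) = c \<odot>\<^bsub>P\<^esub> t x y z" for x x' y z z' c
    using linD(2,3)[OF bilD(1)[OF b(3)]] linD(2,3)[OF bilD(2)[OF b(3)]] by auto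
  show "bil P (\<lambda>x z. sw P (\<lambda>u v. t x u v) z)"
  proof (intro bilI)
    show "lin P (sw P (t x))" for x by (rule sw_lin[OF b(1)])
    have e: "t (x + x') = (\<lambda>u v. t x u v \<oplus>\<^bsub>P\<^esub> t x' u v)" "t (scale c x) = (\<lambda>u v. c \<odot>\<^bsub>P\<^esub> t x u v)" for x x' c
      by (intro ext l)+
    show "lin P (\<lambda>x. sw P (t x) y)" for y
      by (rule linI) (simp_all add: sw_closed[OF b(1)] e sw_add[OF b(1) b(1)] sw_smult[OF b(1)])
  qed
  show "bil P (\<lambda>z c. sw P (\<lambda>u v. t u v c) z)"
  proof (intro bilI)
    show "lin P (\<lambda>z. sw P (\<lambda>u v. t u v c) z)" for c by (rule sw_lin[OF b(2)])
    show "lin P (\<lambda>c. sw P (\<lambda>u v. t u v c) z)" for z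
      by (rule linI) (simp_all add: sw_closed[OF b(2)] l sw_add[OF b(2) b(2)] sw_smult[OF b(2)])
  qed
qed

text \<open>The trilinear map t induces T on A \<otimes> (A \<otimes> A), and F is the reassociation
  used in the axiom of coassociativity. Applying T to the two sides of that axiom gives the two
  nested sums.\<close>

lemma sw_coassoc:
  assumes t: "tril P t"
  shows "sw P (\<lambda>z c. sw P (\<lambda>u v. t u v c) z) a = sw P (\<lambda>x z. sw P (\<lambda>u v. t x u v) z) a"
proof -
  let ?AA = "tensor A A"
  let ?Q = "tensor A ?AA"
  note AA = tensor_module[OF A_module A_module]
  note Q = tensor_module[OF A_module AA]
  note pt = bilin_pure_tensor[OF A_module A_module] and ptQ = bilin_pure_tensor[OF A_module AA]
    and pt' = bilin_pure_tensor[OF AA A_module]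
  have b: "bil P (t x)" "bil P (\<lambda>u v. t u v c)" for x c
    using t by (auto simp: tril_def intro!: bilI)
  have l: "t (x + x') y z = t x y z \<oplus>\<^bsub>P\<^esub> t x' y z" "t (scale c x) y z = c \<odot>\<^bsub>P\<^esub> t x y z" for x x' y z c
    using linD(2,3)[OF bilD(2)[OF b(2)]] by auto
  have bT: "bilin A ?AA P (\<lambda>x s. tlift P (t x) s)"
    unfolding bilin_def
  proof (intro conjI ballI)
    show "linear_map KK ?AA P (tlift P (t x))" for x
      by (rule tlift_linear[OF A_module A_module P b(1)])
    fix s assume s: "s \<in> carrier ?AA"
    note lin = linear_mapD[OF tlift_linear[OF A_module A_module P b(1)]]
    show "lin P (\<lambda>x. tlift P (t x) s)"
    proof (rule linI)
      show "tlift P (t x) s \<in> carrier P" for x using lin(1) s by blast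
      show "tlift P (t (x + y)) s = tlift P (t x) s \<oplus>\<^bsub>P\<^esub> tlift P (t y) s" for x y
      proof (rule tensor_linear_eq[OF A_module A_module P tlift_linear[OF A_module A_module P b(1)] _ _ s])
        show "linear_map KK ?AA P (\<lambda>s. tlift P (t x) s \<oplus>\<^bsub>P\<^esub> tlift P (t y) s)"
          by (rule linear_mapI) (auto simp: lin P.M.a_ac P.smult_r_distr)
      qed (simp add: tlift_pure[OF A_module A_module P b(1)] l)
      show "tlift P (t (scale c x)) s = c \<odot>\<^bsub>P\<^esub> tlift P (t x) s" for c x
      proof (rule tensor_linear_eq[OF A_module A_module P tlift_linear[OF A_module A_module P b(1)] _ _ s])
        show "linear_map KK ?AA P (\<lambda>s. c \<odot>\<^bsub>P\<^esub> tlift P (t x) s)"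
          by (rule linear_mapI) (auto simp: lin P.smult_r_distr mult.commute P.smult_assoc1[symmetric, simplified])
      qed (simp add: tlift_pure[OF A_module A_module P b(1)] l)
    qed
  qed
  define T where "T = tlift P (\<lambda>x s. tlift P (t x) s)"
  have T: "linear_map KK ?Q P T" unfolding T_def by (rule tlift_linear[OF A_module AA P bT])
  have T_pure: "T (pure_tensor A ?AA x s) = tlift P (t x) s" if "s \<in> carrier ?AA" for x s
    unfolding T_def using tlift_pure[OF A_module AA P bT, of x s] that by simp
  have bR: "bil ?Q (\<lambda>v w. pure_tensor A ?AA (id v) (\<Delta> w))"
    using bilin_comp[OF ptQ, of A id A \<Delta> ?Q id] \<Delta>_lin by (simp add: linear_map_def)
  have R: "T (tensor_map A ?AA id \<Delta> (\<Delta> a)) = sw P (\<lambda>x z. sw P (\<lambda>u v. t x u v) z) a"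
    unfolding tensor_map_def sw_def
    by (subst tlift_comp[OF A_module A_module Q P bR T]) (simp_all add: T_pure)
  have bF: "bilin ?AA A ?Q (\<lambda>s c. tlift ?Q (\<lambda>a b. pure_tensor A ?AA a (pure_tensor A A b c)) s)"
  proof -
    have bc: "bil ?Q (\<lambda>a b. pure_tensor A ?AA a (pure_tensor A A b c))" for c
      using bilin_comp[OF ptQ, of A id A "\<lambda>b. pure_tensor A A b c" ?Q id] bilinD(7)[OF pt] by (simp add: linear_map_def)
    note lin = linear_mapD[OF tlift_linear[OF A_module A_module Q bc]]
    interpret Q: module KK ?Q by (rule Q)
    show ?thesis
      unfolding bilin_def
    proof (intro conjI ballI)
      show "linear_map KK ?AA ?Q (\<lambda>s. tlift ?Q (\<lambda>a b. pure_tensor A ?AA a (pure_tensor A A b c)) s)" for c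
        by (rule tlift_linear[OF A_module A_module Q bc])
      fix s assume s: "s \<in> carrier ?AA"
      show "lin ?Q (\<lambda>c. tlift ?Q (\<lambda>a b. pure_tensor A ?AA a (pure_tensor A A b c)) s)"
      proof (rule linI)
        show "tlift ?Q (\<lambda>a b. pure_tensor A ?AA a (pure_tensor A A b c)) s \<in> carrier ?Q" for c
          using lin(1) s by blast
        show "tlift ?Q (\<lambda>a b. pure_tensor A ?AA a (pure_tensor A A b (x + y))) s =
            tlift ?Q (\<lambda>a b. pure_tensor A ?AA a (pure_tensor A A b x)) s \<oplus>\<^bsub>?Q\<^esub>
            tlift ?Q (\<lambda>a b. pure_tensor A ?AA a (pure_tensor A A b y)) s" for x y
        proof (rule tensor_linear_eq[OF A_module A_module Q tlift_linear[OF A_module A_module Q bc] _ _ s])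
          show "linear_map KK ?AA ?Q (\<lambda>s. tlift ?Q (\<lambda>a b. pure_tensor A ?AA a (pure_tensor A A b x)) s \<oplus>\<^bsub>?Q\<^esub>
            tlift ?Q (\<lambda>a b. pure_tensor A ?AA a (pure_tensor A A b y)) s)"
            by (rule linear_mapI) (auto simp: lin Q.M.a_ac Q.smult_r_distr)
        qed (simp only: tlift_pure[OF A_module A_module Q bc], use bilinD(1,3)[OF pt] bilinD(3)[OF ptQ] in simp)
        show "tlift ?Q (\<lambda>a b. pure_tensor A ?AA a (pure_tensor A A b (scale c x))) s =
            c \<odot>\<^bsub>?Q\<^esub> tlift ?Q (\<lambda>a b. pure_tensor A ?AA a (pure_tensor A A b x)) s" for c x
        proof (rule tensor_linear_eq[OF A_module A_module Q tlift_linear[OF A_module A_module Q bc] _ _ s])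
          show "linear_map KK ?AA ?Q (\<lambda>s. c \<odot>\<^bsub>?Q\<^esub> tlift ?Q (\<lambda>a b. pure_tensor A ?AA a (pure_tensor A A b x)) s)"
            by (rule linear_mapI) (auto simp: lin Q.smult_r_distr mult.commute Q.smult_assoc1[symmetric, simplified])
        qed (simp only: tlift_pure[OF A_module A_module Q bc], use bilinD(1,5)[OF pt] bilinD(5)[OF ptQ] in simp)
      qed
    qed
  qed
  define F where "F = tlift ?Q (\<lambda>s c. tlift ?Q (\<lambda>a b. pure_tensor A ?AA a (pure_tensor A A b c)) s)"
  have F: "linear_map KK (tensor ?AA A) ?Q F" unfolding F_def by (rule tlift_linear[OF AA A_module Q bF])
  have F_pure: "F (pure_tensor ?AA A s c) = tlift ?Q (\<lambda>a b. pure_tensor A ?AA a (pure_tensor A A b c)) s"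
    if "s \<in> carrier ?AA" for s c
    unfolding F_def using tlift_pure[OF AA A_module Q bF, of s c] that by simp
  have bL: "bil (tensor ?AA A) (\<lambda>v w. pure_tensor ?AA A (\<Delta> v) (id w))"
    using bilin_comp[OF pt', of A \<Delta> A id "tensor ?AA A" id] \<Delta>_lin by (simp add: linear_map_def)
  have bL': "bil ?Q (\<lambda>v w. F (pure_tensor ?AA A (\<Delta> v) (id w)))"
    using bilin_comp[OF bL, of A id A id ?Q F] F by (simp add: linear_map_def)
  have L: "T (F (tensor_map ?AA A \<Delta> id (\<Delta> a))) = sw P (\<lambda>z c. sw P (\<lambda>u v. t u v c) z) a"
  proof -
    have "T (F (tensor_map ?AA A \<Delta> id (\<Delta> a))) = tlift P (\<lambda>v w. T (F (pure_tensor ?AA A (\<Delta> v) (id w)))) (\<Delta> a)"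
      unfolding tensor_map_def
      by (subst tlift_comp[OF A_module A_module tensor_module[OF AA A_module] Q bL F], simp)
        (rule tlift_comp[OF A_module A_module Q P bL' T], simp)
    also have "\<dots> = tlift P (\<lambda>v w. sw P (\<lambda>x y. t x y w) v) (\<Delta> a)"
    proof (rule arg_cong[where f = "\<lambda>f. tlift P f (\<Delta> a)"], intro ext)
      fix v w
      have bc: "bil ?Q (\<lambda>a b. pure_tensor A ?AA a (pure_tensor A A b w))"
        using bilin_comp[OF ptQ, of A id A "\<lambda>b. pure_tensor A A b w" ?Q id] bilinD(7)[OF pt] by (simp add: linear_map_def)
      show "T (F (pure_tensor ?AA A (\<Delta> v) (id w))) = sw P (\<lambda>x y. t x y w) v"
        using bilinD(1)[OF pt]
        by (simp add: F_pure tlift_comp[OF A_module A_module Q P bc T] T_pure tlift_pure[OF A_module A_module P b(1)] sw_def)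
    qed
    finally show ?thesis by (simp add: sw_def)
  qed
  have "F (tensor_map ?AA A \<Delta> id (\<Delta> a)) = tensor_map A ?AA id \<Delta> (\<Delta> a)"
    using B.coassoc[of a] by (simp add: F_def)
  with L R show ?thesis by simp
qed

end

end

text \<open>Bookkeeping for the commutator of x \<otimes> 1 + 1 \<otimes> x and y \<otimes> 1 + 1
  \<otimes> y: here b and c are the mixed terms, which occur in both products.\<close>

lemma (in abelian_group) cross_terms_cancel:
  assumes "a \<in> carrier G" "b \<in> carrier G" "c \<in> carrier G" "d \<in> carrier G" "e \<in> carrier G" "f \<in> carrier G"
  shows "((a \<oplus> c) \<oplus> (b \<oplus> d)) \<ominus> ((e \<oplus> b) \<oplus> (c \<oplus> f)) = (a \<ominus> e) \<oplus> (d \<ominus> f)"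
proof -
  have "((a \<oplus> c) \<oplus> (b \<oplus> d)) \<ominus> ((e \<oplus> b) \<oplus> (c \<oplus> f)) =
      ((a \<ominus> e) \<oplus> (d \<ominus> f)) \<oplus> ((b \<oplus> \<ominus> b) \<oplus> (c \<oplus> \<ominus> c))"
    using assms by (simp only: a_minus_def minus_add a_ac a_closed a_inv_closed)
  then show ?thesis using assms by (simp add: r_neg)
qed

lemma KM_a_inv [simp]: "\<ominus>\<^bsub>KM\<^esub> x = (- x :: 'k::field)"
proof -
  interpret module KK "KM :: ('k, 'k) module" by (rule KM_module)
  show ?thesis by (rule M.minus_equality) auto
qed

lemma KM_minus [simp]: "x \<ominus>\<^bsub>KM\<^esub> y = (x - y :: 'k::field)"
  by (simp add: a_minus_def)

section \<open>Comultiplication of products; primitive elements\<close>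

context cbialg
begin

lemma bil_sw_mult:
  assumes P: "module KK P" and B: "bil P B"
  shows "bil P (\<lambda>u v. sw P (\<lambda>u' v'. B (u * u') (v * v')) b)"
proof -
  interpret P: module KK P by (rule P)
  have b2: "bil P (\<lambda>u v. B (x * u) (y * v))" for x y
    by (intro bilI linI)
      (simp_all add: bilD(3)[OF B] distrib_left scale_mult linD(2,3)[OF bilD(1)[OF B]] linD(2,3)[OF bilD(2)[OF B]])
  have cl: "sw P (\<lambda>x y. B (u * x) (v * y)) b \<in> carrier P" for u v by (rule sw_closed[OF P b2])
  show ?thesis
  proof (intro bilI linI)
    fix u v w
    have e: "(\<lambda>x y. B ((u + w) * x) (v * y)) = (\<lambda>x y. B (u * x) (v * y) \<oplus>\<^bsub>P\<^esub> B (w * x) (v * y))"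
      "(\<lambda>x y. B (u * x) ((v + w) * y)) = (\<lambda>x y. B (u * x) (v * y) \<oplus>\<^bsub>P\<^esub> B (u * x) (w * y))"
      by (intro ext, simp add: distrib_right linD(2)[OF bilD(1)[OF B]] linD(2)[OF bilD(2)[OF B]])+
    show "sw P (\<lambda>x y. B (u * x) ((v + w) * y)) b = sw P (\<lambda>x y. B (u * x) (v * y)) b \<oplus>\<^bsub>P\<^esub> sw P (\<lambda>x y. B (u * x) (w * y)) b"
      unfolding e by (rule sw_add[OF P b2 b2])
    show "sw P (\<lambda>x y. B ((u + w) * x) (v * y)) b = sw P (\<lambda>x y. B (u * x) (v * y)) b \<oplus>\<^bsub>P\<^esub> sw P (\<lambda>x y. B (w * x) (v * y)) b"
      unfolding e by (rule sw_add[OF P b2 b2])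
  next
    fix u v c
    have e: "(\<lambda>x y. B (scale c u * x) (v * y)) = (\<lambda>x y. c \<odot>\<^bsub>P\<^esub> B (u * x) (v * y))"
      "(\<lambda>x y. B (u * x) (scale c v * y)) = (\<lambda>x y. c \<odot>\<^bsub>P\<^esub> B (u * x) (v * y))"
      by (intro ext, simp add: scale_mult linD(3)[OF bilD(1)[OF B]] linD(3)[OF bilD(2)[OF B]])+
    show "sw P (\<lambda>x y. B (u * x) (scale c v * y)) b = c \<odot>\<^bsub>P\<^esub> sw P (\<lambda>x y. B (u * x) (v * y)) b"
      unfolding e by (rule sw_smult[OF P b2])
    show "sw P (\<lambda>x y. B (scale c u * x) (v * y)) b = c \<odot>\<^bsub>P\<^esub> sw P (\<lambda>x y. B (u * x) (v * y)) b"
      unfolding e by (rule sw_smult[OF P b2])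
  qed (rule cl)+
qed

text \<open>Since \<open>\<Delta>\<close> is multiplicative, the sum over ab is a double sum. The
  product in A \<otimes> A is evaluated one factor at a time: first a pure tensor times a general
  element, then a general element times \<open>\<Delta> b\<close>.\<close>

lemma sw_mult:
  assumes P: "module KK P" and B: "bil P B"
  shows "sw P B (a * b) = sw P (\<lambda>u v. sw P (\<lambda>u' v'. B (u * u') (v * v')) b) a"
proof -
  interpret P: module KK P by (rule P)
  let ?AA = "tensor A A"
  interpret AA: assoc_alg ?AA by (rule tensor_assoc_alg[OF A.assoc_alg_axioms A.assoc_alg_axioms])
  note pt = bilin_pure_tensor[OF A_module A_module]
  have pc: "pure_tensor A A u v \<in> carrier ?AA" for u v using bilinD(1)[OF pt, of u v] by simp
  note T = tlift_linear[OF A_module A_module P B]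
  have b2: "bil P (\<lambda>u v. B (x * u) (y * v))" for x y
    by (intro bilI linI)
      (simp_all add: bilD(3)[OF B] distrib_left scale_mult linD(2,3)[OF bilD(1)[OF B]] linD(2,3)[OF bilD(2)[OF B]])
  have mult_lin: "linear_map KK ?AA ?AA (\<lambda>t. s \<otimes>\<^bsub>?AA\<^esub> t)" if "s \<in> carrier ?AA" for s
    using that by (intro linear_mapI) (auto simp: AA.r_distr AA.smult_mult_right)
  have mult_lin': "linear_map KK ?AA ?AA (\<lambda>s. s \<otimes>\<^bsub>?AA\<^esub> t)" if "t \<in> carrier ?AA" for t
    using that by (intro linear_mapI) (auto simp: AA.l_distr AA.smult_mult_left)
  have 1: "tlift P B (pure_tensor A A u v \<otimes>\<^bsub>?AA\<^esub> t) = tlift P (\<lambda>u' v'. B (u * u') (v * v')) t"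
    if t: "t \<in> carrier ?AA" for u v t
    by (rule tensor_linear_eq[OF A_module A_module P linear_map_comp[OF mult_lin T] tlift_linear[OF A_module A_module P b2] _ t])
      (simp_all add: pc pure_tensor_mult[OF A.assoc_alg_axioms A.assoc_alg_axioms] tlift_pure[OF A_module A_module P B]
        tlift_pure[OF A_module A_module P b2])
  note b3 = bil_sw_mult[OF P B]
  have 2: "tlift P B (s \<otimes>\<^bsub>?AA\<^esub> \<Delta> b) = tlift P (\<lambda>u v. sw P (\<lambda>u' v'. B (u * u') (v * v')) b) s"
    if s: "s \<in> carrier ?AA" for s
    by (rule tensor_linear_eq[OF A_module A_module P linear_map_comp[OF mult_lin' T] tlift_linear[OF A_module A_module P b3] _ s])
      (simp_all add: tlift_pure[OF A_module A_module P b3] 1 flip: sw_def)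
  show ?thesis
    using B.comult_mult[of a b] 2[of "\<Delta> a"] by (simp add: sw_def)
qed

definition prim :: "'a \<Rightarrow> bool" where
  "prim x \<longleftrightarrow> \<Delta> x = pure_tensor A A x 1 \<oplus>\<^bsub>tensor A A\<^esub> pure_tensor A A 1 x"

context
  fixes P :: "('k, 'p, 'z) module_scheme" and B
  assumes P: "module KK P" and B: "bil P B"
begin

interpretation P: module KK P by (rule P)

lemma sw_one: "sw P B 1 = B 1 1"
  using B.comult_one
  by (simp add: sw_def tensor_one[OF A.assoc_alg_axioms A.assoc_alg_axioms] tlift_pure[OF A_module A_module P B])

lemma sw_prim:
  assumes "prim x" shows "sw P B x = B x 1 \<oplus>\<^bsub>P\<^esub> B 1 x"
proof -
  have pc: "pure_tensor A A u v \<in> carrier (tensor A A)" for u v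
    using bilinD(1)[OF bilin_pure_tensor[OF A_module A_module], of u v] by simp
  show ?thesis
    using assms linear_mapD(2)[OF tlift_linear[OF A_module A_module P B] pc pc]
    by (simp add: prim_def sw_def tlift_pure[OF A_module A_module P B])
qed

end

lemma bil_shift:
  assumes "bil P B" shows "bil P (\<lambda>u v. B (x * u) v)" "bil P (\<lambda>u v. B u (x * v))"
    "bil P (\<lambda>u v. B (u * x) v)" "bil P (\<lambda>u v. B u (v * x))"
  by (intro bilI linI; simp add: bilD(3)[OF assms] distrib_left distrib_right scale_mult linD(2,3)[OF bilD(1)[OF assms]]
     linD(2,3)[OF bilD(2)[OF assms]])+

text \<open>For primitive x, the comultiplication of xb is (x \<otimes> 1 + 1 \<otimes> x) times
  that of b. This splitting drives every induction on products of primitive elements.\<close>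

lemma sw_prim_mult:
  assumes P: "module KK P" and B: "bil P B" and x: "prim x"
  shows "sw P B (x * b) = sw P (\<lambda>u v. B (x * u) v) b \<oplus>\<^bsub>P\<^esub> sw P (\<lambda>u v. B u (x * v)) b"
proof -
  show ?thesis
    unfolding sw_mult[OF P B] sw_prim[OF P bil_sw_mult[OF P B] x] by simp
qed

text \<open>Apply \<epsilon> \<otimes> \<epsilon> to \<open>\<Delta> x\<close>: primitivity gives
  twice \<epsilon>(x), the counit law gives it once.\<close>

lemma counit_prim:
  assumes "prim x" shows "\<epsilon> x = 0"
proof -
  have b: "bil KM (\<lambda>x y. \<epsilon> x * \<epsilon> y)"
    by (intro bilI linI) (auto simp: algebra_simps)
  have "sw KM (\<lambda>x y. \<epsilon> x * \<epsilon> y) x = \<epsilon> x + \<epsilon> x"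
    using sw_prim[OF KM_module b assms] by simp
  moreover have "sw KM (\<lambda>x y. \<epsilon> x * \<epsilon> y) x = \<epsilon> x"
    using sw_counit(1)[OF KM_module \<epsilon>_lin, of x] by simp
  ultimately have "\<epsilon> x + \<epsilon> x = \<epsilon> x + 0" by simp
  then show ?thesis by (simp only: add_left_cancel)
qed

lemma prim_subspace: "vs.subspace (Collect prim)"
proof -
  let ?AA = "tensor A A"
  interpret AA: module KK ?AA by (rule tensor_module[OF A_module A_module])
  note pt = bilin_pure_tensor[OF A_module A_module]
  have b: "bil ?AA (\<lambda>x y. pure_tensor A A x y)" using pt by simp
  have l: "lin ?AA (\<lambda>x. pure_tensor A A x 1 \<oplus>\<^bsub>?AA\<^esub> pure_tensor A A 1 x)"
    by (intro linI) (simp_all add: bilD(3)[OF b] linD(2,3)[OF bilD(1)[OF b]] linD(2,3)[OF bilD(2)[OF b]] AA.M.a_ac AA.smult_r_distr)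
  show ?thesis
    unfolding vs.subspace_def prim_def mem_Collect_eq
    using linD(2,3)[OF \<Delta>_lin] linD(2,3)[OF l] lin_zero[OF AA.module_axioms \<Delta>_lin] lin_zero[OF AA.module_axioms l]
    by simp
qed

lemma prim_bracket:
  assumes x: "prim x" and y: "prim y" shows "prim (x * y - y * x)"
proof -
  let ?AA = "tensor A A"
  interpret AA: assoc_alg ?AA by (rule tensor_assoc_alg[OF A.assoc_alg_axioms A.assoc_alg_axioms])
  note pt = bilin_pure_tensor[OF A_module A_module]
  have b: "bil ?AA (\<lambda>x y. pure_tensor A A x y)" using pt by simp
  note pc = bilD(3)[OF b]
  have m: "pure_tensor A A u v \<otimes>\<^bsub>?AA\<^esub> pure_tensor A A u' v' = pure_tensor A A (u * u') (v * v')" for u v u' v'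
    using pure_tensor_mult[OF A.assoc_alg_axioms A.assoc_alg_axioms, of u u' v v'] by simp
  have 1: "\<Delta> (x * y) = (pure_tensor A A x 1 \<oplus>\<^bsub>?AA\<^esub> pure_tensor A A 1 x) \<otimes>\<^bsub>?AA\<^esub> (pure_tensor A A y 1 \<oplus>\<^bsub>?AA\<^esub> pure_tensor A A 1 y)"
    "\<Delta> (y * x) = (pure_tensor A A y 1 \<oplus>\<^bsub>?AA\<^esub> pure_tensor A A 1 y) \<otimes>\<^bsub>?AA\<^esub> (pure_tensor A A x 1 \<oplus>\<^bsub>?AA\<^esub> pure_tensor A A 1 x)"
    using B.comult_mult[of x y] B.comult_mult[of y x] x y by (auto simp: prim_def)
  have "\<Delta> (x * y - y * x) = \<Delta> (x * y) \<ominus>\<^bsub>?AA\<^esub> \<Delta> (y * x)"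
    by (rule lin_minus[OF AA.module_axioms \<Delta>_lin])
  also have "\<dots> = (pure_tensor A A (x * y) 1 \<ominus>\<^bsub>?AA\<^esub> pure_tensor A A (y * x) 1) \<oplus>\<^bsub>?AA\<^esub>
      (pure_tensor A A 1 (x * y) \<ominus>\<^bsub>?AA\<^esub> pure_tensor A A 1 (y * x))"
    unfolding 1 using pc by (simp add: AA.l_distr AA.r_distr m AA.cross_terms_cancel)
  also have "\<dots> = pure_tensor A A (x * y - y * x) 1 \<oplus>\<^bsub>?AA\<^esub> pure_tensor A A 1 (x * y - y * x)"
    using lin_minus[OF AA.module_axioms bilD(1)[OF b]] lin_minus[OF AA.module_axioms bilD(2)[OF b]] by simp
  finally show ?thesis by (simp add: prim_def)
qed

subsection \<open>Functionals and coordinates\<close>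

text \<open>Connects the notion of linearity for which extension from a basis is available with the
  carrier-based one.\<close>

lemma linear_lin: "Vector_Spaces.linear scale (*) f \<longleftrightarrow> lin KM f"
  "Vector_Spaces.linear scale scale e \<longleftrightarrow> lin A e"
proof -
  have K: "vector_space ((*) :: 'k \<Rightarrow> 'k \<Rightarrow> 'k)" by unfold_locales (auto simp: algebra_simps)
  show "Vector_Spaces.linear scale (*) f \<longleftrightarrow> lin KM f"
    using vs.vector_space_axioms K
    by (auto simp: Vector_Spaces.linear_def module_hom_axioms_def module_hom_def linear_map_def module_iff_vector_space)
  show "Vector_Spaces.linear scale scale e \<longleftrightarrow> lin A e"
    using vs.vector_space_axioms
    by (auto simp: Vector_Spaces.linear_def module_hom_axioms_def module_hom_def linear_map_def module_iff_vector_space)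
qed

text \<open>Extend a basis of W to a basis of A. C consists of the added vectors and
  \<open>g b\<close> is the coordinate along b: these functionals kill W and determine a vector
  modulo W.\<close>

lemma coordinates:
  assumes W: "vs.subspace W"
  obtains C g where "\<forall>b\<in>C. lin KM (g b)" "\<forall>b\<in>C. \<forall>w\<in>W. g b w = 0"
    "\<forall>y. finite {b \<in> C. g b y \<noteq> 0}"
    "\<forall>y. y - (\<Sum>b | b \<in> C \<and> g b y \<noteq> 0. scale (g b y) b) \<in> W"
proof -
  obtain S where S: "S \<subseteq> W" "vs.independent S" "W \<subseteq> vs.span S"
    by (rule vs.maximal_independent_subset)
  have spanS: "vs.span S = W" using S W by (metis vs.span_eq_iff vs.span_mono subset_antisym)
  define E where "E = vs.extend_basis S"
  note E = vs.independent_extend_basis[OF S(2), folded E_def] vs.span_extend_basis[OF S(2), folded E_def]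
    vs.extend_basis_superset[OF S(2), folded E_def]
  let ?g = "\<lambda>b y. vs.representation E y b"
  show ?thesis
  proof (rule that[of "E - S" ?g]; (intro ballI allI)?)
    show "lin KM (?g b)" for b
      by (rule linI) (auto simp: vs.representation_add vs.representation_scale E)
    show "?g b w = 0" if "b \<in> E - S" "w \<in> W" for b w
    proof -
      have "vs.representation E w = vs.representation S w"
        using that spanS by (intro vs.representation_extend E) auto
      then show ?thesis using vs.representation_ne_zero[of S w b] that by auto
    qed
    show "finite {b \<in> E - S. ?g b y \<noteq> 0}" for y
      using vs.finite_representation[of E y] by (rule rev_finite_subset) auto
    fix y
    let ?F = "{b. ?g b y \<noteq> 0}"
    have "y = (\<Sum>b\<in>?F. scale (?g b y) b)"
      using vs.sum_nonzero_representation_eq[of E y] E by simp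
    also have "\<dots> = (\<Sum>b\<in>?F - S. scale (?g b y) b) + (\<Sum>b\<in>?F \<inter> S. scale (?g b y) b)"
      using vs.finite_representation[of E y] by (subst sum.Int_Diff[of _ _ S]) (auto simp: add.commute)
    also have "?F - S = {b. b \<in> E - S \<and> ?g b y \<noteq> 0}"
      using vs.representation_ne_zero[of E y] by auto
    finally have "y - (\<Sum>b | b \<in> E - S \<and> ?g b y \<noteq> 0. scale (?g b y) b) = (\<Sum>b\<in>?F \<inter> S. scale (?g b y) b)"
      by (simp add: algebra_simps)
    also have "\<dots> \<in> vs.span S" by (intro vs.span_sum vs.span_scale vs.span_base) auto
    finally show "y - (\<Sum>b | b \<in> E - S \<and> ?g b y \<noteq> 0. scale (?g b y) b) \<in> W" using spanS by simp
  qed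
qed

text \<open>The coordinates along a complement of W are functionals that kill W, so all of them
  vanish at a. Membership in a step of the filtration is usually established in this dual
  way.\<close>

lemma functional_separates:
  assumes W: "vs.subspace W" and a: "\<And>f. lin KM f \<Longrightarrow> (\<And>w. w \<in> W \<Longrightarrow> f w = 0) \<Longrightarrow> f a = 0"
  shows "a \<in> W"
proof -
  obtain C g where C: "\<forall>b\<in>C. lin KM (g b)" "\<forall>b\<in>C. \<forall>w\<in>W. g b w = 0"
    "\<forall>y. finite {b \<in> C. g b y \<noteq> 0}"
    "\<forall>y. y - (\<Sum>b | b \<in> C \<and> g b y \<noteq> 0. scale (g b y) b) \<in> W"
    by (rule coordinates[OF W])
  have "g b a = 0" if "b \<in> C" for b using a[of "g b"] C(1,2) that by simp
  then have "{b. b \<in> C \<and> g b a \<noteq> 0} = {}" by auto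
  then show ?thesis using C(4)[rule_format, of a] by (simp only: sum.empty diff_zero)
qed

lemma functional_eqI:
  assumes "\<And>f. lin KM f \<Longrightarrow> f a = f b" shows "a = b"
proof -
  have "a - b \<in> {0}"
  proof (rule functional_separates[OF vs.subspace_single_0])
    fix f assume f: "lin KM f"
    show "f (a - b) = 0" using lin_minus[OF KM_module f, of a b] assms[OF f] by simp
  qed
  then show ?thesis by simp
qed

lemma projection:
  assumes W: "vs.subspace W"
  obtains e where "lin A e" "\<forall>w\<in>W. e w = w" "\<forall>a. e a \<in> W"
proof -
  obtain S where S: "S \<subseteq> W" "vs.independent S" "W \<subseteq> vs.span S"
    by (rule vs.maximal_independent_subset)
  have spanS: "vs.span S = W" using S W by (metis vs.span_eq_iff vs.span_mono subset_antisym)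
  interpret vp: vector_space_pair scale scale by unfold_locales
  obtain e where e: "Vector_Spaces.linear scale scale e" "\<forall>x\<in>S. e x = x" "range e = vs.span S"
    using vp.linear_independent_extend_subspace[OF S(2), of "\<lambda>x. x"] by auto
  interpret id: Vector_Spaces.linear scale scale "\<lambda>x. x"
    by (simp add: linear_lin) (intro linI, auto)
  show ?thesis
  proof (rule that[of e]; (intro ballI allI)?)
    show "lin A e" using e(1) linear_lin by blast
    show "e a \<in> W" for a using e(3) spanS by auto
    show "e w = w" if "w \<in> W" for w
      using vp.linear_eq_on[OF e(1) id.linear_axioms, of w S] that S e(2) by auto
  qed
qed

end

section \<open>The filtration dual to the powers of the augmentation ideal\<close>

context cbialg
begin

lemma A_finsum: "finsum A f I = sum f I"
  by (induction I rule: infinite_finite_induct) (simp_all add: B.add.finprod_infinite)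

lemma linK:
  assumes "lin KM f"
  shows "f (x + y) = f x + f y" "f (scale c x) = c * f x" "f 0 = 0" "f (x - y) = f x - f y"
  using linD[OF assms] lin_zero[OF KM_module assms] lin_minus[OF KM_module assms] by auto

lemma linA:
  assumes "lin A f"
  shows "f (x + y) = f x + f y" "f (scale c x) = scale c (f x)" "f 0 = 0" "f (x - y) = f x - f y"
  using linD[OF assms] lin_zero[OF A_module assms] lin_minus[OF A_module assms] by auto

text \<open>The dual algebra acting on A: \<open>act f\<close> is the transpose of multiplication by
  f, as \<open>act_apply_K\<close> makes explicit.\<close>

definition act :: "('a \<Rightarrow> 'k) \<Rightarrow> 'a \<Rightarrow> 'a" where
  "act f a = sw A (\<lambda>x y. scale (f x) y) a"

lemma bil_scalar:
  assumes P: "module KK P" and f: "lin KM f" and h: "lin P h"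
  shows "bil P (\<lambda>x y. f x \<odot>\<^bsub>P\<^esub> h y)" "bil P (\<lambda>x y. f y \<odot>\<^bsub>P\<^esub> h x)"
proof -
  interpret P: module KK P by (rule P)
  have *: "(a + b) \<odot>\<^bsub>P\<^esub> h y = a \<odot>\<^bsub>P\<^esub> h y \<oplus>\<^bsub>P\<^esub> b \<odot>\<^bsub>P\<^esub> h y" "(a * b) \<odot>\<^bsub>P\<^esub> h y = a \<odot>\<^bsub>P\<^esub> (b \<odot>\<^bsub>P\<^esub> h y)"
    "a \<odot>\<^bsub>P\<^esub> (b \<odot>\<^bsub>P\<^esub> h y) = b \<odot>\<^bsub>P\<^esub> (a \<odot>\<^bsub>P\<^esub> h y)" for a b y
    using P.smult_l_distr[of a b "h y"] P.smult_assoc1[of a b "h y"] P.smult_assoc1[of b a "h y"] linD(1)[OF h]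
    by (simp_all add: mult.commute)
  show "bil P (\<lambda>x y. f x \<odot>\<^bsub>P\<^esub> h y)" "bil P (\<lambda>x y. f y \<odot>\<^bsub>P\<^esub> h x)"
    by (intro bilI linI; simp add: linD[OF h] linK[OF f] P.smult_r_distr *(1,2); rule *(3))+
qed

lemma bil_act: "lin KM f \<Longrightarrow> lin A h \<Longrightarrow> bil A (\<lambda>x y. scale (f x) (h y))"
  by (intro bilI linI) (auto simp: linK linA vs.scale_left_distrib vs.scale_right_distrib mult.commute)

lemma lin_id: "lin A (\<lambda>x. x)" by (rule linI) auto

lemma act_lin: "lin KM f \<Longrightarrow> lin A (act f)"
  unfolding act_def[abs_def] by (intro sw_lin A_module bil_act lin_id)

lemmas act_simps = linA[OF act_lin]

lemma act_apply:
  assumes "module KK P" "lin KM f" "lin P h"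
  shows "h (act f a) = sw P (\<lambda>x y. f x \<odot>\<^bsub>P\<^esub> h y) a"
  unfolding act_def
  by (subst sw_comp[OF A_module assms(1) bil_act[OF assms(2) lin_id] assms(3)]) (simp add: linD[OF assms(3)])

lemma act_apply_A: "lin KM f \<Longrightarrow> lin A h \<Longrightarrow> h (act f a) = sw A (\<lambda>x y. scale (f x) (h y)) a"
  using act_apply[OF A_module] by simp

lemma act_apply_K: "lin KM f \<Longrightarrow> lin KM h \<Longrightarrow> h (act f a) = sw KM (\<lambda>x y. f x * h y) a"
  using act_apply[OF KM_module] by simp

lemma bil_K: "lin KM f \<Longrightarrow> lin KM h \<Longrightarrow> bil KM (\<lambda>x y. f x * h y)"
  by (intro bilI linI) (auto simp: linK algebra_simps)

lemma act_swap:
  assumes "lin KM f" "lin KM h" shows "h (act f a) = f (act h a)"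
  using sw_cocomm[OF KM_module bil_K[OF assms], of a] by (simp add: act_apply_K assms mult.commute)

text \<open>Paired with a functional h, both sides evaluate the product of f, g and h in the dual
  algebra at a. That product is associative by coassociativity and commutative by
  cocommutativity.\<close>

lemma act_comm:
  assumes f: "lin KM f" and g: "lin KM g" shows "act f (act g a) = act g (act f a)"
proof (rule functional_eqI)
  fix h assume h: "lin KM h"
  have t: "tril KM (\<lambda>x y z. f x * g y * h z)"
    unfolding tril_def using linK[OF f] linK[OF g] linK[OF h]
    by (auto intro!: linI simp: algebra_simps)
  have *: "h (act p (act q a)) = sw KM (\<lambda>z w. sw KM (\<lambda>x y. q x * p y * h w) z) a"
    if p: "lin KM p" and q: "lin KM q" for p q
  proof -
    have t: "tril KM (\<lambda>x y z. q x * p y * h z)"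
      unfolding tril_def using linK[OF p] linK[OF q] linK[OF h]
      by (auto intro!: linI simp: algebra_simps)
    have "lin KM (\<lambda>y. h (act p y))" using linear_map_comp[OF act_lin[OF p] h] .
    then have "h (act p (act q a)) = sw KM (\<lambda>x y. q x * h (act p y)) a"
      using act_apply_K[OF q] by blast
    also have "\<dots> = sw KM (\<lambda>x y. sw KM (\<lambda>u v. q x * p u * h v) y) a"
      using sw_smult[OF KM_module bil_K[OF p h]] by (simp add: act_apply_K p h mult.assoc)
    also have "\<dots> = sw KM (\<lambda>z w. sw KM (\<lambda>x y. q x * p y * h w) z) a"
      by (rule sw_coassoc[OF KM_module t, symmetric])
    finally show ?thesis .
  qed
  have b: "bil KM (\<lambda>x y. g x * f y * h w)" for w
    by (intro bilI linI) (use linK[OF f] linK[OF g] in \<open>auto simp: algebra_simps\<close>)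
  have "sw KM (\<lambda>x y. g x * f y * h w) z = sw KM (\<lambda>x y. f x * g y * h w) z" for z w
    using sw_cocomm[OF KM_module b[of w], of z] by (simp add: mult.commute)
  then show "h (act f (act g a)) = h (act g (act f a))"
    by (simp add: *[OF f g] *[OF g f])
qed

lemma act_one [simp]: "lin KM f \<Longrightarrow> act f 1 = scale (f 1) 1"
  unfolding act_def using sw_one[OF A_module bil_act[OF _ lin_id]] by simp

lemma act_prim: "lin KM f \<Longrightarrow> prim x \<Longrightarrow> act f x = scale (f x) 1 + scale (f 1) x"
  unfolding act_def using sw_prim[OF A_module bil_act[OF _ lin_id]] by simp

lemma act_\<epsilon> [simp]: "act \<epsilon> a = a"
  unfolding act_def using sw_counit(1)[OF A_module lin_id] by simp

lemma act_add:
  assumes "lin KM f" "lin KM g"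
  shows "act (\<lambda>x. f x + g x) a = act f a + act g a"
  unfolding act_def vs.scale_left_distrib
  using sw_add[OF A_module bil_act[OF assms(1) lin_id] bil_act[OF assms(2) lin_id]] by simp

lemma act_smult: "lin KM f \<Longrightarrow> act (\<lambda>x. c * f x) a = scale c (act f a)"
  unfolding act_def using sw_smult[OF A_module bil_act[OF _ lin_id]] by simp

lemma lin_diff: "lin KM f \<Longrightarrow> lin KM g \<Longrightarrow> lin KM (\<lambda>x. f x - g x)"
  and lin_smult: "lin KM f \<Longrightarrow> lin KM (\<lambda>x. c * f x)"
  by (auto intro!: linI simp: linK algebra_simps)

text \<open>
  \<open>act f a\<close> is \<open>\<Sum> f(a\<^sub>1) a\<^sub>2\<close>, so \<open>G n\<close> consists of the elements killed by all products of \<open>n\<close>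
  functionals that vanish at \<open>1\<close>; it is \<open>A\<^sub>n\<^sub>-\<^sub>1\<close> in the notation of the theorem.
\<close>

primrec G :: "nat \<Rightarrow> 'a set" where
  "G 0 = {0}"
| "G (Suc n) = {a. \<forall>f. lin KM f \<longrightarrow> f 1 = 0 \<longrightarrow> act f a \<in> G n}"

lemma G_act: "a \<in> G (Suc n) \<Longrightarrow> lin KM f \<Longrightarrow> f 1 = 0 \<Longrightarrow> act f a \<in> G n"
  by simp

lemma G_subspace: "vs.subspace (G n)"
proof (induction n)
  case 0 then show ?case by (simp add: vs.subspace_single_0)
next
  case (Suc n)
  then show ?case unfolding vs.subspace_def by (auto simp: act_simps)
qed

lemmas G_closed = vs.subspace_0[OF G_subspace] vs.subspace_add[OF G_subspace] vs.subspace_scale[OF G_subspace]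
  vs.subspace_diff[OF G_subspace]

lemma G_Suc_mono: "G n \<subseteq> G (Suc n)"
proof (induction n)
  case 0 then show ?case by (auto simp: act_simps)
next
  case (Suc n) then show ?case by auto
qed

lemma G_mono: "m \<le> n \<Longrightarrow> G m \<subseteq> G n"
  by (rule lift_Suc_mono_le[of G]) (rule G_Suc_mono)

text \<open>Write f = (f - f(1) \<epsilon>) + f(1) \<epsilon>. The first part vanishes at 1 and
  lowers the filtration, the second acts as a scalar.\<close>

lemma act_G:
  assumes "lin KM f" "a \<in> G n" shows "act f a \<in> G n"
proof (cases n)
  case 0 then show ?thesis using assms by (simp add: act_simps)
next
  case (Suc m)
  let ?g = "\<lambda>x. f x - f 1 * \<epsilon> x"
  have g: "lin KM ?g" using assms \<epsilon>_lin by (intro lin_diff lin_smult)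
  have "act f a = act (\<lambda>x. ?g x + f 1 * \<epsilon> x) a" by simp
  also have "\<dots> = act ?g a + scale (f 1) a"
    by (simp only: act_add[OF g lin_smult[OF \<epsilon>_lin]] act_smult[OF \<epsilon>_lin] act_\<epsilon>)
  finally have "act f a = act ?g a + scale (f 1) a" .
  moreover have "act ?g a \<in> G m"
    using assms Suc by (intro G_act g) auto
  then have "act ?g a \<in> G n" using G_Suc_mono[of m] Suc by blast
  ultimately show ?thesis using assms by (simp add: G_closed)
qed

text \<open>For any f the functional f - f(1) \<epsilon> vanishes at 1, so it acts on a by zero.
  Applying \<epsilon> gives f(a) = f(1) \<epsilon>(a) for every f, and functionals separate
  points.\<close>

lemma G_1: "G (Suc 0) = range (\<lambda>c. scale c 1)"
proof
  show "range (\<lambda>c. scale c 1) \<subseteq> G (Suc 0)" by (auto simp: act_simps)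
  show "G (Suc 0) \<subseteq> range (\<lambda>c. scale c 1)"
  proof
    fix a assume a: "a \<in> G (Suc 0)"
    have "a = scale (\<epsilon> a) 1"
    proof (rule functional_eqI)
      fix f assume f: "lin KM f"
      let ?g = "\<lambda>x. f x - f 1 * \<epsilon> x"
      have g: "lin KM ?g" using f \<epsilon>_lin by (intro lin_diff lin_smult)
      have "act ?g a = 0" using a g by simp
      then have "?g a = 0" using act_swap[OF g \<epsilon>_lin, of a] by simp
      then show "f a = f (scale (\<epsilon> a) 1)" using linK[OF f] by (simp add: mult.commute)
    qed
    then show "a \<in> range (\<lambda>c. scale c 1)" by blast
  qed
qed

text \<open>
  The comultiplication maps \<open>G (Suc n)\<close> to \<open>1 \<otimes> A + A \<otimes> G n\<close>: in coordinates \<open>g\<^sub>b\<close> on a complement of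
  \<open>G n\<close>, it is \<open>\<Sum> act g\<^sub>b a \<otimes> b\<close> modulo \<open>A \<otimes> G n\<close>, and each \<open>act g\<^sub>b a\<close> is a scalar.
\<close>

lemma sw_G_zero:
  assumes P: "module KK P" and B: "bil P B" and B1: "\<And>y. B 1 y = \<zero>\<^bsub>P\<^esub>"
    and BG: "\<And>x y. y \<in> G n \<Longrightarrow> B x y = \<zero>\<^bsub>P\<^esub>" and a: "a \<in> G (Suc n)"
  shows "sw P B a = \<zero>\<^bsub>P\<^esub>"
proof -
  interpret P: module KK P by (rule P)
  obtain C g where C: "\<forall>b\<in>C. lin KM (g b)" "\<forall>b\<in>C. \<forall>w\<in>G n. g b w = 0"
    "\<forall>y. finite {b \<in> C. g b y \<noteq> 0}"
    "\<forall>y. y - (\<Sum>b | b \<in> C \<and> g b y \<noteq> 0. scale (g b y) b) \<in> G n"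
    by (rule coordinates[OF G_subspace])
  obtain p where p: "\<Delta> a = bilin_rel A A +>\<^bsub>tens_free A A\<^esub> p"
    using tensor_cases[OF A_module A_module \<Delta>_closed] by metis
  \<comment> \<open>Fix one representative p of \<open>\<Delta> a\<close>. Only finitely many
    coordinates are nonzero on the second factors occurring in p; B' replaces each such factor by
    its part in the complement of G n.\<close>
  define F where "F = (\<Union>z\<in>Poly_Mapping.keys p. {b \<in> C. g b (snd z) \<noteq> 0})"
  have F: "finite F" "F \<subseteq> C" using C(3) by (auto simp: F_def)
  define B' where "B' = (\<lambda>x y. \<Oplus>\<^bsub>P\<^esub>b\<in>F. g b y \<odot>\<^bsub>P\<^esub> B x b)"
  have bil_b: "bil P (\<lambda>x y. g b y \<odot>\<^bsub>P\<^esub> B x b)" if "b \<in> C" for b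
    using C(1) that by (intro bil_scalar(2)[OF P _ bilD(2)[OF B]]) auto
  have eq: "B x y = B' x y" if xy: "(x, y) \<in> Poly_Mapping.keys p" for x y
  proof -
    have sum: "(\<Sum>b | b \<in> C \<and> g b y \<noteq> 0. scale (g b y) b) = (\<Sum>b\<in>F. scale (g b y) b)"
      using xy F by (intro sum.mono_neutral_left) (auto simp: F_def)
    have w: "y - (\<Sum>b\<in>F. scale (g b y) b) \<in> G n"
      using C(4)[rule_format, of y] by (simp only: sum)
    have "B x y = B x (y - (\<Sum>b\<in>F. scale (g b y) b)) \<oplus>\<^bsub>P\<^esub> B x (\<Sum>b\<in>F. scale (g b y) b)"
      using linD(2)[OF bilD(1)[OF B], of x "y - (\<Sum>b\<in>F. scale (g b y) b)" "\<Sum>b\<in>F. scale (g b y) b"] by simp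
    also have "\<dots> = B x (\<Oplus>\<^bsub>A\<^esub>b\<in>F. scale (g b y) b)"
      using BG[OF w] bilD(3)[OF B] by (simp add: A_finsum)
    also have "\<dots> = B' x y"
      unfolding B'_def
      by (subst linear_map_finsum[OF A_module P bilD(1)[OF B] F(1)])
        (simp_all add: linD(3)[OF bilD(1)[OF B]])
    finally show ?thesis .
  qed
  have sB': "sw P B' a = (\<Oplus>\<^bsub>P\<^esub>b\<in>F. sw P (\<lambda>x y. g b y \<odot>\<^bsub>P\<^esub> B x b) a)" and B': "bil P B'"
    unfolding B'_def using sw_finsum[OF P F(1), of "\<lambda>b x y. g b y \<odot>\<^bsub>P\<^esub> B x b" a] bil_b F(2) by auto
  note sB'
  also have "(\<Oplus>\<^bsub>P\<^esub>b\<in>F. sw P (\<lambda>x y. g b y \<odot>\<^bsub>P\<^esub> B x b) a) = (\<Oplus>\<^bsub>P\<^esub>b\<in>F. \<zero>\<^bsub>P\<^esub>)"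
  proof (rule P.finsum_cong')
    fix b assume "b \<in> F"
    then have b: "b \<in> C" using F by auto
    then have gb: "lin KM (g b)" using C by blast
    \<comment> \<open>A functional f that kills G 1 vanishes at 1, so \<open>act f a\<close> lies in
      G n and is killed by g b. By \<open>act_swap\<close>, f then kills \<open>act (g b) a\<close>,
      which must be a scalar.\<close>
    have "act (g b) a \<in> range (\<lambda>c. scale c 1)"
      unfolding G_1[symmetric]
    proof (rule functional_separates[OF G_subspace])
      fix f assume f: "lin KM f" "\<And>w. w \<in> G (Suc 0) \<Longrightarrow> f w = 0"
      have "1 \<in> G (Suc 0)" unfolding G_1 by (rule range_eqI[of _ _ 1]) simp
      then have "act f a \<in> G n" using a f by simp
      then show "f (act (g b) a) = 0" using act_swap[OF gb f(1)] C(2) b by simp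
    qed
    then obtain c where c: "act (g b) a = scale c 1" by auto
    have "sw P (\<lambda>x y. g b y \<odot>\<^bsub>P\<^esub> B x b) a = sw P (\<lambda>x y. g b x \<odot>\<^bsub>P\<^esub> B y b) a"
      by (rule sw_cocomm[OF P bil_b[OF b]])
    also have "\<dots> = B (act (g b) a) b"
      by (rule act_apply[OF P gb bilD(2)[OF B], symmetric])
    also have "\<dots> = \<zero>\<^bsub>P\<^esub>" unfolding c using linD(3)[OF bilD(2)[OF B]] by (simp add: B1)
    finally show "sw P (\<lambda>x y. g b y \<odot>\<^bsub>P\<^esub> B x b) a = \<zero>\<^bsub>P\<^esub>" .
  qed auto
  also have "\<dots> = \<zero>\<^bsub>P\<^esub>" by simp
  finally have "sw P B' a = \<zero>\<^bsub>P\<^esub>" .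
  \<comment> \<open>B and B' need to agree only on the pairs in the support of p, because both
    induced maps are evaluated at that representative.\<close>
  moreover have "sw P B a = sw P B' a"
    unfolding sw_def p using bilD(3)[OF B'] eq
    by (subst (1 2) tlift_coset[OF A_module A_module P]) (auto intro!: lext_cong[OF P] B B')
  ultimately show ?thesis by simp
qed

text \<open>Split both tensor factors of \<open>\<Delta> a\<close> by x = pi(x) + \<epsilon>(x) 1.
  This gives (pi \<otimes> pi)(\<open>\<Delta> a\<close>) + 1 \<otimes> pi(a) + a \<otimes> 1, and
  the first term vanishes by \<open>sw_G_zero\<close> because pi kills 1, hence all of G 1.\<close>

lemma G_2:
  assumes a: "a \<in> G (Suc (Suc 0))" shows "prim (a - scale (\<epsilon> a) 1)"
proof -
  let ?AA = "tensor A A"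
  let ?pi = "\<lambda>x. x - scale (\<epsilon> x) 1"
  interpret AA: module KK ?AA by (rule tensor_module[OF A_module A_module])
  have pt: "bil ?AA (\<lambda>x y. pure_tensor A A x y)" using bilin_pure_tensor[OF A_module A_module] by simp
  note pc = bilD(3)[OF pt] and pl = bilD(1,2)[OF pt] and pl' = linD(2,3)[OF bilD(1)[OF pt]] linD(2,3)[OF bilD(2)[OF pt]]
  have pi: "lin A ?pi"
    by (intro linI) (auto simp: vs.scale_left_distrib vs.scale_right_diff_distrib algebra_simps)
  note id = lin_id
  define b1 where "b1 = (\<lambda>x y. pure_tensor A A (?pi x) (?pi y))"
  define b2 where "b2 = (\<lambda>x y. \<epsilon> x \<odot>\<^bsub>?AA\<^esub> pure_tensor A A 1 (?pi y))"
  define b3 where "b3 = (\<lambda>x y. \<epsilon> y \<odot>\<^bsub>?AA\<^esub> pure_tensor A A x 1)"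
  have b1: "bil ?AA b1"
    unfolding b1_def by (intro bilI linear_map_comp[OF pi] pl)
  have l2: "lin ?AA (\<lambda>y. pure_tensor A A 1 (?pi y))" by (rule linear_map_comp[OF pi pl(1)])
  have b2: "bil ?AA b2"
    unfolding b2_def by (rule bil_scalar(1)[OF AA.module_axioms \<epsilon>_lin l2])
  have b3: "bil ?AA b3"
    unfolding b3_def by (rule bil_scalar(2)[OF AA.module_axioms \<epsilon>_lin pl(2)])
  have e: "pure_tensor A A x y = (b1 x y \<oplus>\<^bsub>?AA\<^esub> b2 x y) \<oplus>\<^bsub>?AA\<^esub> b3 x y" for x y
  proof -
    have "b1 x y \<oplus>\<^bsub>?AA\<^esub> b2 x y = pure_tensor A A x (?pi y)"
      unfolding b1_def b2_def using pl'(3)[of "?pi x" "scale (\<epsilon> x) 1" "?pi y"] pl'(4)[of "\<epsilon> x" 1 "?pi y"] by simp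
    moreover have "\<dots> \<oplus>\<^bsub>?AA\<^esub> b3 x y = pure_tensor A A x y"
      unfolding b3_def using pl'(1)[of x "?pi y" "scale (\<epsilon> y) 1"] pl'(2)[of x "\<epsilon> y" 1] by simp
    ultimately show ?thesis by simp
  qed
  have "\<Delta> a = sw ?AA (\<lambda>x y. pure_tensor A A x y) a"
    by (rule sw_eqI[OF AA.module_axioms _ pt, of "\<lambda>t. t"]) (simp_all add: linear_map_def)
  also have "\<dots> = (sw ?AA b1 a \<oplus>\<^bsub>?AA\<^esub> sw ?AA b2 a) \<oplus>\<^bsub>?AA\<^esub> sw ?AA b3 a"
    unfolding e sw_add[OF AA.module_axioms bil_add[OF AA.module_axioms b1 b2] b3] sw_add[OF AA.module_axioms b1 b2] ..
  also have "sw ?AA b1 a = \<zero>\<^bsub>?AA\<^esub>"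
  proof (rule sw_G_zero[OF AA.module_axioms b1 _ _ a])
    show "b1 1 y = \<zero>\<^bsub>?AA\<^esub>" for y
      unfolding b1_def using lin_zero[OF AA.module_axioms pl(2)] by simp
    show "b1 x y = \<zero>\<^bsub>?AA\<^esub>" if "y \<in> G (Suc 0)" for x y
      using that unfolding b1_def G_1 using lin_zero[OF AA.module_axioms pl(1)] by auto
  qed
  also have "sw ?AA b2 a = pure_tensor A A 1 (?pi a)"
    unfolding b2_def by (rule sw_counit(1)[OF AA.module_axioms l2])
  also have "sw ?AA b3 a = pure_tensor A A a 1"
    unfolding b3_def by (rule sw_counit(2)[OF AA.module_axioms pl(2)])
  finally have "\<Delta> a = pure_tensor A A 1 (?pi a) \<oplus>\<^bsub>?AA\<^esub> pure_tensor A A a 1" using pc by simp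
  moreover have "\<Delta> (scale (\<epsilon> a) 1) = pure_tensor A A (scale (\<epsilon> a) 1) 1"
    using linD(3)[OF \<Delta>_lin] B.comult_one pl' by (simp add: tensor_one[OF A.assoc_alg_axioms A.assoc_alg_axioms])
  ultimately have "\<Delta> (?pi a) = (pure_tensor A A 1 (?pi a) \<oplus>\<^bsub>?AA\<^esub> pure_tensor A A a 1) \<ominus>\<^bsub>?AA\<^esub> pure_tensor A A (scale (\<epsilon> a) 1) 1"
    using lin_minus[OF AA.module_axioms \<Delta>_lin] by simp
  also have "\<dots> = (pure_tensor A A a 1 \<ominus>\<^bsub>?AA\<^esub> pure_tensor A A (scale (\<epsilon> a) 1) 1) \<oplus>\<^bsub>?AA\<^esub> pure_tensor A A 1 (?pi a)"
    using pc by (simp add: a_minus_def AA.M.a_ac)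
  also have "\<dots> = pure_tensor A A (?pi a) 1 \<oplus>\<^bsub>?AA\<^esub> pure_tensor A A 1 (?pi a)"
    using lin_minus[OF AA.module_axioms pl(2)] by simp
  finally show ?thesis by (simp add: prim_def)
qed

lemma prim_G_2: "prim x \<Longrightarrow> x \<in> G (Suc (Suc 0))"
  by (auto simp: act_prim act_simps)

lemma G_2_cases:
  assumes "a \<in> G (Suc (Suc 0))" obtains x c where "prim x" "a = x + scale c 1"
  using G_2[OF assms] by (metis diff_add_cancel)

lemma one_G: "1 \<in> G (Suc 0)"
  unfolding G_1 by (rule range_eqI[of _ _ 1]) simp

text \<open>A functional that kills G 2 = K + L behaves like an element of the square of the
  augmentation ideal and lowers the filtration by two. The base case is the description of G 2; the
  induction moves \<open>act f\<close> past \<open>act g\<close>.\<close>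

lemma act_G_2:
  assumes g: "lin KM g" and g2: "\<And>y. y \<in> G (Suc (Suc 0)) \<Longrightarrow> g y = 0" and a: "a \<in> G (Suc (Suc n))"
  shows "act g a \<in> G n"
  using a
proof (induction n arbitrary: a)
  case 0
  then obtain x c where x: "prim x" "a = x + scale c 1" by (rule G_2_cases)
  have "g 1 = 0" "g x = 0" using g2 one_G G_Suc_mono prim_G_2[OF x(1)] by blast+
  then show ?case using x g by (simp add: act_simps act_prim)
next
  case (Suc n)
  have "act f (act g a) \<in> G n" if f: "lin KM f" "f 1 = 0" for f
    unfolding act_comm[OF f(1) g] using Suc.prems f by (intro Suc.IH) (rule G_act)
  then show ?case by simp
qed

text \<open>Acting by f on xb yields two terms. The functional f(x -) in the first need not vanish
  at 1, but b is only required to stay in its own step there; the second term is covered by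
  induction.\<close>

lemma prim_mult_G:
  assumes x: "prim x" and b: "b \<in> G n" shows "x * b \<in> G (Suc n)"
  using b
proof (induction n arbitrary: b)
  case 0 then show ?case by (simp add: act_simps)
next
  case (Suc n)
  have "act f (x * b) \<in> G (Suc n)" if f: "lin KM f" "f 1 = 0" for f
  proof -
    have fx: "lin KM (\<lambda>u. f (x * u))" using linK[OF f(1)] by (intro linI) (auto simp: distrib_left scale_mult)
    have xl: "lin A (\<lambda>v. x * v)" by (intro linI) (auto simp: distrib_left scale_mult)
    have "act f (x * b) = act (\<lambda>u. f (x * u)) b + x * act f b"
      unfolding act_apply_A[OF f(1) xl] unfolding act_def
      using sw_prim_mult[OF A_module bil_act[OF f(1) lin_id] x] by simp
    moreover have "x * act f b \<in> G (Suc n)" using Suc f by simp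
    ultimately show ?thesis using act_G[OF fx Suc.prems] by (simp only: G_closed)
  qed
  then show ?case by simp
qed

text \<open>This is the image of \<open>U(L)\<^sub>n\<close> in A, expressed without the enveloping
  algebra.\<close>

definition PW :: "nat \<Rightarrow> 'a set" where
  "PW n = vs.span {prod_list w | w. set w \<subseteq> Collect prim \<and> length w \<le> n}"

lemma prod_list_G: "set w \<subseteq> Collect prim \<Longrightarrow> prod_list w \<in> G (Suc (length w))"
  by (induction w) (use one_G prim_mult_G in \<open>auto simp del: G.simps\<close>)

lemma PW_subset_G: "PW n \<subseteq> G (Suc n)"
  unfolding PW_def
proof (rule vs.span_minimal[OF _ G_subspace], safe)
  fix w :: "'a list" assume "set w \<subseteq> Collect prim" "length w \<le> n"
  then show "prod_list w \<in> G (Suc n)" using prod_list_G[of w] G_mono[of "Suc (length w)" "Suc n"] by auto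
qed

lemma PW_mono: "m \<le> n \<Longrightarrow> PW m \<subseteq> PW n"
  unfolding PW_def by (rule vs.span_mono) auto

lemma prim_mult_PW:
  assumes x: "prim x" and b: "b \<in> PW n" shows "x * b \<in> PW (Suc n)"
  using b unfolding PW_def
proof (induction rule: vs.span_induct_alt)
  case base then show ?case by (simp add: vs.span_zero)
next
  case (step c y z)
  then obtain w where w: "y = prod_list w" "set w \<subseteq> Collect prim" "length w \<le> n" by auto
  have "x * y \<in> vs.span {prod_list w |w. set w \<subseteq> Collect prim \<and> length w \<le> Suc n}"
    by (rule vs.span_base) (use w x in \<open>auto intro!: exI[of _ "x # w"]\<close>)
  then show ?case using step by (simp add: distrib_left scale_mult vs.span_add vs.span_scale)
qed

end

section \<open>Characteristic zero: the Euler operator and generation by primitive elements\<close>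

locale cbialg0 = cbialg scale \<Delta> \<epsilon> A
  for scale :: "'k::field_char_0 \<Rightarrow> 'a::ring_1 \<Rightarrow> 'a" and \<Delta> \<epsilon> A
begin

text \<open>Subtracting \<epsilon>(a) e0(1) from a projection e0 forces the value 0 at 1 and changes
  nothing on primitive elements, where \<epsilon> vanishes.\<close>

lemma prim_projection:
  obtains e where "lin A e" "\<forall>x. prim x \<longrightarrow> e x = x" "\<forall>a. prim (e a)" "e 1 = 0"
proof -
  obtain e0 where e0: "lin A e0" "\<forall>w\<in>Collect prim. e0 w = w" "\<forall>a. e0 a \<in> Collect prim"
    by (rule projection[OF prim_subspace])
  show ?thesis
  proof (rule that[of "\<lambda>a. e0 a - scale (\<epsilon> a) (e0 1)"])
    show "lin A (\<lambda>a. e0 a - scale (\<epsilon> a) (e0 1))"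
      by (intro linI) (auto simp: linA[OF e0(1)] vs.scale_left_distrib vs.scale_right_diff_distrib)
    show "\<forall>x. prim x \<longrightarrow> e0 x - scale (\<epsilon> x) (e0 1) = x" using e0(2) by (simp add: counit_prim)
    show "\<forall>a. prim (e0 a - scale (\<epsilon> a) (e0 1))"
      using e0(3) vs.subspace_diff[OF prim_subspace] vs.subspace_scale[OF prim_subspace] by simp
  qed simp
qed

lemma G_Suc_eq_PW: "G (Suc n) = PW n"
proof
  show "PW n \<subseteq> G (Suc n)" by (rule PW_subset_G)
  obtain e where e: "lin A e" "\<forall>x. prim x \<longrightarrow> e x = x" "\<forall>a. prim (e a)" "e 1 = 0"
    by (rule prim_projection)
  have be: "bil A (\<lambda>x y. e x * y)"
    by (intro bilI linI) (auto simp: linA[OF e(1)] algebra_simps scale_mult)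
  define E where "E = sw A (\<lambda>x y. e x * y)"
  have E: "lin A E" unfolding E_def by (rule sw_lin[OF A_module be])
  have E1: "E 1 = 0" and Ex: "prim x \<Longrightarrow> E x = x" for x
    unfolding E_def using sw_one[OF A_module be] sw_prim[OF A_module be] e by auto
  txt \<open>The operator \<open>E a = \<Sum> e(a\<^sub>1) a\<^sub>2\<close> is multiplication by \<open>n\<close> on \<open>G (Suc n) / G n\<close>.\<close>
  have euler: "a \<in> G (Suc n) \<Longrightarrow> E a - scale (of_nat n) a \<in> G n" for n a
  proof (induction n arbitrary: a)
    case 0
    then show ?case unfolding G_1 by (auto simp: linA[OF E] E1)
  next
    case (Suc n)
    have "act f (E a - scale (of_nat (Suc n)) a) \<in> G n" if f: "lin KM f" "f 1 = 0" for f
    proof -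
      have fE: "lin KM (\<lambda>x. f (E x))" by (rule linear_map_comp[OF E f(1)])
      have t1: "tril A (\<lambda>x u v. scale (f (e x * u)) v)"
        unfolding tril_def using linK[OF f(1)] linA[OF e(1)]
        by (auto intro!: linI simp: scale_mult algebra_simps vs.scale_left_distrib vs.scale_right_distrib)
      have t2: "tril A (\<lambda>x u v. scale (f u) (e x * v))" "tril A (\<lambda>u x v. scale (f u) (e x * v))"
        unfolding tril_def using linK[OF f(1)] linA[OF e(1)]
        by (auto intro!: linI simp: scale_mult algebra_simps vs.scale_left_distrib vs.scale_right_distrib)
      have bf: "bil A (\<lambda>u v. scale (f u) v)" by (rule bil_act[OF f(1) lin_id])
      \<comment> \<open>As e(a1) is primitive, \<open>\<Delta>\<close> of e(a1) a2 is the sum of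
        e(a1) a2 \<otimes> a3 and a2 \<otimes> e(a1) a3. Coassociativity turns the first sum into
        the action of f \<circ> E on a; coassociativity together with cocommutativity turns the
        second into E(act f a).\<close>
      have "act f (E a) = sw A (\<lambda>x y. act f (e x * y)) a"
        unfolding E_def by (rule sw_comp[OF A_module A_module be act_lin[OF f(1)]])
      also have "\<dots> = sw A (\<lambda>x y. sw A (\<lambda>u v. scale (f (e x * u)) v) y + sw A (\<lambda>u v. scale (f u) (e x * v)) y) a"
        unfolding act_def using sw_prim_mult[OF A_module bf] e(3) by simp
      also have "\<dots> = sw A (\<lambda>x y. sw A (\<lambda>u v. scale (f (e x * u)) v) y) a
          + sw A (\<lambda>x y. sw A (\<lambda>u v. scale (f u) (e x * v)) y) a"
        using sw_add[OF A_module tril_sw(1)[OF A_module t1] tril_sw(1)[OF A_module t2(1)]] by simp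
      also have "sw A (\<lambda>x y. sw A (\<lambda>u v. scale (f (e x * u)) v) y) a = act (\<lambda>x. f (E x)) a"
      proof -
        have "sw A (\<lambda>x u. scale (f (e x * u)) v) z = scale (f (E z)) v" for v z
          unfolding E_def
          by (rule sw_comp[OF A_module A_module be, of "\<lambda>w. scale (f w) v", symmetric])
            (use linK[OF f(1)] in \<open>auto intro!: linI simp: vs.scale_left_distrib\<close>)
        then show ?thesis by (simp add: act_def flip: sw_coassoc[OF A_module t1])
      qed
      also have "sw A (\<lambda>x y. sw A (\<lambda>u v. scale (f u) (e x * v)) y) a = E (act f a)"
      proof -
        have b: "bil A (\<lambda>x u. scale (f u) (e x * v))" for v
          by (intro bilI linI) (use linK[OF f(1)] linA[OF e(1)] in
              \<open>auto simp: scale_mult algebra_simps vs.scale_left_distrib vs.scale_right_distrib\<close>)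
        have "sw A (\<lambda>x y. sw A (\<lambda>u v. scale (f u) (e x * v)) y) a =
            sw A (\<lambda>z v. sw A (\<lambda>x u. scale (f u) (e x * v)) z) a"
          by (rule sw_coassoc[OF A_module t2(1), symmetric])
        also have "\<dots> = sw A (\<lambda>z v. sw A (\<lambda>u x. scale (f u) (e x * v)) z) a"
          using sw_cocomm[OF A_module b] by simp
        also have "\<dots> = sw A (\<lambda>u z. sw A (\<lambda>x v. scale (f u) (e x * v)) z) a"
          by (rule sw_coassoc[OF A_module t2(2)])
        also have "\<dots> = sw A (\<lambda>u z. scale (f u) (E z)) a"
          unfolding E_def using sw_smult[OF A_module be] by simp
        also have "\<dots> = E (act f a)" by (rule act_apply_A[OF f(1) E, symmetric])
        finally show ?thesis .
      qed
      finally have *: "act f (E a) = act (\<lambda>x. f (E x)) a + E (act f a)" .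
      \<comment> \<open>E is the identity on L and kills 1, so f \<circ> E and f agree on G 2
        whenever f(1) = 0, and their difference lowers the filtration by two. The remaining summand
        \<open>act f a\<close> raises the eigenvalue from n to n + 1.\<close>
      let ?g = "\<lambda>x. f (E x) - f x"
      have g: "lin KM ?g" by (rule lin_diff[OF fE f(1)])
      have "act (\<lambda>x. f (E x)) a = act ?g a + act f a"
        using act_add[OF g f(1), of a] by simp
      moreover have "act ?g a \<in> G n"
      proof (rule act_G_2[OF g _ Suc.prems])
        fix y assume "y \<in> G (Suc (Suc 0))"
        then obtain x c where x: "prim x" "y = x + scale c 1" by (rule G_2_cases)
        then show "?g y = 0" using f by (simp add: linA[OF E] Ex E1 linK[OF f(1)])
      qed
      moreover have "E (act f a) - scale (of_nat n) (act f a) \<in> G n"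
        using Suc f by (intro Suc.IH) simp
      ultimately have "act ?g a + (E (act f a) - scale (of_nat n) (act f a)) \<in> G n"
        by (simp add: G_closed)
      moreover have "act f (E a - scale (of_nat (Suc n)) a) = act ?g a + (E (act f a) - scale (of_nat n) (act f a))"
        using f \<open>act (\<lambda>x. f (E x)) a = act ?g a + act f a\<close>
        by (simp add: act_simps * vs.scale_left_distrib)
      ultimately show ?thesis by simp
    qed
    then show ?case by simp
  qed
  show "G (Suc n) \<subseteq> PW n"
  proof (induction n)
    case 0
    have "1 \<in> PW 0" unfolding PW_def by (rule vs.span_base) (auto intro!: exI[of _ "[]"])
    then show ?case unfolding G_1 using vs.subspace_scale[OF vs.subspace_span] by (auto simp: PW_def)
  next
    case (Suc n)
    have W: "vs.subspace (PW (Suc n))" unfolding PW_def by simp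
    show ?case
    proof
      fix a assume a: "a \<in> G (Suc (Suc n))"
      \<comment> \<open>Tested by functionals f that kill PW (n + 1): f(e(x) y) vanishes for x = 1
        because e(1) = 0, and for y in G (n + 1), which lies in PW n by the induction
        hypothesis.\<close>
      have "E a \<in> PW (Suc n)"
      proof (rule functional_separates[OF W])
        fix f assume f: "lin KM f" "\<And>w. w \<in> PW (Suc n) \<Longrightarrow> f w = 0"
        have b: "bil KM (\<lambda>x y. f (e x * y))"
          by (intro bilI linI) (auto simp: linA[OF e(1)] linK[OF f(1)] algebra_simps scale_mult)
        have "f (E a) = sw KM (\<lambda>x y. f (e x * y)) a"
          unfolding E_def by (rule sw_comp[OF A_module KM_module be f(1)])
        also have "\<dots> = \<zero>\<^bsub>KM\<^esub>"
        proof (rule sw_G_zero[OF KM_module b _ _ a])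
          show "f (e 1 * y) = \<zero>\<^bsub>KM\<^esub>" for y using e linK[OF f(1)] by simp
          show "f (e x * y) = \<zero>\<^bsub>KM\<^esub>" if "y \<in> G (Suc n)" for x y
            using that e(3) prim_mult_PW[of "e x" y n] Suc f(2) by auto
        qed
        finally show "f (E a) = 0" by simp
      qed
      moreover have "E a - scale (of_nat (Suc n)) a \<in> PW (Suc n)"
        using euler[OF a] Suc PW_mono[of n "Suc n"] by auto
      ultimately have "E a - (E a - scale (of_nat (Suc n)) a) \<in> PW (Suc n)"
        by (rule vs.subspace_diff[OF W])
      then have "scale (of_nat (Suc n)) a \<in> PW (Suc n)" by (simp only: diff_diff_eq2 add_diff_cancel_left')
      \<comment> \<open>Characteristic zero permits division by n + 1.\<close>
      then have "scale (inverse (of_nat (Suc n))) (scale (of_nat (Suc n)) a) \<in> PW (Suc n)"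
        by (rule vs.subspace_scale[OF W])
      then show "a \<in> PW (Suc n)" by (simp del: of_nat_Suc)
    qed
  qed
qed

end

section \<open>Symmetric powers\<close>

definition sym_gens :: "('k::field, 'v, 'z) lie_alg_scheme \<Rightarrow> nat \<Rightarrow> ('v list \<Rightarrow>\<^sub>0 'k) set" where
  "sym_gens L n =
    {Poly_Mapping.single (u @ [x \<oplus>\<^bsub>L\<^esub> y] @ v) 1 - Poly_Mapping.single (u @ [x] @ v) 1
          - Poly_Mapping.single (u @ [y] @ v) 1
        | u v x y. u \<in> lists (carrier L) \<and> v \<in> lists (carrier L) \<and>
            x \<in> carrier L \<and> y \<in> carrier L \<and> length u + 1 + length v = n} \<union>
     {Poly_Mapping.single (u @ [c \<odot>\<^bsub>L\<^esub> x] @ v) 1 - Poly_Mapping.single (u @ [x] @ v) c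
        | u v c x. u \<in> lists (carrier L) \<and> v \<in> lists (carrier L) \<and>
            x \<in> carrier L \<and> length u + 1 + length v = n} \<union>
     {Poly_Mapping.single (u @ [x, y] @ v) 1 - Poly_Mapping.single (u @ [y, x] @ v) 1
        | u v x y. u \<in> lists (carrier L) \<and> v \<in> lists (carrier L) \<and>
            x \<in> carrier L \<and> y \<in> carrier L \<and> length u + 2 + length v = n}"

definition sym_rel :: "('k::field, 'v, 'z) lie_alg_scheme \<Rightarrow> nat \<Rightarrow> ('v list \<Rightarrow>\<^sub>0 'k) set" where
  "sym_rel L n = lspan KK (word_space L n) (sym_gens L n)"

lemma sym_power_eq: "sym_power L n = quot_module (word_space L n) (sym_rel L n)"
  by (simp add: sym_power_def sym_rel_def sym_gens_def)

lemma word_space_eq: "word_space L n = free_alg {w \<in> lists (carrier L). length w = n} (@) []"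
  by (simp add: free_alg_def)

locale lie_mod = module KK L for L :: "('k::field, 'v, 'z) lie_alg_scheme" (structure) +
  assumes bracket_closed: "x \<in> carrier L \<Longrightarrow> y \<in> carrier L \<Longrightarrow> bracket L x y \<in> carrier L"
begin

lemma word_space_carrier: "p \<in> carrier (word_space L n) \<longleftrightarrow>
    (\<forall>w\<in>Poly_Mapping.keys p. w \<in> lists (carrier L) \<and> length w = n)"
  by auto

lemma word_space_module: "module KK (word_space L n)"
  unfolding word_space_eq by (rule free_alg_module)

lemma word_space_minus_closed:
  "p \<in> carrier (word_space L n) \<Longrightarrow> q \<in> carrier (word_space L n) \<Longrightarrow> p - q \<in> carrier (word_space L n)"
  unfolding word_space_eq free_alg_simps mem_Collect_eq by (rule keys_minus_subset)

lemma sym_gens_closed: "sym_gens L n \<subseteq> carrier (word_space L n)"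
  unfolding sym_gens_def
  by (intro Un_least; clarify; intro word_space_minus_closed; auto simp: word_space_carrier lists_eq_set)

lemma sym_rel_submodule: "submodule (sym_rel L n) KK (word_space L n)"
  unfolding sym_rel_def by (rule module.lspan_submodule[OF word_space_module sym_gens_closed])

sublocale S: quot_mod KK "word_space L n" "sym_rel L n" for n
  by (intro quot_mod.intro quot_mod_axioms.intro word_space_module sym_rel_submodule)

lemma sym_power_module: "module KK (sym_power L n)"
  unfolding sym_power_eq by (rule S.quot_is_module)

abbreviation scls :: "nat \<Rightarrow> ('v list \<Rightarrow>\<^sub>0 'k) \<Rightarrow> ('v list \<Rightarrow>\<^sub>0 'k) set" where
  "scls n p \<equiv> sym_rel L n +>\<^bsub>word_space L n\<^esub> p"

lemma scls_linear: "linear_map KK (word_space L n) (sym_power L n) (scls n)"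
  unfolding sym_power_eq by (rule S.coset_linear)

lemma word_space_linear_eq:
  assumes P: "module KK P" and f: "linear_map KK (word_space L n) P f" and g: "linear_map KK (word_space L n) P g"
    and fg: "\<And>w. w \<in> lists (carrier L) \<Longrightarrow> length w = n \<Longrightarrow> f (Poly_Mapping.single w 1) = g (Poly_Mapping.single w 1)"
    and p: "p \<in> carrier (word_space L n)"
  shows "f p = g p"
  using free_linear_eq[OF P f[unfolded word_space_eq] g[unfolded word_space_eq], of p] fg p by simp

lemma sym_power_linear_eq:
  assumes P: "module KK P" and f: "linear_map KK (sym_power L n) P f" and g: "linear_map KK (sym_power L n) P g"
    and fg: "\<And>w. w \<in> lists (carrier L) \<Longrightarrow> length w = n \<Longrightarrow>
      f (scls n (Poly_Mapping.single w 1)) = g (scls n (Poly_Mapping.single w 1))"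
    and Z: "Z \<in> carrier (sym_power L n)"
  shows "f Z = g Z"
proof -
  obtain p where p: "p \<in> carrier (word_space L n)" "Z = scls n p"
    using Z unfolding sym_power_eq by (rule S.quot_cases)
  then show ?thesis
    using word_space_linear_eq[OF P linear_map_comp[OF scls_linear f] linear_map_comp[OF scls_linear g], of p] fg
    by simp
qed

definition pre :: "'v \<Rightarrow> ('v list \<Rightarrow>\<^sub>0 'k) \<Rightarrow> ('v list \<Rightarrow>\<^sub>0 'k)" where
  "pre x p = pm_mult (@) (Poly_Mapping.single [x] 1) p"

lemma pre_single [simp]: "pre x (Poly_Mapping.single w c) = Poly_Mapping.single (x # w) c"
  by (simp add: pre_def)

lemma pre_minus [simp]: "pre x (p - q) = pre x p - pre x q"
  by (simp add: pre_def pm_mult_minus_right)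

lemma word_assoc_alg: "assoc_alg (word_alg L)"
  by (rule free_assoc_alg) auto

lemma pre_linear:
  assumes "x \<in> carrier L"
  shows "linear_map KK (word_space L n) (word_space L (Suc n)) (pre x)"
proof -
  interpret W: assoc_alg "free_alg UNIV (@) [] :: ('k, 'v list \<Rightarrow>\<^sub>0 'k) module"
    by (rule free_assoc_alg) auto
  show ?thesis
  proof (rule linear_mapI)
    fix p assume p: "p \<in> carrier (word_space L n)"
    show "pre x p \<in> carrier (word_space L (Suc n))"
    proof -
      have "Poly_Mapping.keys p \<subseteq> {w \<in> lists (carrier L). length w = n}" using p by auto
      then show ?thesis
      proof (induction rule: free_induct)
        case (single w c q)
        have "pre x (Poly_Mapping.single w c + q) = Poly_Mapping.single (x # w) c + pre x q"
          by (simp add: pre_def pm_mult_add_right)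
        then have "Poly_Mapping.keys (pre x (Poly_Mapping.single w c + q)) \<subseteq>
            insert (x # w) (Poly_Mapping.keys (pre x q))"
          using keys_add[of "Poly_Mapping.single (x # w) c" "pre x q"] by (auto split: if_splits)
        also have "\<dots> \<subseteq> {w \<in> lists (carrier L). length w = Suc n}" using single assms by (auto simp: lists_eq_set)
        finally show ?case by simp
      qed (simp add: pre_def)
    qed
  next
    fix p q show "pre x (p \<oplus>\<^bsub>word_space L n\<^esub> q) = pre x p \<oplus>\<^bsub>word_space L (Suc n)\<^esub> pre x q"
      by (simp add: pre_def pm_mult_add_right)
  next
    fix c p show "pre x (c \<odot>\<^bsub>word_space L n\<^esub> p) = c \<odot>\<^bsub>word_space L (Suc n)\<^esub> pre x p"
      using W.smult_mult_right[of "Poly_Mapping.single [x] 1" p c] by (simp add: pre_def)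
  qed
qed

text \<open>A letter put in front of a relator is absorbed into its left context u, which gives a
  relator of the next degree.\<close>

lemma pre_rel:
  assumes x: "x \<in> carrier L" and p: "p \<in> sym_rel L n"
  shows "pre x p \<in> sym_rel L (Suc n)"
proof -
  let ?S = "{p \<in> carrier (word_space L n). pre x p \<in> sym_rel L (Suc n)}"
  note W = word_space_module
  note sub = module.submoduleE[OF W sym_rel_submodule] module.submodule_zero[OF W sym_rel_submodule]
  note car = module.submoduleE[OF W module.carrier_is_submodule[OF W]]
    module.submodule_zero[OF W module.carrier_is_submodule[OF W]]
  have sub1: "submodule ?S KK (word_space L n)"
  proof (rule module.submoduleI'[OF W])
    show "\<zero>\<^bsub>word_space L n\<^esub> \<in> ?S"
      using sub(7) linear_map_zero[OF word_space_module word_space_module pre_linear[OF x]] car(7) by auto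
    show "a \<oplus>\<^bsub>word_space L n\<^esub> b \<in> ?S" if "a \<in> ?S" "b \<in> ?S" for a b
      using that sub(5) linear_mapD(2)[OF pre_linear[OF x], of a n b] car(5)[of a n b] by auto
    show "c \<odot>\<^bsub>word_space L n\<^esub> a \<in> ?S" if "a \<in> ?S" for a c
      using that sub(4) linear_mapD(3)[OF pre_linear[OF x], of c a n] car(4)[of c a n] by auto
  qed auto
  have "sym_gens L n \<subseteq> ?S"
  proof
    fix q assume q: "q \<in> sym_gens L n"
    have "pre x q \<in> sym_gens L (Suc n)"
      using q x unfolding sym_gens_def
      apply (elim UnE)
        apply (intro UnI1, clarsimp)
        apply (rule_tac x = "x # u" in exI, force)
       apply (rule UnI1, rule UnI2, clarsimp)
       apply (rule_tac x = "x # u" in exI, force)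
      apply (rule UnI2, clarsimp)
      apply (rule_tac x = "x # u" in exI, force)
      done
    then show "q \<in> ?S"
      using q sym_gens_closed[of n] lspan_superset[of "sym_gens L (Suc n)" KK "word_space L (Suc n)"]
      unfolding sym_rel_def by blast
  qed
  then have "sym_rel L n \<subseteq> ?S" unfolding sym_rel_def[of L n] by (rule lspan_minimal[OF sub1])
  then show ?thesis using p by auto
qed

text \<open>Multiplication by an element of degree one in the symmetric algebra, the only part of
  its product on which the symmetrization below is built.\<close>

definition mulL :: "nat \<Rightarrow> 'v \<Rightarrow> ('v list \<Rightarrow>\<^sub>0 'k) set \<Rightarrow> ('v list \<Rightarrow>\<^sub>0 'k) set" where
  "mulL n x Z = the_elem ((\<lambda>p. scls (Suc n) (pre x p)) ` Z)"

context
  fixes x assumes x: "x \<in> carrier L"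
begin

lemma scls_pre_zero:
  assumes "p \<in> sym_rel L n" shows "scls (Suc n) (pre x p) = \<zero>\<^bsub>sym_power L (Suc n)\<^esub>"
proof -
  have "pre x p \<in> sym_rel L (Suc n)" by (rule pre_rel[OF x assms])
  then show ?thesis
    using S.coset_eq_H_iff[of "pre x p" "Suc n"] S.H_subset[of "Suc n"] by (auto simp: sym_power_eq quot_module_simps(3))
qed

lemma mulL_scls:
  assumes "p \<in> carrier (word_space L n)" shows "mulL n x (scls n p) = scls (Suc n) (pre x p)"
  unfolding mulL_def
  by (rule S.quot_lift(1)[OF sym_power_module linear_map_comp[OF pre_linear[OF x] scls_linear] scls_pre_zero assms])

lemma mulL_linear: "linear_map KK (sym_power L n) (sym_power L (Suc n)) (mulL n x)"
  unfolding mulL_def[abs_def] sym_power_eq[of L n]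
  by (rule S.quot_lift(2)[OF sym_power_module linear_map_comp[OF pre_linear[OF x] scls_linear] scls_pre_zero])

end

lemma single_word_space: "w \<in> lists (carrier L) \<Longrightarrow> length w = n \<Longrightarrow> Poly_Mapping.single w c \<in> carrier (word_space L n)"
  by simp

lemma scls_eqI:
  assumes "p \<in> carrier (word_space L n)" "q \<in> carrier (word_space L n)" "p - q \<in> sym_rel L n"
  shows "scls n p = scls n q"
proof -
  have "p \<ominus>\<^bsub>word_space L n\<^esub> q = p - q"
    unfolding word_space_eq by (rule free_alg_minus) (use assms(2) in \<open>simp add: word_space_eq\<close>)
  then show ?thesis using assms S.coset_eq_iff[of p n q] by simp
qed

lemma scls_add: "p \<in> carrier (word_space L n) \<Longrightarrow> q \<in> carrier (word_space L n) \<Longrightarrow>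
    scls n (p + q) = scls n p \<oplus>\<^bsub>sym_power L n\<^esub> scls n q"
  using linear_mapD(2)[OF scls_linear, of p n q] by simp

lemma scls_scale: "p \<in> carrier (word_space L n) \<Longrightarrow>
    scls n (Poly_Mapping.map ((*) c) p) = c \<odot>\<^bsub>sym_power L n\<^esub> scls n p"
  using linear_mapD(3)[OF scls_linear, of c p n] by simp

text \<open>Linearity in the letter is given by the linearity relators with empty left
  context.\<close>

lemma mulL_bilin: "bilin L (sym_power L n) (sym_power L (Suc n)) (mulL n)"
  unfolding bilin_def
proof (intro conjI ballI)
  show "linear_map KK (sym_power L n) (sym_power L (Suc n)) (mulL n v)" if "v \<in> carrier L" for v
    by (rule mulL_linear[OF that])
  interpret V: module KK "sym_power L (Suc n)" by (rule sym_power_module)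
  fix Z assume Z: "Z \<in> carrier (sym_power L n)"
  note gens = lspan_superset[of "sym_gens L (Suc n)" KK "word_space L (Suc n)", folded sym_rel_def, THEN subsetD]
  show "linear_map KK L (sym_power L (Suc n)) (\<lambda>v. mulL n v Z)"
  proof (rule linear_mapI)
    show "mulL n x Z \<in> carrier (sym_power L (Suc n))" if "x \<in> carrier L" for x
      using linear_mapD(1)[OF mulL_linear[OF that] Z] .
    fix x y assume x: "x \<in> carrier L" and y: "y \<in> carrier L"
    note xy = M.add.m_closed[OF x y]
    show "mulL n (x \<oplus> y) Z = mulL n x Z \<oplus>\<^bsub>sym_power L (Suc n)\<^esub> mulL n y Z"
    proof (rule sym_power_linear_eq[OF sym_power_module mulL_linear[OF xy] _ _ Z])
      show "linear_map KK (sym_power L n) (sym_power L (Suc n)) (\<lambda>Z. mulL n x Z \<oplus>\<^bsub>sym_power L (Suc n)\<^esub> mulL n y Z)"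
        using linear_mapD[OF mulL_linear[OF x, of n]] linear_mapD[OF mulL_linear[OF y, of n]]
        by (intro linear_mapI) (simp_all add: V.M.a_ac V.smult_r_distr)
      fix w assume w: "w \<in> lists (carrier L)" "length w = n"
      have "Poly_Mapping.single ([] @ [x \<oplus> y] @ w) 1 - Poly_Mapping.single ([] @ [x] @ w) 1
          - Poly_Mapping.single ([] @ [y] @ w) 1 \<in> sym_rel L (Suc n)"
        by (rule gens, unfold sym_gens_def, intro UnI1 CollectI exI conjI, rule refl) (use w x y in auto)
      then have "scls (Suc n) (Poly_Mapping.single ((x \<oplus> y) # w) 1) =
          scls (Suc n) (Poly_Mapping.single (x # w) 1 + Poly_Mapping.single (y # w) 1)"
        using w x y xy
        by (intro scls_eqI) (auto simp: diff_diff_eq word_space_carrier dest!: keys_add[THEN subsetD])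
      then show "mulL n (x \<oplus> y) (scls n (Poly_Mapping.single w 1)) =
          mulL n x (scls n (Poly_Mapping.single w 1)) \<oplus>\<^bsub>sym_power L (Suc n)\<^esub> mulL n y (scls n (Poly_Mapping.single w 1))"
        using w x y xy by (simp add: mulL_scls single_word_space scls_add)
    qed
  next
    fix c :: 'k and x assume x: "x \<in> carrier L"
    have cx: "c \<odot> x \<in> carrier L" using x by simp
    show "mulL n (c \<odot> x) Z = c \<odot>\<^bsub>sym_power L (Suc n)\<^esub> mulL n x Z"
    proof (rule sym_power_linear_eq[OF sym_power_module mulL_linear[OF cx] _ _ Z])
      show "linear_map KK (sym_power L n) (sym_power L (Suc n)) (\<lambda>Z. c \<odot>\<^bsub>sym_power L (Suc n)\<^esub> mulL n x Z)"
        using linear_mapD[OF mulL_linear[OF x, of n]]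
        by (intro linear_mapI) (simp_all add: V.smult_r_distr mult.commute V.smult_assoc1[symmetric, simplified])
      fix w assume w: "w \<in> lists (carrier L)" "length w = n"
      have "Poly_Mapping.single ([] @ [c \<odot> x] @ w) 1 - Poly_Mapping.single ([] @ [x] @ w) c \<in> sym_rel L (Suc n)"
        by (rule gens, unfold sym_gens_def, rule UnI1, rule UnI2, intro CollectI exI conjI, rule refl) (use w x in auto)
      then have "scls (Suc n) (Poly_Mapping.single ((c \<odot> x) # w) 1) =
          scls (Suc n) (Poly_Mapping.map ((*) c) (Poly_Mapping.single (x # w) 1))"
        using w x cx by (intro scls_eqI) auto
      then show "mulL n (c \<odot> x) (scls n (Poly_Mapping.single w 1)) =
          c \<odot>\<^bsub>sym_power L (Suc n)\<^esub> mulL n x (scls n (Poly_Mapping.single w 1))"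
        using w x cx scls_scale[of "Poly_Mapping.single (x # w) 1" "Suc n" c]
        by (simp add: mulL_scls single_word_space)
    qed
  qed
qed

text \<open>The exchange relator with empty left context, applied to words.\<close>

lemma mulL_comm:
  assumes x: "x \<in> carrier L" and y: "y \<in> carrier L" and Z: "Z \<in> carrier (sym_power L n)"
  shows "mulL (Suc n) x (mulL n y Z) = mulL (Suc n) y (mulL n x Z)"
proof (rule sym_power_linear_eq[OF sym_power_module linear_map_comp[OF mulL_linear[OF y] mulL_linear[OF x]]
      linear_map_comp[OF mulL_linear[OF x] mulL_linear[OF y]] _ Z])
  fix w assume w: "w \<in> lists (carrier L)" "length w = n"
  note gens = lspan_superset[of "sym_gens L (Suc (Suc n))" KK "word_space L (Suc (Suc n))", folded sym_rel_def, THEN subsetD]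
  have "Poly_Mapping.single ([] @ [x, y] @ w) 1 - Poly_Mapping.single ([] @ [y, x] @ w) 1 \<in> sym_rel L (Suc (Suc n))"
    by (rule gens, unfold sym_gens_def, rule UnI2, intro CollectI exI conjI, rule refl) (use w x y in auto)
  then have "scls (Suc (Suc n)) (Poly_Mapping.single (x # y # w) 1) = scls (Suc (Suc n)) (Poly_Mapping.single (y # x # w) 1)"
    using w x y by (intro scls_eqI) auto
  then show "mulL (Suc n) x (mulL n y (scls n (Poly_Mapping.single w 1))) =
      mulL (Suc n) y (mulL n x (scls n (Poly_Mapping.single w 1)))"
    using w x y by (simp add: mulL_scls single_word_space)
qed

end

section \<open>The enveloping algebra\<close>

context lie_mod
begin

definition env_gens :: "('v list \<Rightarrow>\<^sub>0 'k) set" where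
  "env_gens = {Poly_Mapping.single [x \<oplus>\<^bsub>L\<^esub> y] 1 - Poly_Mapping.single [x] 1 - Poly_Mapping.single [y] 1
        | x y. x \<in> carrier L \<and> y \<in> carrier L} \<union>
     {Poly_Mapping.single [c \<odot>\<^bsub>L\<^esub> x] 1 - Poly_Mapping.single [x] c | c x. x \<in> carrier L} \<union>
     {Poly_Mapping.single [x, y] 1 - Poly_Mapping.single [y, x] 1
          - Poly_Mapping.single [bracket L x y] 1
        | x y. x \<in> carrier L \<and> y \<in> carrier L}"

lemma env_ideal_eq: "env_ideal L = genideal (word_alg L) env_gens"
  by (simp add: env_ideal_def env_gens_def)

sublocale W: assoc_alg "word_alg L" by (rule word_assoc_alg)

lemma word_minus_closed: "p \<in> carrier (word_alg L) \<Longrightarrow> q \<in> carrier (word_alg L) \<Longrightarrow> p - q \<in> carrier (word_alg L)"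
  unfolding free_alg_simps mem_Collect_eq by (rule keys_minus_subset)

lemma env_gens_closed: "env_gens \<subseteq> carrier (word_alg L)"
  unfolding env_gens_def
  by (intro Un_least; clarify; intro word_minus_closed; auto simp: bracket_closed)

lemma env_ideal: "ideal (env_ideal L) (word_alg L)"
  unfolding env_ideal_eq by (rule W.genideal_ideal[OF env_gens_closed])

sublocale E: quot_mod KK "word_alg L" "env_ideal L"
  by (intro quot_mod.intro quot_mod_axioms.intro W.module_axioms W.ideal_submodule env_ideal)

lemma env_alg_assoc_alg: "assoc_alg (env_alg L)"
  unfolding env_alg_def by (rule W.quot_assoc_alg[OF env_ideal])

lemma env_gens_in_ideal: "g \<in> env_gens \<Longrightarrow> g \<in> env_ideal L"
  unfolding env_ideal_eq using W.genideal_self[OF env_gens_closed] by blast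

lemma env_ideal_closed:
  "p \<in> env_ideal L \<Longrightarrow> q \<in> env_ideal L \<Longrightarrow> p + q \<in> env_ideal L"
  "p \<in> env_ideal L \<Longrightarrow> q \<in> env_ideal L \<Longrightarrow> p - q \<in> env_ideal L"
  "0 \<in> env_ideal L"
  "p \<in> env_ideal L \<Longrightarrow> Poly_Mapping.map ((*) c) p \<in> env_ideal L"
  using W.submoduleE[OF E.H] W.submodule_zero[OF E.H] W.submodule_minus[OF E.H, of p q] by auto

text \<open>Allows a defining relation of U(L) to be applied in the middle of a word.\<close>

lemma env_ideal_sandwich:
  assumes "g \<in> env_gens" "u \<in> lists (carrier L)" "v \<in> lists (carrier L)"
  shows "pm_mult (@) (pm_mult (@) (Poly_Mapping.single u 1) g) (Poly_Mapping.single v 1) \<in> env_ideal L"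
  using ideal.I_r_closed[OF env_ideal ideal.I_l_closed[OF env_ideal env_gens_in_ideal[OF assms(1)],
        of "Poly_Mapping.single u 1"], of "Poly_Mapping.single v 1"] assms by simp

text \<open>The bound is strict so that the index agrees with that of G: \<open>low 0\<close> is
  zero, and \<open>low (Suc n)\<close> represents \<open>U(L)\<^sub>n\<close>.\<close>

definition low :: "nat \<Rightarrow> ('v list \<Rightarrow>\<^sub>0 'k) set" where
  "low n = {p. Poly_Mapping.keys p \<subseteq> {w \<in> lists (carrier L). length w < n}}"

lemma low_closed: "p \<in> low n \<Longrightarrow> q \<in> low n \<Longrightarrow> p + q \<in> low n" "0 \<in> low n"
  "p \<in> low n \<Longrightarrow> Poly_Mapping.map ((*) c) p \<in> low n"
  "p \<in> low n \<Longrightarrow> p \<in> carrier (word_alg L)"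
  unfolding low_def using keys_add[of p q] keys_scale[of c p] by auto

lemma word_space_le: "p \<in> carrier (word_space L n) \<Longrightarrow> p \<in> carrier (word_alg L)"
  by auto

text \<open>Exchanging two neighbouring letters costs a bracket, that is a shorter word.\<close>

lemma sym_rel_env_ideal:
  assumes "p \<in> sym_rel L n" shows "\<exists>q\<in>low n. p - q \<in> env_ideal L"
proof -
  let ?S = "{p \<in> carrier (word_space L n). \<exists>q\<in>low n. p - q \<in> env_ideal L}"
  note W = word_space_module
  note car = module.submoduleE[OF W module.carrier_is_submodule[OF W]]
    module.submodule_zero[OF W module.carrier_is_submodule[OF W]]
  have sub: "submodule ?S KK (word_space L n)"
  proof (rule module.submoduleI'[OF W])
    show "\<zero>\<^bsub>word_space L n\<^esub> \<in> ?S" using low_closed(2) env_ideal_closed(3) by (auto intro!: bexI[of _ 0])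
    show "a \<oplus>\<^bsub>word_space L n\<^esub> b \<in> ?S" if a: "a \<in> ?S" and b: "b \<in> ?S" for a b
    proof -
      obtain q q' where q: "q \<in> low n" "a - q \<in> env_ideal L" "q' \<in> low n" "b - q' \<in> env_ideal L"
        using a b by auto
      have "(a + b) - (q + q') \<in> env_ideal L"
        using env_ideal_closed(1)[OF q(2,4)] by (simp add: algebra_simps)
      then show ?thesis using car(5)[of a n b] a b low_closed(1)[OF q(1,3)] by auto
    qed
    show "c \<odot>\<^bsub>word_space L n\<^esub> a \<in> ?S" if a: "a \<in> ?S" for a c
    proof -
      obtain q where q: "q \<in> low n" "a - q \<in> env_ideal L" using a by auto
      have "Poly_Mapping.map ((*) c) (a - q) = Poly_Mapping.map ((*) c) a - Poly_Mapping.map ((*) c) q"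
        by (rule poly_mapping_eqI) (simp add: lookup_minus algebra_simps)
      then have "Poly_Mapping.map ((*) c) a - Poly_Mapping.map ((*) c) q \<in> env_ideal L"
        using env_ideal_closed(4)[OF q(2), of c] by simp
      then show ?thesis using car(4)[of c a n] a low_closed(3)[OF q(1)] by auto
    qed
  qed auto
  have "sym_gens L n \<subseteq> ?S"
  proof
    fix g assume g: "g \<in> sym_gens L n"
    then have gc: "g \<in> carrier (word_space L n)" using sym_gens_closed by blast
    have "\<exists>q\<in>low n. g - q \<in> env_ideal L"
      using g unfolding sym_gens_def
    proof (elim UnE CollectE exE conjE)
      fix u v x y assume *: "g = Poly_Mapping.single (u @ [x \<oplus> y] @ v) 1 - Poly_Mapping.single (u @ [x] @ v) 1 -
           Poly_Mapping.single (u @ [y] @ v) 1" "u \<in> lists (carrier L)" "v \<in> lists (carrier L)" "x \<in> carrier L" "y \<in> carrier L"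
      have "Poly_Mapping.single [x \<oplus> y] 1 - Poly_Mapping.single [x] 1 - Poly_Mapping.single [y] 1 \<in> env_gens"
        unfolding env_gens_def using * by blast
      from env_ideal_sandwich[OF this *(2,3)] have "g - 0 \<in> env_ideal L"
        using * by (simp add: pm_mult_minus_left pm_mult_minus_right)
      then show ?thesis using low_closed(2) by blast
    next
      fix u v c x assume *: "g = Poly_Mapping.single (u @ [c \<odot> x] @ v) 1 - Poly_Mapping.single (u @ [x] @ v) c"
        "u \<in> lists (carrier L)" "v \<in> lists (carrier L)" "x \<in> carrier L"
      have "Poly_Mapping.single [c \<odot> x] 1 - Poly_Mapping.single [x] c \<in> env_gens"
        unfolding env_gens_def using * by blast
      from env_ideal_sandwich[OF this *(2,3)] have "g - 0 \<in> env_ideal L"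
        using * by (simp add: pm_mult_minus_left pm_mult_minus_right)
      then show ?thesis using low_closed(2) by blast
    next
      fix u v x y assume *: "g = Poly_Mapping.single (u @ [x, y] @ v) 1 - Poly_Mapping.single (u @ [y, x] @ v) 1"
        "u \<in> lists (carrier L)" "v \<in> lists (carrier L)" "x \<in> carrier L" "y \<in> carrier L" "length u + 2 + length v = n"
      have "Poly_Mapping.single [x, y] 1 - Poly_Mapping.single [y, x] 1 - Poly_Mapping.single [bracket L x y] 1 \<in> env_gens"
        unfolding env_gens_def using * by blast
      from env_ideal_sandwich[OF this *(2,3)]
      have "g - Poly_Mapping.single (u @ [bracket L x y] @ v) 1 \<in> env_ideal L"
        using * by (simp add: pm_mult_minus_left pm_mult_minus_right)
      moreover have "Poly_Mapping.single (u @ [bracket L x y] @ v) 1 \<in> low n"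
        using * bracket_closed by (auto simp: low_def lists_eq_set)
      ultimately show ?thesis by blast
    qed
    then show "g \<in> ?S" using gc by blast
  qed
  then have "sym_rel L n \<subseteq> ?S" unfolding sym_rel_def[of L n] by (rule lspan_minimal[OF sub])
  then show ?thesis using assms by auto
qed

lemma top_component:
  assumes "p \<in> low (Suc n)"
  obtains q r where "q \<in> carrier (word_space L n)" "r \<in> low n" "p = q + r"
proof -
  define q where "q = (\<Sum>w\<in>{w \<in> Poly_Mapping.keys p. length w = n}. Poly_Mapping.single w (Poly_Mapping.lookup p w))"
  have q: "Poly_Mapping.lookup q w = (if length w = n then Poly_Mapping.lookup p w else 0)" for w
    by (auto simp: q_def lookup_sum lookup_single when_def in_keys_iff)
  show ?thesis
  proof (rule that[of q "p - q"])
    show "q \<in> carrier (word_space L n)"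
      using assms by (auto simp: low_def in_keys_iff q split: if_splits)
    show "p - q \<in> low n"
      using assms by (fastforce simp: low_def in_keys_iff q lookup_minus split: if_splits)
  qed simp
qed

end

context cbialg0
begin

text \<open>The fields without meaning are \<open>undefined\<close> exactly as in
  \<open>tangent_lie\<close>; once tangent vectors are known to be the primitive elements, the two
  records are equal.\<close>

definition LL :: "('k, 'a) lie_alg" where
  "LL = \<lparr>carrier = Collect prim, monoid.mult = undefined, one = undefined, zero = 0, add = (+),
      module.smult = scale, bracket = (\<lambda>x y. x * y - y * x)\<rparr>"

lemma LL_simps [simp]: "carrier LL = Collect prim" "\<zero>\<^bsub>LL\<^esub> = 0" "x \<oplus>\<^bsub>LL\<^esub> y = x + y" "c \<odot>\<^bsub>LL\<^esub> x = scale c x"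
  "bracket LL x y = x * y - y * x"
  by (simp_all add: LL_def)

lemma LL_module: "module KK LL"
proof (rule moduleI)
  show "abelian_group LL"
  proof (rule abelian_groupI)
    fix x assume "x \<in> carrier LL"
    then show "\<exists>y\<in>carrier LL. y \<oplus>\<^bsub>LL\<^esub> x = \<zero>\<^bsub>LL\<^esub>"
      using vs.subspace_neg[OF prim_subspace] by (intro bexI[of _ "- x"]) auto
  qed (use vs.subspace_add[OF prim_subspace] vs.subspace_0[OF prim_subspace] in \<open>auto simp: algebra_simps\<close>)
qed (use vs.subspace_scale[OF prim_subspace] in \<open>auto simp: vs.scale_left_distrib vs.scale_right_distrib\<close>)

sublocale LL: lie_mod LL
  by (intro lie_mod.intro lie_mod_axioms.intro LL_module) (simp add: prim_bracket)

subsection \<open>Evaluation of words\<close>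

text \<open>The map U(L) \<rightarrow> A before passing to the quotient, so that arguments about
  U(L) can be carried out on words.\<close>

definition ev :: "('a list \<Rightarrow>\<^sub>0 'k) \<Rightarrow> 'a" where
  "ev = lext A (\<lambda>w. foldr (monoid.mult A) w \<one>\<^bsub>A\<^esub>)"

lemma foldr_prod_list: "foldr (*) w 1 = prod_list w"
  by (simp add: prod_list.eq_foldr)

lemma ev_linear: "linear_map KK (free_alg Z m e) A ev"
  unfolding ev_def by (rule lext_linear[OF A_module]) simp

lemma ev_simps [simp]: "ev (Poly_Mapping.single w c) = scale c (prod_list w)" "ev 0 = 0"
  "ev (p + q) = ev p + ev q" "ev (p - q) = ev p - ev q" "ev (Poly_Mapping.map ((*) c) p) = scale c (ev p)"
proof -
  note l = linear_mapD[OF ev_linear[of UNIV "(@)" "[]"]]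
  show "ev (Poly_Mapping.single w c) = scale c (prod_list w)"
    by (simp add: ev_def lext_single[OF A_module] foldr_prod_list)
  show *: "ev (p + q) = ev p + ev q" for p q using l(2)[of p q] by simp
  show "ev (Poly_Mapping.map ((*) c) p) = scale c (ev p)" using l(3)[of c p] by simp
  show "ev 0 = 0" using *[of 0 0] by simp
  show "ev (p - q) = ev p - ev q" using *[of "p - q" q] by simp
qed

lemma ev_mult: "ev (pm_mult (@) p q) = ev p * ev q"
proof -
  have "Poly_Mapping.keys p \<subseteq> UNIV" "Poly_Mapping.keys q \<subseteq> UNIV" by auto
  then show ?thesis
  proof (induction p rule: free_induct)
    case (single x c p')
    have "ev (pm_mult (@) (Poly_Mapping.single x c) q) = scale c (prod_list x) * ev q"
      using single.prems
      by (induction q rule: free_induct) (simp_all add: pm_mult_add_right distrib_left scale_mult)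
    with single show ?case by (simp add: pm_mult_add_left distrib_right)
  qed simp
qed

text \<open>The kernel of evaluation is a two-sided ideal, and it contains the defining relators
  because the bracket of L is the commutator in A.\<close>

lemma ev_env_ideal:
  assumes "p \<in> env_ideal LL" shows "ev p = 0"
proof -
  have "ideal {p \<in> carrier (word_alg LL). ev p = 0} (word_alg LL)"
  proof (rule idealI)
    show "ring (word_alg LL)" by (rule LL.W.ring_axioms)
    have "submodule {p \<in> carrier (word_alg LL). ev p = \<zero>\<^bsub>A\<^esub>} KK (word_alg LL)"
      by (rule LL.W.submodule_kernel[OF A_module ev_linear])
    then show "subgroup {p \<in> carrier (word_alg LL). ev p = 0} (add_monoid (word_alg LL))"
      using submodule.axioms(1) by fastforce
  next
    fix a x assume a: "a \<in> {p \<in> carrier (word_alg LL). ev p = 0}" and x: "x \<in> carrier (word_alg LL)"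
    show "x \<otimes>\<^bsub>word_alg LL\<^esub> a \<in> {p \<in> carrier (word_alg LL). ev p = 0}"
      "a \<otimes>\<^bsub>word_alg LL\<^esub> x \<in> {p \<in> carrier (word_alg LL). ev p = 0}"
      using a x LL.W.m_closed[of x a] LL.W.m_closed[of a x] by (simp_all add: ev_mult)
  qed
  moreover have "ev g = 0" if "g \<in> LL.env_gens" for g
    using that unfolding LL.env_gens_def by (auto simp: vs.scale_left_distrib)
  then have "LL.env_gens \<subseteq> {p \<in> carrier (word_alg LL). ev p = 0}"
    using LL.env_gens_closed by blast
  ultimately have "env_ideal LL \<subseteq> {p \<in> carrier (word_alg LL). ev p = 0}"
    unfolding LL.env_ideal_eq by (rule LL.W.genideal_minimal)
  then show ?thesis using assms by auto
qed

lemma ev_low: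
  assumes "p \<in> LL.low n" shows "ev p \<in> G n"
proof -
  have "Poly_Mapping.keys p \<subseteq> {w \<in> lists (Collect prim). length w < n}" using assms by (simp add: LL.low_def)
  then show ?thesis
  proof (induction rule: free_induct)
    case (single w c q)
    then have "prod_list w \<in> G n"
      using prod_list_G[of w] G_mono[of "Suc (length w)" n] by auto
    then show ?case using single by (simp add: G_closed)
  qed (simp add: G_closed)
qed

text \<open>Generation by primitive elements in terms of words; the strict bound in
  \<open>low\<close> absorbs the index shift of \<open>G_Suc_eq_PW\<close>.\<close>

lemma G_ev: "G n = ev ` LL.low n"
proof (intro equalityI subsetI)
  fix a assume a: "a \<in> G n"
  show "a \<in> ev ` LL.low n"
  proof (cases n)
    case 0
    then show ?thesis using a LL.low_closed(2) by (auto intro!: image_eqI[of _ _ 0])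
  next
    case (Suc m)
    have "a \<in> vs.span {prod_list w | w. set w \<subseteq> Collect prim \<and> length w \<le> m}"
      using a unfolding Suc G_Suc_eq_PW PW_def .
    then show ?thesis
    proof (induction rule: vs.span_induct_alt)
      case base then show ?case using LL.low_closed(2) by (auto intro!: image_eqI[of _ _ 0])
    next
      case (step c y z)
      then obtain w q where w: "y = prod_list w" "set w \<subseteq> Collect prim" "length w \<le> m" and q: "z = ev q" "q \<in> LL.low n"
        by auto
      have "Poly_Mapping.single w c \<in> LL.low n" using w Suc by (auto simp: LL.low_def lists_eq_set)
      then show ?case using q w LL.low_closed(1) by (intro image_eqI[of _ _ "Poly_Mapping.single w c + q"]) auto
    qed
  qed
qed (auto intro: ev_low)

subsection \<open>Injectivity of the symmetrization\<close>

lemma bil_diff: "module KK P \<Longrightarrow> bil P B \<Longrightarrow> bil P C \<Longrightarrow> bil P (\<lambda>x y. B x y \<oplus>\<^bsub>P\<^esub> (-1) \<odot>\<^bsub>P\<^esub> C x y)"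
  by (intro bil_add bil_smult)

text \<open>\<open>sw_G_zero\<close> applied to B - C: two bilinear maps may be exchanged as soon as
  they agree on 1 \<otimes> A and A \<otimes> G n.\<close>

lemma sw_G_cong:
  assumes P: "module KK P" and B: "bil P B" and C: "bil P C" and 1: "\<And>y. B 1 y = C 1 y"
    and G: "\<And>x y. y \<in> G n \<Longrightarrow> B x y = C x y" and a: "a \<in> G (Suc n)"
  shows "sw P B a = sw P C a"
proof -
  interpret P: module KK P by (rule P)
  have z: "x \<oplus>\<^bsub>P\<^esub> (-1) \<odot>\<^bsub>P\<^esub> x = \<zero>\<^bsub>P\<^esub>" if "x \<in> carrier P" for x
    using that P.smult_l_distr[of 1 "-1" x] P by simp
  have "sw P (\<lambda>x y. B x y \<oplus>\<^bsub>P\<^esub> (-1) \<odot>\<^bsub>P\<^esub> C x y) a = \<zero>\<^bsub>P\<^esub>"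
    by (rule sw_G_zero[OF P bil_diff[OF P B C] _ _ a]) (simp_all add: 1 G z bilD(3)[OF C])
  then have s: "sw P B a \<oplus>\<^bsub>P\<^esub> (-1) \<odot>\<^bsub>P\<^esub> sw P C a = \<zero>\<^bsub>P\<^esub>"
    by (simp add: sw_add[OF P B bil_smult[OF P C]] sw_smult[OF P C])
  have cl: "sw P B a \<in> carrier P" "sw P C a \<in> carrier P" by (intro sw_closed[OF P] B C)+
  have "sw P B a \<oplus>\<^bsub>P\<^esub> (-1) \<odot>\<^bsub>P\<^esub> sw P C a = sw P C a \<oplus>\<^bsub>P\<^esub> (-1) \<odot>\<^bsub>P\<^esub> sw P C a"
    using s z[OF cl(2)] by simp
  then show ?thesis using cl by simp
qed

abbreviation "SP \<equiv> sym_power LL"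

context
  fixes e assumes e: "lin A e" "\<forall>x. prim x \<longrightarrow> e x = x" "\<forall>a. prim (e a)" "e 1 = 0"
begin

text \<open>
  \<open>\<phi> n a\<close> is \<open>\<Sum> e(a\<^sub>1) \<cdots> e(a\<^sub>n)\<close> in \<open>S\<^sup>n L\<close>; it kills \<open>G n\<close> and maps a product \<open>x\<^sub>1 \<cdots> x\<^sub>n\<close> of primitive
  elements to \<open>n! x\<^sub>1 \<cdots> x\<^sub>n\<close>.
\<close>

primrec \<phi> :: "nat \<Rightarrow> 'a \<Rightarrow> ('a list \<Rightarrow>\<^sub>0 'k) set" where
  "\<phi> 0 a = \<epsilon> a \<odot>\<^bsub>SP 0\<^esub> LL.scls 0 (Poly_Mapping.single [] 1)"
| "\<phi> (Suc n) a = sw (SP (Suc n)) (\<lambda>u v. LL.mulL n (e u) (\<phi> n v)) a"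

lemma scls_closed: "p \<in> carrier (word_space LL n) \<Longrightarrow> LL.scls n p \<in> carrier (SP n)"
  by (rule linear_mapD(1)[OF LL.scls_linear])

lemma bil_mulL:
  assumes h: "lin (SP n) h" and f: "lin A f" "\<And>u. prim (f u)"
  shows "bil (SP (Suc n)) (\<lambda>u v. LL.mulL n (f u) (h v))"
  using bilinD[OF LL.mulL_bilin[of n]] linD[OF h] linA[OF f(1)] f(2)
  by (intro bilI linI) auto

lemma \<phi>_lin: "lin (SP n) (\<phi> n)"
proof (induction n)
  case 0
  interpret V: module KK "SP 0" by (rule LL.sym_power_module)
  have c: "LL.scls 0 (Poly_Mapping.single [] 1) \<in> carrier (SP 0)" by (rule scls_closed) simp
  show ?case
    using c V.smult_l_distr[OF _ _ c] V.smult_assoc1[OF _ _ c] by (intro linI) auto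
next
  case (Suc n)
  then show ?case
    using sw_lin[OF LL.sym_power_module bil_mulL[OF Suc e(1)]] e(3) by simp
qed

lemma bil_\<phi>: "bil (SP (Suc n)) (\<lambda>u v. LL.mulL n (e u) (\<phi> n v))"
  using bil_mulL[OF \<phi>_lin e(1)] e(3) by simp

lemma mulL_zero: "Z \<in> carrier (SP n) \<Longrightarrow> LL.mulL n 0 Z = \<zero>\<^bsub>SP (Suc n)\<^esub>"
  "prim x \<Longrightarrow> LL.mulL n x \<zero>\<^bsub>SP n\<^esub> = \<zero>\<^bsub>SP (Suc n)\<^esub>"
  using linear_map_zero[OF LL_module LL.sym_power_module bilinD(7)[OF LL.mulL_bilin]]
    linear_map_zero[OF LL.sym_power_module LL.sym_power_module bilinD(6)[OF LL.mulL_bilin]] by auto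

text \<open>The bilinear map behind the recursion vanishes on 1 \<otimes> A because e(1) = 0, and on
  A \<otimes> G n by induction, so \<open>sw_G_zero\<close> applies.\<close>

lemma \<phi>_G: "a \<in> G n \<Longrightarrow> \<phi> n a = \<zero>\<^bsub>SP n\<^esub>"
proof (induction n arbitrary: a)
  case 0
  then have "a = 0" by simp
  then show ?case using lin_zero[OF LL.sym_power_module \<phi>_lin[of 0]] by simp
next
  case (Suc n)
  show ?case
    unfolding \<phi>.simps
    by (rule sw_G_zero[OF LL.sym_power_module bil_\<phi> _ _ Suc.prems])
      (use Suc.IH e linD(1)[OF \<phi>_lin] mulL_zero in auto)
qed

text \<open>The comultiplication of xb places x either in the first factor, where e extracts it
  once, or in the remaining ones, where the induction hypothesis counts it n times. Commutativity of
  the symmetric algebra moves x to the front, for a total of n + 1.\<close>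

lemma \<phi>_prim_mult:
  assumes x: "prim x" and b: "b \<in> G (Suc n)"
  shows "\<phi> (Suc n) (x * b) = of_nat (Suc n) \<odot>\<^bsub>SP (Suc n)\<^esub> LL.mulL n x (\<phi> n b)"
  using b
proof (induction n arbitrary: b)
  have split: "\<phi> (Suc n) (x * b) = LL.mulL n x (\<phi> n b) \<oplus>\<^bsub>SP (Suc n)\<^esub>
      sw (SP (Suc n)) (\<lambda>u v. LL.mulL n (e u) (\<phi> n (x * v))) b" if b: "b \<in> G (Suc n)" for n b
  proof -
    interpret V: module KK "SP (Suc n)" by (rule LL.sym_power_module)
    note V = V.module_axioms
    have m: "lin (SP (Suc n)) (\<lambda>v. LL.mulL n x (\<phi> n v))"
      by (rule linear_map_comp[OF \<phi>_lin LL.mulL_linear]) (use x in simp)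
    \<comment> \<open>The value e(xu) is unknown for general u but may be replaced by \<epsilon>(u)
      x: both give x at u = 1, and for v in G n the factor \<phi>(v) is already zero. The counit law
      then evaluates the sum.\<close>
    have "sw (SP (Suc n)) (\<lambda>u v. LL.mulL n (e (x * u)) (\<phi> n v)) b =
        sw (SP (Suc n)) (\<lambda>u v. \<epsilon> u \<odot>\<^bsub>SP (Suc n)\<^esub> LL.mulL n x (\<phi> n v)) b"
    proof (rule sw_G_cong[OF V _ _ _ _ b])
      show "bil (SP (Suc n)) (\<lambda>u v. LL.mulL n (e (x * u)) (\<phi> n v))" by (rule bil_shift(1)[OF bil_\<phi>])
      show "bil (SP (Suc n)) (\<lambda>u v. \<epsilon> u \<odot>\<^bsub>SP (Suc n)\<^esub> LL.mulL n x (\<phi> n v))"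
        by (rule bil_scalar(1)[OF V \<epsilon>_lin m])
      show "LL.mulL n (e (x * 1)) (\<phi> n y) = \<epsilon> 1 \<odot>\<^bsub>SP (Suc n)\<^esub> LL.mulL n x (\<phi> n y)" for y
        using e x linD(1)[OF m] by (simp add: V)
      show "LL.mulL n (e (x * u)) (\<phi> n y) = \<epsilon> u \<odot>\<^bsub>SP (Suc n)\<^esub> LL.mulL n x (\<phi> n y)" if "y \<in> G n" for u y
        using e x that by (simp add: \<phi>_G mulL_zero)
    qed
    also have "\<dots> = LL.mulL n x (\<phi> n b)" by (rule sw_counit(1)[OF V m])
    finally show ?thesis
      using sw_prim_mult[OF V bil_\<phi> x, of b] by simp
  qed
  {
    case 0
    interpret V: module KK "SP (Suc 0)" by (rule LL.sym_power_module)
    interpret V0: module KK "SP 0" by (rule LL.sym_power_module)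
    have c: "LL.scls 0 (Poly_Mapping.single [] 1) \<in> carrier (SP 0)" by (rule scls_closed) simp
    have "\<phi> 0 (x * v) = \<zero>\<^bsub>SP 0\<^esub>" for v using counit_prim[OF x] c V0.module_axioms by simp
    then have "sw (SP (Suc 0)) (\<lambda>u v. LL.mulL 0 (e u) (\<phi> 0 (x * v))) b = \<zero>\<^bsub>SP (Suc 0)\<^esub>"
      using e(3) sw_zero[OF V.module_axioms] by (simp add: mulL_zero)
    moreover have "LL.mulL 0 x (\<phi> 0 b) \<in> carrier (SP (Suc 0))"
      using linear_mapD(1)[OF LL.mulL_linear, of x "\<phi> 0 b" 0] x linD(1)[OF \<phi>_lin[of 0]] by simp
    ultimately show ?case unfolding split[OF 0] using V.module_axioms by (simp del: \<phi>.simps)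
  next
    case (Suc m)
    let ?V = "SP (Suc (Suc m))"
    interpret V: module KK ?V by (rule LL.sym_power_module)
    note V = V.module_axioms
    have m: "lin (SP (Suc m)) (\<lambda>v. LL.mulL m x (\<phi> m v))"
      by (rule linear_map_comp[OF \<phi>_lin LL.mulL_linear]) (use x in simp)
    have mm: "linear_map KK (SP (Suc m)) ?V (LL.mulL (Suc m) x)"
      by (rule LL.mulL_linear) (use x in simp)
    have bm: "bil ?V (\<lambda>u v. LL.mulL (Suc m) (e u) (LL.mulL m x (\<phi> m v)))"
      using bil_mulL[OF m e(1)] e(3) by simp
    \<comment> \<open>The induction hypothesis covers v in G (m + 1) only. This is enough for
      \<open>sw_G_cong\<close>, since at u = 1 both sides vanish by e(1) = 0.\<close>
    have "sw ?V (\<lambda>u v. LL.mulL (Suc m) (e u) (\<phi> (Suc m) (x * v))) b =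
        sw ?V (\<lambda>u v. of_nat (Suc m) \<odot>\<^bsub>?V\<^esub> LL.mulL (Suc m) (e u) (LL.mulL m x (\<phi> m v))) b"
    proof (rule sw_G_cong[OF V _ _ _ _ Suc.prems])
      show "bil ?V (\<lambda>u v. LL.mulL (Suc m) (e u) (\<phi> (Suc m) (x * v)))" by (rule bil_shift(2)[OF bil_\<phi>])
      show "bil ?V (\<lambda>u v. of_nat (Suc m) \<odot>\<^bsub>?V\<^esub> LL.mulL (Suc m) (e u) (LL.mulL m x (\<phi> m v)))"
        by (rule bil_smult[OF V bm])
      show "LL.mulL (Suc m) (e 1) (\<phi> (Suc m) (x * y)) = of_nat (Suc m) \<odot>\<^bsub>?V\<^esub> LL.mulL (Suc m) (e 1) (LL.mulL m x (\<phi> m y))" for y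
        using e(4) linD(1)[OF m] linD(1)[OF \<phi>_lin[of "Suc m"]] by (simp add: mulL_zero del: \<phi>.simps)
      show "LL.mulL (Suc m) (e u) (\<phi> (Suc m) (x * y)) = of_nat (Suc m) \<odot>\<^bsub>?V\<^esub> LL.mulL (Suc m) (e u) (LL.mulL m x (\<phi> m y))"
        if "y \<in> G (Suc m)" for u y
        unfolding Suc.IH[OF that] using bilinD(5)[OF LL.mulL_bilin] e(3) linD(1)[OF m] by simp
    qed
    also have "\<dots> = of_nat (Suc m) \<odot>\<^bsub>?V\<^esub> sw ?V (\<lambda>u v. LL.mulL (Suc m) (e u) (LL.mulL m x (\<phi> m v))) b"
      by (rule sw_smult[OF V bm])
    also have "sw ?V (\<lambda>u v. LL.mulL (Suc m) (e u) (LL.mulL m x (\<phi> m v))) b =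
        sw ?V (\<lambda>u v. LL.mulL (Suc m) x (LL.mulL m (e u) (\<phi> m v))) b"
      using LL.mulL_comm e(3) x linD(1)[OF \<phi>_lin] by simp
    also have "\<dots> = LL.mulL (Suc m) x (\<phi> (Suc m) b)"
      unfolding \<phi>.simps by (rule sw_comp[OF LL.sym_power_module V bil_\<phi> mm, symmetric])
    finally have s: "sw ?V (\<lambda>u v. LL.mulL (Suc m) (e u) (\<phi> (Suc m) (x * v))) b =
        of_nat (Suc m) \<odot>\<^bsub>?V\<^esub> LL.mulL (Suc m) x (\<phi> (Suc m) b)" .
    have c: "LL.mulL (Suc m) x (\<phi> (Suc m) b) \<in> carrier ?V"
      using linear_mapD(1)[OF mm] linD(1)[OF \<phi>_lin] by blast
    show ?case
      unfolding split[OF Suc.prems] s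
      using V.smult_l_distr[OF _ _ c, of 1 "of_nat (Suc m)"] c V by (simp del: \<phi>.simps)
  }
qed

lemma \<phi>_prod_list:
  assumes "set w \<subseteq> Collect prim"
  shows "\<phi> (length w) (prod_list w) = fact (length w) \<odot>\<^bsub>SP (length w)\<^esub> LL.scls (length w) (Poly_Mapping.single w 1)"
  using assms
proof (induction w)
  case Nil
  then show ?case by simp
next
  case (Cons x w)
  let ?n = "length w"
  interpret V: module KK "SP (Suc ?n)" by (rule LL.sym_power_module)
  have x: "prim x" and w: "w \<in> lists (Collect prim)" using Cons.prems by auto
  have c: "LL.scls (Suc ?n) (Poly_Mapping.single (x # w) 1) \<in> carrier (SP (Suc ?n))"
    by (rule scls_closed) (use x w in auto)
  have c': "LL.scls ?n (Poly_Mapping.single w 1) \<in> carrier (SP ?n)"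
    by (rule scls_closed) (use w in auto)
  have "\<phi> (Suc ?n) (x * prod_list w) = of_nat (Suc ?n) \<odot>\<^bsub>SP (Suc ?n)\<^esub> LL.mulL ?n x (\<phi> ?n (prod_list w))"
    using \<phi>_prim_mult[OF x] prod_list_G[of w] Cons.prems by simp
  also have "\<dots> = of_nat (Suc ?n) \<odot>\<^bsub>SP (Suc ?n)\<^esub> (fact ?n \<odot>\<^bsub>SP (Suc ?n)\<^esub>
      LL.mulL ?n x (LL.scls ?n (Poly_Mapping.single w 1)))"
    using Cons bilinD(5)[OF LL.mulL_bilin] x c' by simp
  also have "LL.mulL ?n x (LL.scls ?n (Poly_Mapping.single w 1)) = LL.scls (Suc ?n) (Poly_Mapping.single (x # w) 1)"
    using x w LL.mulL_scls[of x "Poly_Mapping.single w 1" ?n] by simp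
  also have "of_nat (Suc ?n) \<odot>\<^bsub>SP (Suc ?n)\<^esub> (fact ?n \<odot>\<^bsub>SP (Suc ?n)\<^esub> LL.scls (Suc ?n) (Poly_Mapping.single (x # w) 1)) =
      fact (Suc ?n) \<odot>\<^bsub>SP (Suc ?n)\<^esub> LL.scls (Suc ?n) (Poly_Mapping.single (x # w) 1)"
    using V.smult_assoc1[OF _ _ c, of "of_nat (Suc ?n)" "fact ?n"] by (simp add: fact_Suc)
  finally show ?case by (simp del: \<phi>.simps)
qed

lemma \<phi>_ev:
  assumes "p \<in> carrier (word_space LL n)"
  shows "\<phi> n (ev p) = fact n \<odot>\<^bsub>SP n\<^esub> LL.scls n p"
proof (rule LL.word_space_linear_eq[OF LL.sym_power_module _ _ _ assms])
  interpret V: module KK "SP n" by (rule LL.sym_power_module)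
  show "linear_map KK (word_space LL n) (SP n) (\<lambda>p. \<phi> n (ev p))"
    unfolding word_space_eq by (rule linear_map_comp[OF ev_linear \<phi>_lin])
  show "linear_map KK (word_space LL n) (SP n) (\<lambda>p. fact n \<odot>\<^bsub>SP n\<^esub> LL.scls n p)"
    using linear_mapD[OF LL.scls_linear[of n]]
    by (intro linear_mapI) (simp_all add: V.smult_r_distr mult.commute V.smult_assoc1[symmetric, simplified])
  show "\<phi> n (ev (Poly_Mapping.single w 1)) = fact n \<odot>\<^bsub>SP n\<^esub> LL.scls n (Poly_Mapping.single w 1)"
    if "w \<in> lists (carrier LL)" "length w = n" for w
    using that \<phi>_prod_list[of w] by (auto simp: lists_eq_set)
qed

end

text \<open>The symmetrization kills \<open>ev p\<close>, yet equals n! times the class of p; in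
  characteristic zero that class must vanish. This is injectivity of \<open>S\<^sup>n L\<close>
  \<rightarrow> G (n + 1) / G n.\<close>

lemma ev_G_sym_rel:
  assumes p: "p \<in> carrier (word_space LL n)" and "ev p \<in> G n"
  shows "p \<in> sym_rel LL n"
proof -
  interpret V: module KK "SP n" by (rule LL.sym_power_module)
  obtain e where e: "lin A e" "\<forall>x. prim x \<longrightarrow> e x = x" "\<forall>a. prim (e a)" "e 1 = 0"
    by (rule prim_projection)
  have c: "LL.scls n p \<in> carrier (SP n)" by (rule linear_mapD(1)[OF LL.scls_linear p])
  have "fact n \<odot>\<^bsub>SP n\<^esub> LL.scls n p = \<zero>\<^bsub>SP n\<^esub>"
    using \<phi>_ev[OF e p] \<phi>_G[OF e assms(2)] by simp
  then have "inverse (fact n) \<odot>\<^bsub>SP n\<^esub> (fact n \<odot>\<^bsub>SP n\<^esub> LL.scls n p) = \<zero>\<^bsub>SP n\<^esub>" by simp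
  then have "LL.scls n p = \<zero>\<^bsub>SP n\<^esub>"
    using V.smult_assoc1[OF _ _ c, of "inverse (fact n)" "fact n"] c V.module_axioms by simp
  then show ?thesis
    using LL.S.coset_eq_H_iff[OF p] by (simp add: sym_power_eq quot_module_simps(3))
qed

text \<open>The component of top degree evaluates into G n as well, so it is a combination of
  symmetric relators; modulo the ideal of U(L) these are shorter words.\<close>

lemma ev_G_lower:
  assumes p: "p \<in> LL.low (Suc n)" and e: "ev p \<in> G n"
  obtains q where "q \<in> LL.low n" "p - q \<in> env_ideal LL"
proof -
  obtain t r where t: "t \<in> carrier (word_space LL n)" "r \<in> LL.low n" "p = t + r"
    by (rule LL.top_component[OF p])
  have "ev t = ev p - ev r" using t by simp
  then have "ev t \<in> G n" using e ev_low[OF t(2)] by (simp add: G_closed)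
  then obtain q where q: "q \<in> LL.low n" "t - q \<in> env_ideal LL"
    using LL.sym_rel_env_ideal[OF ev_G_sym_rel[OF t(1)]] by blast
  show ?thesis
    by (rule that[of "q + r"]) (use q t LL.low_closed(1) in \<open>auto simp: algebra_simps\<close>)
qed

text \<open>Zero lies in every G n, so p can be replaced modulo the ideal by shorter and shorter
  combinations with value zero, until no words are left.\<close>

lemma ev_zero_env_ideal:
  assumes "p \<in> carrier (word_alg LL)" "ev p = 0" shows "p \<in> env_ideal LL"
proof -
  have "p \<in> LL.low n \<Longrightarrow> ev p = 0 \<Longrightarrow> p \<in> env_ideal LL" for n p
  proof (induction n arbitrary: p)
    case 0
    then show ?case using LL.env_ideal_closed(3) by (simp add: LL.low_def)
  next
    case (Suc n)
    obtain q where q: "q \<in> LL.low n" "p - q \<in> env_ideal LL"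
      by (rule ev_G_lower[OF Suc.prems(1)]) (use Suc.prems(2) G_closed in auto)
    have "ev q = 0" using ev_env_ideal[OF q(2)] Suc.prems by simp
    then show ?case using LL.env_ideal_closed(1)[OF q(2) Suc.IH[OF q(1)]] by simp
  qed
  \<comment> \<open>The inserted 0 keeps the maximum meaningful when p has empty support.\<close>
  moreover have "p \<in> LL.low (Suc (Max (insert 0 (length ` Poly_Mapping.keys p))))"
    using assms(1) by (auto simp: LL.low_def less_Suc_eq_le)
  ultimately show ?thesis using assms by blast
qed

end

section \<open>The structure theorem\<close>

lemma module_cong:
  assumes "module R V" "carrier W = carrier V" "add W = add V" "\<zero>\<^bsub>W\<^esub> = \<zero>\<^bsub>V\<^esub>" "module.smult W = module.smult V"
  shows "module R W"
proof -
  interpret V: module R V by fact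
  show ?thesis
  proof (rule moduleI)
    show "cring R" by (rule V.R.is_cring)
    show "abelian_group W"
    proof (rule abelian_groupI)
      fix x assume "x \<in> carrier W"
      then show "\<exists>y\<in>carrier W. y \<oplus>\<^bsub>W\<^esub> x = \<zero>\<^bsub>W\<^esub>"
        by (intro bexI[of _ "\<ominus>\<^bsub>V\<^esub> x"]) (auto simp: assms V.M.l_neg)
    qed (auto simp: assms V.M.a_ac)
  qed (auto simp: assms V.smult_l_distr V.smult_r_distr V.smult_assoc1)
qed

lemma a_r_coset_carrier_update [simp]: "H +>\<^bsub>M\<lparr>carrier := K\<rparr>\<^esub> x = H +>\<^bsub>M\<^esub> x"
  by (simp add: a_r_coset_def r_coset_def)

text \<open>Graded pieces are quotients of one filtration step by the previous one, taken inside a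
  record whose carrier has been shrunk.\<close>

lemma submodule_restrict:
  assumes M: "module R M" and H: "submodule H R M" and K: "submodule K R M" and HK: "H \<subseteq> K"
  shows "quot_mod R (M\<lparr>carrier := K\<rparr>) H"
proof -
  interpret M: module R M by fact
  interpret K: module R "M\<lparr>carrier := K\<rparr>" by (rule submodule.submodule_is_module[OF K M])
  show ?thesis
    by (intro quot_mod.intro quot_mod_axioms.intro K.module_axioms K.submoduleI')
      (use HK M.submoduleE[OF H] M.submodule_zero[OF H] in auto)
qed

text \<open>If the preimage of H' is exactly H, the induced map is both well defined and injective;
  surjectivity is required only modulo H'. Both isomorphisms of graded pieces are obtained from this
  criterion.\<close>

lemma quot_map_iso:
  assumes M: "quot_mod R M H" and N: "quot_mod R N H'" and f: "linear_map R M N f"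
    and fH: "\<And>x. x \<in> carrier M \<Longrightarrow> f x \<in> H' \<longleftrightarrow> x \<in> H"
    and surj: "\<And>y. y \<in> carrier N \<Longrightarrow> \<exists>x\<in>carrier M. \<exists>h\<in>H'. y = h \<oplus>\<^bsub>N\<^esub> f x"
  shows "linear_iso R (quot_module M H) (quot_module N H') (\<lambda>Z. \<Union>x\<in>Z. H' +>\<^bsub>N\<^esub> f x)"
proof -
  interpret M: quot_mod R M H by fact
  interpret N: quot_mod R N H' by fact
  let ?g = "\<lambda>Z. \<Union>x\<in>Z. H' +>\<^bsub>N\<^esub> f x"
  have g: "?g (H +>\<^bsub>M\<^esub> x) = H' +>\<^bsub>N\<^esub> f x" if x: "x \<in> carrier M" for x
  proof (rule M.coset_UN[OF _ x])
    fix x y assume xy: "x \<in> carrier M" "y \<in> carrier M" "x \<ominus>\<^bsub>M\<^esub> y \<in> H"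
    have "f x \<ominus>\<^bsub>N\<^esub> f y \<in> H'"
      using fH[of "x \<ominus>\<^bsub>M\<^esub> y"] xy linear_map_minus[OF M.module_axioms N.module_axioms f] by simp
    then show "H' +>\<^bsub>N\<^esub> f x = H' +>\<^bsub>N\<^esub> f y"
      using N.coset_eq_iff linear_mapD(1)[OF f] xy by simp
  qed
  have lin: "linear_map R (quot_module M H) (quot_module N H') ?g"
  proof (rule linear_mapI)
    fix Z assume "Z \<in> carrier (quot_module M H)"
    then show "?g Z \<in> carrier (quot_module N H')"
      by (elim M.quot_cases) (simp only: g N.coset_carrier linear_mapD(1)[OF f])
  next
    fix Z Y assume "Z \<in> carrier (quot_module M H)" "Y \<in> carrier (quot_module M H)"
    then show "?g (Z \<oplus>\<^bsub>quot_module M H\<^esub> Y) = ?g Z \<oplus>\<^bsub>quot_module N H'\<^esub> ?g Y"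
      by (elim M.quot_cases) (simp only: M.coset_add g N.coset_add linear_mapD(1,2)[OF f] M.M.a_closed)
  next
    fix c Z assume "c \<in> carrier R" "Z \<in> carrier (quot_module M H)"
    then show "?g (c \<odot>\<^bsub>quot_module M H\<^esub> Z) = c \<odot>\<^bsub>quot_module N H'\<^esub> ?g Z"
      by (elim M.quot_cases) (simp only: M.coset_smult g N.coset_smult linear_mapD(1,3)[OF f] M.smult_closed)
  qed
  have "inj_on ?g (carrier (quot_module M H))"
  proof (rule linear_map_inj_on[OF M.quot_is_module N.quot_is_module lin])
    fix Z assume "Z \<in> carrier (quot_module M H)" and z: "?g Z = \<zero>\<^bsub>quot_module N H'\<^esub>"
    then obtain x where x: "x \<in> carrier M" "Z = H +>\<^bsub>M\<^esub> x" by (elim M.quot_cases)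
    have "H' +>\<^bsub>N\<^esub> f x = H'" using z unfolding x(2) g[OF x(1)] by (simp add: quot_module_simps(3))
    then have "x \<in> H" using N.coset_eq_H_iff linear_mapD(1)[OF f x(1)] fH[OF x(1)] by simp
    then show "Z = \<zero>\<^bsub>quot_module M H\<^esub>" using M.coset_eq_H_iff x by (simp add: quot_module_simps(3))
  qed
  moreover have "?g ` carrier (quot_module M H) = carrier (quot_module N H')"
  proof
    show "?g ` carrier (quot_module M H) \<subseteq> carrier (quot_module N H')"
      using linear_mapD(1)[OF lin] by blast
    show "carrier (quot_module N H') \<subseteq> ?g ` carrier (quot_module M H)"
    proof
      fix Y assume "Y \<in> carrier (quot_module N H')"
      then obtain y where y: "y \<in> carrier N" "Y = H' +>\<^bsub>N\<^esub> y" by (rule N.quot_cases)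
      obtain x h where x: "x \<in> carrier M" "h \<in> H'" "y = h \<oplus>\<^bsub>N\<^esub> f x" using surj[OF y(1)] by blast
      have h: "h \<in> carrier N" and fx: "f x \<in> carrier N" using x(2) N.H_subset linear_mapD(1)[OF f x(1)] by auto
      interpret Q: module R "quot_module N H'" by (rule N.quot_is_module)
      have "Y = (H' +>\<^bsub>N\<^esub> h) \<oplus>\<^bsub>quot_module N H'\<^esub> (H' +>\<^bsub>N\<^esub> f x)"
        unfolding y(2) x(3) by (rule N.coset_add[OF h fx, symmetric])
      also have "H' +>\<^bsub>N\<^esub> h = \<zero>\<^bsub>quot_module N H'\<^esub>"
        using N.coset_eq_H_iff[OF h] x(2) by (simp add: quot_module_simps(3))
      also have "\<dots> \<oplus>\<^bsub>quot_module N H'\<^esub> (H' +>\<^bsub>N\<^esub> f x) = H' +>\<^bsub>N\<^esub> f x"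
        by (rule Q.M.l_zero[OF N.coset_carrier[OF fx]])
      also have "\<dots> = ?g (H +>\<^bsub>M\<^esub> x)" by (rule g[OF x(1), symmetric])
      finally show "Y \<in> ?g ` carrier (quot_module M H)" using M.coset_carrier[OF x(1)] by blast
    qed
  qed
  ultimately show ?thesis using lin by (simp add: linear_iso_def bij_betw_def)
qed

section \<open>Structure maps of the enveloping algebra and maps between tensor products\<close>

lemma env_simps [simp]:
  "carrier (env L) = carrier (env_alg L)" "add (env L) = add (env_alg L)" "\<zero>\<^bsub>env L\<^esub> = \<zero>\<^bsub>env_alg L\<^esub>"
  "\<one>\<^bsub>env L\<^esub> = \<one>\<^bsub>env_alg L\<^esub>" "monoid.mult (env L) = monoid.mult (env_alg L)" "module.smult (env L) = module.smult (env_alg L)"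
  by (simp_all add: env_def Let_def module.defs)

definition env_delta :: "('k::field, 'v, 'z) lie_alg_scheme \<Rightarrow> 'v \<Rightarrow>
    (('v list \<Rightarrow>\<^sub>0 'k) set \<times> ('v list \<Rightarrow>\<^sub>0 'k) set \<Rightarrow>\<^sub>0 'k) set" where
  "env_delta L x = pure_tensor (env_alg L) (env_alg L) (env_incl L x) \<one>\<^bsub>env_alg L\<^esub>
     \<oplus>\<^bsub>tensor (env_alg L) (env_alg L)\<^esub> pure_tensor (env_alg L) (env_alg L) \<one>\<^bsub>env_alg L\<^esub> (env_incl L x)"

lemma env_comult:
  "comult (env L) Z = the_elem (lext (tensor (env_alg L) (env_alg L))
     (\<lambda>w. foldr (\<lambda>x t. env_delta L x \<otimes>\<^bsub>tensor (env_alg L) (env_alg L)\<^esub> t) w \<one>\<^bsub>tensor (env_alg L) (env_alg L)\<^esub>) ` Z)"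
  "counit (env L) Z = the_elem ((\<lambda>p. Poly_Mapping.lookup p []) ` Z)"
  by (simp_all add: env_def Let_def module.defs bialg.defs env_delta_def)

text \<open>\<open>env\<close> adds only comultiplication and counit to \<open>env_alg\<close>, and
  the tensor construction reads neither of these fields.\<close>

lemma tensor_env [simp]:
  "tensor (env L) (env L) = tensor (env_alg L) (env_alg L)"
  "pure_tensor (env L) (env L) = pure_tensor (env_alg L) (env_alg L)"
proof -
  have 1: "tens_free (env L) (env L) = tens_free (env_alg L) (env_alg L)"
    by (simp add: tens_free_def)
  have 2: "bilin_rel (env L) (env L) = bilin_rel (env_alg L) (env_alg L)"
    by (simp add: bilin_rel_def 1)
  show "tensor (env L) (env L) = tensor (env_alg L) (env_alg L)"
    "pure_tensor (env L) (env L) = pure_tensor (env_alg L) (env_alg L)"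
    by (simp_all add: tensor_def pure_tensor_def[abs_def] 1 2)
qed

context
  fixes V :: "('k::field, 'v, 'y) module_scheme" and W :: "('k, 'w, 'z) module_scheme"
    and V' :: "('k, 'v2, 'y2) module_scheme" and W' :: "('k, 'w2, 'z2) module_scheme" and f g
  assumes V: "module KK V" and W: "module KK W" and V': "module KK V'" and W': "module KK W'"
    and f: "linear_map KK V V' f" and g: "linear_map KK W W' g"
begin

lemma bilin_tensor_map: "bilin V W (tensor V' W') (\<lambda>v w. pure_tensor V' W' (f v) (g w))"
  by (rule bilin_comp[OF bilin_pure_tensor[OF V' W'] f g, of "tensor V' W'" "\<lambda>t. t"]) (simp add: linear_map_def)

lemma tensor_map_linear: "linear_map KK (tensor V W) (tensor V' W') (tensor_map V' W' f g)"
  unfolding tensor_map_def[abs_def] by (rule tlift_linear[OF V W tensor_module[OF V' W'] bilin_tensor_map])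

lemma tensor_map_pure:
  "v \<in> carrier V \<Longrightarrow> w \<in> carrier W \<Longrightarrow> tensor_map V' W' f g (pure_tensor V W v w) = pure_tensor V' W' (f v) (g w)"
  unfolding tensor_map_def by (rule tlift_pure[OF V W tensor_module[OF V' W'] bilin_tensor_map])

end

text \<open>The inverse of f, tensored with itself, is a left inverse.\<close>

lemma tensor_map_bij:
  assumes V: "module KK V" and V': "module KK V'" and f: "linear_map KK V V' f"
    and b: "bij_betw f (carrier V) (carrier V')"
  shows "inj_on (tensor_map V' V' f f) (carrier (tensor V V))"
proof -
  let ?h = "inv_into (carrier V) f"
  have h: "linear_map KK V' V ?h" by (rule linear_map_inv_into[OF f b V])
  have "tensor_map V V ?h ?h (tensor_map V' V' f f t) = t" if t: "t \<in> carrier (tensor V V)" for t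
  proof (rule tensor_linear_eq[OF V V tensor_module[OF V V] _ _ _ t])
    show "linear_map KK (tensor V V) (tensor V V) (\<lambda>t. tensor_map V V ?h ?h (tensor_map V' V' f f t))"
      by (rule linear_map_comp[OF tensor_map_linear[OF V V V' V' f f] tensor_map_linear[OF V' V' V V h h]])
    show "linear_map KK (tensor V V) (tensor V V) (\<lambda>t. t)" by (simp add: linear_map_def)
    show "tensor_map V V ?h ?h (tensor_map V' V' f f (pure_tensor V V v w)) = pure_tensor V V v w"
      if "v \<in> carrier V" "w \<in> carrier V" for v w
      using that linear_mapD(1)[OF f] b
      by (simp add: tensor_map_pure[OF V V V' V' f f] tensor_map_pure[OF V' V' V V h h] bij_betw_def)
  qed
  then show ?thesis by (rule inj_on_inverseI)
qed

lemma tensor_map_mult: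
  assumes V: "assoc_alg V" and V': "assoc_alg V'" and f: "linear_map KK V V' f"
    and m: "\<And>x y. x \<in> carrier V \<Longrightarrow> y \<in> carrier V \<Longrightarrow> f (x \<otimes>\<^bsub>V\<^esub> y) = f x \<otimes>\<^bsub>V'\<^esub> f y"
    and s: "s \<in> carrier (tensor V V)" and t: "t \<in> carrier (tensor V V)"
  shows "tensor_map V' V' f f (s \<otimes>\<^bsub>tensor V V\<^esub> t) = tensor_map V' V' f f s \<otimes>\<^bsub>tensor V' V'\<^esub> tensor_map V' V' f f t"
proof -
  interpret V: assoc_alg V by fact
  interpret V': assoc_alg V' by fact
  interpret VV: assoc_alg "tensor V V" by (rule tensor_assoc_alg[OF V V])
  interpret VV': assoc_alg "tensor V' V'" by (rule tensor_assoc_alg[OF V' V'])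
  note mV = V.module_axioms and mV' = V'.module_axioms
  let ?H = "tensor_map V' V' f f"
  note H = tensor_map_linear[OF mV mV mV' mV' f f] and Hp = tensor_map_pure[OF mV mV mV' mV' f f]
  note Hl = linear_mapD[OF H]
  note pc = bilinD(1)[OF bilin_pure_tensor[OF mV mV]] bilinD(1)[OF bilin_pure_tensor[OF mV' mV']]
  note fc = linear_mapD(1)[OF f]
  have 1: "?H (pure_tensor V V u v \<otimes>\<^bsub>tensor V V\<^esub> t) = ?H (pure_tensor V V u v) \<otimes>\<^bsub>tensor V' V'\<^esub> ?H t"
    if uv: "u \<in> carrier V" "v \<in> carrier V" and t: "t \<in> carrier (tensor V V)" for u v t
  proof (rule tensor_linear_eq[OF mV mV VV'.module_axioms _ _ _ t])
    show "linear_map KK (tensor V V) (tensor V' V') (\<lambda>t. ?H (pure_tensor V V u v \<otimes>\<^bsub>tensor V V\<^esub> t))"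
      using uv pc Hl by (intro linear_mapI) (simp_all add: VV.r_distr VV.smult_mult_right)
    show "linear_map KK (tensor V V) (tensor V' V') (\<lambda>t. ?H (pure_tensor V V u v) \<otimes>\<^bsub>tensor V' V'\<^esub> ?H t)"
      using uv pc Hl by (intro linear_mapI) (simp_all add: VV'.r_distr VV'.smult_mult_right)
    show "?H (pure_tensor V V u v \<otimes>\<^bsub>tensor V V\<^esub> pure_tensor V V u' v') =
        ?H (pure_tensor V V u v) \<otimes>\<^bsub>tensor V' V'\<^esub> ?H (pure_tensor V V u' v')"
      if "u' \<in> carrier V" "v' \<in> carrier V" for u' v'
      using uv that fc by (simp add: pure_tensor_mult[OF V V] pure_tensor_mult[OF V' V'] Hp m)
  qed
  show ?thesis
  proof (rule tensor_linear_eq[OF mV mV VV'.module_axioms _ _ _ s])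
    show "linear_map KK (tensor V V) (tensor V' V') (\<lambda>s. ?H (s \<otimes>\<^bsub>tensor V V\<^esub> t))"
      using t Hl by (intro linear_mapI) (simp_all add: VV.l_distr VV.smult_mult_left)
    show "linear_map KK (tensor V V) (tensor V' V') (\<lambda>s. ?H s \<otimes>\<^bsub>tensor V' V'\<^esub> ?H t)"
      using t Hl by (intro linear_mapI) (simp_all add: VV'.l_distr VV'.smult_mult_left)
  qed (rule 1[OF _ _ t])
qed

section \<open>The enveloping algebra of the primitive elements compared with A\<close>

context cbialg0
begin

abbreviation "U \<equiv> env_alg LL"
abbreviation ecls :: "('a list \<Rightarrow>\<^sub>0 'k) \<Rightarrow> ('a list \<Rightarrow>\<^sub>0 'k) set" where
  "ecls p \<equiv> env_ideal LL +>\<^bsub>word_alg LL\<^esub> p"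

sublocale U: assoc_alg U by (rule LL.env_alg_assoc_alg)

lemma U_cases:
  assumes "Z \<in> carrier U" obtains p where "p \<in> carrier (word_alg LL)" "Z = ecls p"
  using assms unfolding env_alg_def by (rule LL.E.quot_cases)

lemma ecls_linear: "linear_map KK (word_alg LL) U ecls"
  unfolding env_alg_def by (rule LL.E.coset_linear)

lemma ecls_closed: "p \<in> carrier (word_alg LL) \<Longrightarrow> ecls p \<in> carrier U"
  by (rule linear_mapD(1)[OF ecls_linear])

lemma ecls_mult: "p \<in> carrier (word_alg LL) \<Longrightarrow> q \<in> carrier (word_alg LL) \<Longrightarrow>
    ecls p \<otimes>\<^bsub>U\<^esub> ecls q = ecls (pm_mult (@) p q)"
  using LL.W.quot_mult[OF LL.env_ideal, of p q] by (simp add: env_alg_def)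

lemma ecls_one: "\<one>\<^bsub>U\<^esub> = ecls (Poly_Mapping.single [] 1)"
  by (simp add: env_alg_def quot_module_simps(6))

lemma env_map_ecls:
  assumes "p \<in> carrier (word_alg LL)" shows "env_map A (ecls p) = ev p"
  unfolding env_map_def ev_def[symmetric]
  by (rule LL.E.quot_lift(1)[OF A_module ev_linear _ assms]) (simp add: ev_env_ideal)

lemma env_map_linear: "linear_map KK U A (env_map A)"
  unfolding env_map_def[abs_def] ev_def[symmetric] env_alg_def
  by (rule LL.E.quot_lift(2)[OF A_module ev_linear]) (simp add: ev_env_ideal)

lemma env_map_mult: "x \<in> carrier U \<Longrightarrow> y \<in> carrier U \<Longrightarrow> env_map A (x \<otimes>\<^bsub>U\<^esub> y) = env_map A x * env_map A y"
proof -
  assume "x \<in> carrier U" "y \<in> carrier U"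
  then obtain p q where p: "p \<in> carrier (word_alg LL)" "x = ecls p" and q: "q \<in> carrier (word_alg LL)" "y = ecls q"
    by (elim U_cases)
  have pq: "pm_mult (@) p q \<in> carrier (word_alg LL)" using LL.W.m_closed[OF p(1) q(1)] by simp
  show ?thesis
    unfolding p(2) q(2) ecls_mult[OF p(1) q(1)] env_map_ecls[OF pq] env_map_ecls[OF p(1)] env_map_ecls[OF q(1)]
    by (rule ev_mult)
qed

lemma env_map_inj: "inj_on (env_map A) (carrier U)"
proof (rule linear_map_inj_on[OF U.module_axioms A_module env_map_linear])
  fix Z assume Z: "Z \<in> carrier U" "env_map A Z = \<zero>\<^bsub>A\<^esub>"
  obtain p where p: "p \<in> carrier (word_alg LL)" "Z = ecls p" using Z(1) by (rule U_cases)
  have "ev p = 0" using Z(2) env_map_ecls[OF p(1)] p(2) by simp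
  with p show "Z = \<zero>\<^bsub>U\<^esub>"
    using ev_zero_env_ideal[of p] LL.E.coset_eq_H_iff[of p] by (simp add: env_alg_def quot_module_simps(3))
qed

lemma env_incl_ecls: "env_incl LL x = ecls (Poly_Mapping.single [x] 1)"
  by (simp add: env_incl_def)

lemma env_map_env_incl [simp]: "prim x \<Longrightarrow> env_map A (env_incl LL x) = x"
  unfolding env_incl_ecls by (subst env_map_ecls) auto

abbreviation "hh \<equiv> tensor_map A A (env_map A) (env_map A)"
abbreviation "UU \<equiv> tensor U U"

lemma hh_linear: "linear_map KK UU (tensor A A) hh"
  by (rule tensor_map_linear[OF U.module_axioms U.module_axioms A_module A_module env_map_linear env_map_linear])

lemma hh_pure: "u \<in> carrier U \<Longrightarrow> v \<in> carrier U \<Longrightarrow>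
    hh (pure_tensor U U u v) = pure_tensor A A (env_map A u) (env_map A v)"
  by (rule tensor_map_pure[OF U.module_axioms U.module_axioms A_module A_module env_map_linear env_map_linear])

lemma hh_mult: "s \<in> carrier UU \<Longrightarrow> t \<in> carrier UU \<Longrightarrow> hh (s \<otimes>\<^bsub>UU\<^esub> t) = hh s \<otimes>\<^bsub>tensor A A\<^esub> hh t"
  by (rule tensor_map_mult[OF U.assoc_alg_axioms A.assoc_alg_axioms env_map_linear]) (simp_all add: env_map_mult)

definition word_comult :: "'a list \<Rightarrow> (('a list \<Rightarrow>\<^sub>0 'k) set \<times> ('a list \<Rightarrow>\<^sub>0 'k) set \<Rightarrow>\<^sub>0 'k) set" where
  "word_comult w = foldr (\<lambda>x t. env_delta LL x \<otimes>\<^bsub>UU\<^esub> t) w \<one>\<^bsub>UU\<^esub>"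

interpretation UU: assoc_alg UU by (rule tensor_assoc_alg[OF U.assoc_alg_axioms U.assoc_alg_axioms])

lemma UU_pure: "u \<in> carrier U \<Longrightarrow> v \<in> carrier U \<Longrightarrow> pure_tensor U U u v \<in> carrier UU"
  by (rule bilinD(1)[OF bilin_pure_tensor[OF U.module_axioms U.module_axioms]])

lemma env_map_one: "env_map A \<one>\<^bsub>U\<^esub> = 1"
  unfolding ecls_one by (subst env_map_ecls) auto

lemma env_incl_closed: "prim x \<Longrightarrow> env_incl LL x \<in> carrier U"
  unfolding env_incl_ecls by (rule ecls_closed) auto

lemma hh_primitive:
  assumes "u \<in> carrier U"
  shows "hh (pure_tensor U U u \<one>\<^bsub>U\<^esub> \<oplus>\<^bsub>UU\<^esub> pure_tensor U U \<one>\<^bsub>U\<^esub> u) =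
    pure_tensor A A (env_map A u) 1 \<oplus>\<^bsub>tensor A A\<^esub> pure_tensor A A 1 (env_map A u)"
  using assms linear_mapD(2)[OF hh_linear UU_pure UU_pure] hh_pure by (simp add: env_map_one)

lemma env_delta_closed: "prim x \<Longrightarrow> env_delta LL x \<in> carrier UU"
  unfolding env_delta_def using env_incl_closed by (intro UU.a_closed UU_pure) auto

lemma hh_env_delta: "prim x \<Longrightarrow> hh (env_delta LL x) = \<Delta> x"
  unfolding env_delta_def using hh_primitive[OF env_incl_closed] by (simp add: prim_def[of x])

text \<open>\<open>hh\<close> is multiplicative and sends the prescribed comultiplication of a
  generator to \<open>\<Delta>\<close> of that primitive element; multiplicativity of
  \<open>\<Delta>\<close> then gives all words.\<close>

lemma word_comult:
  assumes "set w \<subseteq> Collect prim"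
  shows "word_comult w \<in> carrier UU \<and> hh (word_comult w) = \<Delta> (prod_list w)"
  using assms
proof (induction w)
  case Nil
  have "hh \<one>\<^bsub>UU\<^esub> = \<one>\<^bsub>tensor A A\<^esub>"
    by (simp add: tensor_one[OF U.assoc_alg_axioms U.assoc_alg_axioms] tensor_one[OF A.assoc_alg_axioms A.assoc_alg_axioms]
        hh_pure env_map_one)
  then show ?case using B.comult_one by (simp add: word_comult_def)
next
  case (Cons x w)
  have e: "word_comult (x # w) = env_delta LL x \<otimes>\<^bsub>UU\<^esub> word_comult w" by (simp add: word_comult_def)
  show ?case
    unfolding e using Cons env_delta_closed[of x] hh_env_delta[of x] hh_mult B.comult_mult[of x "prod_list w"] by simp
qed

lemma lext_word_comult:
  assumes p: "p \<in> carrier (word_alg LL)"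
  shows "lext UU word_comult p \<in> carrier UU" "hh (lext UU word_comult p) = \<Delta> (ev p)"
proof -
  have c: "word_comult w \<in> carrier UU" if "w \<in> lists (Collect prim)" for w
    using word_comult[of w] that by (auto simp: lists_eq_set)
  note l = lext_linear[OF UU.module_axioms, of "lists (carrier LL)" word_comult "(@)" "[]"]
  show "lext UU word_comult p \<in> carrier UU" using linear_mapD(1)[OF l p] c by simp
  show "hh (lext UU word_comult p) = \<Delta> (ev p)"
  proof (rule free_linear_eq[OF tensor_module[OF A_module A_module] _ _ _ p])
    show "linear_map KK (word_alg LL) (tensor A A) (\<lambda>p. hh (lext UU word_comult p))"
      by (rule linear_map_comp[OF l hh_linear]) (use c in simp)
    show "linear_map KK (word_alg LL) (tensor A A) (\<lambda>p. \<Delta> (ev p))"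
      by (rule linear_map_comp[OF ev_linear \<Delta>_lin])
    show "hh (lext UU word_comult (Poly_Mapping.single w 1)) = \<Delta> (ev (Poly_Mapping.single w 1))"
      if "w \<in> lists (carrier LL)" for w
      using that word_comult[of w] c[of w] UU.module_axioms
      by (auto simp: lext_single[OF UU.module_axioms] lists_eq_set)
  qed
qed

context
  assumes exhaustive: "\<And>a. \<exists>n. a \<in> G n"
begin

text \<open>Every element lies in some G n, whose elements are values of words in L; this gives
  surjectivity.\<close>

lemma env_map_bij: "bij_betw (env_map A) (carrier U) (carrier A)"
proof -
  have "a \<in> env_map A ` carrier U" for a
  proof -
    obtain n where "a \<in> G n" using exhaustive by blast
    then obtain p where p: "p \<in> LL.low n" "a = ev p" using G_ev by auto
    then show ?thesis
      using env_map_ecls[OF LL.low_closed(4)[OF p(1)]] ecls_closed[OF LL.low_closed(4)[OF p(1)]] by (metis imageI)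
  qed
  then show ?thesis using env_map_inj by (auto simp: bij_betw_def)
qed

lemma hh_inj: "inj_on hh (carrier UU)"
  by (rule tensor_map_bij[OF U.module_axioms A_module env_map_linear env_map_bij])

text \<open>
  That the comultiplication of \<open>U(L)\<close> is constant on cosets is deduced from the corresponding fact in
  \<open>A\<close>, because \<open>hh\<close> is injective.
\<close>

lemma comult_env_ecls:
  assumes p: "p \<in> carrier (word_alg LL)"
  shows "comult (env LL) (ecls p) = lext UU word_comult p"
  unfolding env_comult word_comult_def[abs_def, symmetric]
proof (rule LL.E.quot_lift(1)[OF UU.module_axioms _ _ p])
  show "linear_map KK (word_alg LL) UU (lext UU word_comult)"
    by (rule lext_linear[OF UU.module_axioms]) (use word_comult in \<open>auto simp: lists_eq_set\<close>)
  fix x assume x: "x \<in> env_ideal LL"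
  then have xc: "x \<in> carrier (word_alg LL)" using LL.E.H_subset by blast
  have "hh (lext UU word_comult x) = hh \<zero>\<^bsub>UU\<^esub>"
    unfolding lext_word_comult(2)[OF xc] ev_env_ideal[OF x]
      linear_map_zero[OF UU.module_axioms tensor_module[OF A_module A_module] hh_linear]
    using lin_zero[OF tensor_module[OF A_module A_module] \<Delta>_lin] .
  then show "lext UU word_comult x = \<zero>\<^bsub>UU\<^esub>"
    using inj_onD[OF hh_inj] lext_word_comult(1)[OF xc] by simp
qed

lemma comult_env:
  assumes "Z \<in> carrier U"
  shows "comult (env LL) Z \<in> carrier UU" "hh (comult (env LL) Z) = \<Delta> (env_map A Z)"
proof -
  obtain p where p: "p \<in> carrier (word_alg LL)" "Z = ecls p" using assms by (rule U_cases)
  show "comult (env LL) Z \<in> carrier UU" "hh (comult (env LL) Z) = \<Delta> (env_map A Z)"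
    unfolding p(2) comult_env_ecls[OF p(1)] env_map_ecls[OF p(1)] by (rule lext_word_comult[OF p(1)])+
qed

text \<open>Primitive elements have counit zero, so only the empty word contributes to the counit of
  a value. The coefficient of the empty word therefore factors through evaluation and is constant on
  cosets.\<close>

lemma counit_env:
  assumes "Z \<in> carrier U" shows "counit (env LL) Z = \<epsilon> (env_map A Z)"
proof -
  obtain p where p: "p \<in> carrier (word_alg LL)" "Z = ecls p" using assms by (rule U_cases)
  have *: "Poly_Mapping.lookup p [] = \<epsilon> (ev p)" if p: "p \<in> carrier (word_alg LL)" for p
  proof -
    have "Poly_Mapping.keys p \<subseteq> lists (Collect prim)" using p by simp
    then show ?thesis
    proof (induction rule: free_induct)
      case (single w c q)
      then show ?case
        by (cases w) (auto simp: lookup_add lookup_single counit_prim)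
    qed simp
  qed
  have "counit (env LL) (ecls p) = Poly_Mapping.lookup p []"
    unfolding env_comult
  proof (rule LL.E.coset_the_elem[OF _ p(1)])
    fix x y assume xy: "x \<in> carrier (word_alg LL)" "y \<in> carrier (word_alg LL)" "x \<ominus>\<^bsub>word_alg LL\<^esub> y \<in> env_ideal LL"
    then have "ev x = ev y" using ev_env_ideal[of "x - y"] by simp
    then show "Poly_Mapping.lookup x [] = Poly_Mapping.lookup y []"
      using *[OF xy(1)] *[OF xy(2)] by simp
  qed
  then show ?thesis using p *[OF p(1)] env_map_ecls[OF p(1)] by simp
qed

theorem env_bialgebra_iso: "bialgebra_iso (env LL) A (env_map A)"
  unfolding bialgebra_iso_def linear_iso_def
proof (intro conjI ballI)
  show "linear_map KK (env LL) A (env_map A)"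
    using env_map_linear by (simp add: linear_map_def)
  show "bij_betw (env_map A) (carrier (env LL)) (carrier A)" using env_map_bij by simp
  show "env_map A \<in> ring_hom (env LL) A"
    by (rule ring_hom_memI) (use linear_mapD[OF env_map_linear] env_map_mult env_map_one in auto)
qed (simp_all add: comult_env counit_env)

text \<open>Injectivity of \<open>hh\<close> transfers primitivity: u is primitive in U(L) if and
  only if its image in A is. The restriction of \<open>env_map\<close> is then inverse to the
  inclusion of L.\<close>

theorem env_primitives: "linear_iso KK LL ((env LL)\<lparr>carrier := primitives (env LL)\<rparr>) (env_incl LL)"
proof -
  have prims: "u \<in> primitives (env LL) \<longleftrightarrow> u \<in> carrier U \<and> prim (env_map A u)" for u
  proof -
    have "comult (env LL) u = pure_tensor U U u \<one>\<^bsub>U\<^esub> \<oplus>\<^bsub>UU\<^esub> pure_tensor U U \<one>\<^bsub>U\<^esub> u \<longleftrightarrow> prim (env_map A u)"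
      if u: "u \<in> carrier U"
    proof -
      have "pure_tensor U U u \<one>\<^bsub>U\<^esub> \<oplus>\<^bsub>UU\<^esub> pure_tensor U U \<one>\<^bsub>U\<^esub> u \<in> carrier UU"
        using u by (intro UU.a_closed UU_pure) auto
      from inj_on_eq_iff[OF hh_inj comult_env(1)[OF u] this] show ?thesis
        unfolding comult_env(2)[OF u] hh_primitive[OF u] prim_def by simp
    qed
    then show ?thesis by (auto simp: primitives_def)
  qed
  note lin = linear_mapD[OF ecls_linear]
  have "linear_map KK LL ((env LL)\<lparr>carrier := primitives (env LL)\<rparr>) (env_incl LL)"
  proof (rule linear_mapI)
    fix x assume "x \<in> carrier LL"
    then show "env_incl LL x \<in> carrier ((env LL)\<lparr>carrier := primitives (env LL)\<rparr>)"
      using env_incl_closed by (simp add: prims)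
  next
    fix x y assume xy: "x \<in> carrier LL" "y \<in> carrier LL"
    then have "env_incl LL (x + y) = env_incl LL x \<oplus>\<^bsub>U\<^esub> env_incl LL y"
      using vs.subspace_add[OF prim_subspace, of x y] linear_mapD(2)[OF env_map_linear, of "env_incl LL x" "env_incl LL y"]
      by (intro inj_onD[OF env_map_inj]) (simp_all add: env_incl_closed)
    then show "env_incl LL (x \<oplus>\<^bsub>LL\<^esub> y) = env_incl LL x \<oplus>\<^bsub>(env LL)\<lparr>carrier := primitives (env LL)\<rparr>\<^esub> env_incl LL y"
      by simp
  next
    fix c :: 'k and x assume x: "x \<in> carrier LL"
    then have "env_incl LL (scale c x) = c \<odot>\<^bsub>U\<^esub> env_incl LL x"
      using vs.subspace_scale[OF prim_subspace, of x c] linear_mapD(3)[OF env_map_linear, of c "env_incl LL x"]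
      by (intro inj_onD[OF env_map_inj]) (simp_all add: env_incl_closed)
    then show "env_incl LL (c \<odot>\<^bsub>LL\<^esub> x) = c \<odot>\<^bsub>(env LL)\<lparr>carrier := primitives (env LL)\<rparr>\<^esub> env_incl LL x" by simp
  qed
  moreover have "bij_betw (env_incl LL) (carrier LL) (primitives (env LL))"
    by (rule bij_betw_byWitness[where f' = "env_map A"])
      (use env_incl_closed env_map_inj in \<open>auto simp: prims inj_on_def\<close>)
  ultimately show ?thesis by (simp add: linear_iso_def)
qed

end

lemma env_module: "module KK (env LL)"
  by (rule module_cong[OF U.module_axioms]) simp_all

lemma ecls_low_submodule: "submodule (ecls ` LL.low n) KK (env LL)"
proof (rule module.submoduleI'[OF env_module])
  note lin = linear_mapD[OF ecls_linear]
  have z: "ecls 0 = \<zero>\<^bsub>U\<^esub>"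
    using linear_map_zero[OF LL.W.module_axioms U.module_axioms ecls_linear] by simp
  show "ecls ` LL.low n \<subseteq> carrier (env LL)" using ecls_closed LL.low_closed(4) by auto
  show "\<zero>\<^bsub>env LL\<^esub> \<in> ecls ` LL.low n" using z LL.low_closed(2) by (auto intro: image_eqI[of _ _ 0])
  show "a \<oplus>\<^bsub>env LL\<^esub> b \<in> ecls ` LL.low n" if ab: "a \<in> ecls ` LL.low n" "b \<in> ecls ` LL.low n" for a b
  proof -
    obtain p q where p: "p \<in> LL.low n" "a = ecls p" and q: "q \<in> LL.low n" "b = ecls q" using ab by auto
    then have "a \<oplus>\<^bsub>env LL\<^esub> b = ecls (p + q)" using lin(2)[OF LL.low_closed(4) LL.low_closed(4)] by simp
    then show ?thesis using LL.low_closed(1) p q by blast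
  qed
  show "c \<odot>\<^bsub>env LL\<^esub> a \<in> ecls ` LL.low n" if a: "a \<in> ecls ` LL.low n" for c a
  proof -
    obtain p where p: "p \<in> LL.low n" "a = ecls p" using a by auto
    then have "c \<odot>\<^bsub>env LL\<^esub> a = ecls (Poly_Mapping.map ((*) c) p)" using lin(3)[of c p] LL.low_closed(4) by simp
    then show ?thesis using LL.low_closed(3) p by blast
  qed
qed

lemma env_filt_eq: "env_filt LL n = ecls ` LL.low (Suc n)"
  unfolding env_filt_def LL.low_def by (auto simp: less_Suc_eq_le)

lemma prev_env_filt: "prev_filt (env LL) (env_filt LL) n = ecls ` LL.low n"
proof (cases n)
  case 0
  have "ecls 0 = \<zero>\<^bsub>U\<^esub>"
    using linear_map_zero[OF LL.W.module_axioms U.module_axioms ecls_linear] by simp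
  moreover have "LL.low 0 = {0}" by (auto simp: LL.low_def)
  ultimately show ?thesis using 0 by (simp add: prev_filt_def)
qed (simp add: prev_filt_def env_filt_eq)

lemma low_mono: "LL.low n \<subseteq> LL.low (Suc n)"
  by (auto simp: LL.low_def)

lemma env_gr_quot_mod: "quot_mod KK ((env LL)\<lparr>carrier := ecls ` LL.low (Suc n)\<rparr>) (ecls ` LL.low n)"
  by (rule submodule_restrict[OF env_module ecls_low_submodule ecls_low_submodule]) (use low_mono in blast)

text \<open>Strictness for the filtrations: an element of \<open>U(L)\<^sub>n\<close> whose image
  drops by one step already comes from shorter words. The substance is
  \<open>ev_G_lower\<close>.\<close>

lemma env_map_filt:
  assumes "Z \<in> ecls ` LL.low (Suc n)"
  shows "env_map A Z \<in> G n \<longleftrightarrow> Z \<in> ecls ` LL.low n"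
proof -
  obtain p where p: "p \<in> LL.low (Suc n)" "Z = ecls p" using assms by auto
  note pc = LL.low_closed(4)[OF p(1)]
  show ?thesis
  proof
    assume "env_map A Z \<in> G n"
    then have "ev p \<in> G n" using p pc env_map_ecls by simp
    then obtain q where q: "q \<in> LL.low n" "p - q \<in> env_ideal LL" by (rule ev_G_lower[OF p(1)])
    then have "ecls p = ecls q"
      using LL.E.coset_eq_iff[OF pc LL.low_closed(4)[OF q(1)]] LL.low_closed(4)[OF q(1)] by simp
    then show "Z \<in> ecls ` LL.low n" using q p by blast
  next
    assume "Z \<in> ecls ` LL.low n"
    then obtain q where q: "q \<in> LL.low n" "Z = ecls q" by auto
    then show "env_map A Z \<in> G n" using env_map_ecls[OF LL.low_closed(4)[OF q(1)]] ev_low by simp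
  qed
qed

lemma G_submodule: "submodule (G n) KK A"
  by (rule module.submoduleI'[OF A_module]) (auto simp: G_closed simp del: G.simps)

text \<open>F stands for \<open>dual_filt\<close>, whose identification with G requires the test
  algebras treated below.\<close>

theorem env_gr_iso:
  assumes F: "\<And>n. F n = G (Suc n)"
  shows "linear_iso KK (gr (env LL) (env_filt LL) n) (gr A F n) (gr_map A F n (env_map A))"
proof -
  \<comment> \<open>For n = 0 this is the convention that the previous step is zero, matching G
    0.\<close>
  have prev: "prev_filt A F n = G n" by (cases n) (simp_all add: prev_filt_def F)
  have "quot_mod KK (A\<lparr>carrier := G (Suc n)\<rparr>) (G n)"
    by (rule submodule_restrict[OF A_module G_submodule G_submodule G_Suc_mono])
  moreover have "linear_map KK ((env LL)\<lparr>carrier := ecls ` LL.low (Suc n)\<rparr>) (A\<lparr>carrier := G (Suc n)\<rparr>) (env_map A)"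
  proof (rule linear_mapI)
    fix Z assume "Z \<in> carrier ((env LL)\<lparr>carrier := ecls ` LL.low (Suc n)\<rparr>)"
    then obtain p where p: "p \<in> LL.low (Suc n)" "Z = ecls p" by auto
    then show "env_map A Z \<in> carrier (A\<lparr>carrier := G (Suc n)\<rparr>)"
      using ev_low[OF p(1)] env_map_ecls[OF LL.low_closed(4)[OF p(1)]] by (simp del: G.simps)
  qed (use linear_mapD(2,3)[OF env_map_linear] ecls_closed LL.low_closed(4) in auto)
  ultimately have "linear_iso KK (quot_module ((env LL)\<lparr>carrier := ecls ` LL.low (Suc n)\<rparr>) (ecls ` LL.low n))
     (quot_module (A\<lparr>carrier := G (Suc n)\<rparr>) (G n)) (\<lambda>Z. \<Union>x\<in>Z. G n +>\<^bsub>A\<lparr>carrier := G (Suc n)\<rparr>\<^esub> env_map A x)"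
  proof (rule quot_map_iso[OF env_gr_quot_mod])
    fix y assume "y \<in> carrier (A\<lparr>carrier := G (Suc n)\<rparr>)"
    then have "y \<in> ev ` LL.low (Suc n)" unfolding G_ev[symmetric] by (simp del: G.simps)
    then obtain p where p: "p \<in> LL.low (Suc n)" "y = ev p" by auto
    then show "\<exists>x\<in>carrier ((env LL)\<lparr>carrier := ecls ` LL.low (Suc n)\<rparr>). \<exists>h\<in>G n. y = h \<oplus>\<^bsub>A\<lparr>carrier := G (Suc n)\<rparr>\<^esub> env_map A x"
      using G_closed(1)[of n] env_map_ecls[OF LL.low_closed(4)[OF p(1)]]
      by (intro bexI[of _ "ecls p"] bexI[of _ 0]) auto
  qed (use env_map_filt in auto)
  then show ?thesis by (simp add: gr_def gr_map_def[abs_def] env_filt_eq prev_env_filt prev F del: G.simps)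
qed

text \<open>A homogeneous p is a symmetric relation iff \<open>ev p\<close> drops to G n, iff its
  class in U(L) comes from shorter words. Surjectivity holds because an element of
  \<open>U(L)\<^sub>n\<close> differs from its top component by shorter words.\<close>

theorem sym_power_gr_iso: "linear_iso KK (SP n) (gr (env LL) (env_filt LL) n) (sym_to_gr LL n)"
proof -
  let ?N = "(env LL)\<lparr>carrier := ecls ` LL.low (Suc n)\<rparr>"
  have wl: "p \<in> LL.low (Suc n)" if "p \<in> carrier (word_space LL n)" for p
    using that by (auto simp: LL.low_def)
  have "linear_iso KK (quot_module (word_space LL n) (sym_rel LL n)) (quot_module ?N (ecls ` LL.low n))
      (\<lambda>Z. \<Union>x\<in>Z. ecls ` LL.low n +>\<^bsub>?N\<^esub> ecls x)"
  proof (rule quot_map_iso[OF LL.S.quot_mod_axioms env_gr_quot_mod])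
    show "linear_map KK (word_space LL n) ?N ecls"
    proof (rule linear_mapI)
      show "ecls x \<in> carrier ?N" if "x \<in> carrier (word_space LL n)" for x using wl[OF that] by simp
    next
      fix x y assume "x \<in> carrier (word_space LL n)" "y \<in> carrier (word_space LL n)"
      then show "ecls (x \<oplus>\<^bsub>word_space LL n\<^esub> y) = ecls x \<oplus>\<^bsub>?N\<^esub> ecls y"
        using linear_mapD(2)[OF ecls_linear LL.word_space_le LL.word_space_le, of x n y n] by simp
    next
      fix c :: 'k and x assume "x \<in> carrier (word_space LL n)"
      then show "ecls (c \<odot>\<^bsub>word_space LL n\<^esub> x) = c \<odot>\<^bsub>?N\<^esub> ecls x"
        using linear_mapD(3)[OF ecls_linear _ LL.word_space_le, of c x n] by simp
    qed
    fix p assume p: "p \<in> carrier (word_space LL n)"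
    note pl = wl[OF p]
    have "ecls p \<in> ecls ` LL.low n \<longleftrightarrow> ev p \<in> G n"
      using env_map_filt[of "ecls p" n] env_map_ecls[OF LL.low_closed(4)[OF pl]] pl by simp
    also have "\<dots> \<longleftrightarrow> p \<in> sym_rel LL n"
    proof
      assume "p \<in> sym_rel LL n"
      then obtain q where q: "q \<in> LL.low n" "p - q \<in> env_ideal LL" using LL.sym_rel_env_ideal by blast
      have "ev p = ev q" using ev_env_ideal[OF q(2)] by simp
      then show "ev p \<in> G n" using ev_low[OF q(1)] by simp
    qed (rule ev_G_sym_rel[OF p])
    finally show "ecls p \<in> ecls ` LL.low n \<longleftrightarrow> p \<in> sym_rel LL n" .
  next
    fix Z assume "Z \<in> carrier ?N"
    then obtain p where p: "p \<in> LL.low (Suc n)" "Z = ecls p" by auto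
    obtain t r where t: "t \<in> carrier (word_space LL n)" "r \<in> LL.low n" "p = t + r"
      by (rule LL.top_component[OF p(1)])
    have "Z = ecls r \<oplus>\<^bsub>?N\<^esub> ecls t"
      using linear_mapD(2)[OF ecls_linear, of r t] t p LL.low_closed(4)[OF t(2)] LL.low_closed(4)[OF wl[OF t(1)]]
      by (simp add: add.commute)
    then show "\<exists>x\<in>carrier (word_space LL n). \<exists>h\<in>ecls ` LL.low n. Z = h \<oplus>\<^bsub>?N\<^esub> ecls x" using t by blast
  qed
  then show ?thesis
    by (simp add: sym_power_eq gr_def sym_to_gr_def gr_map_def[abs_def] env_filt_eq prev_env_filt)
qed

end

section \<open>Test algebras\<close>

text \<open>Test algebras must have their carrier inside the universe 's, so constructions living in
  product or set types are copied there along an injection.\<close>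

definition transport :: "('t \<Rightarrow> 's) \<Rightarrow> ('k, 't, 'z) module_scheme \<Rightarrow> ('k, 's) module" where
  "transport j V = (let i = inv_into (carrier V) j in
     \<lparr>carrier = j ` carrier V, monoid.mult = (\<lambda>x y. j (i x \<otimes>\<^bsub>V\<^esub> i y)), one = j \<one>\<^bsub>V\<^esub>, zero = j \<zero>\<^bsub>V\<^esub>,
      add = (\<lambda>x y. j (i x \<oplus>\<^bsub>V\<^esub> i y)), module.smult = (\<lambda>c x. j (c \<odot>\<^bsub>V\<^esub> i x))\<rparr>)"

context
  fixes j :: "'t \<Rightarrow> 's" and V :: "('k, 't, 'z) module_scheme"
  assumes inj: "inj_on j (carrier V)"
begin

lemma transport_simps:
  "carrier (transport j V) = j ` carrier V"
  "\<zero>\<^bsub>transport j V\<^esub> = j \<zero>\<^bsub>V\<^esub>" "\<one>\<^bsub>transport j V\<^esub> = j \<one>\<^bsub>V\<^esub>"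
  "x \<in> carrier V \<Longrightarrow> y \<in> carrier V \<Longrightarrow> j x \<oplus>\<^bsub>transport j V\<^esub> j y = j (x \<oplus>\<^bsub>V\<^esub> y)"
  "x \<in> carrier V \<Longrightarrow> y \<in> carrier V \<Longrightarrow> j x \<otimes>\<^bsub>transport j V\<^esub> j y = j (x \<otimes>\<^bsub>V\<^esub> y)"
  "x \<in> carrier V \<Longrightarrow> c \<odot>\<^bsub>transport j V\<^esub> j x = j (c \<odot>\<^bsub>V\<^esub> x)"
  using inj by (simp_all add: transport_def Let_def)

lemma transport_abelian_group:
  assumes "abelian_group V" shows "abelian_group (transport j V)"
proof -
  interpret V: abelian_group V by fact
  show ?thesis
  proof (rule abelian_groupI)
    fix x assume "x \<in> carrier (transport j V)"
    then obtain v where v: "v \<in> carrier V" "x = j v" by (auto simp: transport_simps)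
    then show "\<exists>y\<in>carrier (transport j V). y \<oplus>\<^bsub>transport j V\<^esub> x = \<zero>\<^bsub>transport j V\<^esub>"
      by (intro bexI[of _ "j (\<ominus>\<^bsub>V\<^esub> v)"]) (simp_all add: transport_simps V.l_neg)
  qed (auto simp: transport_simps V.a_ac)
qed

lemma transport_module:
  assumes "module R V" shows "module R (transport j V)"
proof -
  interpret V: module R V by fact
  show ?thesis
    by (rule moduleI)
      (use transport_abelian_group[OF V.abelian_group_axioms] V.R.is_cring in
        \<open>auto simp: transport_simps V.smult_l_distr V.smult_r_distr V.smult_assoc1\<close>)
qed

lemma transport_algebra:
  assumes "algebra R V" shows "algebra R (transport j V)"
proof -
  interpret V: algebra R V by fact
  interpret T: module R "transport j V" by (rule transport_module) (rule V.module_axioms)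
  have "cring (transport j V)"
  proof (rule cringI)
    show "abelian_group (transport j V)" by (rule T.abelian_group_axioms)
    show "Group.comm_monoid (transport j V)"
      by (rule comm_monoidI) (auto simp: transport_simps V.m_ac)
  qed (auto simp: transport_simps V.l_distr)
  then show ?thesis
    by (intro algebra.intro algebra_axioms.intro T.module_axioms)
      (auto simp: transport_simps V.smult_assoc2)
qed

lemma transport_linear: "linear_map R V (transport j V) j"
  by (rule linear_mapI) (simp_all add: transport_simps)

lemma transport_bij: "bij_betw j (carrier V) (carrier (transport j V))"
  using inj by (simp add: bij_betw_def transport_simps)

end

text \<open>The algebra T \<oplus> V in which V has square zero; for V = T these are the dual
  numbers over T. Since V is only a T-module, a base scalar c acts on it through c 1 in T.\<close>

definition sq_zero_ext :: "('k, 't, 'y) module_scheme \<Rightarrow> ('t, 'v, 'z) module_scheme \<Rightarrow> ('k, 't \<times> 'v) module" where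
  "sq_zero_ext T V = \<lparr>carrier = carrier T \<times> carrier V,
     monoid.mult = (\<lambda>x y. (fst x \<otimes>\<^bsub>T\<^esub> fst y, fst x \<odot>\<^bsub>V\<^esub> snd y \<oplus>\<^bsub>V\<^esub> fst y \<odot>\<^bsub>V\<^esub> snd x)),
     one = (\<one>\<^bsub>T\<^esub>, \<zero>\<^bsub>V\<^esub>), zero = (\<zero>\<^bsub>T\<^esub>, \<zero>\<^bsub>V\<^esub>), add = (\<lambda>x y. (fst x \<oplus>\<^bsub>T\<^esub> fst y, snd x \<oplus>\<^bsub>V\<^esub> snd y)),
     module.smult = (\<lambda>c x. (c \<odot>\<^bsub>T\<^esub> fst x, (c \<odot>\<^bsub>T\<^esub> \<one>\<^bsub>T\<^esub>) \<odot>\<^bsub>V\<^esub> snd x))\<rparr>"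

lemma sq_zero_ext_simps [simp]:
  "carrier (sq_zero_ext T V) = carrier T \<times> carrier V"
  "x \<otimes>\<^bsub>sq_zero_ext T V\<^esub> y = (fst x \<otimes>\<^bsub>T\<^esub> fst y, fst x \<odot>\<^bsub>V\<^esub> snd y \<oplus>\<^bsub>V\<^esub> fst y \<odot>\<^bsub>V\<^esub> snd x)"
  "\<one>\<^bsub>sq_zero_ext T V\<^esub> = (\<one>\<^bsub>T\<^esub>, \<zero>\<^bsub>V\<^esub>)" "\<zero>\<^bsub>sq_zero_ext T V\<^esub> = (\<zero>\<^bsub>T\<^esub>, \<zero>\<^bsub>V\<^esub>)"
  "x \<oplus>\<^bsub>sq_zero_ext T V\<^esub> y = (fst x \<oplus>\<^bsub>T\<^esub> fst y, snd x \<oplus>\<^bsub>V\<^esub> snd y)"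
  "c \<odot>\<^bsub>sq_zero_ext T V\<^esub> x = (c \<odot>\<^bsub>T\<^esub> fst x, (c \<odot>\<^bsub>T\<^esub> \<one>\<^bsub>T\<^esub>) \<odot>\<^bsub>V\<^esub> snd x)"
  by (simp_all add: sq_zero_ext_def)

lemma sq_zero_ext_algebra:
  assumes T: "algebra R T" and V: "module T V"
  shows "algebra R (sq_zero_ext T V)"
proof -
  interpret T: algebra R T by fact
  interpret V: module T V by fact
  let ?E = "sq_zero_ext T V"
  have ab: "abelian_group ?E"
  proof (rule abelian_groupI)
    fix x assume "x \<in> carrier ?E"
    then show "\<exists>y\<in>carrier ?E. y \<oplus>\<^bsub>?E\<^esub> x = \<zero>\<^bsub>?E\<^esub>"
      by (intro bexI[of _ "(\<ominus>\<^bsub>T\<^esub> fst x, \<ominus>\<^bsub>V\<^esub> snd x)"]) (auto simp: T.l_neg V.M.l_neg)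
  qed (auto simp: T.a_ac V.M.a_ac)
  have "cring ?E"
  proof (rule cringI[OF ab])
    show "Group.comm_monoid ?E"
    proof (rule comm_monoidI)
      fix x y z assume "x \<in> carrier ?E" "y \<in> carrier ?E" "z \<in> carrier ?E"
      then show "x \<otimes>\<^bsub>?E\<^esub> y \<otimes>\<^bsub>?E\<^esub> z = x \<otimes>\<^bsub>?E\<^esub> (y \<otimes>\<^bsub>?E\<^esub> z)"
        by (auto simp: T.m_ac V.smult_r_distr V.smult_assoc1[symmetric] V.M.a_ac)
    qed (auto simp: T.m_ac V.M.a_ac)
    fix x y z assume "x \<in> carrier ?E" "y \<in> carrier ?E" "z \<in> carrier ?E"
    then show "(x \<oplus>\<^bsub>?E\<^esub> y) \<otimes>\<^bsub>?E\<^esub> z = x \<otimes>\<^bsub>?E\<^esub> z \<oplus>\<^bsub>?E\<^esub> y \<otimes>\<^bsub>?E\<^esub> z"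
      by (auto simp: T.l_distr V.smult_r_distr V.smult_l_distr V.M.a_ac)
  qed
  moreover have key: "(c \<odot>\<^bsub>T\<^esub> (d \<odot>\<^bsub>T\<^esub> \<one>\<^bsub>T\<^esub>)) \<odot>\<^bsub>V\<^esub> v = (c \<odot>\<^bsub>T\<^esub> \<one>\<^bsub>T\<^esub>) \<odot>\<^bsub>V\<^esub> ((d \<odot>\<^bsub>T\<^esub> \<one>\<^bsub>T\<^esub>) \<odot>\<^bsub>V\<^esub> v)"
    if "c \<in> carrier R" "d \<in> carrier R" "v \<in> carrier V" for c d v
    using that by (subst V.smult_assoc1[symmetric]) (simp_all add: T.smult_assoc2)
  ultimately show ?thesis
  proof (intro algebraI)
    show "cring R" by (rule T.R_cring)
    fix a x y assume a: "a \<in> carrier R" and x: "x \<in> carrier ?E" and y: "y \<in> carrier ?E"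
    have ax: "a \<odot>\<^bsub>T\<^esub> fst x = (a \<odot>\<^bsub>T\<^esub> \<one>\<^bsub>T\<^esub>) \<otimes>\<^bsub>T\<^esub> fst x" using a x by (auto simp: T.smult_assoc2)
    have "fst y \<odot>\<^bsub>V\<^esub> ((a \<odot>\<^bsub>T\<^esub> \<one>\<^bsub>T\<^esub>) \<odot>\<^bsub>V\<^esub> snd x) = (a \<odot>\<^bsub>T\<^esub> \<one>\<^bsub>T\<^esub>) \<odot>\<^bsub>V\<^esub> (fst y \<odot>\<^bsub>V\<^esub> snd x)"
      using a x y by (auto simp: V.smult_assoc1[symmetric] T.m_comm)
    moreover have "(a \<odot>\<^bsub>T\<^esub> fst x) \<odot>\<^bsub>V\<^esub> snd y = (a \<odot>\<^bsub>T\<^esub> \<one>\<^bsub>T\<^esub>) \<odot>\<^bsub>V\<^esub> (fst x \<odot>\<^bsub>V\<^esub> snd y)"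
      unfolding ax using a x y by (auto simp: V.smult_assoc1)
    ultimately show "(a \<odot>\<^bsub>?E\<^esub> x) \<otimes>\<^bsub>?E\<^esub> y = a \<odot>\<^bsub>?E\<^esub> (x \<otimes>\<^bsub>?E\<^esub> y)"
      using a x y by (auto simp: T.smult_assoc2 V.smult_r_distr)
  qed (auto simp: T.smult_l_distr T.smult_r_distr T.smult_assoc1 V.smult_l_distr V.smult_r_distr key)
qed

text \<open>An infinite set is equipotent to its square, so the universe has room for square-zero
  extensions.\<close>

lemma inj_pair:
  assumes "infinite (UNIV :: 's set)"
  obtains j :: "'s \<times> 's \<Rightarrow> 's" where "inj j"
proof -
  have "(card_of (UNIV \<times> UNIV :: ('s \<times> 's) set), card_of (UNIV :: 's set)) \<in> ordIso"
    by (rule card_of_Times_same_infinite[OF assms])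
  then obtain j where "bij_betw j (UNIV \<times> UNIV :: ('s \<times> 's) set) (UNIV :: 's set)"
    unfolding card_of_ordIso[symmetric] by blast
  then show ?thesis using that by (auto simp: bij_betw_def)
qed

lemma kalgsD:
  assumes "S \<in> kalgs"
  shows "algebra KK S" "module KK S" "cring S"
proof -
  show a: "algebra KK S" using assms by (simp add: kalgs_def)
  interpret algebra KK S by (rule a)
  show "module KK S" "cring S" by (rule module_axioms, rule M_cring)
qed

lemma transport_kalgs:
  fixes V :: "('k::field, 't, 'z) module_scheme"
  assumes "algebra KK V" "inj_on j (carrier V)" shows "transport j V \<in> kalgs"
  using transport_algebra[OF assms(2,1)] by (simp add: kalgs_def)

lemma KM_algebra: "algebra KK (KM :: ('k::field, 'k) module)"
proof -
  interpret K: cring "KK :: 'k ring" by (rule cring_from_type_algebra)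
  interpret KM: module KK "KM :: ('k, 'k) module" by (rule KM_module)
  have "cring (KM :: ('k, 'k) module)"
  proof (rule cringI)
    show "Group.comm_monoid (KM :: ('k, 'k) module)" by (rule comm_monoidI) auto
  qed (use KM.abelian_group_axioms in \<open>auto simp: algebra_simps\<close>)
  then show ?thesis by (intro algebra.intro algebra_axioms.intro KM_module) auto
qed

text \<open>\<open>KM\<close> is the ground field regarded as an algebra over itself, the form in
  which it can be the base of a square-zero extension.\<close>

lemma KM_scalars:
  assumes "module KK V" shows "module (KM :: ('k::field, 'k) module) V"
proof -
  interpret V: module KK V by fact
  interpret KM: algebra KK "KM :: ('k, 'k) module" by (rule KM_algebra)
  show ?thesis
    using V.smult_l_distr V.smult_assoc1 V.smult_r_distr KM.M_cring V.abelian_group_axioms assms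
    by (intro moduleI) auto
qed

lemma transport_kalg_hom:
  assumes i: "inj_on i (carrier V)" and j: "inj_on j (carrier W)" and V: "algebra KK V"
    and h: "h \<in> ring_hom V W" "linear_map KK V W h"
  shows "(\<lambda>x. j (h (inv_into (carrier V) i x))) \<in> kalg_hom (transport i V) (transport j W)"
proof -
  interpret V: algebra KK V by fact
  have hc: "h v \<in> carrier W" if "v \<in> carrier V" for v using linear_mapD(1)[OF h(2) that] .
  have "linear_map KK (transport i V) (transport j W) (\<lambda>x. j (h (inv_into (carrier V) i x)))"
    by (rule linear_map_comp[OF linear_map_comp[OF linear_map_inv_into[OF transport_linear[OF i] transport_bij[OF i] V.module_axioms] h(2)]
          transport_linear[OF j]])
  moreover have "(\<lambda>x. j (h (inv_into (carrier V) i x))) \<in> ring_hom (transport i V) (transport j W)"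
    using ring_hom_mult[OF h(1)] ring_hom_add[OF h(1)] ring_hom_one[OF h(1)] i hc
    by (intro ring_hom_memI) (auto simp: transport_simps[OF i] transport_simps[OF j])
  ultimately show ?thesis by (simp add: kalg_hom_def)
qed

section \<open>Module schemes\<close>

lemma dual_simps [simp]:
  "f \<in> carrier (fob (dual V) S) \<longleftrightarrow> f \<in> extensional (carrier V) \<and> linear_map KK V S f"
  "\<zero>\<^bsub>fob (dual V) S\<^esub> = (\<lambda>x\<in>carrier V. \<zero>\<^bsub>S\<^esub>)"
  "f \<oplus>\<^bsub>fob (dual V) S\<^esub> g = (\<lambda>x\<in>carrier V. f x \<oplus>\<^bsub>S\<^esub> g x)"
  "s \<odot>\<^bsub>fob (dual V) S\<^esub> f = (\<lambda>x\<in>carrier V. s \<otimes>\<^bsub>S\<^esub> f x)"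
  "far (dual V) S T h f = (\<lambda>x\<in>carrier V. h (f x))"
  by (simp_all add: dual_def)

lemma dual_module:
  assumes V: "module KK V" and S: "S \<in> kalgs"
  shows "module S (fob (dual V) S)"
proof -
  interpret V: module KK V by fact
  interpret S: algebra KK S by (rule kalgsD[OF S])
  have lin: "linear_map KK V S (restrict f (carrier V)) \<longleftrightarrow> linear_map KK V S f" for f
    by (rule linear_map_cong[OF _ V]) simp
  have sm: "s \<otimes>\<^bsub>S\<^esub> (c \<odot>\<^bsub>S\<^esub> x) = c \<odot>\<^bsub>S\<^esub> (s \<otimes>\<^bsub>S\<^esub> x)" if "s \<in> carrier S" "x \<in> carrier S" for s c x
    using that S.smult_assoc2[of c x s] by (simp add: S.m_comm)
  show ?thesis
  proof (rule moduleI)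
    show "cring S" by (rule S.M_cring)
    show "abelian_group (fob (dual V) S)"
    proof (rule abelian_groupI)
      show "\<zero>\<^bsub>fob (dual V) S\<^esub> \<in> carrier (fob (dual V) S)"
        by (auto simp: lin intro!: linear_mapI)
      fix f assume f: "f \<in> carrier (fob (dual V) S)"
      note fl = linear_mapD[of KK V S f]
      show "\<zero>\<^bsub>fob (dual V) S\<^esub> \<oplus>\<^bsub>fob (dual V) S\<^esub> f = f"
        using f fl by (intro extensionalityI[of _ "carrier V"]) auto
      have "linear_map KK V S (\<lambda>x. \<ominus>\<^bsub>S\<^esub> f x)"
        using f fl by (intro linear_mapI) (auto simp: S.minus_add S.smult_r_minus)
      then show "\<exists>g\<in>carrier (fob (dual V) S). g \<oplus>\<^bsub>fob (dual V) S\<^esub> f = \<zero>\<^bsub>fob (dual V) S\<^esub>"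
        using f fl by (intro bexI[of _ "\<lambda>x\<in>carrier V. \<ominus>\<^bsub>S\<^esub> f x"])
          (auto simp: lin S.l_neg intro!: extensionalityI[of _ "carrier V"])
      fix g assume g: "g \<in> carrier (fob (dual V) S)"
      note gl = linear_mapD[of KK V S g]
      have "linear_map KK V S (\<lambda>x. f x \<oplus>\<^bsub>S\<^esub> g x)"
        using f fl g gl by (intro linear_mapI) (auto simp: S.smult_r_distr S.a_ac)
      then show "f \<oplus>\<^bsub>fob (dual V) S\<^esub> g \<in> carrier (fob (dual V) S)" by (simp add: lin)
      show "f \<oplus>\<^bsub>fob (dual V) S\<^esub> g = g \<oplus>\<^bsub>fob (dual V) S\<^esub> f"
        using f fl g gl by (auto simp: S.a_ac intro!: restrict_ext)
      fix h assume h: "h \<in> carrier (fob (dual V) S)"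
      show "f \<oplus>\<^bsub>fob (dual V) S\<^esub> g \<oplus>\<^bsub>fob (dual V) S\<^esub> h = f \<oplus>\<^bsub>fob (dual V) S\<^esub> (g \<oplus>\<^bsub>fob (dual V) S\<^esub> h)"
        using f fl g gl h linear_mapD(1)[of KK V S h] by (auto simp: S.a_ac intro!: restrict_ext)
    qed
  next
    fix a f assume a: "a \<in> carrier S" and f: "f \<in> carrier (fob (dual V) S)"
    note fl = linear_mapD[of KK V S f]
    have "linear_map KK V S (\<lambda>x. a \<otimes>\<^bsub>S\<^esub> f x)"
      using a f fl by (intro linear_mapI) (auto simp: S.r_distr sm)
    then show "a \<odot>\<^bsub>fob (dual V) S\<^esub> f \<in> carrier (fob (dual V) S)" by (simp add: lin)
    fix b assume b: "b \<in> carrier S"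
    show "(a \<oplus>\<^bsub>S\<^esub> b) \<odot>\<^bsub>fob (dual V) S\<^esub> f = a \<odot>\<^bsub>fob (dual V) S\<^esub> f \<oplus>\<^bsub>fob (dual V) S\<^esub> b \<odot>\<^bsub>fob (dual V) S\<^esub> f"
      using a b f fl by (auto simp: S.l_distr intro!: restrict_ext)
    show "(a \<otimes>\<^bsub>S\<^esub> b) \<odot>\<^bsub>fob (dual V) S\<^esub> f = a \<odot>\<^bsub>fob (dual V) S\<^esub> (b \<odot>\<^bsub>fob (dual V) S\<^esub> f)"
      using a b f fl by (auto simp: S.m_assoc intro!: restrict_ext)
  next
    fix f assume f: "f \<in> carrier (fob (dual V) S)"
    then show "\<one>\<^bsub>S\<^esub> \<odot>\<^bsub>fob (dual V) S\<^esub> f = f"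
      using linear_mapD(1)[of KK V S f] by (intro extensionalityI[of _ "carrier V"]) auto
  next
    fix a f g assume a: "a \<in> carrier S" and f: "f \<in> carrier (fob (dual V) S)" and g: "g \<in> carrier (fob (dual V) S)"
    show "a \<odot>\<^bsub>fob (dual V) S\<^esub> (f \<oplus>\<^bsub>fob (dual V) S\<^esub> g) =
        a \<odot>\<^bsub>fob (dual V) S\<^esub> f \<oplus>\<^bsub>fob (dual V) S\<^esub> a \<odot>\<^bsub>fob (dual V) S\<^esub> g"
      using a f g linear_mapD(1)[of KK V S f] linear_mapD(1)[of KK V S g] by (auto simp: S.r_distr intro!: restrict_ext)
  qed
qed

text \<open>
  The anti-equivalence: a morphism \<open>M\<^sup>* \<rightarrow> V\<^sup>*\<close> is dual to a linear map \<open>p : V \<rightarrow> M\<close>, which is read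
  off its value at the inclusion of \<open>M\<close> in \<open>K \<oplus> M\<close>. For \<open>g : M \<rightarrow> T\<close>, the homomorphism
  \<open>K \<oplus> M \<rightarrow> T[\<epsilon>]\<close> given by \<open>g\<close> maps that inclusion to \<open>\<epsilon> g\<close>.
\<close>

lemma morphism_of_duals:
  fixes M :: "('k::field, 's) module" and V :: "('k, 'v, 'z) module_scheme"
    and \<theta> :: "('k, 's) module \<Rightarrow> ('s \<Rightarrow> 's) \<Rightarrow> ('v \<Rightarrow> 's)"
  assumes inf: "infinite (UNIV :: 's set)" and jK: "inj (jK :: 'k \<Rightarrow> 's)"
    and M: "module KK M" and V: "module KK V"
    and lin: "\<And>S. S \<in> kalgs \<Longrightarrow> linear_map S (fob (dual M) S) (fob (dual V) S) (\<theta> S)"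
    and nat: "\<And>S T h g. S \<in> kalgs \<Longrightarrow> T \<in> kalgs \<Longrightarrow> h \<in> kalg_hom S T \<Longrightarrow> g \<in> carrier (fob (dual M) S) \<Longrightarrow>
      \<theta> T (far (dual M) S T h g) = far (dual V) S T h (\<theta> S g)"
  obtains p where "linear_map KK V M p"
    "\<forall>T\<in>kalgs. \<forall>g\<in>carrier (fob (dual M) T). \<theta> T g = (\<lambda>a\<in>carrier V. g (p a))"
proof -
  interpret M: module KK M by fact
  interpret V: module KK V by fact
  obtain j2 :: "'s \<times> 's \<Rightarrow> 's" where j2: "inj j2" by (rule inj_pair[OF inf])
  let ?E0 = "sq_zero_ext KM M"
  define jE where "jE = (\<lambda>x. j2 (jK (fst x), snd x))"
  have jE: "inj_on jE (carrier ?E0)"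
    by (auto simp: inj_on_def jE_def inj_eq[OF j2] inj_eq[OF jK])
  have E0: "algebra KK ?E0" by (rule sq_zero_ext_algebra[OF KM_algebra KM_scalars[OF M]])
  interpret E0: algebra KK ?E0 by (rule E0)
  let ?S = "transport jE ?E0"
  have S: "?S \<in> kalgs" by (rule transport_kalgs[OF E0 jE])
  let ?iE = "inv_into (carrier ?E0) jE"
  have iE: "linear_map KK ?S ?E0 ?iE"
    by (rule linear_map_inv_into[OF transport_linear[OF jE] transport_bij[OF jE] E0.module_axioms])
  define u where "u = (\<lambda>m\<in>carrier M. jE (0, m))"
  have "linear_map KK M ?E0 (\<lambda>m. (0, m))"
    by (rule linear_mapI) auto
  from linear_map_comp[OF this transport_linear[OF jE]] have u: "u \<in> carrier (fob (dual M) ?S)"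
    unfolding u_def by (simp add: linear_map_cong[OF _ M, of "\<lambda>m\<in>carrier M. jE (0, m)" "\<lambda>m. jE (0, m)"])
  have w: "linear_map KK V ?S (\<theta> ?S u)"
    using linear_mapD(1)[OF lin[OF S] u] by simp
  define p where "p = (\<lambda>a. snd (?iE (\<theta> ?S u a)))"
  have "linear_map KK ?E0 M snd" by (rule linear_mapI) auto
  then have p: "linear_map KK V M p"
    unfolding p_def by (rule linear_map_comp[OF linear_map_comp[OF w iE]])
  have "\<theta> T g = (\<lambda>a\<in>carrier V. g (p a))" if T: "T \<in> kalgs" and g: "g \<in> carrier (fob (dual M) T)" for T g
  proof -
    interpret T: algebra KK T by (rule kalgsD[OF T])
    \<comment> \<open>The dual numbers over T, placed in the universe by \<open>j2\<close>.\<close>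
    let ?E1 = "sq_zero_ext T (self_module T)"
    have E1: "algebra KK ?E1"
      by (rule sq_zero_ext_algebra[OF T.algebra_axioms self_module_module[OF T.M_cring]])
    have j2i: "inj_on j2 (carrier ?E1)" by (rule inj_on_subset[OF j2]) simp
    let ?S1 = "transport j2 ?E1"
    have S1: "?S1 \<in> kalgs" by (rule transport_kalgs[OF E1 j2i])
    note gl = linear_mapD[of KK M T g] and tr = transport_simps[OF j2i]
    have g1: "linear_map KK M T g" using g by simp
    have sc: "(a * b) \<odot>\<^bsub>T\<^esub> \<one>\<^bsub>T\<^esub> = (a \<odot>\<^bsub>T\<^esub> \<one>\<^bsub>T\<^esub>) \<otimes>\<^bsub>T\<^esub> (b \<odot>\<^bsub>T\<^esub> \<one>\<^bsub>T\<^esub>)" for a b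
      using T.smult_assoc1[of a b "\<one>\<^bsub>T\<^esub>"] by (simp add: T.smult_assoc2)
    have sc': "(a \<odot>\<^bsub>T\<^esub> \<one>\<^bsub>T\<^esub>) \<otimes>\<^bsub>T\<^esub> t = a \<odot>\<^bsub>T\<^esub> t" if "t \<in> carrier T" for a t
      using that by (simp add: T.smult_assoc2)
    \<comment> \<open>A linear map from M to T is in general not part of an algebra morphism K
      \<oplus> M \<rightarrow> T. Placed in the nilpotent part it always is, because products of
      elements of M vanish on both sides.\<close>
    define h0 where "h0 = (\<lambda>x. (fst x \<odot>\<^bsub>T\<^esub> \<one>\<^bsub>T\<^esub>, g (snd x)))"
    have "h0 \<in> ring_hom ?E0 ?E1"
      using g1 gl T.smult_l_distr[of _ _ "\<one>\<^bsub>T\<^esub>"] linear_map_zero[OF M T.module_axioms g1] T.module_axioms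
      by (intro ring_hom_memI) (auto simp: h0_def sc sc')
    moreover have "linear_map KK ?E0 ?E1 h0"
      using g1 gl T.smult_l_distr[of _ _ "\<one>\<^bsub>T\<^esub>"] T.smult_assoc1[of _ _ "\<one>\<^bsub>T\<^esub>"]
      by (intro linear_mapI) (auto simp: h0_def sc')
    ultimately have h: "(\<lambda>x. j2 (h0 (?iE x))) \<in> kalg_hom ?S ?S1" (is "?h \<in> _")
      by (rule transport_kalg_hom[OF jE j2i E0])
    have i: "(\<lambda>t. j2 (t, \<zero>\<^bsub>T\<^esub>)) \<in> kalg_hom T ?S1" (is "?i \<in> _")
      unfolding kalg_hom_def
      by (auto intro!: ring_hom_memI linear_mapI simp: tr sc')
    define \<delta> where "\<delta> = j2 (\<zero>\<^bsub>T\<^esub>, \<one>\<^bsub>T\<^esub>)"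
    have \<delta>: "\<delta> \<in> carrier ?S1" by (simp add: \<delta>_def tr)
    have \<delta>_mult: "\<delta> \<otimes>\<^bsub>?S1\<^esub> ?i t = j2 (\<zero>\<^bsub>T\<^esub>, t)" if "t \<in> carrier T" for t
      using that by (simp add: \<delta>_def tr)
    have ig: "far (dual M) T ?S1 ?i g \<in> carrier (fob (dual M) ?S1)"
    proof -
      have "linear_map KK M ?S1 (\<lambda>m. ?i (g m))"
        by (rule linear_map_comp[OF g1]) (use i in \<open>simp add: kalg_hom_def\<close>)
      then show ?thesis
        by (simp add: linear_map_cong[OF _ M, of "\<lambda>m\<in>carrier M. ?i (g m)" "\<lambda>m. ?i (g m)"])
    qed
    \<comment> \<open>The right side is \<delta> times the base change of g along T \<rightarrow>
      T[\<epsilon>]. Naturality handles both base changes and linearity over T[\<epsilon>] extracts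
      \<delta>, so \<theta>(g) appears as the nilpotent coefficient of \<theta> at the universal
      inclusion.\<close>
    have eq: "far (dual M) ?S ?S1 ?h u = \<delta> \<odot>\<^bsub>fob (dual M) ?S1\<^esub> far (dual M) T ?S1 ?i g"
      unfolding dual_simps using \<delta>_mult linear_mapD(1)[OF g1] jE T.module_axioms
      by (intro restrict_ext) (simp add: u_def h0_def)
    have "far (dual V) ?S ?S1 ?h (\<theta> ?S u) = \<theta> ?S1 (far (dual M) ?S ?S1 ?h u)"
      by (rule nat[OF S S1 h u, symmetric])
    also have "\<dots> = \<delta> \<odot>\<^bsub>fob (dual V) ?S1\<^esub> \<theta> ?S1 (far (dual M) T ?S1 ?i g)"
      unfolding eq by (rule linear_mapD(3)[OF lin[OF S1] \<delta> ig])
    also have "\<theta> ?S1 (far (dual M) T ?S1 ?i g) = far (dual V) T ?S1 ?i (\<theta> T g)"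
      by (rule nat[OF T S1 i g])
    finally have *: "far (dual V) ?S ?S1 ?h (\<theta> ?S u) = \<delta> \<odot>\<^bsub>fob (dual V) ?S1\<^esub> far (dual V) T ?S1 ?i (\<theta> T g)" .
    have tg: "\<theta> T g \<in> extensional (carrier V)" "linear_map KK V T (\<theta> T g)"
      using linear_mapD(1)[OF lin[OF T] g] by auto
    show ?thesis
    proof (rule extensionalityI[OF tg(1) restrict_extensional])
      fix a assume a: "a \<in> carrier V"
      have "j2 (h0 (?iE (\<theta> ?S u a))) = j2 (\<zero>\<^bsub>T\<^esub>, \<theta> T g a)"
        using fun_cong[OF *, of a] a \<delta>_mult[OF linear_mapD(1)[OF tg(2) a]] by simp
      then have "h0 (?iE (\<theta> ?S u a)) = (\<zero>\<^bsub>T\<^esub>, \<theta> T g a)" by (rule injD[OF j2])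
      then show "\<theta> T g a = (\<lambda>a\<in>carrier V. g (p a)) a" using a by (simp add: h0_def p_def)
    qed
  qed
  then show ?thesis using that p by blast
qed

section \<open>The powers of the augmentation ideal\<close>

lemma (in abelian_group) minus_eqI:
  assumes "d \<in> carrier G" "y \<in> carrier G" "x = d \<oplus> y" shows "x \<ominus> y = d"
  using assms by (simp add: a_minus_def a_assoc r_neg)

lemma restrict_UNIV [simp]: "restrict f UNIV = f"
  by auto

lemma dual_alg_simps:
  "monoid.mult (fob (dual_alg V) S) = (\<lambda>f g. \<lambda>a\<in>carrier V. tlift S (\<lambda>x y. f x \<otimes>\<^bsub>S\<^esub> g y) (comult V a))"
  "\<one>\<^bsub>fob (dual_alg V) S\<^esub> = (\<lambda>a\<in>carrier V. counit V a \<odot>\<^bsub>S\<^esub> \<one>\<^bsub>S\<^esub>)"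
  by (simp_all add: dual_alg_def)

context cbialg
begin

lemma dual_A_carrier [simp]: "f \<in> carrier (fob (dual A) S) \<longleftrightarrow> lin S f"
  by (simp add: extensional_def)

declare dual_simps(1) [simp del]

lemma dual_A_ops [simp]:
  "\<zero>\<^bsub>fob (dual A) S\<^esub> = (\<lambda>x. \<zero>\<^bsub>S\<^esub>)"
  "f \<oplus>\<^bsub>fob (dual A) S\<^esub> g = (\<lambda>x. f x \<oplus>\<^bsub>S\<^esub> g x)"
  "s \<odot>\<^bsub>fob (dual A) S\<^esub> f = (\<lambda>x. s \<otimes>\<^bsub>S\<^esub> f x)"
  "far (dual A) S T h f = (\<lambda>x. h (f x))"
  "monoid.mult (fob (dual_alg A) S) = (\<lambda>f g. sw S (\<lambda>x y. f x \<otimes>\<^bsub>S\<^esub> g y))"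
  "\<one>\<^bsub>fob (dual_alg A) S\<^esub> = (\<lambda>a. \<epsilon> a \<odot>\<^bsub>S\<^esub> \<one>\<^bsub>S\<^esub>)"
  by (simp_all add: dual_simps dual_alg_simps sw_def[abs_def])

abbreviation dual_prod :: "('k, 's) module \<Rightarrow> ('a \<Rightarrow> 's) list \<Rightarrow> 'a \<Rightarrow> 's" where
  "dual_prod S fs \<equiv> foldr (monoid.mult (fob (dual_alg A) S)) fs \<one>\<^bsub>fob (dual_alg A) S\<^esub>"

context
  fixes S :: "('k, 's) module"
  assumes S: "S \<in> kalgs"
begin

interpretation S: algebra KK S by (rule kalgsD[OF S])
interpretation D: module S "fob (dual A) S" by (rule dual_module[OF A_module S])

lemma bil_dual_mult: "lin S f \<Longrightarrow> lin S g \<Longrightarrow> bil S (\<lambda>x y. f x \<otimes>\<^bsub>S\<^esub> g y)"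
  using linD[of S f] linD[of S g] S.smult_assoc2
  by (intro bilI linI) (auto simp: S.l_distr S.r_distr S.m_comm)

lemma lin_dual_prod: "(\<And>f. f \<in> set fs \<Longrightarrow> lin S f) \<Longrightarrow> lin S (dual_prod S fs)"
proof (induction fs)
  case Nil
  show ?case
    using S.smult_l_distr[of _ _ "\<one>\<^bsub>S\<^esub>"] S.smult_assoc1[of _ _ "\<one>\<^bsub>S\<^esub>"] by (intro linI) auto
next
  case (Cons f fs)
  then show ?case using sw_lin[OF S.module_axioms bil_dual_mult[of f "dual_prod S fs"]] by simp
qed

text \<open>G n is defined by K-valued functionals, but the factors here take values in an arbitrary
  test algebra. \<open>sw_G_zero\<close> bridges the gap because its target is any K-module: split
  off one factor and use induction for the others.\<close>

lemma dual_prod_G: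
  assumes "\<And>f. f \<in> set fs \<Longrightarrow> lin S f" "\<And>f. f \<in> set fs \<Longrightarrow> f 1 = \<zero>\<^bsub>S\<^esub>" "a \<in> G (length fs)"
  shows "dual_prod S fs a = \<zero>\<^bsub>S\<^esub>"
  using assms
proof (induction fs arbitrary: a)
  case Nil
  then show ?case using S.module_axioms by simp
next
  case (Cons f fs)
  have l: "lin S (dual_prod S fs)" using Cons.prems by (intro lin_dual_prod) simp
  have "sw S (\<lambda>x y. f x \<otimes>\<^bsub>S\<^esub> dual_prod S fs y) a = \<zero>\<^bsub>S\<^esub>"
  proof (rule sw_G_zero[OF S.module_axioms bil_dual_mult[OF _ l], of f])
    show "f 1 \<otimes>\<^bsub>S\<^esub> dual_prod S fs y = \<zero>\<^bsub>S\<^esub>" for y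
      using Cons.prems(2)[of f] linD(1)[OF l, of y] by simp
    show "f x \<otimes>\<^bsub>S\<^esub> dual_prod S fs y = \<zero>\<^bsub>S\<^esub>" if "y \<in> G (length fs)" for x y
      using Cons that linD(1)[of S f] by simp
    show "a \<in> G (Suc (length fs))" using Cons.prems by simp
  qed (use Cons in simp)
  then show ?case by simp
qed

end

text \<open>The explicit candidate for the n-th power of the augmentation ideal.\<close>

definition ann :: "nat \<Rightarrow> ('k, 's) module \<Rightarrow> ('a \<Rightarrow> 's) set" where
  "ann n S = {f. lin S f \<and> (\<forall>w\<in>G n. f w = \<zero>\<^bsub>S\<^esub>)}"

lemma ann_submodule:
  assumes S: "S \<in> kalgs" shows "submodule (ann n S) S (fob (dual A) S)"
proof -
  interpret S: algebra KK S by (rule kalgsD[OF S])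
  interpret D: module S "fob (dual A) S" by (rule dual_module[OF A_module S])
  show ?thesis
    using D.zero_closed D.a_closed D.smult_closed
    by (intro D.submoduleI') (auto simp: ann_def)
qed

lemma aug_mult_image_ann:
  assumes S: "S \<in> kalgs" shows "aug_mult_image A n S \<subseteq> ann n S"
  unfolding aug_mult_image_def
proof (rule lspan_minimal[OF ann_submodule[OF S]], safe)
  fix fs :: "('a \<Rightarrow> 'b) list" assume fs: "set fs \<subseteq> aug_ideal A S" "n = length fs"
  then have "lin S f" "f 1 = \<zero>\<^bsub>S\<^esub>" if "f \<in> set fs" for f
    using that by (auto simp: aug_ideal_def)
  then show "dual_prod S fs \<in> ann (length fs) S"
    using lin_dual_prod[OF S] dual_prod_G[OF S] by (auto simp: ann_def)
qed

lemma dual_prod_aug_mult_image: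
  assumes "\<And>f. f \<in> set fs \<Longrightarrow> lin S f" "\<And>f. f \<in> set fs \<Longrightarrow> f 1 = \<zero>\<^bsub>S\<^esub>"
  shows "dual_prod S fs \<in> aug_mult_image A (length fs) S"
  unfolding aug_mult_image_def
  by (rule lspan_superset[THEN subsetD]) (use assms in \<open>auto simp: aug_ideal_def\<close>)

lemma kalg_homD:
  assumes "h \<in> kalg_hom S T" "S \<in> kalgs" "T \<in> kalgs"
  shows "linear_map KK S T h" "h \<zero>\<^bsub>S\<^esub> = \<zero>\<^bsub>T\<^esub>"
  using assms linear_map_zero[OF kalgsD(2) kalgsD(2)] by (auto simp: kalg_hom_def)

end

section \<open>The test algebra K, completeness and the tangent space\<close>

context cbialg0
begin

context
  fixes \<iota> :: "'a \<Rightarrow> 's"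
  assumes \<iota>: "inj \<iota>"
begin

text \<open>The field reaches the universe through the scalar multiples of 1 in A. In characteristic
  zero this also makes the universe infinite.\<close>

definition jK :: "'k \<Rightarrow> 's" where "jK c = \<iota> (scale c 1)"

lemma jK: "inj jK"
proof (rule injI)
  fix c d assume "jK c = jK d"
  then have "scale c 1 = scale d 1" using \<iota> by (simp add: jK_def inj_eq)
  then have "\<epsilon> (scale c 1) = \<epsilon> (scale d 1)" by simp
  then show "c = d" by simp
qed

lemma infinite_universe: "infinite (UNIV :: 's set)"
  using finite_imageD[OF _ jK] infinite_UNIV_char_0 finite_subset[of "range jK" UNIV] by auto

abbreviation SK :: "('k, 's) module" where "SK \<equiv> transport jK KM"

lemma jK_on: "inj_on jK (carrier KM)" using jK by simp

lemma SK: "SK \<in> kalgs" by (rule transport_kalgs[OF KM_algebra jK_on])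

lemma jK_lin: "linear_map KK KM SK jK" by (rule transport_linear[OF jK_on])

interpretation SK: algebra KK SK by (rule kalgsD[OF SK])

lemma lin_jK: "lin KM f \<Longrightarrow> lin SK (\<lambda>x. jK (f x))"
  by (rule linear_map_comp[OF _ jK_lin])

lemma jK_simps: "jK c \<otimes>\<^bsub>SK\<^esub> jK d = jK (c * d)" "jK c \<oplus>\<^bsub>SK\<^esub> jK d = jK (c + d)" "\<zero>\<^bsub>SK\<^esub> = jK 0" "\<one>\<^bsub>SK\<^esub> = jK 1"
  "c \<odot>\<^bsub>SK\<^esub> jK d = jK (c * d)"
  using transport_simps[OF jK_on] by simp_all

text \<open>Over the copy of K in the universe, multiplication in the dual algebra becomes the
  transpose of \<open>act\<close>.\<close>

lemma dual_mult_jK: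
  assumes f: "lin KM f" and h: "lin SK h"
  shows "sw SK (\<lambda>x y. jK (f x) \<otimes>\<^bsub>SK\<^esub> h y) a = h (act f a)"
proof -
  have "jK (f x) \<otimes>\<^bsub>SK\<^esub> h y = f x \<odot>\<^bsub>SK\<^esub> h y" for x y
  proof -
    obtain c where "h y = jK c" using linD(1)[OF h, of y] by (auto simp: transport_simps(1)[OF jK_on])
    then show ?thesis by (simp add: jK_simps)
  qed
  then show ?thesis using act_apply[OF SK.module_axioms f h] by simp
qed

text \<open>Converse of \<open>dual_prod_G\<close> at K: splitting off the first factor f replaces a
  by \<open>act f a\<close>, as in the recursion for G. The induction starts at one factor because
  the empty product is \<epsilon>, whose kernel is in general larger than G 0 = 0.\<close>

lemma G_dual_prod:
  assumes "\<And>fs. length fs = Suc n \<Longrightarrow> (\<And>f. f \<in> set fs \<Longrightarrow> lin SK f) \<Longrightarrow> (\<And>f. f \<in> set fs \<Longrightarrow> f 1 = \<zero>\<^bsub>SK\<^esub>) \<Longrightarrow>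
    dual_prod SK fs a = \<zero>\<^bsub>SK\<^esub>"
  shows "a \<in> G (Suc n)"
  using assms
proof (induction n arbitrary: a)
  case 0
  have one: "dual_prod SK [] = (\<lambda>x. jK (\<epsilon> x))" by (simp add: jK_simps)
  have "f a = 0" if f: "lin KM f" "f 1 = 0" for f
  proof -
    have "dual_prod SK [\<lambda>x. jK (f x)] a = jK (\<epsilon> (act f a))"
      using dual_mult_jK[OF f(1) lin_jK[OF \<epsilon>_lin], of a] by (simp add: jK_simps)
    also have "\<epsilon> (act f a) = f a" using act_swap[OF f(1) \<epsilon>_lin, of a] by simp
    finally have "jK (f a) = jK 0"
      using 0[of "[\<lambda>x. jK (f x)]"] f lin_jK[OF f(1)] by (simp add: jK_simps)
    then show ?thesis using injD[OF jK] by blast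
  qed
  note * = this
  have "a = scale (\<epsilon> a) 1"
  proof (rule functional_eqI)
    fix f assume f: "lin KM f"
    have "lin KM (\<lambda>x. f x - f 1 * \<epsilon> x)" using f \<epsilon>_lin by (intro lin_diff lin_smult)
    then show "f a = f (scale (\<epsilon> a) 1)" using *[of "\<lambda>x. f x - f 1 * \<epsilon> x"] linK[OF f] by (simp add: mult.commute)
  qed
  then show ?case unfolding G_1 by blast
next
  case (Suc n)
  have "act f a \<in> G (Suc n)" if f: "lin KM f" "f 1 = 0" for f
  proof (rule Suc.IH)
    fix fs :: "('a \<Rightarrow> 's) list"
    assume fs: "length fs = Suc n" "\<And>f. f \<in> set fs \<Longrightarrow> lin SK f" "\<And>f. f \<in> set fs \<Longrightarrow> f 1 = \<zero>\<^bsub>SK\<^esub>"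
    have l: "lin SK (dual_prod SK fs)" using fs by (intro lin_dual_prod[OF SK])
    have "dual_prod SK fs (act f a) = dual_prod SK ((\<lambda>x. jK (f x)) # fs) a"
      using dual_mult_jK[OF f(1) l, of a] by simp
    also have "\<dots> = \<zero>\<^bsub>SK\<^esub>"
      by (rule Suc.prems) (use fs f lin_jK in \<open>auto simp: jK_simps\<close>)
    finally show "dual_prod SK fs (act f a) = \<zero>\<^bsub>SK\<^esub>" .
  qed
  then show ?case by simp
qed

text \<open>Functionals that vanish on G n are the same as functionals on a complement of G n,
  naturally in the test algebra; the annihilator is thus the dual of that complement.\<close>

lemma ann_subscheme: "module_subscheme (dual A :: ('k, 's, 'a \<Rightarrow> 's) modfun) (ann n)"
  unfolding module_subscheme_def
proof (intro conjI)
  show "submodule_fun (dual A :: ('k, 's, 'a \<Rightarrow> 's) modfun) (ann n)"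
    unfolding submodule_fun_def
  proof (intro conjI ballI subsetI)
    fix S T :: "('k, 's) module" and h f
    assume S: "S \<in> kalgs" and T: "T \<in> kalgs" and h: "h \<in> kalg_hom S T" and "f \<in> far (dual A) S T h ` ann n S"
    then show "f \<in> ann n T"
      using kalg_homD[OF h S T] linear_map_comp[of KK A S _ T h] by (auto simp: ann_def)
  qed (rule ann_submodule)
  obtain e where e: "lin A e" "\<forall>w\<in>G n. e w = w" "\<forall>a. e a \<in> G n" by (rule projection[OF G_subspace])
  \<comment> \<open>The complement cut out by the projection e onto G n. It is a subspace of A, so
    \<iota> carries it into the universe, where representing modules must live.\<close>
  define C where "C = range (\<lambda>a. a - e a)"
  have Csub: "submodule C KK A"
  proof (rule B.submoduleI')
    show "\<zero>\<^bsub>A\<^esub> \<in> C" unfolding C_def using linA[OF e(1)] by (auto intro!: image_eqI[of _ _ 0])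
    show "a \<oplus>\<^bsub>A\<^esub> b \<in> C" if "a \<in> C" "b \<in> C" for a b
      using that linA[OF e(1)] unfolding C_def by (auto simp: image_iff) (metis add_diff_add)
    show "c \<odot>\<^bsub>A\<^esub> a \<in> C" if "a \<in> C" for c a
      using that linA[OF e(1)] unfolding C_def by (auto simp: image_iff vs.scale_right_diff_distrib) metis
  qed simp
  have i: "inj_on \<iota> (carrier (A\<lparr>carrier := C\<rparr>))" using \<iota> by (auto intro: inj_on_subset)
  let ?M = "transport \<iota> (A\<lparr>carrier := C\<rparr>) :: ('k, 's) module"
  note tr = transport_simps[OF i]
  have M: "module KK ?M"
    by (rule transport_module[OF i submodule.submodule_is_module[OF Csub A_module]])
  have pC: "a - e a \<in> C" for a by (simp add: C_def)
  have pl: "lin ?M (\<lambda>a. \<iota> (a - e a))"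
  proof (rule linI)
    show "\<iota> (x - e x) \<in> carrier ?M" for x by (simp add: tr pC)
    show "\<iota> (x + y - e (x + y)) = \<iota> (x - e x) \<oplus>\<^bsub>?M\<^esub> \<iota> (y - e y)" for x y
      using tr(4)[of "x - e x" "y - e y"] pC linA[OF e(1)] by (simp add: algebra_simps)
    show "\<iota> (scale c x - e (scale c x)) = c \<odot>\<^bsub>?M\<^esub> \<iota> (x - e x)" for c x
      using tr(6)[of "x - e x" c] pC linA[OF e(1)] by (simp add: vs.scale_right_diff_distrib)
  qed
  have eC: "e x = 0" if "x \<in> C" for x
    using that e linA[OF e(1)] by (auto simp: C_def)
  define \<theta> :: "('k, 's) module \<Rightarrow> ('s \<Rightarrow> 's) \<Rightarrow> 'a \<Rightarrow> 's" where "\<theta> = (\<lambda>S g a. g (\<iota> (a - e a)))"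
  have \<theta>_ann: "\<theta> S g \<in> ann n S" if S: "S \<in> kalgs" and g: "g \<in> carrier (fob (dual ?M) S)" for S g
  proof -
    have g: "linear_map KK ?M S g" using g by (simp add: dual_simps)
    have "\<theta> S g w = \<zero>\<^bsub>S\<^esub>" if "w \<in> G n" for w
      using that e(2) linear_map_zero[OF M kalgsD(2)[OF S] g] by (simp add: \<theta>_def tr)
    then show ?thesis using linear_map_comp[OF pl g] by (simp add: ann_def \<theta>_def)
  qed
  have M_cases: "\<exists>a. x = \<iota> (a - e a)" if "x \<in> carrier ?M" for x
    using that unfolding tr(1) by (auto simp: C_def)
  show "\<exists>(M :: ('k, 's) module) \<theta>. module KK M \<and> \<theta> \<in> Hom_fun (dual M) (sub_fun (dual A :: ('k, 's, 'a \<Rightarrow> 's) modfun) (ann n)) \<and>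
        (\<forall>S\<in>kalgs. bij_betw (\<theta> S) (carrier (fob (dual M) S)) (ann n S))"
  proof (rule exI[of _ ?M], rule exI[of _ \<theta>], intro conjI ballI)
    show "module KK ?M" by (rule M)
    show "\<theta> \<in> Hom_fun (dual ?M) (sub_fun (dual A) (ann n))"
      unfolding Hom_fun_def
    proof (intro CollectI conjI ballI)
      fix S :: "('k, 's) module" assume S: "S \<in> kalgs"
      show "linear_map S (fob (dual ?M) S) (fob (sub_fun (dual A) (ann n)) S) (\<theta> S)"
      proof (rule linear_mapI)
        show "\<theta> S x \<in> carrier (fob (sub_fun (dual A) (ann n)) S)" if "x \<in> carrier (fob (dual ?M) S)" for x
          using \<theta>_ann[OF S that] by (simp add: sub_fun_def)
      qed (simp_all add: \<theta>_def sub_fun_def dual_simps linD(1)[OF pl])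
    next
      fix S T :: "('k, 's) module" and h x
      assume "x \<in> carrier (fob (dual ?M) S)"
      show "\<theta> T (far (dual ?M) S T h x) = far (sub_fun (dual A) (ann n)) S T h (\<theta> S x)"
        by (simp add: \<theta>_def sub_fun_def dual_simps linD(1)[OF pl])
    qed
    fix S :: "('k, 's) module" assume S: "S \<in> kalgs"
    show "bij_betw (\<theta> S) (carrier (fob (dual ?M) S)) (ann n S)"
      unfolding bij_betw_def
    proof (intro conjI inj_onI subset_antisym subsetI)
      fix g g' assume g: "g \<in> carrier (fob (dual ?M) S)" "g' \<in> carrier (fob (dual ?M) S)" and eq: "\<theta> S g = \<theta> S g'"
      show "g = g'"
      proof (rule extensionalityI[of _ "carrier ?M"])
        fix x assume "x \<in> carrier ?M"
        then obtain a where "x = \<iota> (a - e a)" using M_cases by blast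
        then show "g x = g' x" using fun_cong[OF eq, of a] by (simp add: \<theta>_def)
      qed (use g in \<open>simp_all add: dual_simps\<close>)
    next
      fix f assume "f \<in> \<theta> S ` carrier (fob (dual ?M) S)"
      then show "f \<in> ann n S" using \<theta>_ann[OF S] by auto
    next
      fix f assume f: "f \<in> ann n S"
      then have fl: "lin S f" and f0: "\<And>w. w \<in> G n \<Longrightarrow> f w = \<zero>\<^bsub>S\<^esub>" by (auto simp: ann_def)
      define g where "g = (\<lambda>x\<in>carrier ?M. f (inv_into UNIV \<iota> x))"
      have "linear_map KK ?M S g"
      proof (rule linear_mapI)
        show "g x \<in> carrier S" if "x \<in> carrier ?M" for x using that linD(1)[OF fl] by (simp add: g_def)
        fix x y assume xy: "x \<in> carrier ?M" "y \<in> carrier ?M"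
        then obtain a b where ab: "x = \<iota> a" "y = \<iota> b" "a \<in> C" "b \<in> C" by (auto simp: tr)
        have "a + b \<in> C" using B.submoduleE(5)[OF Csub ab(3,4)] by simp
        then show "g (x \<oplus>\<^bsub>?M\<^esub> y) = g x \<oplus>\<^bsub>S\<^esub> g y"
          using ab tr(4)[of a b] linD(2)[OF fl] \<iota> by (simp add: g_def tr(1))
      next
        fix c :: 'k and x assume "x \<in> carrier ?M"
        then obtain a where a: "x = \<iota> a" "a \<in> C" by (auto simp: tr)
        have "scale c a \<in> C" using B.submoduleE(4)[OF Csub _ a(2), of c] by simp
        then show "g (c \<odot>\<^bsub>?M\<^esub> x) = c \<odot>\<^bsub>S\<^esub> g x"
          using a tr(6)[of a c] linD(3)[OF fl] \<iota> by (simp add: g_def tr(1))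
      qed
      then have "g \<in> carrier (fob (dual ?M) S)" by (simp add: dual_simps g_def)
      moreover have "\<theta> S g = f"
      proof
        fix a
        interpret Sm: module KK S by (rule kalgsD[OF S])
        have "f a = f (a - e a) \<oplus>\<^bsub>S\<^esub> f (e a)" using linD(2)[OF fl, of "a - e a" "e a"] by simp
        also have "\<dots> = f (a - e a)" using f0 e(3) linD(1)[OF fl] by simp
        finally show "\<theta> S g a = f a" using \<iota> linD(1)[OF pl] by (simp add: \<theta>_def g_def)
      qed
      ultimately show "f \<in> \<theta> S ` carrier (fob (dual ?M) S)" by blast
    qed
  qed
qed

lemma aug_power_subset_ann:
  fixes S :: "('k, 's) module"
  assumes "S \<in> kalgs" shows "aug_power A n S \<subseteq> ann n S"
  unfolding aug_power_def scheme_closure_def using ann_subscheme[of n] aug_mult_image_ann[of _ n] by blast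

lemma aug_mult_image_subset:
  fixes S :: "('k, 's) module"
  assumes "S \<in> kalgs" shows "aug_mult_image A n S \<subseteq> aug_power A n S"
  unfolding aug_power_def scheme_closure_def using assms by blast

text \<open>Submodules are stable under intersection, and the family intersected is not empty
  because \<open>ann n\<close> belongs to it.\<close>

lemma aug_power_submodule:
  fixes S :: "('k, 's) module"
  assumes S: "S \<in> kalgs" shows "submodule (aug_power A n S) S (fob (dual A) S)"
  unfolding aug_power_def scheme_closure_def
proof (rule module.submodule_Inter[OF dual_module[OF A_module S]])
  show "{N S |N. module_subscheme (dual A) N \<and> (\<forall>T\<in>kalgs. aug_mult_image A n T \<subseteq> N T)} \<noteq> {}"
    using ann_subscheme[of n] aug_mult_image_ann[of _ n] by blast
  show "submodule H S (fob (dual A) S)"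
    if "H \<in> {N S |N. module_subscheme (dual A) N \<and> (\<forall>T\<in>kalgs. aug_mult_image A n T \<subseteq> N T)}" for H
    using that S unfolding module_subscheme_def submodule_fun_def by blast
qed

lemma aug_power_far:
  fixes S T :: "('k, 's) module"
  assumes S: "S \<in> kalgs" and T: "T \<in> kalgs" and h: "h \<in> kalg_hom S T" and f: "f \<in> aug_power A n S"
  shows "far (dual A) S T h f \<in> aug_power A n T"
  unfolding aug_power_def scheme_closure_def
proof (rule InterI)
  fix Y assume "Y \<in> {N T |N. module_subscheme (dual A) N \<and> (\<forall>T\<in>kalgs. aug_mult_image A n T \<subseteq> N T)}"
  then obtain N where N: "Y = N T" "module_subscheme (dual A) N" "\<forall>T\<in>kalgs. aug_mult_image A n T \<subseteq> N T" by blast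
  then have "f \<in> N S" using f unfolding aug_power_def scheme_closure_def by blast
  then show "far (dual A) S T h f \<in> Y"
    using N(1,2) S T h unfolding module_subscheme_def submodule_fun_def by blast
qed

lemma aug_power_quot_mod: "S \<in> kalgs \<Longrightarrow> quot_mod S (fob (dual A) S) (aug_power A n (S :: ('k, 's) module))"
  by (intro quot_mod.intro quot_mod_axioms.intro dual_module[OF A_module] aug_power_submodule)

text \<open>
  At \<open>S = K\<close> the closure contains every functional vanishing on \<open>G (Suc i)\<close>: by the anti-equivalence, a module
  subscheme \<open>N\<close> is given by a linear map \<open>p\<close>, which is onto, and \<open>N\<close> consists of all functionals on \<open>A\<close> that
  kill the kernel of \<open>p\<close>.
\<close>

lemma ann_subset_aug_power: "ann (Suc i) SK \<subseteq> aug_power A (Suc i) SK"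
proof
  fix f assume "f \<in> ann (Suc i) SK"
  then have f: "lin SK f" "\<And>w. w \<in> G (Suc i) \<Longrightarrow> f w = \<zero>\<^bsub>SK\<^esub>" by (auto simp: ann_def)
  have "f \<in> N SK" if sub: "module_subscheme (dual A) N" and Z: "\<forall>T\<in>kalgs. aug_mult_image A (Suc i) T \<subseteq> N T"
    for N :: "('k, 's) module \<Rightarrow> ('a \<Rightarrow> 's) set"
  proof -
    obtain M :: "('k, 's) module" and \<theta> where M: "module KK M" and \<theta>: "\<theta> \<in> Hom_fun (dual M) (sub_fun (dual A) N)"
      and bij: "\<forall>S\<in>kalgs. bij_betw (\<theta> S) (carrier (fob (dual M) S)) (N S)"
      and subm: "\<forall>S\<in>kalgs. submodule (N S) S (fob (dual A) S)"
      using sub unfolding module_subscheme_def submodule_fun_def by blast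
    interpret M: module KK M by (rule M)
    have Nsub: "N S \<subseteq> carrier (fob (dual A) S)" if "S \<in> kalgs" for S
      using subm that module.submoduleE(1)[OF dual_module[OF A_module that]] by blast
    have \<theta>_lin: "linear_map S (fob (dual M) S) (fob (dual A) S) (\<theta> S)" if S: "S \<in> kalgs" for S
    proof -
      have l: "linear_map S (fob (dual M) S) (fob (sub_fun (dual A) N) S) (\<theta> S)"
        using \<theta> S by (simp add: Hom_fun_def)
      show ?thesis
        using linear_mapD[OF l] Nsub[OF S] by (intro linear_mapI) (auto simp: sub_fun_def simp del: dual_A_carrier dual_A_ops)
    qed
    have \<theta>_nat: "\<theta> T (far (dual M) S T h g) = far (dual A) S T h (\<theta> S g)"
      if "S \<in> kalgs" "T \<in> kalgs" "h \<in> kalg_hom S T" "g \<in> carrier (fob (dual M) S)" for S T h g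
      using \<theta> that unfolding Hom_fun_def sub_fun_def by simp
    obtain p where p: "lin M p"
      and \<theta>_eq: "\<forall>T\<in>kalgs. \<forall>g\<in>carrier (fob (dual M) T). \<theta> T g = (\<lambda>a\<in>carrier A. g (p a))"
      by (rule morphism_of_duals[OF infinite_universe jK M A_module \<theta>_lin \<theta>_nat])
    \<comment> \<open>Over T = K \<oplus> M / range p, the quotient map of M is a T-valued
      functional whose composite with p is zero. Injectivity of \<theta> forces it to be zero
      itself, so the quotient is trivial.\<close>
    have p_onto: "\<exists>a. p a = m" if m: "m \<in> carrier M" for m
    proof -
      have "submodule (range p) KK M"
      proof (rule M.submoduleI')
        show "range p \<subseteq> carrier M" using linD(1)[OF p] by auto
        show "\<zero>\<^bsub>M\<^esub> \<in> range p" using lin_zero[OF M p] by (metis rangeI)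
        show "x \<oplus>\<^bsub>M\<^esub> y \<in> range p" if "x \<in> range p" "y \<in> range p" for x y
          using that linD(2)[OF p] by (metis (no_types, lifting) imageE rangeI)
        show "c \<odot>\<^bsub>M\<^esub> x \<in> range p" if "x \<in> range p" for c x
          using that linD(3)[OF p] by (metis (no_types, lifting) imageE rangeI)
      qed
      then interpret Q: quot_mod KK M "range p" by (intro quot_mod.intro quot_mod_axioms.intro M)
      let ?E = "sq_zero_ext KM (quot_module M (range p))"
      have E: "algebra KK ?E" by (rule sq_zero_ext_algebra[OF KM_algebra KM_scalars[OF Q.quot_is_module]])
      obtain j2 :: "'s \<times> 's \<Rightarrow> 's" where j2: "inj j2" by (rule inj_pair[OF infinite_universe])
      \<comment> \<open>Elements of the quotient are subsets of the universe; chosen representatives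
        embed it into the universe itself.\<close>
      define r where "r = (\<lambda>Z :: 's set. SOME z. z \<in> Z)"
      have r: "r Z \<in> Z \<and> Z = range p +>\<^bsub>M\<^esub> r Z" if Z: "Z \<in> carrier (quot_module M (range p))" for Z
      proof -
        obtain m where m: "m \<in> carrier M" "Z = range p +>\<^bsub>M\<^esub> m" using Z by (rule Q.quot_cases)
        then have rZ: "r Z \<in> Z" unfolding r_def using Q.coset_self by (metis someI)
        then show ?thesis using Q.coset_mem_iff[OF m(1), of "r Z"] Q.coset_subset[OF m(1)] m(2) by auto
      qed
      define j where "j = (\<lambda>x. j2 (jK (fst x), r (snd x)))"
      have "inj_on r (carrier (quot_module M (range p)))"
      proof (rule inj_onI)
        fix Z Y assume "Z \<in> carrier (quot_module M (range p))" "Y \<in> carrier (quot_module M (range p))" "r Z = r Y"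
        then show "Z = Y" using r[of Z] r[of Y] by metis
      qed
      then have j: "inj_on j (carrier ?E)"
        by (auto simp: inj_on_def j_def inj_eq[OF j2] inj_eq[OF jK])
      let ?T = "transport j ?E"
      have T: "?T \<in> kalgs" by (rule transport_kalgs[OF E j])
      interpret T: algebra KK ?T by (rule kalgsD[OF T])
      interpret E: algebra KK ?E by (rule E)
      let ?u = "\<lambda>m\<in>carrier M. j (0, range p +>\<^bsub>M\<^esub> m)" and ?z = "\<lambda>m\<in>carrier M. \<zero>\<^bsub>?T\<^esub>"
      have "linear_map KK M ?E (\<lambda>m. (0, range p +>\<^bsub>M\<^esub> m))"
        by (rule linear_mapI) (auto simp: Q.coset_add Q.coset_smult Q.coset_carrier)
      from linear_map_comp[OF this transport_linear[OF j]]
      have "linear_map KK M ?T ?u"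
        by (simp add: linear_map_cong[OF _ M, of ?u "\<lambda>m. j (0, range p +>\<^bsub>M\<^esub> m)"])
      then have u: "?u \<in> carrier (fob (dual M) ?T)" by (simp add: dual_simps)
      interpret DM: module ?T "fob (dual M) ?T" by (rule dual_module[OF M T])
      have z: "?z \<in> carrier (fob (dual M) ?T)" using DM.zero_closed by (simp add: dual_simps(2))
      have z0: "\<zero>\<^bsub>?T\<^esub> = j (0, range p)" by (simp add: transport_simps[OF j] quot_module_simps(3))
      have "range p +>\<^bsub>M\<^esub> p a = range p" for a
        using Q.coset_eq_H_iff[of "p a"] linD(1)[OF p] by simp
      then have "\<theta> ?T ?u = \<theta> ?T ?z"
        using \<theta>_eq[rule_format, OF T u] \<theta>_eq[rule_format, OF T z] linD(1)[OF p] z0 by simp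
      then have uz: "?u = ?z" using bij[rule_format, OF T] u z unfolding bij_betw_def by (auto dest: inj_onD)
      have "?u m = ?z m" by (simp only: uz)
      then have "j (0, range p +>\<^bsub>M\<^esub> m) = j (0, range p)" using m z0 by simp
      moreover have "(0, range p) \<in> carrier ?E" "(0, range p +>\<^bsub>M\<^esub> m) \<in> carrier ?E"
        using E.zero_closed Q.coset_carrier[OF m] by (simp_all add: quot_module_simps(3))
      ultimately have "range p +>\<^bsub>M\<^esub> m = range p" using inj_onD[OF j] by blast
      then show ?thesis using Q.coset_eq_H_iff[OF m] by auto
    qed
    \<comment> \<open>N contains all products of Suc i augmentation functionals, so each of them
      factors through p and vanishes on its kernel; \<open>G_dual_prod\<close> turns this into
      membership.\<close>
    have ker: "a \<in> G (Suc i)" if a: "p a = \<zero>\<^bsub>M\<^esub>" for a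
    proof (rule G_dual_prod)
      fix fs :: "('a \<Rightarrow> 's) list"
      assume fs: "length fs = Suc i" "\<And>f. f \<in> set fs \<Longrightarrow> lin SK f" "\<And>f. f \<in> set fs \<Longrightarrow> f 1 = \<zero>\<^bsub>SK\<^esub>"
      have "dual_prod SK fs \<in> N SK"
        using dual_prod_aug_mult_image[of fs SK] fs Z SK by auto
      then obtain g where g: "g \<in> carrier (fob (dual M) SK)" "dual_prod SK fs = \<theta> SK g"
        using bij SK unfolding bij_betw_def by blast
      then have "dual_prod SK fs a = g (p a)" using \<theta>_eq SK by simp
      then show "dual_prod SK fs a = \<zero>\<^bsub>SK\<^esub>"
        using a g(1) linear_map_zero[OF M SK.module_axioms] by (simp add: dual_simps)
    qed
    have f_eq: "f a = f b" if "p a = p b" for a b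
    proof -
      have "p (a - b) = \<zero>\<^bsub>M\<^esub>" using that lin_minus[OF M p, of a b] linD(1)[OF p] by simp
      then have "f (a - b) = \<zero>\<^bsub>SK\<^esub>" using ker f(2) by blast
      then show ?thesis using linD(2)[OF f(1), of "a - b" b] linD(1)[OF f(1)] by simp
    qed
    \<comment> \<open>f kills G (Suc i), hence the kernel of p, so its value does not depend on the
      chosen preimage. The induced functional on M corresponds to f under \<theta>, which places f
      in N.\<close>
    define g where "g = (\<lambda>m\<in>carrier M. f (SOME a. p a = m))"
    have gp: "g (p a) = f a" for a
    proof -
      have "p (SOME b. p b = p a) = p a" by (rule someI[of _ a]) simp
      from f_eq[OF this] show ?thesis using linD(1)[OF p] by (simp add: g_def)
    qed
    have "linear_map KK M SK g"
    proof (rule linear_mapI)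
      fix x y assume x: "x \<in> carrier M" and y: "y \<in> carrier M"
      obtain a b where ab: "x = p a" "y = p b" using p_onto x y by metis
      then show "g (x \<oplus>\<^bsub>M\<^esub> y) = g x \<oplus>\<^bsub>SK\<^esub> g y"
        using gp[of "a + b"] linD(2)[OF p] linD(2)[OF f(1)] by (simp add: gp)
    next
      fix c :: 'k and x assume x: "x \<in> carrier M"
      obtain a where a: "x = p a" using p_onto x by metis
      then show "g (c \<odot>\<^bsub>M\<^esub> x) = c \<odot>\<^bsub>SK\<^esub> g x"
        using gp[of "scale c a"] linD(3)[OF p] linD(3)[OF f(1)] by (simp add: gp)
    next
      fix x assume x: "x \<in> carrier M"
      obtain a where "x = p a" using p_onto x by metis
      then show "g x \<in> carrier SK" using gp linD(1)[OF f(1)] by simp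
    qed
    then have g: "g \<in> carrier (fob (dual M) SK)" by (simp add: dual_simps g_def)
    then have "\<theta> SK g = f" using \<theta>_eq SK gp by simp
    then show "f \<in> N SK" using g bij SK unfolding bij_betw_def by blast
  qed
  then show "f \<in> aug_power A (Suc i) SK" unfolding aug_power_def scheme_closure_def by blast
qed

text \<open>A functional that vanishes on the union of the G n lies in every positive power of the
  augmentation ideal at K. Its image in the inverse limit is therefore that of 0, and completeness
  makes it zero; functionals separate the union from any element outside it.\<close>

lemma G_exhaustive:
  assumes "infinitesimal_formal_monoid TYPE('s) A"
  shows "\<exists>n. a \<in> G n"
proof -
  interpret D: module SK "fob (dual A) SK" by (rule dual_module[OF A_module SK])
  have "vs.subspace (\<Union>n. G n)"
    unfolding vs.subspace_def
  proof (intro conjI ballI allI)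
    show "0 \<in> (\<Union>n. G n)" using G_closed(1) by blast
    fix x y assume "x \<in> (\<Union>n. G n)" "y \<in> (\<Union>n. G n)"
    then obtain m n where "x \<in> G m" "y \<in> G n" by blast
    then have "x \<in> G (max m n)" "y \<in> G (max m n)" using G_mono[of m "max m n"] G_mono[of n "max m n"] by auto
    then show "x + y \<in> (\<Union>n. G n)" using G_closed(2) by blast
  next
    fix c x assume "x \<in> (\<Union>n. G n)"
    then show "scale c x \<in> (\<Union>n. G n)" using G_closed(3) by blast
  qed
  then have "a \<in> (\<Union>n. G n)"
  proof (rule functional_separates)
    fix f assume f: "lin KM f" and f0: "\<And>w. w \<in> (\<Union>n. G n) \<Longrightarrow> f w = 0"
    let ?f = "\<lambda>x. jK (f x)" and ?z = "\<lambda>x. \<zero>\<^bsub>SK\<^esub>"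
    have fl: "lin SK ?f" by (rule lin_jK[OF f])
    have zl: "lin SK ?z" using D.zero_closed by simp
    have "aug_power A i SK +>\<^bsub>fob (dual A) SK\<^esub> ?f = aug_power A i SK +>\<^bsub>fob (dual A) SK\<^esub> ?z" if i: "i \<ge> 1" for i
    proof -
      interpret Q: quot_mod SK "fob (dual A) SK" "aug_power A i SK" by (rule aug_power_quot_mod[OF SK])
      have zero: "\<zero>\<^bsub>fob (dual A) SK\<^esub> \<in> aug_power A i SK"
        by (rule module.submodule_zero[OF dual_module[OF A_module SK] aug_power_submodule[OF SK]])
      obtain k where k: "i = Suc k" using i by (cases i) auto
      have "f w = 0" if "w \<in> G i" for w using f0 that by blast
      then have "?f \<in> ann i SK" using fl by (simp add: ann_def jK_simps)
      then have "?f \<in> aug_power A i SK" using ann_subset_aug_power k by blast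
      moreover have "?z \<in> aug_power A i SK" using zero by simp
      ultimately show ?thesis using Q.coset_eq_H_iff[of ?f] Q.coset_eq_H_iff[of ?z] fl zl by simp
    qed
    then have "(\<lambda>i\<in>{1..}. aug_power A i SK +>\<^bsub>fob (dual A) SK\<^esub> ?f) = (\<lambda>i\<in>{1..}. aug_power A i SK +>\<^bsub>fob (dual A) SK\<^esub> ?z)"
      by (intro restrict_ext) simp
    moreover have "inj_on (\<lambda>f. \<lambda>i\<in>{1..}. aug_power A i SK +>\<^bsub>fob (dual A) SK\<^esub> f) (carrier (fob (dual A) SK))"
      using assms SK unfolding infinitesimal_formal_monoid_def bij_betw_def by blast
    ultimately have "?f = ?z" using fl zl by (auto dest: inj_onD)
    then have "jK (f a) = jK 0" using jK_simps(3) by metis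
    then show "f a = 0" using injD[OF jK] by blast
  qed
  then show ?thesis by blast
qed

text \<open>If evaluation at a factors through the quotient, it kills all products of n + 1
  augmentation functionals over K, which puts a in G (n + 1). Conversely, over every test algebra
  the power lies in the annihilator of G (n + 1), so evaluation at such an a descends.\<close>

lemma dual_filt_eq_G: "dual_filt TYPE('s) A n = G (Suc n)"
proof (intro equalityI subsetI)
  fix a assume "a \<in> dual_filt TYPE('s) A n"
  then obtain \<eta> where \<eta>: "\<forall>S :: ('k, 's) module \<in> kalgs. \<forall>f\<in>carrier (fob (dual A) S).
         \<eta> S (aug_power A (n + 1) S +>\<^bsub>fob (dual A) S\<^esub> f) = f a"
    unfolding dual_filt_def by blast
  interpret Q: quot_mod SK "fob (dual A) SK" "aug_power A (n + 1) SK" by (rule aug_power_quot_mod[OF SK])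
  show "a \<in> G (Suc n)"
  proof (rule G_dual_prod)
    fix fs :: "('a \<Rightarrow> 's) list"
    assume fs: "length fs = Suc n" "\<And>f. f \<in> set fs \<Longrightarrow> lin SK f" "\<And>f. f \<in> set fs \<Longrightarrow> f 1 = \<zero>\<^bsub>SK\<^esub>"
    let ?f = "dual_prod SK fs" and ?z = "\<lambda>x. \<zero>\<^bsub>SK\<^esub>"
    have zero: "\<zero>\<^bsub>fob (dual A) SK\<^esub> \<in> aug_power A (n + 1) SK"
      by (rule module.submodule_zero[OF dual_module[OF A_module SK] aug_power_submodule[OF SK]])
    have fz: "?f \<in> aug_power A (n + 1) SK"
      using dual_prod_aug_mult_image[of fs SK] fs aug_mult_image_subset[OF SK, of "n + 1"] by auto
    have zz: "?z \<in> aug_power A (n + 1) SK" using zero by simp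
    have fc: "?f \<in> carrier (fob (dual A) SK)" and zc: "?z \<in> carrier (fob (dual A) SK)"
      using Q.H_subset fz zz by blast+
    have "aug_power A (n + 1) SK +>\<^bsub>fob (dual A) SK\<^esub> ?f = aug_power A (n + 1) SK +>\<^bsub>fob (dual A) SK\<^esub> ?z"
      using Q.coset_eq_H_iff[OF fc] Q.coset_eq_H_iff[OF zc] fz zz by argo
    then show "?f a = \<zero>\<^bsub>SK\<^esub>"
      using \<eta>[rule_format, OF SK fc] \<eta>[rule_format, OF SK zc] by argo
  qed
next
  fix a assume a: "a \<in> G (Suc n)"
  define \<eta> where "\<eta> = (\<lambda>(S :: ('k, 's) module) Z. the_elem ((\<lambda>f :: 'a \<Rightarrow> 's. f a) ` Z))"
  have lift: "\<eta> S (aug_power A (n + 1) S +>\<^bsub>fob (dual A) S\<^esub> f) = f a"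
    "linear_map S (quot_module (fob (dual A) S) (aug_power A (n + 1) S)) (self_module S) (\<eta> S)"
    if S: "S \<in> kalgs" and f: "f \<in> carrier (fob (dual A) S)" for S f
  proof -
    interpret S: algebra KK S by (rule kalgsD[OF S])
    interpret Q: quot_mod S "fob (dual A) S" "aug_power A (n + 1) S" by (rule aug_power_quot_mod[OF S])
    have l: "linear_map S (fob (dual A) S) (self_module S) (\<lambda>f. f a)"
      by (rule linear_mapI) (auto simp: linD(1))
    have z: "x a = \<zero>\<^bsub>self_module S\<^esub>" if "x \<in> aug_power A (n + 1) S" for x
      using that aug_power_subset_ann[OF S, of "n + 1"] a by (auto simp: ann_def simp del: G.simps)
    show "\<eta> S (aug_power A (n + 1) S +>\<^bsub>fob (dual A) S\<^esub> f) = f a"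
      unfolding \<eta>_def by (rule Q.quot_lift(1)[where f = "\<lambda>f. f a", OF self_module_module[OF S.M_cring] l _ f], erule z)
    show "linear_map S (quot_module (fob (dual A) S) (aug_power A (n + 1) S)) (self_module S) (\<eta> S)"
      unfolding \<eta>_def by (rule Q.quot_lift(2)[where f = "\<lambda>f. f a", OF self_module_module[OF S.M_cring] l], erule z)
  qed
  have "\<eta> \<in> Hom_fun (quot_fun (dual A) (aug_power A (n + 1))) K_fun"
    unfolding Hom_fun_def
  proof (intro CollectI conjI ballI)
    fix S :: "('k, 's) module" assume S: "S \<in> kalgs"
    interpret D: module S "fob (dual A) S" by (rule dual_module[OF A_module S])
    show "linear_map S (fob (quot_fun (dual A) (aug_power A (n + 1))) S) (fob K_fun S) (\<eta> S)"
      using lift(2)[OF S D.zero_closed] by (simp add: quot_fun_def K_fun_def)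
  next
    fix S T :: "('k, 's) module" and h Z
    assume S: "S \<in> kalgs" and T: "T \<in> kalgs" and h: "h \<in> kalg_hom S T"
      and Z: "Z \<in> carrier (fob (quot_fun (dual A) (aug_power A (n + 1))) S)"
    interpret Q: quot_mod S "fob (dual A) S" "aug_power A (n + 1) S" by (rule aug_power_quot_mod[OF S])
    interpret QT: quot_mod T "fob (dual A) T" "aug_power A (n + 1) T" by (rule aug_power_quot_mod[OF T])
    interpret TK: module KK T by (rule kalgsD[OF T])
    interpret SS: module KK S by (rule kalgsD[OF S])
    obtain f where f: "f \<in> carrier (fob (dual A) S)" "Z = aug_power A (n + 1) S +>\<^bsub>fob (dual A) S\<^esub> f"
      by (rule Q.quot_cases[of Z]) (use Z in \<open>simp add: quot_fun_def\<close>)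
    note hl = kalg_homD(1)[OF h S T]
    have far: "(\<lambda>x. h (g x)) \<in> carrier (fob (dual A) T)" if "g \<in> carrier (fob (dual A) S)" for g
      using that linear_map_comp[OF _ hl] by simp
    \<comment> \<open>Base change along h preserves the ideal power, so all members of the coset Z
      are sent to a single coset over T.\<close>
    have "(\<Union>x\<in>Z. aug_power A (n + 1) T +>\<^bsub>fob (dual A) T\<^esub> far (dual A) S T h x) =
        aug_power A (n + 1) T +>\<^bsub>fob (dual A) T\<^esub> far (dual A) S T h f"
      unfolding f(2)
    proof (rule Q.coset_UN[OF _ f(1)])
      fix x y assume xy: "x \<in> carrier (fob (dual A) S)" "y \<in> carrier (fob (dual A) S)"
        "x \<ominus>\<^bsub>fob (dual A) S\<^esub> y \<in> aug_power A (n + 1) S"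
      show "aug_power A (n + 1) T +>\<^bsub>fob (dual A) T\<^esub> far (dual A) S T h x =
          aug_power A (n + 1) T +>\<^bsub>fob (dual A) T\<^esub> far (dual A) S T h y"
      proof -
        let ?d = "x \<ominus>\<^bsub>fob (dual A) S\<^esub> y"
        have d: "?d \<in> carrier (fob (dual A) S)" by (rule Q.M.minus_closed[OF xy(1,2)])
        have "x = ?d \<oplus>\<^bsub>fob (dual A) S\<^esub> y"
          using xy(1,2) Q.M.a_assoc Q.M.l_neg Q.M.r_zero Q.M.a_inv_closed unfolding a_minus_def by metis
        then have x: "x b = ?d b \<oplus>\<^bsub>S\<^esub> y b" for b by (metis dual_A_ops(2))
        have "h (x b) = h (?d b) \<oplus>\<^bsub>T\<^esub> h (y b)" for b
          unfolding x[of b] by (rule linear_mapD(2)[OF hl]) (use d xy(2) linD(1) in auto)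
        then have e: "(\<lambda>b. h (x b)) = (\<lambda>b. h (?d b)) \<oplus>\<^bsub>fob (dual A) T\<^esub> (\<lambda>b. h (y b))" by simp
        have "aug_power A (n + 1) T +>\<^bsub>fob (dual A) T\<^esub> (\<lambda>b. h (x b)) =
            aug_power A (n + 1) T +>\<^bsub>fob (dual A) T\<^esub> (\<lambda>b. h (y b))"
          using QT.coset_eq_iff[OF far[OF xy(1)] far[OF xy(2)]] aug_power_far[OF S T h xy(3)]
            QT.M.minus_eqI[OF far[OF d] far[OF xy(2)] e] by (simp only: dual_A_ops(4))
        then show ?thesis by (simp only: dual_A_ops(4))
      qed
    qed
    then show "\<eta> T (far (quot_fun (dual A) (aug_power A (n + 1))) S T h Z) = far K_fun S T h (\<eta> S Z)"
      using lift(1)[OF T far[OF f(1)]] lift(1)[OF S f(1)] f(2) by (simp add: quot_fun_def K_fun_def)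
  qed
  then show "a \<in> dual_filt TYPE('s) A n"
    unfolding dual_filt_def by (intro CollectI conjI bexI[of _ \<eta>] ballI lift(1)) simp_all
qed

text \<open>At K the derivation rule reads g(act f a) = f(a) g(1) + f(1) g(a). The choice f = g =
  \<epsilon> gives \<epsilon>(a) = 0; for f(1) = 0 it says that \<open>act f a\<close> is a scalar,
  so a lies in G 2 and \<open>G_2\<close> shows that it is primitive. The converse evaluates
  \<open>\<Delta> a\<close> directly.\<close>

lemma tangent_eq_prim: "tangent TYPE('s) A = Collect prim"
proof (intro equalityI subsetI CollectI)
  fix a assume "a \<in> tangent TYPE('s) A"
  then have der: "f a \<otimes>\<^bsub>SK\<^esub> g 1 \<oplus>\<^bsub>SK\<^esub> f 1 \<otimes>\<^bsub>SK\<^esub> g a = sw SK (\<lambda>x y. f x \<otimes>\<^bsub>SK\<^esub> g y) a"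
    if "lin SK f" "lin SK g" for f g
    using that SK unfolding tangent_def Der_e_def by auto
  have K: "g (act f a) = f a * g 1 + f 1 * g a" if f: "lin KM f" and g: "lin KM g" for f g
  proof -
    have "jK (g (act f a)) = jK (f a * g 1 + f 1 * g a)"
      using der[OF lin_jK[OF f] lin_jK[OF g]] dual_mult_jK[OF f lin_jK[OF g], of a] by (simp add: jK_simps)
    then show ?thesis using injD[OF jK] by blast
  qed
  have "\<epsilon> a = \<epsilon> a + \<epsilon> a" using K[OF \<epsilon>_lin \<epsilon>_lin] by simp
  then have "\<epsilon> a = 0" by (metis add_cancel_right_right)
  moreover have "a \<in> G (Suc (Suc 0))"
  proof -
    have "act f a \<in> G (Suc 0)" if f: "lin KM f" "f 1 = 0" for f
    proof -
      have "act f a = scale (f a) 1"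
        by (rule functional_eqI) (simp add: K[OF f(1)] f(2) linK)
      then show ?thesis unfolding G_1 by blast
    qed
    then show ?thesis by (simp only: G.simps(2)[of "Suc 0"]) blast
  qed
  ultimately show "prim a" using G_2[of a] by simp
next
  fix a assume "a \<in> Collect prim"
  then have a: "prim a" by simp
  have "(\<lambda>(S :: ('k, 's) module) f. f a) \<in> Der_e A"
    unfolding Der_e_def Hom_fun_def
  proof (intro CollectI conjI ballI)
    fix S :: "('k, 's) module" assume S: "S \<in> kalgs"
    show "linear_map S (fob (dual A) S) (fob K_fun S) (\<lambda>f. f a)"
      by (rule linear_mapI) (auto simp: K_fun_def linD(1))
    fix f g assume "f \<in> carrier (fob (dual A) S)" "g \<in> carrier (fob (dual A) S)"
    then show "(f \<otimes>\<^bsub>fob (dual_alg A) S\<^esub> g) a = f a \<otimes>\<^bsub>S\<^esub> g \<one>\<^bsub>A\<^esub> \<oplus>\<^bsub>S\<^esub> f \<one>\<^bsub>A\<^esub> \<otimes>\<^bsub>S\<^esub> g a"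
      using sw_prim[OF kalgsD(2)[OF S] bil_dual_mult[OF S] a, of f g] by simp
  qed (simp add: K_fun_def)
  then show "a \<in> tangent TYPE('s) A" by (simp add: tangent_def)
qed

end

end

theorem theorem9p13:
  fixes scale :: "'k::field_char_0 \<Rightarrow> 'a::ring_1 \<Rightarrow> 'a"
    and \<Delta> :: "'a \<Rightarrow> ('a \<times> 'a \<Rightarrow>\<^sub>0 'k) set"
    and \<epsilon> :: "'a \<Rightarrow> 'k"
    and A :: "('k, 'a) bialg"
    and L :: "('k, 'a) lie_alg"
    and \<iota> :: "'a \<Rightarrow> 's"
  assumes A: "A = bialg_of_type scale \<Delta> \<epsilon>"
    and universe: "inj \<iota>"
    and formal_group: "infinitesimal_formal_group TYPE('s) A"
    and L: "L = tangent_lie TYPE('s) A"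
  shows "bialgebra_iso (env L) A (env_map A) \<and>
    (\<forall>n. linear_iso KK (gr (env L) (env_filt L) n) (gr A (dual_filt TYPE('s) A) n)
           (gr_map A (dual_filt TYPE('s) A) n (env_map A))) \<and>
    linear_iso KK L ((env L)\<lparr>carrier := primitives (env L)\<rparr>) (env_incl L) \<and>
    (\<forall>n. linear_iso KK (sym_power L n) (gr (env L) (env_filt L) n) (sym_to_gr L n))"
proof -
  have fm: "infinitesimal_formal_monoid TYPE('s) A"
    using formal_group by (simp add: infinitesimal_formal_group_def)
  then have "cocommutative_bialgebra A" by (simp add: infinitesimal_formal_monoid_def)
  then interpret cbialg0 scale \<Delta> \<epsilon> A by (intro cbialg0.intro cbialg.intro A)
  have "L = LL"
    unfolding L tangent_lie_def LL_def tangent_eq_prim[OF universe] by simp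
  moreover note exhaustive = G_exhaustive[OF universe fm]
  ultimately show ?thesis
    using env_bialgebra_iso[OF exhaustive] env_primitives[OF exhaustive] sym_power_gr_iso
      env_gr_iso[OF dual_filt_eq_G[OF universe]] by simp
qed

end
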